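(* Let $u$ be a weak solution to the Euler equations on $\mathbb{R}^n\times[0,T]$ with associated pressure $p$, and let $S$ be a slit of $u$. Then: 1) $u_+\cdot \vec\nu = u_-\cdot \vec\nu=:u_\nu$ and $p_+ = p_-$ for a.e. $t\in [0,T]$ and ($\sigma_t$-)a.e. $x \in S(t)$; 2) for a.e. $t\in[0,T]$, $d\mu_t + u_\nu\, d\sigma_t = 0$ on the set $\{x\in S(t): u_+(x,t) \neq u_-(x,t)\}$.
   Context: Weak solution. A vector field $u\in C_w([0,T];L^2(\mathbb{R}^n))$ (weakly continuous in time) is a weak solution of the Euler equations $\partial_t u+(u\cdot\nabla)u=-\nabla p$, $\nabla\cdot u=0$, with initial data $u_0\in L^2(\mathbb{R}^n)$ if $\nabla_x\cdot u(t)=0$ in the sense of distributions and for every $\psi\in C_0^\infty([0,T]\times\mathbb{R}^n)$ (compact support; not required to vanish at $t=0$ or $t=T$) with $\nabla_x\cdot\psi=0$ and every $0\le t\le T$, $$\int_{\mathbb{R}^n\times\{t\}}u\cdot\psi-\int_{\mathbb{R}^n\times\{0\}}u_0\cdot\psi-\int_0^t\int_{\mathbb{R}^n}u\cdot\partial_s\psi=\int_0^t\int_{\mathbb{R}^n}(u\otimes u):\nabla\psi,$$ where $A:B=\mathrm{Tr}[AB]$. The associated pressure is $p=-\sum_{l,k}R_lR_k(u_lu_k)$, where $R_l$ are the Riesz transforms normalized to have Fourier symbol $\xi_l/|\xi|$ (so $-\Delta p=\sum_{l,k}\partial_l\partial_k(u_lu_k)$). Surfaces. $S\subset\mathbb{R}^n\times[0,T]$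 is a $C^1$-family (in $t$) of closed orientable $C^2$-submanifolds $S(t)$ of $\mathbb{R}^n$ of dimension $n-1$: for every $(x_0,t_0)\in S$ there are an open neighborhood $U$ of $x_0$, a relatively open interval $I\ni t_0$ in $[0,T]$, and a local parametrization $r=r(\bar y,t)$, $\bar y\in(-1,1)^{n-1}$, of $S(t)\cap U$ for all $t\in I$, with $r\in C^{2,1}_{\bar y,t}$ ($C^2$ in $\bar y$, $C^1$ in $t$). $\vec\nu(x,t)$ is the positively oriented unit normal to $S(t)$ at $x$, and $d\sigma_t$ is the surface measure of $S(t)$. The surface is assumed regular enough that, for small $\epsilon_0>0$, the maps $(\bar y,y_n)\mapsto r(\bar y,t)+\epsilon_0y_n\vec\nu(r(\bar y,t),t)$, $|y_n|<1$, are diffeomorphisms onto neighborhoods of $S(t)\cap U$, $C^1$ jointly in space and time. The measure $\mu_t$. On a chart $U$, let $H(x,t)\in C^1$ be such that $\{H(\cdot,t)=0\}=S(t)\cap U$ for all $t\in I$ and $\nabla_xH\ne0$ points in the direction of $\vec\nu$. Then $d\mu_t=\frac{\partial_tH}{|\nabla_xH|}d\sigma_t$ on $S(t)\cap U$; equivalently, in local coordinates $d\mu_t=-\partial_tr(\bar y,t)\cdot\vec\nu(r(\bar y,t),t)\,J_t(\bar y)\,d\bar y$, where $J_t$ is the surface volume element. This is independent of $H$ and of the parametrization and defines (via a partition of unity) a signed measure $\mu_t$ on $S(t)$. Normal limits and maximal functions. For $(x,t)\in S$ put $\Gamma_+(x,t)=\{x+s\vec\nu(x,t):0\le s\le\epsilon_1\}$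 and $\Gamma_-(x,t)=\{x-s\vec\nu(x,t):0\le s\le\epsilon_1\}$, where $\epsilon_1>0$ is small (chosen locally, chart by chart, if necessary) so that all these segments lie in a neighborhood $W$ of $S$. For a function or field $f$ on $W$, $$f^*_\pm(x,t)=\sup_{x'\in\Gamma_\pm(x,t)}|f(x',t)|,\qquad f_\pm(x,t)=\lim_{x'\to x,\ x'\in\Gamma_\pm(x,t),\,x'\neq x}f(x',t)$$ (when the limit exists). Slit. The surface $S$ is a slit of $u$ if 1) the limits $u_\pm,p_\pm$ exist for a.e. $t\in[0,T]$ and $\sigma_t$-a.e. $x\in S(t)$; 2) $u^*_\pm\in L^2(d\sigma_tdt)_{\mathrm{loc}}$ and $p^*_\pm\in L^1(d\sigma_tdt)_{\mathrm{loc}}$. (Implicitly, $p$ is represented by a function near $S$ and representatives of $u$, $p$ are fixed.) *)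

theory Defs
  imports "HOL-Analysis.Analysis"
begin

section \<open>Calculus\<close>

primrec Ck :: "nat \<Rightarrow> ('a::euclidean_space \<Rightarrow> 'b::real_normed_vector) \<Rightarrow> bool" where
  "Ck 0 f \<longleftrightarrow> continuous_on UNIV f"
| "Ck (Suc m) f \<longleftrightarrow> (\<forall>x. f differentiable at x) \<and>
     (\<forall>b\<in>Basis. Ck m (\<lambda>x. frechet_derivative f (at x) b))"

definition smooth :: "('a::euclidean_space \<Rightarrow> 'b::real_normed_vector) \<Rightarrow> bool" where
  "smooth f \<longleftrightarrow> (\<forall>m. Ck m f)"

definition test_function :: "('a::euclidean_space \<Rightarrow> 'b::real_normed_vector) \<Rightarrow> bool" where
  "test_function \<phi> \<longleftrightarrow> smooth \<phi> \<and> compact (closure {x. \<phi> x \<noteq> 0})"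

text \<open>On sets that are not open (time intervals containing an end point of \<open>[0,T]\<close>) the
  derivative is taken within the set, so it is one-sided at the end points.\<close>

definition C1_on :: "'a::real_normed_vector set \<Rightarrow> ('a \<Rightarrow> 'b::real_normed_vector) \<Rightarrow> bool" where
  "C1_on A f \<longleftrightarrow> (\<exists>f'. (\<forall>z\<in>A. (f has_derivative blinfun_apply (f' z)) (at z within A)) \<and>
     continuous_on A f')"

definition C1_diffeomorphism ::
  "'a::real_normed_vector set \<Rightarrow> 'b::real_normed_vector set \<Rightarrow> ('a \<Rightarrow> 'b) \<Rightarrow> bool" where
  "C1_diffeomorphism A B f \<longleftrightarrow> open A \<and> open B \<and> C1_on A f \<and>
     (\<exists>g. homeomorphism A B f g \<and> C1_on B g)"

definition C21_on ::
  "'a::real_normed_vector set \<Rightarrow> real set \<Rightarrow> ('a \<Rightarrow> real \<Rightarrow> 'b::real_normed_vector) \<Rightarrow> bool" where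
  "C21_on Q I r \<longleftrightarrow> (\<exists>D D2 Dt.
     (\<forall>y\<in>Q. \<forall>t\<in>I.
        ((\<lambda>y. r y t) has_derivative blinfun_apply (D (y, t))) (at y within Q) \<and>
        ((\<lambda>y. D (y, t)) has_derivative blinfun_apply (D2 (y, t))) (at y within Q) \<and>
        ((\<lambda>t. r y t) has_vector_derivative Dt (y, t)) (at t within I)) \<and>
     continuous_on (Q \<times> I) D \<and> continuous_on (Q \<times> I) D2 \<and> continuous_on (Q \<times> I) Dt)"

definition gradient :: "(real^'n \<Rightarrow> real) \<Rightarrow> real^'n \<Rightarrow> real^'n" where
  "gradient f x = (\<chi> i. frechet_derivative f (at x) (axis i 1))"

definition divergence :: "(real^'n \<Rightarrow> real^'n) \<Rightarrow> real^'n \<Rightarrow> real" where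
  "divergence f x = trace (jacobian f (at x))"

definition tensor :: "real^'n \<Rightarrow> real^'n \<Rightarrow> real^'n^'n" where
  "tensor v w = (\<chi> i j. v $ i * w $ j)"

definition slice :: "('a \<times> 'b) set \<Rightarrow> 'b \<Rightarrow> 'a set" where
  "slice A t = {x. (x, t) \<in> A}"


section \<open>Weak solutions of the Euler equations\<close>

definition L2 :: "('a::euclidean_space \<Rightarrow> 'b::euclidean_space) \<Rightarrow> bool" where
  "L2 f \<longleftrightarrow> f \<in> borel_measurable lebesgue \<and> integrable lebesgue (\<lambda>x. (norm (f x))\<^sup>2)"

definition weakly_continuous_L2 :: "real \<Rightarrow> (real^'n \<Rightarrow> real \<Rightarrow> real^'n) \<Rightarrow> bool" where
  "weakly_continuous_L2 T u \<longleftrightarrow> (\<forall>t\<in>{0..T}. L2 (\<lambda>x. u x t)) \<and>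
     (\<forall>g. L2 g \<longrightarrow> continuous_on {0..T} (\<lambda>t. LINT x|lebesgue. u x t \<bullet> g x))"

text \<open>The field \<open>u\<close> is a fixed pointwise representative of a curve in \<open>L\<^sup>2\<close>; it is taken to
  be jointly measurable. Test functions on \<open>[0,T] \<times> \<real>\<^sup>n\<close>, which need not vanish at
  \<open>t = 0\<close> or \<open>t = T\<close>, are restrictions of test functions on the whole space-time.\<close>

definition weak_solution ::
  "real \<Rightarrow> (real^'n \<Rightarrow> real^'n) \<Rightarrow> (real^'n \<Rightarrow> real \<Rightarrow> real^'n) \<Rightarrow> bool" where
  "weak_solution T u0 u \<longleftrightarrow>
     L2 u0 \<and> weakly_continuous_L2 T u \<and>
     (\<lambda>(x, t). u x t) \<in> borel_measurable (lebesgue_on (UNIV \<times> {0..T})) \<and>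
     (\<forall>t\<in>{0..T}. \<forall>\<phi>. test_function \<phi> \<longrightarrow> (LINT x|lebesgue. u x t \<bullet> gradient \<phi> x) = 0) \<and>
     (\<forall>\<psi> :: (real^'n) \<times> real \<Rightarrow> real^'n.
        test_function \<psi> \<and> (\<forall>t\<in>{0..T}. \<forall>x. divergence (\<lambda>x. \<psi> (x, t)) x = 0) \<longrightarrow>
        (\<forall>t\<in>{0..T}.
           (LINT x|lebesgue. u x t \<bullet> \<psi> (x, t)) - (LINT x|lebesgue. u0 x \<bullet> \<psi> (x, 0))
           - (LINT s:{0..t}|lebesgue. LINT x|lebesgue.
                u x s \<bullet> vector_derivative (\<lambda>s. \<psi> (x, s)) (at s))
           = (LINT s:{0..t}|lebesgue. LINT x|lebesgue.
                trace (tensor (u x s) (u x s) ** jacobian (\<lambda>x. \<psi> (x, s)) (at x)))))"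


section \<open>The associated pressure\<close>

definition fourier :: "(real^'n \<Rightarrow> real) \<Rightarrow> real^'n \<Rightarrow> complex" where
  "fourier f \<xi> = (LINT x|lebesgue. cis (- (\<xi> \<bullet> x)) * of_real (f x))"

definition inv_fourier :: "(real^'n \<Rightarrow> real) \<Rightarrow> real^'n \<Rightarrow> complex" where
  "inv_fourier f \<xi> =
     of_real (1 / (2 * pi) ^ CARD('n)) * (LINT x|lebesgue. cis (\<xi> \<bullet> x) * of_real (f x))"

definition riesz_symbol :: "'n \<Rightarrow> real^'n \<Rightarrow> real" where
  "riesz_symbol l \<xi> = \<xi> $ l / norm \<xi>"

text \<open>For \<open>v \<in> L\<^sup>2\<close> the products \<open>v\<^sub>l v\<^sub>k\<close> are only in \<open>L\<^sup>1\<close>, so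
  \<open>- \<Sum>\<^sub>l\<^sub>,\<^sub>k R\<^sub>l R\<^sub>k (v\<^sub>l v\<^sub>k)\<close> is a tempered distribution.
  Its Fourier transform is the bounded function \<open>pressure_fourier v\<close>, and it acts on \<open>\<phi>\<close> by
  pairing that function with the inverse Fourier transform of \<open>\<phi>\<close>.\<close>

definition pressure_fourier :: "(real^'n \<Rightarrow> real^'n) \<Rightarrow> real^'n \<Rightarrow> complex" where
  "pressure_fourier v \<xi> = - (\<Sum>l\<in>UNIV. \<Sum>k\<in>UNIV.
     of_real (riesz_symbol l \<xi>) * (of_real (riesz_symbol k \<xi>) * fourier (\<lambda>x. v x $ l * v x $ k) \<xi>))"

definition pressure_distribution :: "(real^'n \<Rightarrow> real^'n) \<Rightarrow> (real^'n \<Rightarrow> real) \<Rightarrow> complex" where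
  "pressure_distribution v \<phi> = (LINT \<xi>|lebesgue. pressure_fourier v \<xi> * inv_fourier \<phi> \<xi>)"

definition associated_pressure_on ::
  "real \<Rightarrow> ((real^'n) \<times> real) set \<Rightarrow> (real^'n \<Rightarrow> real \<Rightarrow> real^'n) \<Rightarrow>
     (real^'n \<Rightarrow> real \<Rightarrow> real) \<Rightarrow> bool" where
  "associated_pressure_on T W u p \<longleftrightarrow>
     (\<lambda>(x, t). p x t) \<in> borel_measurable (lebesgue_on W) \<and>
     (AE t in lebesgue_on {0..T}.
        (\<forall>K. compact K \<and> K \<subseteq> slice W t \<longrightarrow> set_integrable lebesgue K (\<lambda>x. p x t)) \<and>
        (\<forall>\<phi>. test_function \<phi> \<and> closure {x. \<phi> x \<noteq> 0} \<subseteq> slice W t \<longrightarrow>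
           complex_of_real (LINT x|lebesgue. p x t * \<phi> x) = pressure_distribution (\<lambda>x. u x t) \<phi>))"


section \<open>Moving surfaces\<close>

text \<open>A point of \<open>(-1,1)\<^sup>n\<close> is split as \<open>y = (\<bar>y\<bar>, y\<^sub>n)\<close>, the last coordinate
  being the one with an arbitrary but fixed index \<open>k\<close>. The parameter domain
  \<open>(-1,1)\<^sup>n\<^sup>-\<^sup>1\<close> is the set \<open>flat_cube k\<close>, and a parametrization is extended to
  the whole cube so as not to depend on \<open>y $ k\<close>. This makes sense also for \<open>n = 1\<close>.\<close>

definition cube :: "(real^'n) set" where
  "cube = {y. \<forall>i. \<bar>y $ i\<bar> < 1}"

definition flat_cube :: "'n \<Rightarrow> (real^'n) set" where
  "flat_cube k = {y\<in>cube. y $ k = 0}"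

definition flatten :: "'n \<Rightarrow> real^'n \<Rightarrow> real^'n" where
  "flatten k y = (\<chi> i. if i = k then 0 else y $ i)"

definition time_interval :: "real \<Rightarrow> real set \<Rightarrow> bool" where
  "time_interval T I \<longleftrightarrow> openin (top_of_set {0..T}) I \<and> is_interval I"

definition tangent :: "(real^'n \<Rightarrow> real \<Rightarrow> real^'n) \<Rightarrow> real^'n \<Rightarrow> real \<Rightarrow> 'n \<Rightarrow> real^'n" where
  "tangent r y t i = frechet_derivative (\<lambda>y. r y t) (at y) (axis i 1)"

definition local_parametrization ::
  "real \<Rightarrow> ((real^'n) \<times> real) set \<Rightarrow> (real^'n) set \<Rightarrow> real set \<Rightarrow> 'n \<Rightarrow>
     (real^'n \<Rightarrow> real \<Rightarrow> real^'n) \<Rightarrow> bool" where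
  "local_parametrization T S U I k r \<longleftrightarrow>
     open U \<and> time_interval T I \<and>
     (\<forall>y t. r y t = r (flatten k y) t) \<and>
     C21_on cube I r \<and>
     (\<forall>t\<in>I. (\<exists>g. homeomorphism (flat_cube k) (slice S t \<inter> U) (\<lambda>y. r y t) g) \<and>
        (\<forall>y\<in>cube. \<forall>v. v $ k = 0 \<and> frechet_derivative (\<lambda>y. r y t) (at y) v = 0 \<longrightarrow> v = 0))"

definition tubular_map ::
  "(real^'n \<Rightarrow> real \<Rightarrow> real^'n) \<Rightarrow> real \<Rightarrow> 'n \<Rightarrow> (real^'n \<Rightarrow> real \<Rightarrow> real^'n) \<Rightarrow>
     real^'n \<Rightarrow> real \<Rightarrow> real^'n" where
  "tubular_map \<nu> \<epsilon> k r y t = r y t + (\<epsilon> * y $ k) *\<^sub>R \<nu> (r y t) t"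

text \<open>\<open>\<nu>\<close> is the orienting unit normal field: its existence as a continuous field is the
  orientability of the surfaces, and the choice of \<open>\<nu>\<close> is the choice of the orientation.
  The surfaces are closed as subsets of \<open>\<real>\<^sup>n\<close> and need not be compact.\<close>

definition C1_family_of_surfaces ::
  "real \<Rightarrow> ((real^'n) \<times> real) set \<Rightarrow> (real^'n \<Rightarrow> real \<Rightarrow> real^'n) \<Rightarrow> bool" where
  "C1_family_of_surfaces T S \<nu> \<longleftrightarrow>
     S \<subseteq> UNIV \<times> {0..T} \<and>
     (\<forall>t\<in>{0..T}. closed (slice S t) \<and> continuous_on (slice S t) (\<lambda>x. \<nu> x t)) \<and>
     (\<forall>(x, t)\<in>S. norm (\<nu> x t) = 1) \<and>
     (\<forall>(x0, t0)\<in>S. \<exists>U I k r. x0 \<in> U \<and> t0 \<in> I \<and>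
        local_parametrization T S U I k r \<and>
        (\<forall>y\<in>cube. \<forall>t\<in>I. \<forall>i. \<nu> (r y t) t \<bullet> tangent r y t i = 0) \<and>
        (\<exists>\<epsilon>>0. C1_on (cube \<times> I) (\<lambda>(y, t). tubular_map \<nu> \<epsilon> k r y t) \<and>
           (\<forall>t\<in>I. C1_diffeomorphism cube ((\<lambda>y. tubular_map \<nu> \<epsilon> k r y t) ` cube)
                    (\<lambda>y. tubular_map \<nu> \<epsilon> k r y t))))"

text \<open>The square root of the Gram determinant of the \<open>n - 1\<close> tangent vectors with index
  different from \<open>k\<close>; the row and column with index \<open>k\<close> are those of the identity matrix.\<close>

definition volume_element ::
  "'n \<Rightarrow> (real^'n \<Rightarrow> real \<Rightarrow> real^'n) \<Rightarrow> real^'n \<Rightarrow> real \<Rightarrow> real" where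
  "volume_element k r y t =
     sqrt (det (\<chi> i j. if i = k \<or> j = k then (if i = j then 1 else 0)
                       else tangent r y t i \<bullet> tangent r y t j))"

text \<open>\<open>\<sigma> t\<close> is the surface measure of \<open>S(t)\<close>, as a Borel measure on \<open>\<real>\<^sup>n\<close>; it is uniquely
  determined by its values in all the charts. An integral over \<open>(-1,1)\<^sup>n\<^sup>-\<^sup>1\<close> is half
  of the integral over the cube, since the integrand does not depend on \<open>y $ k\<close>.\<close>

definition surface_measures ::
  "real \<Rightarrow> ((real^'n) \<times> real) set \<Rightarrow> (real \<Rightarrow> (real^'n) measure) \<Rightarrow> bool" where
  "surface_measures T S \<sigma> \<longleftrightarrow> (\<forall>t\<in>{0..T}.
     sets (\<sigma> t) = sets borel \<and> emeasure (\<sigma> t) (- slice S t) = 0 \<and>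
     (\<forall>U I k r A. local_parametrization T S U I k r \<and> t \<in> I \<and> A \<in> sets borel \<and> A \<subseteq> U \<longrightarrow>
        emeasure (\<sigma> t) A =
          (\<integral>\<^sup>+y\<in>cube. ennreal (volume_element k r y t) * indicator A (r y t) \<partial>lborel) / 2))"

definition spacetime_surface_measure ::
  "real \<Rightarrow> (real \<Rightarrow> (real^'n) measure) \<Rightarrow> ((real^'n) \<times> real) measure" where
  "spacetime_surface_measure T \<sigma> =
     measure_of UNIV (sets borel) (\<lambda>A. \<integral>\<^sup>+t\<in>{0..T}. emeasure (\<sigma> t) (slice A t) \<partial>lborel)"

definition local_defining_function ::
  "real \<Rightarrow> ((real^'n) \<times> real) set \<Rightarrow> (real^'n \<Rightarrow> real \<Rightarrow> real^'n) \<Rightarrow>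
     (real^'n) set \<Rightarrow> real set \<Rightarrow> (real^'n \<Rightarrow> real \<Rightarrow> real) \<Rightarrow> bool" where
  "local_defining_function T S \<nu> U I H \<longleftrightarrow>
     open U \<and> time_interval T I \<and> C1_on (U \<times> I) (\<lambda>(x, t). H x t) \<and>
     (\<forall>t\<in>I. {x\<in>U. H x t = 0} = slice S t \<inter> U \<and>
        (\<forall>x\<in>slice S t \<inter> U. \<exists>c>0. gradient (\<lambda>x. H x t) x = c *\<^sub>R \<nu> x t))"

text \<open>The quotient \<open>\<partial>\<^sub>t H / |\<nabla>\<^sub>x H|\<close> is the same for all local defining functions
  at a point of \<open>S\<close>: differentiating \<open>H(r(\<bar>y\<bar>,t),t) = 0\<close> shows that it is \<open>- \<partial>\<^sub>t r \<bullet> \<nu>\<close>.\<close>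

definition mu_density ::
  "real \<Rightarrow> ((real^'n) \<times> real) set \<Rightarrow> (real^'n \<Rightarrow> real \<Rightarrow> real^'n) \<Rightarrow> real^'n \<Rightarrow> real \<Rightarrow> real" where
  "mu_density T S \<nu> x t = (THE c. \<exists>U I H. local_defining_function T S \<nu> U I H \<and> x \<in> U \<and> t \<in> I \<and>
     c = vector_derivative (\<lambda>s. H x s) (at t within {0..T}) / norm (gradient (\<lambda>x. H x t) x))"

text \<open>For a non-compact surface the signed measure \<open>\<mu>\<^sub>t\<close> is finite only locally, for
  instance on bounded sets; \<open>mu\<close> is meaningful on sets where the density is integrable.\<close>

definition mu ::
  "real \<Rightarrow> ((real^'n) \<times> real) set \<Rightarrow> (real^'n \<Rightarrow> real \<Rightarrow> real^'n) \<Rightarrow> (real \<Rightarrow> (real^'n) measure) \<Rightarrow>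
     real \<Rightarrow> (real^'n) set \<Rightarrow> real" where
  "mu T S \<nu> \<sigma> t A = (LINT x:A|completion (\<sigma> t). mu_density T S \<nu> x t)"


section \<open>Slits\<close>

text \<open>The sign \<open>c\<close> is \<open>1\<close> for the positive and \<open>-1\<close> for the negative side.\<close>

definition normal_segment ::
  "(real^'n \<Rightarrow> real \<Rightarrow> real^'n) \<Rightarrow> real \<Rightarrow> real \<Rightarrow> real^'n \<Rightarrow> real \<Rightarrow> (real^'n) set" where
  "normal_segment \<nu> c \<epsilon> x t = {x + (c * s) *\<^sub>R \<nu> x t | s. 0 \<le> s \<and> s \<le> \<epsilon>}"

definition normal_max ::
  "(real^'n \<Rightarrow> real \<Rightarrow> real^'n) \<Rightarrow> real \<Rightarrow> real \<Rightarrow> (real^'n \<Rightarrow> real \<Rightarrow> 'b::real_normed_vector) \<Rightarrow>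
     real^'n \<Rightarrow> real \<Rightarrow> ennreal" where
  "normal_max \<nu> c \<epsilon> f x t = (SUP x'\<in>normal_segment \<nu> c \<epsilon> x t. ennreal (norm (f x' t)))"

text \<open>The limit along a normal segment does not depend on the length of the segment.\<close>

definition has_normal_limit ::
  "(real^'n \<Rightarrow> real \<Rightarrow> real^'n) \<Rightarrow> real \<Rightarrow> (real^'n \<Rightarrow> real \<Rightarrow> 'b::real_normed_vector) \<Rightarrow>
     real^'n \<Rightarrow> real \<Rightarrow> bool" where
  "has_normal_limit \<nu> c f x t \<longleftrightarrow>
     (\<exists>l. ((\<lambda>x'. f x' t) \<longlongrightarrow> l) (at x within normal_segment \<nu> c 1 x t))"

definition normal_limit ::
  "(real^'n \<Rightarrow> real \<Rightarrow> real^'n) \<Rightarrow> real \<Rightarrow> (real^'n \<Rightarrow> real \<Rightarrow> 'b::real_normed_vector) \<Rightarrow>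
     real^'n \<Rightarrow> real \<Rightarrow> 'b" where
  "normal_limit \<nu> c f x t = Lim (at x within normal_segment \<nu> c 1 x t) (\<lambda>x'. f x' t)"

definition Lq_on :: "'a measure \<Rightarrow> 'a set \<Rightarrow> nat \<Rightarrow> ('a \<Rightarrow> ennreal) \<Rightarrow> bool" where
  "Lq_on M N q f \<longleftrightarrow> (\<lambda>z. f z * indicator N z) \<in> borel_measurable (completion M) \<and>
     (\<integral>\<^sup>+z\<in>N. f z ^ q \<partial>completion M) < \<infinity>"

text \<open>Local integrability on \<open>S\<close> is integrability near each point of \<open>S\<close>; the length
  \<open>\<epsilon>\<close> of the normal segments is chosen locally as well. \<open>W\<close> is the neighborhood of \<open>S\<close> where
  the pressure is a function.\<close>

definition slit ::
  "real \<Rightarrow> ((real^'n) \<times> real) set \<Rightarrow> (real^'n \<Rightarrow> real \<Rightarrow> real^'n) \<Rightarrow> (real \<Rightarrow> (real^'n) measure) \<Rightarrow>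
     ((real^'n) \<times> real) set \<Rightarrow> (real^'n \<Rightarrow> real \<Rightarrow> real^'n) \<Rightarrow> (real^'n \<Rightarrow> real \<Rightarrow> real) \<Rightarrow> bool" where
  "slit T S \<nu> \<sigma> W u p \<longleftrightarrow>
     (AE t in lebesgue_on {0..T}. AE x in \<sigma> t. x \<in> slice S t \<longrightarrow>
        (\<forall>c\<in>{1, -1}. has_normal_limit \<nu> c u x t \<and> has_normal_limit \<nu> c p x t)) \<and>
     (\<forall>z\<in>S. \<exists>N \<epsilon>. openin (top_of_set S) N \<and> z \<in> N \<and> \<epsilon> > 0 \<and>
        (\<forall>c\<in>{1, -1}.
           (\<forall>(x, t)\<in>N. normal_segment \<nu> c \<epsilon> x t \<subseteq> slice W t) \<and>
           Lq_on (spacetime_surface_measure T \<sigma>) N 2 (\<lambda>(x, t). normal_max \<nu> c \<epsilon> u x t) \<and>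
           Lq_on (spacetime_surface_measure T \<sigma>) N 1 (\<lambda>(x, t). normal_max \<nu> c \<epsilon> p x t)))"

end

theory Submission
 imports Defs "HOL-Probability.Probability"
begin

text \<open>The proof is a blow-up at the points of the surface. Near a surface point \<open>z\<^sub>0\<close> the weak
 equations are tested against second derivatives of a bump function of scale \<open>\<epsilon>\<close>: for a
 matrix \<open>F\<close> of functions of \<open>(u, p)\<close>, each of the three relations (vanishing divergence,
 the pressure equation, and the momentum equation tested with
 \<open>e\<^sub>i \<partial>\<^sub>j \<eta> - e\<^sub>j \<partial>\<^sub>i \<eta>\<close>) has the form
 \<open>\<Sum>\<^sub>a\<^sub>b \<integral> F\<^sub>a\<^sub>b(u, p) \<partial>\<^sub>a \<partial>\<^sub>b \<eta> = 0\<close> in space-time.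
 As \<open>\<epsilon> \<rightarrow> 0\<close>, the normal limits and the maximal functions allow \<open>(u, p)\<close> to be replaced,
 for almost every \<open>z\<^sub>0\<close>, by its limits on the two sides of the tangent hyperplane with space-time
 normal \<open>N = (\<nu>, m)\<close>, where \<open>m\<close> is the density of \<open>\<mu>\<close>. Letting the bump vary over translates yields
 \<open>\<Sum>\<^sub>a\<^sub>b [F\<^sub>a\<^sub>b] N\<^sub>a N\<^sub>b = 0\<close>, that is \<open>[u] \<bullet> \<nu> = 0\<close>, \<open>[p] = 0\<close> and
 \<open>(m + u\<^sub>\<nu>) ([u\<^sub>i] \<nu>\<^sub>j - [u\<^sub>j] \<nu>\<^sub>i) = 0\<close>.\<close>

section \<open>Smooth functions and a bump function\<close>

text \<open>The one-sided limits exist only almost everywhere on the surface and only along normals,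
  so no blow-up at a prescribed point is possible. Instead the scaled test integrals are integrated
  over a box of base points. For each fixed position \<open>om\<close> in the rescaled kernel the
  base point is translated tangentially; this leaves the integral unchanged and puts the sampled
  point on the normal through the base point, where the maximal function dominates and the limit
  exists. All box averages of the limit vanish, hence the relation holds at almost every point. The
  limits are not assumed jointly measurable, so the averages are iterated Lebesgue integrals, in
  space and then in time. Second derivatives are forced by the pressure: only its Laplacian is local
  in \<open>u\<close>, since the factor \<open>\<xi> \<bullet> \<xi>\<close> cancels the
  denominators of the Riesz symbols. A divergence-free field made from a scalar already costs one
  derivative, and the divergence relation is differentiated once more to give all relations the same
  scaling. Exceptional sets depend on the bump, so only countably many bumps are used, namely
  rational translates in basis directions.\<close>

definition pderivative :: "('a::euclidean_space => 'b::real_normed_vector) => 'a => 'a => 'b" where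
 "pderivative f b x = frechet_derivative f (at x) b"

lemma pderivative_eq: "(f has_derivative f') (at x) ==> pderivative f b x = f' b"
 unfolding pderivative_def by (metis frechet_derivative_at)

lemma Ck_Suc_pderivative:
 "Ck (Suc m) f \<longleftrightarrow> (\<forall>x. f differentiable at x) \<and> (\<forall>b\<in>Basis. Ck m (pderivative f b))"
 by (simp add: pderivative_def[abs_def])

declare Ck.simps(2) [simp del]

lemma Ck_SucI:
 assumes "\<And>x. (f has_derivative f' x) (at x)"
  and "\<And>b. b \<in> Basis ==> Ck m (\<lambda>x. f' x b)"
 shows "Ck (Suc m) f"
proof -
 have "pderivative f b = (\<lambda>x. f' x b)" for b
  using pderivative_eq[OF assms(1)] by auto
 then show ?thesis
  using assms by (auto simp: Ck_Suc_pderivative differentiable_def)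
qed

lemma Ck_SucD:
 assumes "Ck (Suc m) f"
 shows "(f has_derivative (\<lambda>h. pderivative f h x)) (at x)"
  and "b \<in> Basis ==> Ck m (pderivative f b)"
 using assms by (auto simp: Ck_Suc_pderivative pderivative_def[abs_def] frechet_derivative_works[symmetric])

lemma Ck_Suc_imp_Ck: "Ck (Suc m) f ==> Ck m f"
proof (induction m arbitrary: f)
 case 0
 have "isCont f x" for x
  using Ck_SucD(1)[OF 0] has_derivative_continuous by blast
 then show ?case by (simp add: continuous_at_imp_continuous_on)
next
 case (Suc m)
 show ?case
  using Suc.prems by (auto simp: Ck_Suc_pderivative intro: Suc.IH)
qed

lemma Ck_const: "Ck m (\<lambda>x::'a::euclidean_space. c::'b::real_normed_vector)"
proof (induction m arbitrary: c)
 case (Suc m)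
 show ?case by (rule Ck_SucI[where f'="\<lambda>_ _. 0"]) (auto intro: Suc)
qed simp

lemma Ck_add:
 fixes f :: "'a::euclidean_space => 'b::real_normed_vector"
 shows "Ck m f ==> Ck m g ==> Ck m (\<lambda>x. f x + g x)"
proof (induction m arbitrary: f g)
 case (Suc m)
 show ?case
  by (rule Ck_SucI[OF has_derivative_add[OF Ck_SucD(1)[OF Suc.prems(1)] Ck_SucD(1)[OF Suc.prems(2)]]])
   (intro Suc.IH Ck_SucD[OF Suc.prems(1)] Ck_SucD[OF Suc.prems(2)])
qed (auto intro: continuous_intros)

lemma Ck_bounded_linear:
 fixes f :: "'a::euclidean_space => 'b::real_normed_vector"
 assumes "bounded_linear h"
 shows "Ck m f ==> Ck m (\<lambda>x. h (f x))"
proof (induction m arbitrary: f)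
 case 0
 then show ?case using assms
  by (simp add: bounded_linear.continuous_on)
next
 case (Suc m)
 show ?case
  by (rule Ck_SucI[OF bounded_linear.has_derivative[OF assms Ck_SucD(1)[OF Suc.prems]]])
   (intro Suc.IH Ck_SucD[OF Suc.prems])
qed

lemma Ck_linear:
 fixes f :: "'a::euclidean_space => 'b::real_normed_vector"
 assumes "linear f" shows "Ck m f"
proof (cases m)
 case 0
 then show ?thesis using assms by (simp add: linear_continuous_on linear_linear)
next
 case (Suc k)
 show ?thesis unfolding Suc
  by (rule Ck_SucI[where f'="\<lambda>_. f"])
   (auto intro: Ck_const linear_imp_has_derivative assms)
qed

lemma Ck_sum:
 fixes f :: "'i => 'a::euclidean_space => 'b::real_normed_vector"
 shows "(\<And>i. i \<in> I ==> Ck m (f i)) ==> Ck m (\<lambda>x. \<Sum>i\<in>I. f i x)"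
 by (induction I rule: infinite_finite_induct) (simp_all add: Ck_const Ck_add)

text \<open>The Leibniz rule needs each factor once undifferentiated, at order \<open>m\<close>
  instead of \<open>Suc m\<close>; this is where \<open>Ck_Suc_imp_Ck\<close> enters.\<close>

lemma Ck_mult:
 fixes f :: "'a::euclidean_space => real"
 shows "Ck m f ==> Ck m g ==> Ck m (\<lambda>x. f x * g x)"
proof (induction m arbitrary: f g)
 case (Suc m)
 show ?case
  by (rule Ck_SucI[OF has_derivative_mult[OF Ck_SucD(1)[OF Suc.prems(1)] Ck_SucD(1)[OF Suc.prems(2)]]])
   (intro Ck_add Suc.IH Ck_SucD[OF Suc.prems(1)] Ck_SucD[OF Suc.prems(2)]
    Ck_Suc_imp_Ck[OF Suc.prems(1)] Ck_Suc_imp_Ck[OF Suc.prems(2)])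
qed (auto intro: continuous_intros)

text \<open>The derivative in a basis direction \<open>b\<close> is a derivative of \<open>f\<close>
  in the direction \<open>A b\<close>, which is not a basis vector; expanding it in the basis brings
  back the induction hypothesis.\<close>

lemma Ck_affine_compose:
 fixes f :: "'b::euclidean_space => 'c::real_normed_vector" and A :: "'a::euclidean_space => 'b"
 assumes "linear A"
 shows "Ck m f ==> Ck m (\<lambda>x. f (A x + c))"
proof (induction m arbitrary: f)
 case 0
 have "continuous_on UNIV (\<lambda>x. A x + c)"
  using assms by (intro continuous_intros linear_continuous_on) (simp add: linear_linear)
 then show ?case
  using 0 by (auto intro: continuous_on_compose2)
next
 case (Suc m)
 have A: "((\<lambda>x. A x + c) has_derivative A) (at x)" for x
  using assms by (auto intro!: derivative_eq_intros bounded_linear_imp_has_derivative simp: linear_linear)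
 have *: "((\<lambda>x. f (A x + c)) has_derivative (\<lambda>h. pderivative f (A h) (A x + c))) (at x)" for x
  using has_derivative_compose[OF A Ck_SucD(1)[OF Suc.prems]] by (simp add: o_def)
 show ?case
 proof (rule Ck_SucI[OF *])
  fix b :: 'a assume "b \<in> Basis"
  have lin: "linear (\<lambda>h. pderivative f h y)" for y
   using Ck_SucD(1)[OF Suc.prems] has_derivative_linear by blast
  have "pderivative f (A b) y = (\<Sum>j\<in>Basis. (A b \<bullet> j) *\<^sub>R pderivative f j y)" for y
   using linear_sum[OF lin, of "\<lambda>j. (A b \<bullet> j) *\<^sub>R j" Basis y] linear_cmul[OF lin, of _ _ y]
   by (simp add: euclidean_representation)
  then show "Ck m (\<lambda>x. pderivative f (A b) (A x + c))"
   by (auto intro!: Ck_sum Ck_bounded_linear[OF bounded_linear_scaleR_right] Suc.IH Ck_SucD(2)[OF Suc.prems])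
 qed
qed

lemma smooth_imp_differentiable: "smooth f ==> (f has_derivative (\<lambda>h. pderivative f h x)) (at x)"
 using Ck_SucD(1) unfolding smooth_def by blast

lemma smooth_pderivative: "smooth f ==> b \<in> Basis ==> smooth (pderivative f b)"
 using Ck_SucD(2) unfolding smooth_def by blast

lemma smooth_imp_continuous: "smooth f ==> continuous_on S f"
 unfolding smooth_def by (metis Ck.simps(1) continuous_on_subset subset_UNIV)

section \<open>Closure properties of test functions\<close>

lemma test_function_iff_bounded: "test_function f \<longleftrightarrow> smooth f \<and> bounded {x. f x \<noteq> 0}"
 by (simp add: test_function_def)

lemma test_function_pderivative:
 assumes "test_function f" "b \<in> Basis"
 shows "test_function (pderivative f b)"
proof -
 have "pderivative f b x = 0" if x: "x \<notin> closure {x. f x \<noteq> 0}" for x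
 proof -
  have "f y = 0" if "y \<in> - closure {x. f x \<noteq> 0}" for y
   using that closure_subset[of "{x. f x \<noteq> 0}"] by blast
  then have "(f has_derivative (\<lambda>_. 0)) (at x)"
   using has_derivative_transform_within_open[OF has_derivative_const[of 0], of "- closure {x. f x \<noteq> 0}" x f] x
   by (metis ComplI closed_closure open_Compl)
  then show ?thesis by (rule pderivative_eq)
 qed
 then have "{x. pderivative f b x \<noteq> 0} \<subseteq> closure {x. f x \<noteq> 0}" by blast
 then have "bounded {x. pderivative f b x \<noteq> 0}"
  by (rule bounded_subset[rotated]) (use assms(1) in \<open>simp add: test_function_iff_bounded bounded_closure\<close>)
 then show ?thesis
  using assms by (simp add: test_function_iff_bounded smooth_pderivative)
qed

lemma test_function_add:
 assumes "test_function f" "test_function g"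
 shows "test_function (\<lambda>x. f x + g x)"
proof -
 have "bounded {x. f x + g x \<noteq> 0}"
  by (rule bounded_subset[of "{x. f x \<noteq> 0} \<union> {x. g x \<noteq> 0}"]) (use assms in \<open>auto simp: test_function_iff_bounded\<close>)
 then show ?thesis
  using assms by (auto simp: test_function_iff_bounded smooth_def Ck_add)
qed

lemma test_function_linear_image:
 assumes "bounded_linear h" "test_function f"
 shows "test_function (\<lambda>x. h (f x))"
proof -
 have "bounded {x. h (f x) \<noteq> 0}"
  by (rule bounded_subset[of "{x. f x \<noteq> 0}"]) (use assms linear_0[OF bounded_linear.linear[OF assms(1)]] in \<open>auto simp: test_function_iff_bounded\<close>)
 then show ?thesis
  using assms by (auto simp: test_function_iff_bounded smooth_def Ck_bounded_linear)
qed

text \<open>An injective linear map is bounded below by a multiple of the norm, which keeps the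
  support of the composition bounded.\<close>

lemma test_function_affine_compose:
 fixes f :: "'b::euclidean_space => 'c::real_normed_vector" and A :: "'a::euclidean_space => 'b"
 assumes "test_function f" "linear A" "inj A"
 shows "test_function (\<lambda>x. f (A x + c))"
proof -
 obtain B where B: "B > 0" "\<And>x. B * norm x \<le> norm (A x)"
  using linear_inj_bounded_below_pos[OF assms(2,3)] by blast
 obtain R where R: "\<And>x. f x \<noteq> 0 ==> norm x \<le> R"
  using assms(1) unfolding test_function_iff_bounded bounded_iff by auto
 have "norm x \<le> (R + norm c) / B" if "f (A x + c) \<noteq> 0" for x
 proof -
  have "norm (A x) \<le> norm (A x + c) + norm c"
   using norm_triangle_ineq[of "A x + c" "-c"] by simp
  also have "\<dots> \<le> R + norm c" using R[OF that] by simp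
  finally show ?thesis using B(1) B(2)[of x] by (simp add: field_simps)
 qed
 then have "bounded {x. f (A x + c) \<noteq> 0}" unfolding bounded_iff by auto
 then show ?thesis
  using assms by (auto simp: test_function_iff_bounded smooth_def Ck_affine_compose)
qed

text \<open>The functions \<open>s\<^sup>-\<^sup>j exp (-1/s)\<close>, extended by \<open>0\<close> to \<open>s \<le> 0\<close>; their span is closed under
 differentiation.\<close>

definition flat_exp :: "nat => real => real" where
 "flat_exp j s = (if s > 0 then (1 / s) ^ j * exp (- (1 / s)) else 0)"

text \<open>With \<open>x = 1 / s\<close> this is the decay of \<open>x ^ j / exp x\<close> at
  infinity; on the left of \<open>0\<close> the function vanishes identically.\<close>

lemma flat_exp_div_tendsto: "((\<lambda>s. flat_exp j s) \<longlongrightarrow> 0) (at 0)"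
proof -
 have "((\<lambda>x::real. x ^ j / exp x) \<longlongrightarrow> 0) at_top" by (rule tendsto_power_div_exp_0)
 moreover have "filterlim (\<lambda>s::real. 1 / s) at_top (at_right 0)"
  using filterlim_inverse_at_top_right by (simp add: divide_inverse)
 ultimately have "((\<lambda>s::real. (1/s) ^ j / exp (1/s)) \<longlongrightarrow> 0) (at_right 0)"
  by (rule filterlim_compose)
 then have "(flat_exp j \<longlongrightarrow> 0) (at_right 0)"
  by (rule Lim_transform_eventually)
   (auto simp: flat_exp_def eventually_at_filter exp_minus divide_inverse)
 moreover have "(flat_exp j \<longlongrightarrow> 0) (at_left 0)"
  by (rule Lim_transform_eventually[OF tendsto_const]) (auto simp: flat_exp_def eventually_at_filter)
 ultimately show ?thesis by (simp add: filterlim_at_split)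
qed

lemma flat_exp_has_derivative:
 "(flat_exp j has_real_derivative (flat_exp (j + 2) s - real j * flat_exp (j + 1) s)) (at s)"
proof -
 consider "s < 0" | "s = 0" | "s > 0" by linarith
 then show ?thesis
 proof cases
  case 1
  have "\<forall>\<^sub>F x in nhds s. flat_exp j x = 0"
   using eventually_nhds_in_open[of "{..<0}" s] 1 by (auto elim!: eventually_mono simp: flat_exp_def)
  then show ?thesis using 1 DERIV_cong_ev[of s s "flat_exp j" "\<lambda>_. 0" 0 0] by (simp add: flat_exp_def)
 next
  case 2
  \<comment> \<open>At \<open>0\<close> the difference quotient of \<open>flat_exp j\<close> is
    exactly \<open>flat_exp (j + 1)\<close>.\<close>
  have "((\<lambda>h. flat_exp (j + 1) h) \<longlongrightarrow> 0) (at 0)" by (rule flat_exp_div_tendsto)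
  then have "((\<lambda>h. (flat_exp j (0 + h) - flat_exp j 0) / h) \<longlongrightarrow> 0) (at 0)"
   by (rule Lim_transform_eventually) (auto simp: eventually_at_filter flat_exp_def field_simps)
  then show ?thesis using 2 by (simp add: DERIV_def flat_exp_def)
 next
  case 3
  have inv: "((\<lambda>s. 1 / s) has_real_derivative - ((1 / s)\<^sup>2)) (at s)"
   using 3 by (auto intro!: derivative_eq_intros simp: power2_eq_square)
  \<comment> \<open>\<open>DERIV_power\<close> yields the exponent \<open>j - Suc 0\<close>; its
    truncation at \<open>j = 0\<close> is harmless because of the factor
    \<open>real j\<close>.\<close>
  have "real j * (- (r\<^sup>2) * r ^ (j - Suc 0)) = - real j * r ^ (j + 1)" for r
   by (cases j) (simp_all add: power2_eq_square algebra_simps)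
  then have "((\<lambda>s. (1 / s) ^ j) has_real_derivative - real j * (1 / s) ^ (j + 1)) (at s)"
   using DERIV_power[OF inv, of j] by (simp only:)
  moreover have "((\<lambda>s. exp (- (1 / s))) has_real_derivative exp (- (1 / s)) * (1 / s)\<^sup>2) (at s)"
   using DERIV_fun_exp[OF DERIV_minus[OF inv]] by simp
  ultimately have "((\<lambda>s. (1 / s) ^ j * exp (- (1 / s))) has_real_derivative
   (flat_exp (j + 2) s - real j * flat_exp (j + 1) s)) (at s)"
   by (rule DERIV_cong[OF DERIV_mult]) (use 3 in \<open>simp add: flat_exp_def algebra_simps power_add power2_eq_square\<close>)
  moreover have "\<forall>\<^sub>F x in nhds s. flat_exp j x = (1 / x) ^ j * exp (- (1 / x))"
   using eventually_nhds_in_open[of "{0<..}" s] 3 by (auto elim!: eventually_mono simp: flat_exp_def)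
  ultimately show ?thesis by (subst DERIV_cong_ev[OF refl _ refl]) auto
 qed
qed

text \<open>Only \<open>bump 0\<close> serves as a test function. The index makes the family stable:
  each derivative is a combination of bumps of higher index with polynomial coefficients.\<close>

definition bump :: "nat => 'a::euclidean_space => real" where
 "bump j z = flat_exp j (1 - z \<bullet> z)"

lemma bump_has_derivative:
 "(bump j has_derivative (\<lambda>h. -2 * (z \<bullet> h) * (bump (j + 2) z - real j * bump (j + 1) z))) (at z)"
proof -
 have "((\<lambda>z. 1 - z \<bullet> z) has_derivative (\<lambda>h. - (2 * (z \<bullet> h)))) (at z)"
  by (auto intro!: derivative_eq_intros simp: inner_commute)
 from has_derivative_compose[OF this flat_exp_has_derivative[of j "1 - z \<bullet> z", unfolded has_field_derivative_def]]
 show ?thesis unfolding bump_def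
  by (rule has_derivative_eq_rhs) (simp add: fun_eq_iff)
qed

lemma pderivative_bump:
 "pderivative (bump j) b = (\<lambda>z. -2 * (z \<bullet> b) * (bump (j + 2) z - real j * bump (j + 1) z))"
 using pderivative_eq[OF bump_has_derivative] by blast

lemma Ck_bump: "Ck m (bump j :: 'a::euclidean_space => real)"
proof (induction m arbitrary: j)
 case 0
 have "isCont (bump j) (z::'a)" for z
  using bump_has_derivative has_derivative_continuous by blast
 then show ?case by (simp add: continuous_at_imp_continuous_on)
next
 case (Suc m)
 show ?case
 proof (rule Ck_SucI[OF bump_has_derivative])
  fix b :: 'a
  have "linear (\<lambda>z::'a. -2 * (z \<bullet> b))"
   by (rule linearI) (simp_all add: inner_left_distrib distrib_left)
  then have "Ck m (\<lambda>z::'a. (-2 * (z \<bullet> b)) * (bump (j + 2) z + (- real j) * bump (j + 1) z))"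
   by (intro Ck_mult Ck_add Suc Ck_const Ck_linear)
  then show "Ck m (\<lambda>z. - 2 * (z \<bullet> b) * (bump (j + 2) z - real j * bump (j + 1) z))" by simp
 qed
qed

lemma test_function_bump: "test_function (bump j)"
proof -
 have "norm z \<le> 1" if "bump j z \<noteq> 0" for z :: 'a
 proof -
  have "z \<bullet> z \<le> 1" using that by (auto simp: bump_def flat_exp_def split: if_splits)
  then show ?thesis by (simp add: norm_eq_sqrt_inner)
 qed
 then show ?thesis
  by (auto simp: test_function_iff_bounded smooth_def Ck_bump bounded_iff)
qed

text \<open>The bump is radial, so its Hessian is explicit: a multiple of
  \<open>(z \<bullet> a) * (z \<bullet> b)\<close> plus a multiple of \<open>b \<bullet> a\<close>.
  The symmetry makes the test field of the momentum equation divergence-free.\<close>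

lemma bump_hessian_symmetric:
 "pderivative (pderivative (bump j) a) b = pderivative (pderivative (bump j) b) a"
proof -
 define g where "g z = bump (j + 2) z - real j * bump (j + 1) z" for z :: 'a
 define G where "G z = (bump (j + 2 + 2) z - real (j + 2) * bump (j + 2 + 1) z)
  - real j * (bump (j + 1 + 2) z - real (j + 1) * bump (j + 1 + 1) z)" for z :: 'a
 have g: "(g has_derivative (\<lambda>h. -2 * (z \<bullet> h) * (bump (j + 2 + 2) z - real (j + 2) * bump (j + 2 + 1) z)
  - real j * (-2 * (z \<bullet> h) * (bump (j + 1 + 2) z - real (j + 1) * bump (j + 1 + 1) z)))) (at z)" for z
  unfolding g_def by (intro has_derivative_diff has_derivative_mult_right bump_has_derivative)
 have "(g has_derivative (\<lambda>h. -2 * (z \<bullet> h) * G z)) (at z)" for z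
  by (rule has_derivative_eq_rhs[OF g], rule ext) (simp only: G_def algebra_simps)
 then have "((\<lambda>z. -2 * (z \<bullet> a) * g z) has_derivative
   (\<lambda>h. -2 * (z \<bullet> a) * (-2 * (z \<bullet> h) * G z) + -2 * (h \<bullet> a) * g z)) (at z)" for z a
  by (intro has_derivative_mult has_derivative_mult_right has_derivative_inner_left has_derivative_ident)
 then have "pderivative (pderivative (bump j) a) b z = -2 * (z \<bullet> a) * (-2 * (z \<bullet> b) * G z) + -2 * (b \<bullet> a) * g z" for z a b
  unfolding pderivative_bump g_def[symmetric] by (rule pderivative_eq)
 then show ?thesis by (simp add: fun_eq_iff inner_commute)
qed

lemma bump_nonneg: "bump j z \<ge> 0" and bump_zero_pos: "bump j 0 > 0"
 by (auto simp: bump_def flat_exp_def)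

section \<open>Change of variables\<close>

lemma smooth_zero_outside_derivative:
 fixes g :: "'a::euclidean_space => 'b::real_normed_vector"
 assumes "(g has_derivative g') (at x)" "\<And>y. g y \<noteq> 0 ==> norm y \<le> R" "R < norm x"
 shows "g' = (\<lambda>_. 0)"
proof -
 have o: "open (- cball (0::'a) R)" by (simp add: open_Compl)
 have "((\<lambda>_. 0) has_derivative g') (at x)"
  by (rule has_derivative_transform_within_open[OF assms(1) o]) (use assms in force)+
 then show ?thesis using has_derivative_unique[OF has_derivative_const] by metis
qed

text \<open>Differentiation of \<open>s \<mapsto> \<integral>\<^sub>X g (x + s v) dx\<close>. For a set \<open>X\<close> invariant under
 translation by \<open>v\<close> it says that the integral of \<open>\<partial>\<^sub>v g\<close> over \<open>X\<close> vanishes.\<close>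

lemma integral_translation_has_derivative:
 fixes g :: "'a::euclidean_space => real"
 assumes der: "\<And>x. (g has_derivative g' x) (at x)"
  and cont: "continuous_on UNIV (\<lambda>x. g' x v)" and bdd: "bounded {x. g x \<noteq> 0}"
  and X: "X \<in> sets borel"
 shows "((\<lambda>s. LINT x|lborel. indicator X x * g (x + s *\<^sub>R v)) has_real_derivative
  (LINT x|lborel. indicator X x * g' (x + s *\<^sub>R v) v)) (at s)"
proof -
 obtain R where R: "\<And>y. g y \<noteq> 0 ==> norm y \<le> R"
  using bdd unfolding bounded_iff by auto
 have g'0: "g' y v = 0" if "R < norm y" for y
  using smooth_zero_outside_derivative[OF der R that] by simp
 have "compact ((\<lambda>x. g' x v) ` cball 0 R)"
  by (intro compact_continuous_image continuous_on_subset[OF cont]) auto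
 then have "bounded ((\<lambda>x. g' x v) ` cball 0 R)" by (rule compact_imp_bounded)
 then obtain B where B: "B > 0" "\<And>x. x \<in> cball 0 R ==> \<bar>g' x v\<bar> \<le> B"
  unfolding bounded_pos by auto
 have B': "\<bar>g' y v\<bar> \<le> B" for y
  using B g'0[of y] by (cases "R < norm y") auto
 have contg: "continuous_on UNIV g"
  using der has_derivative_continuous continuous_at_imp_continuous_on by blast
 note [measurable] = borel_measurable_continuous_onI[OF contg] borel_measurable_continuous_onI[OF cont] X
 have line: "((\<lambda>t. g (x + t *\<^sub>R v)) has_real_derivative g' (x + t *\<^sub>R v) v) (at t)" for x t
 proof -
  have "((\<lambda>t. x + t *\<^sub>R v) has_derivative (\<lambda>h. h *\<^sub>R v)) (at t)" by (auto intro!: derivative_eq_intros)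
  from has_derivative_compose[OF this der]
  have "((\<lambda>t. g (x + t *\<^sub>R v)) has_derivative (\<lambda>h. g' (x + t *\<^sub>R v) (h *\<^sub>R v))) (at t)" .
  moreover have "g' (x + t *\<^sub>R v) (h *\<^sub>R v) = g' (x + t *\<^sub>R v) v * h" for h
   using linear_cmul[OF has_derivative_linear[OF der]] by (simp add: mult.commute)
  ultimately show ?thesis by (simp add: has_field_derivative_def)
 qed
 \<comment> \<open>The bound on the directional derivative bounds the difference quotients uniformly
   in \<open>x\<close>.\<close>
 have lip: "\<bar>g (x + t *\<^sub>R v) - g (x + s *\<^sub>R v)\<bar> \<le> B * \<bar>t - s\<bar>" for x t
  using field_differentiable_bound[of UNIV "\<lambda>t. g (x + t *\<^sub>R v)" "\<lambda>t. g' (x + t *\<^sub>R v) v" B t s] line B'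
  by auto
 show ?thesis
  unfolding DERIV_def tendsto_at_iff_sequentially
 proof (intro allI impI)
  fix h :: "nat => real" assume h: "\<forall>i. h i \<in> UNIV - {0}" "h \<longlonglongrightarrow> 0"
  obtain K where K: "\<And>i. \<bar>h i\<bar> \<le> K"
   using convergent_imp_Bseq[of h] h(2) unfolding Bseq_def convergent_def by auto
  \<comment> \<open>\<open>Z\<close> contains the supports of all translates that occur along the
    sequence, so a constant times its indicator is an integrable majorant of the difference
    quotients.\<close>
  define Z where "Z = cball (0::'a) (R + (\<bar>s\<bar> + K) * norm v)"
  have [measurable]: "Z \<in> sets borel" unfolding Z_def by simp
  have K0: "K \<ge> 0" using K[of 0] by linarith
  have out: "g (x + t *\<^sub>R v) = 0" if "x \<notin> Z" "\<bar>t\<bar> \<le> \<bar>s\<bar> + K" for x t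
  proof (rule ccontr)
   assume "g (x + t *\<^sub>R v) \<noteq> 0"
   then have "norm (x + t *\<^sub>R v) \<le> R" by (rule R)
   moreover have "norm x \<le> norm (x + t *\<^sub>R v) + \<bar>t\<bar> * norm v"
    using norm_triangle_ineq4[of "x + t *\<^sub>R v" "t *\<^sub>R v"] by simp
   moreover have "\<bar>t\<bar> * norm v \<le> (\<bar>s\<bar> + K) * norm v" using that by (intro mult_right_mono) auto
   ultimately show False using that(1) by (simp add: Z_def)
  qed
  have int: "integrable lborel (\<lambda>x. indicator X x * g (x + t *\<^sub>R v))" if "\<bar>t\<bar> \<le> \<bar>s\<bar> + K" for t
  proof -
   have "compact (g ` cball 0 R)"
    by (intro compact_continuous_image continuous_on_subset[OF contg]) auto
   then have "bounded (g ` cball 0 R)" by (rule compact_imp_bounded)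
   then obtain C where C: "C > 0" "\<And>x. x \<in> cball 0 R ==> \<bar>g x\<bar> \<le> C"
    unfolding bounded_pos by auto
   have C': "\<bar>g y\<bar> \<le> C" for y
    using C R[of y] by (cases "g y = 0") auto
   show ?thesis
   proof (rule Bochner_Integration.integrable_bound[where f="\<lambda>x. C * indicator Z x"])
    show "AE x in lborel. norm (indicator X x * g (x + t *\<^sub>R v)) \<le> norm (C * indicator Z x :: real)"
     using C' C(1) out[OF _ that] by (auto simp: indicator_def abs_mult)
   qed (auto simp: Z_def intro!: integrable_mult_right integrable_real_indicator emeasure_lborel_cball_finite)
  qed
  have 1: "(\<lambda>i. LINT x|lborel. indicator X x * ((g (x + (s + h i) *\<^sub>R v) - g (x + s *\<^sub>R v)) / h i))
   \<longlonglongrightarrow> (LINT x|lborel. indicator X x * g' (x + s *\<^sub>R v) v)"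
  proof (rule integral_dominated_convergence[where w="\<lambda>x. B * indicator Z x"])
   show "integrable lborel (\<lambda>x. B * indicator Z x)"
    by (auto simp: Z_def intro!: integrable_mult_right integrable_real_indicator emeasure_lborel_cball_finite)
   show "AE x in lborel. (\<lambda>i. indicator X x * ((g (x + (s + h i) *\<^sub>R v) - g (x + s *\<^sub>R v)) / h i))
    \<longlonglongrightarrow> indicator X x * g' (x + s *\<^sub>R v) v"
   proof (intro AE_I2 tendsto_mult_left)
    fix x
    show "(\<lambda>i. (g (x + (s + h i) *\<^sub>R v) - g (x + s *\<^sub>R v)) / h i) \<longlonglongrightarrow> g' (x + s *\<^sub>R v) v"
     using line[of x s] h unfolding DERIV_def tendsto_at_iff_sequentially o_def by blast
   qed
   show "AE x in lborel. norm (indicator X x * ((g (x + (s + h i) *\<^sub>R v) - g (x + s *\<^sub>R v)) / h i)) \<le> B * indicator Z x" for i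
   proof (intro AE_I2)
    fix x
    have hi: "h i \<noteq> 0" "\<bar>s + h i\<bar> \<le> \<bar>s\<bar> + K" "\<bar>s\<bar> \<le> \<bar>s\<bar> + K"
     using h(1) K[of i] K0 by auto
    have "\<bar>(g (x + (s + h i) *\<^sub>R v) - g (x + s *\<^sub>R v)) / h i\<bar> \<le> B"
     using lip[of x "s + h i"] hi(1) by (simp add: abs_divide field_simps)
    then show "norm (indicator X x * ((g (x + (s + h i) *\<^sub>R v) - g (x + s *\<^sub>R v)) / h i)) \<le> B * indicator Z x"
     using out[of x "s + h i"] out[of x s] hi B(1) by (auto simp: indicator_def)
   qed
  qed measurable
  have 2: "(LINT x|lborel. indicator X x * ((g (x + (s + h i) *\<^sub>R v) - g (x + s *\<^sub>R v)) / h i)) =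
   ((LINT x|lborel. indicator X x * g (x + (s + h i) *\<^sub>R v)) - (LINT x|lborel. indicator X x * g (x + s *\<^sub>R v))) / h i" for i
  proof -
   have hi: "\<bar>s + h i\<bar> \<le> \<bar>s\<bar> + K" "\<bar>s\<bar> \<le> \<bar>s\<bar> + K" using K[of i] K0 by auto
   show ?thesis
    unfolding Bochner_Integration.integral_diff[OF int[OF hi(1)] int[OF hi(2)], symmetric]
     integral_divide_zero[symmetric]
    by (simp add: right_diff_distrib)
  qed
  show "((\<lambda>k. ((LINT x|lborel. indicator X x * g (x + (s + k) *\<^sub>R v)) - (LINT x|lborel. indicator X x * g (x + s *\<^sub>R v))) / k) \<circ> h)
   \<longlonglongrightarrow> (LINT x|lborel. indicator X x * g' (x + s *\<^sub>R v) v)"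
   using 1 unfolding 2 o_def .
 qed
qed

section \<open>Translations, scalings and integrals of derivatives\<close>

lemma nn_integral_lborel_translation:
 fixes f :: "'a::euclidean_space => ennreal"
 assumes [measurable]: "f \<in> borel_measurable borel"
 shows "(\<integral>\<^sup>+x. f (c + x) \<partial>lborel) = (\<integral>\<^sup>+x. f x \<partial>lborel)"
 by (subst lborel_distr_plus[symmetric, of c], subst nn_integral_distr) auto

lemma integral_lborel_translation:
 fixes f :: "'a::euclidean_space => 'b::{banach, second_countable_topology}"
 assumes [measurable]: "f \<in> borel_measurable borel"
 shows "(LINT x|lborel. f (c + x)) = (LINT x|lborel. f x)"
 by (subst (2) lborel_distr_plus[symmetric, of c], subst integral_distr) auto

lemma integral_lborel_affine:
 fixes f :: "'a::euclidean_space => 'b::{banach, second_countable_topology}"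
 assumes [measurable]: "f \<in> borel_measurable borel" and "c > 0"
 shows "(LINT x|lborel. f x) = (c ^ DIM('a)) *\<^sub>R (LINT x|lborel. f (t + c *\<^sub>R x))"
 by (subst lborel_affine[of c t], use assms(2) in simp, subst integral_density, simp, simp, simp,
   subst integral_distr) (use assms(2) in auto)

lemma integrable_compact_support:
 fixes f :: "'a::euclidean_space => 'b::{banach, second_countable_topology}"
 assumes "continuous_on UNIV f" "bounded {x. f x \<noteq> 0}"
 shows "integrable lborel f"
proof -
 obtain R where R: "\<And>x. f x \<noteq> 0 ==> norm x \<le> R" using assms(2) unfolding bounded_iff by auto
 have "integrable lborel (\<lambda>x. indicator (cball 0 R) x *\<^sub>R f x)"
  by (intro borel_integrable_compact continuous_on_subset[OF assms(1)]) auto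
 moreover have "indicator (cball 0 R) x *\<^sub>R f x = f x" for x
  using R by (cases "f x = 0") (auto simp: indicator_def)
 ultimately show ?thesis by simp
qed

lemma AE_lborel_affine:
 fixes t :: "'a::euclidean_space"
 assumes "c \<noteq> 0" "Measurable.pred borel P" "AE x in lborel. P x"
 shows "AE x in lborel. P (t + c *\<^sub>R x)"
proof -
 have "AE x in density (distr lborel borel (\<lambda>x. t + c *\<^sub>R x)) (\<lambda>_. \<bar>c\<bar> ^ DIM('a)). P x"
  using assms by (subst lborel_affine[OF assms(1), of t, symmetric]) auto
 then show ?thesis
  using assms by (subst (asm) AE_density) (auto simp: AE_distr_iff)
qed

lemma integral_pderivative_zero:
 fixes g :: "'a::euclidean_space => real"
 assumes der: "\<And>x. (g has_derivative g' x) (at x)"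
  and cont: "continuous_on UNIV (\<lambda>x. g' x v)" and bdd: "bounded {x. g x \<noteq> 0}"
 shows "(LINT x|lborel. g' x v) = 0"
proof -
 have contg: "continuous_on UNIV g"
  using der has_derivative_continuous continuous_at_imp_continuous_on by blast
 note [measurable] = borel_measurable_continuous_onI[OF contg]
 have "(LINT x|lborel. g (x + s *\<^sub>R v)) = (LINT x|lborel. g x)" for s
  using integral_lborel_translation[of g "s *\<^sub>R v"] by (simp add: add.commute)
 then have "((\<lambda>s::real. LINT x|lborel. g x) has_real_derivative (LINT x|lborel. g' x v)) (at 0)"
  using integral_translation_has_derivative[OF assms, of UNIV 0] by simp
 then show ?thesis using DERIV_unique DERIV_const by metis
qed

text \<open>The change of variables theorem of the library is stated for index types in class
 \<open>wellorder\<close>. The type \<open>'n idx\<close> is a well-ordered copy of the index type \<open>'n\<close>.\<close>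

typedef ('a::finite) idx = "{..<CARD('a)}"
 by (rule exI[of _ 0]) simp

instance idx :: (finite) finite
proof
 have "(UNIV :: 'a idx set) = Abs_idx ` {..<CARD('a)}"
  by (rule type_definition.Abs_image[OF type_definition_idx, symmetric])
 then show "finite (UNIV :: 'a idx set)" by (metis finite_imageI finite_lessThan)
qed

instantiation idx :: (finite) wellorder
begin
definition less_eq_idx :: "'a idx => 'a idx => bool" where "less_eq_idx a b \<longleftrightarrow> Rep_idx a \<le> Rep_idx b"
definition less_idx :: "'a idx => 'a idx => bool" where "less_idx a b \<longleftrightarrow> Rep_idx a < Rep_idx b"
instance
proof
 fix P :: "'a idx => bool" and a
 assume *: "\<And>x. (\<And>y. y < x ==> P y) ==> P x"
 show "P a" by (induction a rule: measure_induct_rule[of Rep_idx]) (rule *, simp add: less_idx_def)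
qed (auto simp: less_eq_idx_def less_idx_def Rep_idx_inject)
end

lemma ex_bij_idx: "\<exists>e :: 'a::finite => 'a idx. bij e"
proof -
 have "CARD('a idx) = CARD('a)"
  using type_definition.card[OF type_definition_idx] by simp
 then show ?thesis using finite_same_card_bij[of "UNIV :: 'a set" "UNIV :: 'a idx set"] by auto
qed

definition to_idx :: "'a::finite => 'a idx" where "to_idx = (SOME e. bij e)"

lemma bij_to_idx: "bij to_idx"
 unfolding to_idx_def using ex_bij_idx by (rule someI_ex)

definition reindex :: "real^'n => real^'n idx" where "reindex v = (\<chi> i. v $ inv to_idx i)"
definition unindex :: "real^'n idx => real^'n" where "unindex w = (\<chi> i. w $ to_idx i)"

lemma reindex_unindex [simp]: "reindex (unindex w) = w" and unindex_reindex [simp]: "unindex (reindex v) = v"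
 by (simp_all add: reindex_def unindex_def vec_eq_iff surj_f_inv_f[OF bij_is_surj[OF bij_to_idx]]
   inv_f_f[OF bij_is_inj[OF bij_to_idx]])

lemma linear_reindex: "linear reindex" and linear_unindex: "linear unindex"
 by (auto intro!: linearI simp: reindex_def unindex_def vec_eq_iff)

lemma borel_measurable_reindex [measurable]:
 "reindex \<in> borel_measurable borel" "unindex \<in> borel_measurable borel"
 by (auto intro!: borel_measurable_continuous_onI linear_continuous_on simp: linear_reindex linear_unindex linear_linear)

lemma prod_Basis_vec:
 fixes f :: "real^'n => 'b::comm_monoid_mult"
 shows "(\<Prod>b\<in>Basis. f b) = (\<Prod>i\<in>UNIV. f (axis i 1))"
proof -
 have B: "(Basis :: (real^'n) set) = range (\<lambda>i. axis i 1)" by (auto simp: Basis_vec_def)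
 have i: "inj (\<lambda>i::'n. axis i 1 :: real^'n)" by (auto simp: inj_def axis_eq_axis)
 show ?thesis unfolding B prod.reindex[OF i] by simp
qed

text \<open>Relabelling coordinates carries boxes to boxes with the same side lengths, and Lebesgue
  measure is determined by its values on boxes.\<close>

lemma distr_reindex: "distr lborel borel reindex = (lborel :: (real^('n::finite) idx) measure)"
proof (rule lborel_eqI[symmetric])
 fix l u :: "real^'n idx"
 assume le: "\<And>b. b \<in> Basis ==> l \<bullet> b \<le> u \<bullet> b"
 have le': "l $ i \<le> u $ i" for i using le[of "axis i 1"] by (simp add: inner_axis)
 have le'': "unindex l \<bullet> b \<le> unindex u \<bullet> b" if "b \<in> Basis" for b
  using that le' by (auto simp: Basis_vec_def inner_axis unindex_def)
 have eq: "(reindex -` box l u :: (real^'n) set) = box (unindex l) (unindex u)"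
 proof -
  have *: "(\<forall>i. P (inv to_idx i) i) \<longleftrightarrow> (\<forall>i::'n. P i (to_idx i))" for P
   using bij_to_idx by (metis bij_inv_eq_iff)
  show ?thesis
   by (auto simp: mem_box_cart reindex_def unindex_def)
    (metis bij_to_idx bij_inv_eq_iff)+
 qed
 have "emeasure (distr lborel borel reindex) (box l u) = emeasure lborel (box (unindex l) (unindex u))"
  by (subst emeasure_distr) (auto simp: eq)
 also have "\<dots> = (\<Prod>i\<in>UNIV. (unindex u - unindex l) $ i)"
  using le'' by (subst emeasure_lborel_box_eq)
   (auto simp: prod_Basis_vec inner_axis prod_ennreal simp flip: inner_diff_left)
 also have "\<dots> = (\<Prod>i\<in>UNIV. (u - l) $ i)"
  using prod.reindex_bij_betw[OF bij_to_idx, of "\<lambda>i. (u - l) $ i"] by (simp add: unindex_def)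
 finally show "emeasure (distr lborel borel reindex) (box l u) = (\<Prod>b\<in>Basis. (u - l) \<bullet> b)"
  by (simp add: prod_Basis_vec inner_axis)
qed simp

text \<open>The absolute Jacobian determinant, taken in the reindexed coordinates so that it is
  literally the density which the change of variables theorem produces there.\<close>

definition jac :: "(real^'n => real^'n) => real" where
 "jac L = \<bar>det (matrix (reindex \<circ> L \<circ> unindex))\<bar>"

lemma jac_nonneg: "jac L \<ge> 0" by (simp add: jac_def)

lemma jac_pos: assumes "linear L" "inj L" shows "jac L > 0"
proof -
 have "linear (reindex \<circ> L \<circ> unindex)"
  using assms linear_reindex linear_unindex by (intro linear_compose)
 moreover have "inj (reindex \<circ> L \<circ> unindex)"
  by (intro inj_compose assms) (metis inj_on_inverseI reindex_unindex unindex_reindex)+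
 ultimately show ?thesis by (simp add: jac_def det_nz_iff_inj)
qed

text \<open>A determinant is a polynomial in the matrix entries, and each entry depends continuously
  on \<open>y\<close>.\<close>

lemma continuous_on_jac:
 fixes D :: "'a::topological_space => (real^'n) \<Rightarrow>\<^sub>L (real^'n)"
 assumes "continuous_on S D"
 shows "continuous_on S (\<lambda>y. jac (blinfun_apply (D y)))"
proof -
 have "continuous_on S (\<lambda>y. reindex (blinfun_apply (D y) v))" for v
  using linear_reindex assms
  by (intro bounded_linear.continuous_on[of reindex] continuous_intros) (simp_all add: linear_linear)
 then show ?thesis
  unfolding jac_def det_def matrix_def by (auto intro!: continuous_intros)
qed

text \<open>The theorem \<open>has_measure_differentiable_image\<close> is applied to
  \<open>\<Phi>\<close> conjugated by the relabelling. It equates finite values only, so the work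
  lies in reaching an identity in \<open>ennreal\<close>.\<close>

lemma emeasure_differentiable_image:
 fixes \<Phi> :: "real^'n => real^'n"
 assumes A: "A \<in> sets borel" and im: "\<Phi> ` A \<in> sets borel"
  and der: "\<And>y. y \<in> A ==> (\<Phi> has_derivative \<Phi>' y) (at y within A)"
  and inj: "inj_on \<Phi> A"
  and meas: "(\<lambda>y. indicator A y * jac (\<Phi>' y)) \<in> borel_measurable borel"
 shows "emeasure lborel (\<Phi> ` A) = (\<integral>\<^sup>+y. ennreal (indicator A y * jac (\<Phi>' y)) \<partial>lborel)"
proof -
 let ?A = "reindex ` A" and ?F = "reindex \<circ> \<Phi> \<circ> unindex"
 let ?F' = "\<lambda>x. reindex \<circ> \<Phi>' (unindex x) \<circ> unindex"
 have A': "?A = unindex -` A" by (auto simp: image_iff) (metis reindex_unindex)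
 have [measurable]: "?A \<in> sets borel"
  unfolding A' using measurable_sets[OF borel_measurable_reindex(2) A] by simp
 have bl: "bounded_linear reindex" "bounded_linear unindex"
  using linear_reindex linear_unindex by (simp_all add: linear_linear)
 have der': "(?F has_derivative ?F' x) (at x within ?A)" if "x \<in> ?A" for x
 proof -
  have "unindex x \<in> A" using that A' by auto
  moreover have "unindex ` ?A = A" by (auto simp: image_image)
  ultimately have "((\<Phi> \<circ> unindex) has_derivative (\<Phi>' (unindex x) \<circ> unindex)) (at x within ?A)"
   by (intro diff_chain_within bounded_linear_imp_has_derivative bl) (simp add: der)
  from bounded_linear.has_derivative[OF bl(1) this] show ?thesis
   by (simp add: o_def)
 qed
 have inj': "inj_on ?F ?A"
  using inj by (auto simp: inj_on_def) (metis unindex_reindex)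
 have img: "?F ` ?A = reindex ` \<Phi> ` A" by (force simp: image_image)
 have img': "reindex ` \<Phi> ` A = unindex -` (\<Phi> ` A)"
  by (auto simp: image_iff) (metis reindex_unindex)
 have img_meas: "reindex ` \<Phi> ` A \<in> sets borel"
  unfolding img' using measurable_sets[OF borel_measurable_reindex(2) im] by simp
 have e1: "emeasure lborel (?F ` ?A) = emeasure lborel (\<Phi> ` A)"
  unfolding img using img_meas im
  by (subst distr_reindex[symmetric], subst emeasure_distr) (auto simp: img' vimage_def)
 define f where "f = (\<lambda>x. \<bar>det (matrix (?F' x))\<bar>)"
 have f: "f x = jac (\<Phi>' (unindex x))" for x unfolding f_def jac_def by simp
 have fm: "(\<lambda>x. indicator ?A x * f x) \<in> borel_measurable borel"
 proof -
  have "(\<lambda>x. indicator A (unindex x) * jac (\<Phi>' (unindex x))) \<in> borel_measurable borel"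
   using measurable_compose[OF borel_measurable_reindex(2) meas] .
  then show ?thesis unfolding f A' by (simp add: indicator_vimage[symmetric] o_def)
 qed
 have e2: "(\<integral>\<^sup>+x. ennreal (indicator ?A x * f x) \<partial>lborel) = (\<integral>\<^sup>+y. ennreal (indicator A y * jac (\<Phi>' y)) \<partial>lborel)"
  using fm by (subst distr_reindex[symmetric], subst nn_integral_distr)
   (auto simp: f A' indicator_def intro!: nn_integral_cong)
 have key: "?F ` ?A \<in> lmeasurable \<and> measure lebesgue (?F ` ?A) = m \<longleftrightarrow> (f has_integral m) ?A" for m
  unfolding f_def by (rule has_measure_differentiable_image[OF _ der' inj']) (auto simp: sets_completionI_sets)
 have "emeasure lborel (?F ` ?A) = (\<integral>\<^sup>+x. ennreal (indicator ?A x * f x) \<partial>lborel)"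
 \<comment> \<open>Once one side is finite, \<open>key\<close> makes the other side finite and
   equal; in the remaining case both sides are infinite.\<close>
 proof (cases "emeasure lborel (?F ` ?A) = \<infinity> \<and> (\<integral>\<^sup>+x. ennreal (indicator ?A x * f x) \<partial>lborel) = \<infinity>")
  case False
  have lm: "?F ` ?A \<in> lmeasurable"
  proof (cases "emeasure lborel (?F ` ?A) = \<infinity>")
   case True
   with False have "(\<integral>\<^sup>+x. ennreal (indicator ?A x * f x) \<partial>lborel) < \<infinity>" by (simp add: top.not_eq_extremum)
   then have "(\<lambda>x. indicator ?A x * f x) integrable_on UNIV"
    using fm by (intro nn_integral_integrable_on) (auto simp: f jac_nonneg)
   then have "f integrable_on ?A"
    by (subst integrable_restrict_UNIV[symmetric]) (auto simp: indicator_def intro: integrable_eq)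
   then show ?thesis using key by blast
  next
   case False
   then show ?thesis using img_meas unfolding img
    by (simp add: fmeasurable_def top.not_eq_extremum emeasure_completion sets_completionI_sets)
  qed
  then have "(f has_integral measure lebesgue (?F ` ?A)) ?A" using key by blast
  then have "(\<integral>\<^sup>+x. ennreal (indicator ?A x * f x) \<partial>lborel) = ennreal (measure lebesgue (?F ` ?A))"
   by (intro nn_integral_has_integral_lebesgue) (auto simp: f_def)
  also have "\<dots> = emeasure lborel (?F ` ?A)"
   using emeasure_eq_measure2[OF lm] img_meas unfolding img by (simp add: emeasure_completion)
  finally show ?thesis by simp
 qed auto
 then show ?thesis unfolding e1 e2 .
qed

text \<open>All integral formulas follow from one identity of measures: Lebesgue measure restricted
  to the image is the image of the Jacobian density. It is checked on a Borel set \<open>B\<close>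
  by applying \<open>emeasure_differentiable_image\<close> to the points of \<open>Q\<close> that
  are mapped into \<open>B\<close>.\<close>

lemma
 fixes \<Phi> :: "real^'n => real^'n"
 assumes Q: "open Q" and der: "\<And>y. y \<in> Q ==> (\<Phi> has_derivative \<Phi>' y) (at y)"
  and inj: "inj_on \<Phi> Q" and cont: "continuous_on Q (\<lambda>y. jac (\<Phi>' y))"
 shows open_diffeomorphic_image: "open (\<Phi> ` Q)"
  and nn_integral_diffeomorphic_image: "\<And>f :: real^'n => ennreal. f \<in> borel_measurable borel ==>
   (\<integral>\<^sup>+x. indicator (\<Phi> ` Q) x * f x \<partial>lborel) = (\<integral>\<^sup>+y. ennreal (indicator Q y * jac (\<Phi>' y)) * f (\<Phi> y) \<partial>lborel)"
  and integral_diffeomorphic_image: "\<And>f :: real^'n => real. f \<in> borel_measurable borel ==>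
   (LINT x|lborel. indicator (\<Phi> ` Q) x * f x) = (LINT y|lborel. indicator Q y * jac (\<Phi>' y) * f (\<Phi> y))"
proof -
 have contf: "continuous_on Q \<Phi>"
  using der has_derivative_continuous continuous_at_imp_continuous_on by blast
 show op: "open (\<Phi> ` Q)" by (rule invariance_of_domain[OF contf Q inj])
 \<comment> \<open>\<open>F\<close> extends \<open>\<Phi>\<close> by \<open>0\<close>, so that it is
   Borel on the whole space and can define an image measure.\<close>
 define F where "F y = (if y \<in> Q then \<Phi> y else 0)" for y
 have Q': "Q \<in> sets borel" using Q by simp
 have [measurable]: "F \<in> borel_measurable borel"
  unfolding F_def by (rule borel_measurable_continuous_on_if[OF Q' contf]) auto
 have [measurable]: "(\<lambda>y. indicator Q y * jac (\<Phi>' y)) \<in> borel_measurable borel"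
  using borel_measurable_continuous_on_indicator[OF Q' cont] by simp
 have M: "density lborel (indicator (\<Phi> ` Q)) =
   distr (density lborel (\<lambda>y. ennreal (indicator Q y * jac (\<Phi>' y)))) borel F" (is "?L = ?R")
 proof (rule measure_eqI)
  fix B assume "B \<in> sets ?L"
  then have [measurable]: "B \<in> sets borel" by simp
  define A where "A = {y \<in> Q. \<Phi> y \<in> B}"
  have A': "A = Q \<inter> F -` B" by (auto simp: A_def F_def)
  have Am: "A \<in> sets borel"
   unfolding A' using Q' measurable_sets[of F borel borel B] by (intro sets.Int) auto
  have im: "\<Phi> ` A = B \<inter> \<Phi> ` Q" by (auto simp: A_def)
  have "emeasure ?L B = emeasure lborel (\<Phi> ` A)"
   unfolding im using op by (subst emeasure_density) (auto simp: indicator_inter_arith mult.commute intro!: nn_integral_cong simp flip: nn_integral_indicator)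
  also have "\<dots> = (\<integral>\<^sup>+y. ennreal (indicator A y * jac (\<Phi>' y)) \<partial>lborel)"
  proof (rule emeasure_differentiable_image[OF Am])
   show "\<Phi> ` A \<in> sets borel" unfolding im using op by auto
   show "(\<Phi> has_derivative \<Phi>' y) (at y within A)" if "y \<in> A" for y
    using der that by (auto simp: A_def intro: has_derivative_at_withinI)
   show "inj_on \<Phi> A" using inj by (rule inj_on_subset) (auto simp: A_def)
   have "(\<lambda>y. indicator A y * (indicator Q y * jac (\<Phi>' y))) \<in> borel_measurable borel" using Am by measurable
   then show "(\<lambda>y. indicator A y * jac (\<Phi>' y)) \<in> borel_measurable borel"
    by (rule measurable_cong[THEN iffD1, rotated]) (auto simp: A_def indicator_def)
  qed
  also have "\<dots> = emeasure ?R B"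
   using measurable_sets[of F borel borel B]
   by (subst emeasure_distr, simp, simp, subst emeasure_density, simp, simp)
    (auto simp: A' indicator_def intro!: nn_integral_cong)
  finally show "emeasure ?L B = emeasure ?R B" .
 qed simp
 show "(\<integral>\<^sup>+x. indicator (\<Phi> ` Q) x * f x \<partial>lborel) = (\<integral>\<^sup>+y. ennreal (indicator Q y * jac (\<Phi>' y)) * f (\<Phi> y) \<partial>lborel)"
  if [measurable]: "f \<in> borel_measurable borel" for f :: "real^'n => ennreal"
 proof -
  have "(\<integral>\<^sup>+x. indicator (\<Phi> ` Q) x * f x \<partial>lborel) = (\<integral>\<^sup>+x. f x \<partial>?L)"
   using op by (subst nn_integral_density) auto
  also have "\<dots> = (\<integral>\<^sup>+y. ennreal (indicator Q y * jac (\<Phi>' y)) * f (F y) \<partial>lborel)"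
   unfolding M by (subst nn_integral_distr, simp, simp, subst nn_integral_density) auto
  finally show ?thesis by (auto simp: F_def indicator_def intro!: nn_integral_cong)
 qed
 show "(LINT x|lborel. indicator (\<Phi> ` Q) x * f x) = (LINT y|lborel. indicator Q y * jac (\<Phi>' y) * f (\<Phi> y))"
  if [measurable]: "f \<in> borel_measurable borel" for f :: "real^'n => real"
 proof -
  have "(LINT x|lborel. indicator (\<Phi> ` Q) x * f x) = (LINT x|density lborel (\<lambda>x. ennreal (indicator (\<Phi> ` Q) x)). f x)"
   using op by (subst integral_density) auto
  also have "\<dots> = (LINT x|?L. f x)" by (simp add: ennreal_indicator)
  also have "\<dots> = (LINT y|lborel. indicator Q y * jac (\<Phi>' y) * f (F y))"
   unfolding M by (subst integral_distr, simp, simp, subst integral_density) (auto simp: jac_nonneg)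
  finally show ?thesis by (auto simp: F_def indicator_def intro!: Bochner_Integration.integral_cong)
 qed
qed

section \<open>The Fourier transform and the pressure\<close>

lemma integral_lborel_prod:
 fixes f :: "'a::euclidean_space => real => complex"
 assumes "\<And>b. b \<in> Basis ==> integrable lborel (f b)"
 shows "(LINT x|lborel. (\<Prod>b\<in>Basis. f b (x \<bullet> b))) = (\<Prod>b\<in>Basis. (LINT x|lborel. f b x))"
proof -
 interpret product_sigma_finite "\<lambda>_::'a. lborel :: real measure" by standard
 have m: "f b \<in> borel_measurable borel" if "b \<in> Basis" for b
  using borel_measurable_integrable[OF assms[OF that]] by simp
 have lb: "(lborel :: 'a measure) = distr (\<Pi>\<^sub>M b\<in>Basis. lborel) borel (\<lambda>f. \<Sum>b\<in>Basis. f b *\<^sub>R b)"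
  by (subst lborel_def) (simp add: lborel_eq_real)
 have "(LINT x|lborel. (\<Prod>b\<in>Basis. f b (x \<bullet> b))) =
   (LINT g|(\<Pi>\<^sub>M b\<in>Basis. lborel). (\<Prod>b\<in>Basis. f b ((\<Sum>b\<in>Basis. g b *\<^sub>R b) \<bullet> b)))"
 proof (subst lb, rule integral_distr)
  show "(\<lambda>x::'a. \<Prod>b\<in>Basis. f b (x \<bullet> b)) \<in> borel_measurable borel"
   by (intro borel_measurable_prod measurable_compose[OF _ m]) auto
 qed simp
 also have "\<dots> = (LINT g|(\<Pi>\<^sub>M b\<in>Basis. lborel). (\<Prod>b\<in>Basis. f b (g b)))"
  by (intro Bochner_Integration.integral_cong prod.cong) auto
 also have "\<dots> = (\<Prod>b\<in>Basis. (LINT x|lborel. f b x))"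
  by (intro product_integral_prod assms) auto
 finally show ?thesis .
qed

text \<open>The standard normal density. In product form its transform is a product of
  characteristic functions of the one-dimensional normal law.\<close>

definition gauss :: "'a::euclidean_space => real" where
 "gauss x = (\<Prod>b\<in>Basis. std_normal_density (x \<bullet> b))"

lemma gauss_eq: "gauss (x::'a::euclidean_space) = exp (- (x \<bullet> x) / 2) / sqrt (2 * pi) ^ DIM('a)"
proof -
 have "gauss x = (\<Prod>b\<in>(Basis::'a set). (1 / sqrt (2 * pi)) * exp (- (x \<bullet> b)\<^sup>2 / 2))"
  by (simp add: gauss_def std_normal_density_def)
 also have "\<dots> = (1 / sqrt (2 * pi)) ^ DIM('a) * exp (\<Sum>b\<in>Basis. - (x \<bullet> b)\<^sup>2 / 2)"
  by (simp only: prod.distrib prod_constant exp_sum[OF finite_Basis])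
 also have "(\<Sum>b\<in>Basis. - (x \<bullet> b)\<^sup>2 / 2) = - (x \<bullet> x) / 2"
  by (simp add: euclidean_inner[of x x] power2_eq_square sum_negf sum_divide_distrib)
 finally show ?thesis by (simp add: power_divide)
qed

lemma gauss_pos: "gauss x > 0"
 by (simp add: gauss_eq)

lemma gauss_measurable [measurable]: "gauss \<in> borel_measurable borel"
 unfolding gauss_def[abs_def] by measurable

lemma gauss_fourier:
 "(LINT x|lborel. cis (v \<bullet> x) * complex_of_real (gauss x)) = complex_of_real (exp (- (v \<bullet> v) / 2))"
 for v :: "'a::euclidean_space"
proof -
 have eq: "cis (v \<bullet> x) * complex_of_real (gauss x) =
   (\<Prod>b\<in>Basis. iexp ((v \<bullet> b) * (x \<bullet> b)) * complex_of_real (std_normal_density (x \<bullet> b)))" for x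
  by (simp add: cis_conv_exp gauss_def prod.distrib exp_sum[symmetric] sum_distrib_left[symmetric]
    euclidean_inner[of v x])
 have int: "integrable lborel (\<lambda>x. iexp (t * x) * complex_of_real (std_normal_density x))" for t
 proof (rule Bochner_Integration.integrable_bound[OF integrable_normal_density[of 1 0]])
  show "AE x in lborel. norm (iexp (t * x) * complex_of_real (std_normal_density x)) \<le> norm (std_normal_density x)"
   by (simp add: norm_mult)
 qed measurable
 have one: "(LINT x|lborel. iexp (t * x) * complex_of_real (std_normal_density x)) = complex_of_real (exp (- t\<^sup>2 / 2))" for t
 proof -
  have "char std_normal_distribution t = complex_of_real (exp (- t\<^sup>2 / 2))"
   by (simp add: char_std_normal_distribution)
  moreover have "char std_normal_distribution t = (LINT x|lborel. iexp (t * x) * complex_of_real (std_normal_density x))"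
   unfolding char_def by (subst integral_density) (auto simp: scaleR_conv_of_real mult.commute)
  ultimately show ?thesis by simp
 qed
 have "(LINT x|lborel. cis (v \<bullet> x) * complex_of_real (gauss x)) = (\<Prod>b\<in>Basis. complex_of_real (exp (- (v \<bullet> b)\<^sup>2 / 2)))"
  unfolding eq by (subst integral_lborel_prod, rule int) (simp only: one)
 also have "\<dots> = complex_of_real (exp (\<Sum>b\<in>Basis. - (v \<bullet> b)\<^sup>2 / 2))"
  by (simp only: exp_sum[OF finite_Basis] of_real_prod)
 also have "(\<Sum>b\<in>Basis. - (v \<bullet> b)\<^sup>2 / 2) = - (v \<bullet> v) / 2"
  by (simp add: euclidean_inner[of v v] power2_eq_square sum_negf sum_divide_distrib)
 finally show ?thesis .
qed

lemma nn_integral_gauss: "(\<integral>\<^sup>+x. ennreal (gauss (x::'a::euclidean_space)) \<partial>lborel) = 1"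
proof -
 have "(\<integral>\<^sup>+x. ennreal (gauss (x::'a)) \<partial>lborel) = (\<integral>\<^sup>+x. (\<Prod>b\<in>Basis. ennreal (std_normal_density (x \<bullet> b))) \<partial>(lborel :: 'a measure))"
  by (simp add: gauss_def prod_ennreal)
 also have "\<dots> = (\<Prod>b\<in>(Basis :: 'a set). (\<integral>\<^sup>+x. ennreal (std_normal_density x) \<partial>lborel))"
  by (rule nn_integral_lborel_prod) auto
 also have "(\<integral>\<^sup>+x. ennreal (std_normal_density x) \<partial>lborel) = 1"
  by (subst nn_integral_eq_integral) (auto intro: integrable_normal_density simp: integral_normal_density)
 finally show ?thesis by simp
qed

lemma integrable_gauss: "integrable lborel (gauss :: 'a::euclidean_space => real)"
 and integral_gauss: "(LINT x|lborel. gauss (x::'a)) = 1"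
proof -
 have n: "AE x in lborel. 0 \<le> gauss (x :: 'a)" by (intro AE_I2 less_imp_le gauss_pos)
 show "integrable lborel (gauss :: 'a => real)"
  by (rule integrableI_nonneg[OF _ n]) (auto simp: nn_integral_gauss)
 show "(LINT x|lborel. gauss (x::'a)) = 1"
  by (subst integral_eq_nn_integral[OF _ n]) (auto simp: nn_integral_gauss)
qed

text \<open>Rescaling by \<open>1 / d\<close> reduces this to \<open>gauss_fourier\<close>. The
  integrand contains the factor that damps the inversion integral; as a function of \<open>w\<close>
  the value is \<open>(2 * pi) ^ DIM('a)\<close> times a Gaussian approximate identity of width
  \<open>d\<close>.\<close>

lemma gauss_fourier_scaled:
 fixes w :: "'a::euclidean_space"
 assumes "d > 0"
 shows "(LINT x|lborel. cis (w \<bullet> x) * complex_of_real (exp (- (d\<^sup>2 * (x \<bullet> x)) / 2)))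
  = complex_of_real ((2 * pi / d) ^ DIM('a) * gauss (w /\<^sub>R d))"
proof -
 let ?n = "DIM('a)"
 have m: "(\<lambda>x. cis (w \<bullet> x) * complex_of_real (exp (- (d\<^sup>2 * (x \<bullet> x)) / 2))) \<in> borel_measurable borel"
  unfolding cis_conv_exp by measurable
 have "(LINT x|lborel. cis (w \<bullet> x) * complex_of_real (exp (- (d\<^sup>2 * (x \<bullet> x)) / 2)))
  = ((1/d) ^ ?n) *\<^sub>R (LINT x|lborel. cis (w \<bullet> (0 + (1/d) *\<^sub>R x)) *
    complex_of_real (exp (- (d\<^sup>2 * ((0 + (1/d) *\<^sub>R x) \<bullet> (0 + (1/d) *\<^sub>R x))) / 2)))"
  by (rule integral_lborel_affine[OF m]) (use assms in simp)
 also have "(\<lambda>x. cis (w \<bullet> (0 + (1/d) *\<^sub>R x)) * complex_of_real (exp (- (d\<^sup>2 * ((0 + (1/d) *\<^sub>R x) \<bullet> (0 + (1/d) *\<^sub>R x))) / 2)))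
  = (\<lambda>x. complex_of_real (sqrt (2 * pi) ^ ?n) * (cis ((w /\<^sub>R d) \<bullet> x) * complex_of_real (gauss x)))"
 proof
  fix x :: 'a
  have "d\<^sup>2 * ((0 + (1/d) *\<^sub>R x) \<bullet> (0 + (1/d) *\<^sub>R x)) = x \<bullet> x" using assms by (simp add: power2_eq_square)
  moreover have "exp (- (x \<bullet> x) / 2) = sqrt (2 * pi) ^ ?n * gauss x" by (simp add: gauss_eq)
  moreover have "w \<bullet> (0 + (1/d) *\<^sub>R x) = (w /\<^sub>R d) \<bullet> x" by (simp add: divide_inverse)
  ultimately show "cis (w \<bullet> (0 + (1/d) *\<^sub>R x)) * complex_of_real (exp (- (d\<^sup>2 * ((0 + (1/d) *\<^sub>R x) \<bullet> (0 + (1/d) *\<^sub>R x))) / 2))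
   = complex_of_real (sqrt (2 * pi) ^ ?n) * (cis ((w /\<^sub>R d) \<bullet> x) * complex_of_real (gauss x))"
   by (simp only: of_real_mult mult_ac)
 qed
 also have "(LINT x|lborel. complex_of_real (sqrt (2 * pi) ^ ?n) * (cis ((w /\<^sub>R d) \<bullet> x) * complex_of_real (gauss x)))
  = complex_of_real (sqrt (2 * pi) ^ ?n) * complex_of_real (exp (- ((w /\<^sub>R d) \<bullet> (w /\<^sub>R d)) / 2))"
  by (simp only: integral_mult_right_zero gauss_fourier)
 also have "exp (- ((w /\<^sub>R d) \<bullet> (w /\<^sub>R d)) / 2) = sqrt (2 * pi) ^ ?n * gauss (w /\<^sub>R d)"
  by (simp add: gauss_eq)
 also have "((1/d) ^ ?n) *\<^sub>R (complex_of_real (sqrt (2 * pi) ^ ?n) * complex_of_real (sqrt (2 * pi) ^ ?n * gauss (w /\<^sub>R d)))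
  = complex_of_real ((1/d * sqrt (2 * pi) * sqrt (2 * pi)) ^ ?n * gauss (w /\<^sub>R d))"
  by (simp only: scaleR_conv_of_real of_real_mult power_mult_distrib mult.assoc)
 also have "1/d * sqrt (2 * pi) * sqrt (2 * pi) = 2 * pi / d" by simp
 finally show ?thesis .
qed

lemma test_function_integrable:
 fixes f :: "'a::euclidean_space => 'b::euclidean_space"
 assumes "test_function f"
 shows "integrable lborel f" "f \<in> borel_measurable borel"
 using assms integrable_compact_support smooth_imp_continuous borel_measurable_continuous_onI
 unfolding test_function_iff_bounded by blast+

section \<open>Inverse Fourier transforms of test functions\<close>

lemma inv_fourier_lborel:
 fixes f :: "real^'n => real"
 assumes [measurable]: "f \<in> borel_measurable borel"
 shows "inv_fourier f \<xi> = of_real (1 / (2 * pi) ^ CARD('n)) * (LINT x|lborel. cis (\<xi> \<bullet> x) * of_real (f x))"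
 unfolding inv_fourier_def by (subst integral_completion) (auto simp: cis_conv_exp)

text \<open>The normalising constant is at most \<open>1\<close> and is simply dropped; only
  boundedness in \<open>\<xi>\<close> matters.\<close>

lemma norm_inv_fourier_le:
 fixes f :: "real^'n => real"
 assumes "integrable lborel f"
 shows "norm (inv_fourier f \<xi>) \<le> (LINT x|lborel. \<bar>f x\<bar>)"
proof -
 have [measurable]: "f \<in> borel_measurable borel" using assms by auto
 let ?I = "LINT x|lborel. cis (\<xi> \<bullet> x) * complex_of_real (f x)"
 have "norm ?I \<le> (LINT x|lborel. \<bar>f x\<bar>)"
  by (rule integral_norm_bound[THEN order_trans]) (simp add: norm_mult)
 moreover have "1 \<le> (2 * pi) ^ CARD('n)" using pi_gt3 by (intro one_le_power) auto
 then have "1 / (2 * pi) ^ CARD('n) * norm ?I \<le> 1 * norm ?I" by (intro mult_right_mono) auto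
 moreover have "norm (inv_fourier f \<xi>) = 1 / (2 * pi) ^ CARD('n) * norm ?I"
  unfolding inv_fourier_lborel[OF \<open>f \<in> borel_measurable borel\<close>] by (simp add: norm_mult norm_divide norm_power)
 ultimately show ?thesis by linarith
qed

text \<open>Integration by parts. The cosine and sine parts are treated separately because
  \<open>integral_pderivative_zero\<close> is a statement about real functions.\<close>

lemma inv_fourier_pderivative:
 fixes f :: "real^'n => real"
 assumes f: "test_function f"
 shows "inv_fourier (pderivative f (axis l 1)) \<xi> = - (\<i> * of_real (\<xi> $ l)) * inv_fourier f \<xi>"
proof -
 let ?b = "axis l 1 :: real^'n"
 have b: "?b \<in> Basis" by (simp add: axis_in_Basis_iff)
 have f': "test_function (pderivative f ?b)" by (rule test_function_pderivative[OF f b])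
 note df = smooth_imp_differentiable[OF f[unfolded test_function_iff_bounded, THEN conjunct1]]
 have c: "continuous_on UNIV f" "continuous_on UNIV (pderivative f ?b)"
  using f f' smooth_imp_continuous unfolding test_function_iff_bounded by blast+
 have bd: "bounded {x. f x \<noteq> 0}" using f by (simp add: test_function_iff_bounded)
 have xb: "\<xi> \<bullet> ?b = \<xi> $ l" by (simp add: inner_axis)
 have dlin: "(\<lambda>x. \<xi> \<bullet> x) = (\<lambda>x. \<xi> \<bullet> x)" ..
 have dcos: "((\<lambda>x. cos (\<xi> \<bullet> x) * f x) has_derivative
   (\<lambda>h. cos (\<xi> \<bullet> x) * pderivative f h x + - (sin (\<xi> \<bullet> x) * (\<xi> \<bullet> h)) * f x)) (at x)" for x
  by (rule has_derivative_mult[OF _ df]) (auto intro!: derivative_eq_intros simp: fun_eq_iff)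
 have dsin: "((\<lambda>x. sin (\<xi> \<bullet> x) * f x) has_derivative
   (\<lambda>h. sin (\<xi> \<bullet> x) * pderivative f h x + cos (\<xi> \<bullet> x) * (\<xi> \<bullet> h) * f x)) (at x)" for x
  by (rule has_derivative_mult[OF _ df]) (auto intro!: derivative_eq_intros simp: fun_eq_iff)
 have bdd: "bounded {x. g x * f x \<noteq> 0}" for g :: "real^'n => real"
  by (rule bounded_subset[OF bd]) auto
 have "bounded {x. pderivative f ?b x \<noteq> 0}" using f' by (simp add: test_function_iff_bounded)
 then have bdd': "bounded {x. g x * pderivative f ?b x \<noteq> 0}" for g :: "real^'n => real"
  by (rule bounded_subset) auto
 have i1: "integrable lborel (\<lambda>x. cos (\<xi> \<bullet> x) * f x)" "integrable lborel (\<lambda>x. sin (\<xi> \<bullet> x) * f x)"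
  "integrable lborel (\<lambda>x. cos (\<xi> \<bullet> x) * pderivative f ?b x)" "integrable lborel (\<lambda>x. sin (\<xi> \<bullet> x) * pderivative f ?b x)"
  by (intro integrable_compact_support bdd bdd' continuous_intros c)+
 have "(LINT x|lborel. cos (\<xi> \<bullet> x) * pderivative f ?b x + - (sin (\<xi> \<bullet> x) * (\<xi> \<bullet> ?b)) * f x) = 0"
  by (rule integral_pderivative_zero[OF dcos _ bdd]) (intro continuous_intros c)
 also have "(\<lambda>x. cos (\<xi> \<bullet> x) * pderivative f ?b x + - (sin (\<xi> \<bullet> x) * (\<xi> \<bullet> ?b)) * f x) =
   (\<lambda>x. cos (\<xi> \<bullet> x) * pderivative f ?b x - \<xi> $ l * (sin (\<xi> \<bullet> x) * f x))"
  by (simp add: fun_eq_iff xb)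
 finally have re: "(LINT x|lborel. cos (\<xi> \<bullet> x) * pderivative f ?b x) = \<xi> $ l * (LINT x|lborel. sin (\<xi> \<bullet> x) * f x)"
  using i1 by (simp add: integral_diff)
 have "(LINT x|lborel. sin (\<xi> \<bullet> x) * pderivative f ?b x + cos (\<xi> \<bullet> x) * (\<xi> \<bullet> ?b) * f x) = 0"
  by (rule integral_pderivative_zero[OF dsin _ bdd]) (intro continuous_intros c)
 also have "(\<lambda>x. sin (\<xi> \<bullet> x) * pderivative f ?b x + cos (\<xi> \<bullet> x) * (\<xi> \<bullet> ?b) * f x) =
   (\<lambda>x. sin (\<xi> \<bullet> x) * pderivative f ?b x + \<xi> $ l * (cos (\<xi> \<bullet> x) * f x))"
  by (simp add: fun_eq_iff xb)
 finally have im: "(LINT x|lborel. sin (\<xi> \<bullet> x) * pderivative f ?b x) = - (\<xi> $ l * (LINT x|lborel. cos (\<xi> \<bullet> x) * f x))"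
  using i1 by (simp add: integral_add)
 have split: "(LINT x|lborel. cis (\<xi> \<bullet> x) * of_real (g x)) =
   Complex (LINT x|lborel. cos (\<xi> \<bullet> x) * g x) (LINT x|lborel. sin (\<xi> \<bullet> x) * g x)"
  if g: "test_function g" for g
 proof -
  have cg: "continuous_on UNIV g" using g smooth_imp_continuous unfolding test_function_iff_bounded by blast
  have "bounded {x. g x \<noteq> 0}" using g by (simp add: test_function_iff_bounded)
  then have "bounded {x. cis (\<xi> \<bullet> x) * of_real (g x) \<noteq> 0}" by (rule bounded_subset) auto
  moreover have "continuous_on UNIV (\<lambda>x. cis (\<xi> \<bullet> x) * of_real (g x))"
   unfolding cis_conv_exp by (intro continuous_intros cg)
  ultimately have int: "integrable lborel (\<lambda>x. cis (\<xi> \<bullet> x) * complex_of_real (g x))"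
   by (rule integrable_compact_support[rotated])
  show ?thesis
   unfolding complex_eq_iff by (simp add: integral_Re[OF int, symmetric] integral_Im[OF int, symmetric])
 qed
 have m: "f \<in> borel_measurable borel" "pderivative f ?b \<in> borel_measurable borel"
  using test_function_integrable f f' by auto
 show ?thesis
  unfolding inv_fourier_lborel[OF m(1)] inv_fourier_lborel[OF m(2)] split[OF f] split[OF f'] re im
  by (simp add: complex_eq_iff)
qed

definition second_derivative :: "('a::euclidean_space => real) => 'a => 'a => 'a => real" where
 "second_derivative f a b = pderivative (pderivative f a) b"

lemma test_function_second_derivative:
 "test_function f ==> a \<in> Basis ==> b \<in> Basis ==> test_function (second_derivative f a b)"
 unfolding second_derivative_def by (intro test_function_pderivative)

lemma test_function_sum:
 fixes f :: "'i => 'a::euclidean_space => 'b::real_normed_vector"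
 assumes "\<And>i. i \<in> I ==> test_function (f i)"
 shows "test_function (\<lambda>x. \<Sum>i\<in>I. f i x)"
 using assms
proof (induction I rule: infinite_finite_induct)
 case (insert i I)
 then show ?case by (simp add: test_function_add)
qed (simp_all add: test_function_iff_bounded smooth_def Ck_const)

definition laplacian :: "(real^'n => real) => real^'n => real" where
 "laplacian f x = (\<Sum>l\<in>UNIV. second_derivative f (axis l 1) (axis l 1) x)"

lemma test_function_laplacian: "test_function f ==> test_function (laplacian f)"
 unfolding laplacian_def[abs_def]
 by (intro test_function_sum test_function_second_derivative) (auto simp: axis_in_Basis_iff)

lemma inv_fourier_second_derivative:
 assumes "test_function f"
 shows "inv_fourier (second_derivative f (axis l 1) (axis k 1)) \<xi> = - of_real (\<xi> $ l * \<xi> $ k) * inv_fourier f \<xi>"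
proof -
 have "test_function (pderivative f (axis l 1))"
  by (intro test_function_pderivative assms) (auto simp: axis_in_Basis_iff)
 then show ?thesis
  unfolding second_derivative_def by (simp add: inv_fourier_pderivative assms algebra_simps)
qed

lemma integrable_cis_mult:
 assumes "integrable lborel f" "g \<in> borel_measurable borel"
 shows "integrable lborel (\<lambda>x. cis (g x) * complex_of_real (f x))"
proof (rule Bochner_Integration.integrable_bound[OF assms(1)])
 have [measurable]: "f \<in> borel_measurable lborel" "g \<in> borel_measurable lborel" using assms by auto
 show "(\<lambda>x. cis (g x) * complex_of_real (f x)) \<in> borel_measurable lborel"
  unfolding cis_conv_exp by measurable
qed (simp add: norm_mult)

lemma inv_fourier_sum:
 fixes f :: "'i => real^'n => real"
 assumes "\<And>i. i \<in> I ==> integrable lborel (f i)"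
 shows "inv_fourier (\<lambda>x. \<Sum>i\<in>I. f i x) \<xi> = (\<Sum>i\<in>I. inv_fourier (f i) \<xi>)"
proof -
 have m: "f i \<in> borel_measurable borel" if "i \<in> I" for i using assms[OF that] by auto
 let ?c = "complex_of_real (1 / (2 * pi) ^ CARD('n))"
 have int: "integrable lborel (\<lambda>x. cis (\<xi> \<bullet> x) * complex_of_real (f i x))" if "i \<in> I" for i
  by (intro integrable_cis_mult assms that) simp
 have "(\<lambda>x. \<Sum>i\<in>I. f i x) \<in> borel_measurable borel" by (intro borel_measurable_sum m)
 then have "inv_fourier (\<lambda>x. \<Sum>i\<in>I. f i x) \<xi> = ?c * (LINT x|lborel. (\<Sum>i\<in>I. cis (\<xi> \<bullet> x) * complex_of_real (f i x)))"
  by (simp only: inv_fourier_lborel of_real_sum sum_distrib_left)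
 also have "\<dots> = (\<Sum>i\<in>I. ?c * (LINT x|lborel. cis (\<xi> \<bullet> x) * complex_of_real (f i x)))"
  by (simp only: Bochner_Integration.integral_sum[OF int] sum_distrib_left)
 also have "\<dots> = (\<Sum>i\<in>I. inv_fourier (f i) \<xi>)"
  by (intro sum.cong refl inv_fourier_lborel[symmetric] m)
 finally show ?thesis .
qed

lemma inv_fourier_laplacian:
 assumes "test_function f"
 shows "inv_fourier (laplacian f) \<xi> = - of_real (\<xi> \<bullet> \<xi>) * inv_fourier f \<xi>"
proof -
 have "inv_fourier (laplacian f) \<xi> = (\<Sum>l\<in>UNIV. inv_fourier (second_derivative f (axis l 1) (axis l 1)) \<xi>)"
  unfolding laplacian_def[abs_def]
  by (intro inv_fourier_sum test_function_integrable test_function_second_derivative assms)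
   (auto simp: axis_in_Basis_iff)
 also have "\<dots> = - of_real (\<xi> \<bullet> \<xi>) * inv_fourier f \<xi>"
  by (simp add: inv_fourier_second_derivative assms inner_vec_def sum_negf sum_distrib_right)
 finally show ?thesis .
qed

lemma inv_fourier_measurable [measurable]:
 fixes f :: "real^'n => real"
 assumes [measurable]: "f \<in> borel_measurable borel"
 shows "inv_fourier f \<in> borel_measurable borel"
proof -
 have "(\<lambda>\<xi>. of_real (1 / (2 * pi) ^ CARD('n)) * (LINT x|lborel. exp (\<i> * complex_of_real (\<xi> \<bullet> x)) * complex_of_real (f x)))
  \<in> borel_measurable borel"
  by measurable
 moreover have "inv_fourier f = (\<lambda>\<xi>. of_real (1 / (2 * pi) ^ CARD('n)) * (LINT x|lborel. exp (\<i> * complex_of_real (\<xi> \<bullet> x)) * complex_of_real (f x)))"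
  by (rule ext) (simp only: inv_fourier_lborel[OF assms] cis_conv_exp)
 ultimately show ?thesis by simp
qed

text \<open>The product form splits into one-dimensional integrals, which makes it a convenient
  majorant for the transforms of test functions.\<close>

lemma integrable_prod_inverse_square:
 "integrable lborel (\<lambda>x::'a::euclidean_space. \<Prod>b\<in>Basis. inverse (1 + (x \<bullet> b)\<^sup>2))"
proof (rule integrableI_nonneg)
 have "integrable lborel (\<lambda>x::real. inverse (1 + x\<^sup>2))"
  using integrable_inverse_1_plus_square by (simp add: set_integrable_def)
 then have "(\<integral>\<^sup>+x. ennreal (inverse (1 + (x::real)\<^sup>2)) \<partial>lborel) < \<infinity>"
  by (subst nn_integral_eq_integral) (auto simp: add_nonneg_nonneg)
 then have "(\<Prod>b\<in>(Basis::'a set). (\<integral>\<^sup>+x. ennreal (inverse (1 + (x::real)\<^sup>2)) \<partial>lborel)) < \<infinity>"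
  by (simp add: power_less_top_ennreal)
 also have "(\<Prod>b\<in>(Basis::'a set). (\<integral>\<^sup>+x. ennreal (inverse (1 + (x::real)\<^sup>2)) \<partial>lborel))
  = (\<integral>\<^sup>+x. (\<Prod>b\<in>Basis. ennreal (inverse (1 + (x \<bullet> b)\<^sup>2))) \<partial>(lborel::'a measure))"
  by (rule nn_integral_lborel_prod[symmetric]) auto
 also have "\<dots> = (\<integral>\<^sup>+x. ennreal (\<Prod>b\<in>Basis. inverse (1 + (x \<bullet> b)\<^sup>2)) \<partial>(lborel::'a measure))"
  by (subst prod_ennreal) (auto simp: add_nonneg_nonneg)
 finally show "(\<integral>\<^sup>+x. ennreal (\<Prod>b\<in>Basis. inverse (1 + (x \<bullet> b)\<^sup>2)) \<partial>(lborel::'a measure)) < \<infinity>" .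
qed (auto intro!: prod_nonneg AE_I2 simp: add_nonneg_nonneg)

text \<open>Applying \<open>1 - laplacian\<close> to a test function multiplies the transform by
  \<open>1 + \<xi> \<bullet> \<xi>\<close>, and transforms of test functions are bounded. One
  application per dimension suffices, since every factor of the product majorant is at least
  \<open>inverse (1 + \<xi> \<bullet> \<xi>)\<close>.\<close>

lemma inv_fourier_integrable:
 fixes f :: "real^'n => real"
 assumes f: "test_function f"
 shows "integrable lborel (inv_fourier f)"
proof -
 define L where "L g x = g x + (-1) *\<^sub>R laplacian g x" for g :: "real^'n => real" and x
 have tL: "test_function (L g)" if "test_function g" for g
  unfolding L_def
  by (rule test_function_add[OF that test_function_linear_image[OF bounded_linear_scaleR_right test_function_laplacian[OF that]]])
 have fL: "inv_fourier (L g) \<xi> = of_real (1 + \<xi> \<bullet> \<xi>) * inv_fourier g \<xi>" if g: "test_function g" for g \<xi>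
 proof -
  note [measurable] = test_function_integrable(2)[OF g] test_function_integrable(2)[OF test_function_laplacian[OF g]]
  have i: "integrable lborel (\<lambda>x. cis (\<xi> \<bullet> x) * complex_of_real (g x))"
   "integrable lborel (\<lambda>x. cis (\<xi> \<bullet> x) * complex_of_real (laplacian g x))"
   using test_function_integrable(1)[OF g] test_function_integrable(1)[OF test_function_laplacian[OF g]]
   by (intro integrable_cis_mult; simp)+
  have "inv_fourier (L g) \<xi> = inv_fourier g \<xi> - inv_fourier (laplacian g) \<xi>"
   unfolding L_def by (simp add: inv_fourier_lborel right_diff_distrib Bochner_Integration.integral_diff[OF i])
  then show ?thesis by (simp add: inv_fourier_laplacian[OF g] algebra_simps)
 qed
 have tk: "test_function ((L ^^ k) f)" for k by (induction k) (auto simp: f tL)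
 have fk: "inv_fourier ((L ^^ k) f) \<xi> = of_real ((1 + \<xi> \<bullet> \<xi>) ^ k) * inv_fourier f \<xi>" for k \<xi>
  by (induction k) (auto simp: fL tk)
 let ?n = "DIM(real^'n)"
 let ?g = "(L ^^ ?n) f"
 define C where "C = (LINT x|lborel. \<bar>?g x\<bar>)"
 have "norm (inv_fourier f \<xi>) \<le> C * (\<Prod>b\<in>Basis. inverse (1 + (\<xi> \<bullet> b)\<^sup>2))" for \<xi> :: "real^'n"
 proof -
  have pos: "0 < 1 + (\<xi> \<bullet> b)\<^sup>2" for b by (simp add: add_pos_nonneg)
  have "(\<xi> \<bullet> b)\<^sup>2 \<le> \<xi> \<bullet> \<xi>" if "b \<in> Basis" for b
   using Basis_le_norm[OF that, of \<xi>] by (simp add: power2_norm_eq_inner[symmetric] abs_le_square_iff[symmetric])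
  then have "(\<Prod>b\<in>(Basis :: (real^'n) set). 1 + (\<xi> \<bullet> b)\<^sup>2) \<le> (\<Prod>b\<in>(Basis :: (real^'n) set). 1 + \<xi> \<bullet> \<xi>)"
   by (intro prod_mono) (auto simp: add_nonneg_nonneg)
  then have "(\<Prod>b\<in>(Basis :: (real^'n) set). 1 + (\<xi> \<bullet> b)\<^sup>2) * norm (inv_fourier f \<xi>) \<le> (1 + \<xi> \<bullet> \<xi>) ^ ?n * norm (inv_fourier f \<xi>)"
   by (intro mult_right_mono) auto
  also have "\<dots> = norm (inv_fourier ?g \<xi>)" unfolding fk norm_mult norm_of_real
   by (simp add: add_nonneg_nonneg)
  also have "\<dots> \<le> C" unfolding C_def by (rule norm_inv_fourier_le[OF test_function_integrable(1)[OF tk]])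
  finally have "(\<Prod>b\<in>(Basis :: (real^'n) set). 1 + (\<xi> \<bullet> b)\<^sup>2) * norm (inv_fourier f \<xi>) \<le> C" .
  moreover have "(\<Prod>b\<in>(Basis :: (real^'n) set). 1 + (\<xi> \<bullet> b)\<^sup>2) > 0" using pos by (intro prod_pos) auto
  moreover have "(\<Prod>b\<in>(Basis :: (real^'n) set). inverse (1 + (\<xi> \<bullet> b)\<^sup>2)) = inverse (\<Prod>b\<in>(Basis :: (real^'n) set). 1 + (\<xi> \<bullet> b)\<^sup>2)"
   using prod_inversef[of "\<lambda>b. 1 + (\<xi> \<bullet> b)\<^sup>2" "Basis :: (real^'n) set"] by (simp add: o_def)
  ultimately show ?thesis by (metis (no_types, lifting) divide_inverse pos_le_divide_eq mult.commute)
 qed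
 moreover have "0 \<le> C * (\<Prod>b\<in>Basis. inverse (1 + (\<xi> \<bullet> b)\<^sup>2))" for \<xi> :: "real^'n"
  unfolding C_def by (intro mult_nonneg_nonneg prod_nonneg) auto
 ultimately have "AE \<xi> in lborel. norm (inv_fourier f \<xi>) \<le> norm (C * (\<Prod>b\<in>Basis. inverse (1 + (\<xi> \<bullet> b)\<^sup>2)))"
  by (intro AE_I2) (metis abs_of_nonneg real_norm_def)
 then show ?thesis
  using test_function_integrable(2)[OF f]
  by (intro Bochner_Integration.integrable_bound[OF integrable_mult_right[OF integrable_prod_inverse_square, of C]]) auto
qed

lemma integrable_pair_bound:
 fixes k :: "'a::euclidean_space => 'b::euclidean_space => 'c::{banach, second_countable_topology}"
 assumes f: "integrable lborel (f :: 'a => real)" and g: "integrable lborel (g :: 'b => real)"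
  and k: "case_prod k \<in> borel_measurable (lborel \<Otimes>\<^sub>M lborel)" and bd: "\<And>x y. norm (k x y) \<le> f x * g y"
  and nn: "\<And>x. f x \<ge> 0"
 shows "integrable (lborel \<Otimes>\<^sub>M lborel) (case_prod k)"
proof (rule Bochner_Integration.integrable_bound[OF _ k])
 have [measurable]: "f \<in> borel_measurable borel" "g \<in> borel_measurable borel" using f g by auto
 show "integrable (lborel \<Otimes>\<^sub>M lborel) (\<lambda>(x, y). f x * \<bar>g y\<bar>)"
 proof (rule lborel_pair.Fubini_integrable)
  show "(\<lambda>(x, y). f x * \<bar>g y\<bar>) \<in> borel_measurable (lborel \<Otimes>\<^sub>M lborel)" by measurable
  show "integrable lborel (\<lambda>x. LINT y|lborel. norm (case (x, y) of (x, y) => f x * \<bar>g y\<bar>))"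
   using f nn by (simp add: abs_mult)
  show "AE x in lborel. integrable lborel (\<lambda>y. case (x, y) of (x, y) => f x * \<bar>g y\<bar>)"
   using g by simp
 qed
 show "AE z in lborel \<Otimes>\<^sub>M lborel. norm (case_prod k z) \<le> norm (case z of (x, y) => f x * \<bar>g y\<bar>)"
 proof (intro AE_I2, clarify)
  fix x y
  have "f x * g y \<le> f x * \<bar>g y\<bar>" using nn by (intro mult_left_mono) auto
  then show "norm (k x y) \<le> norm (f x * \<bar>g y\<bar>)" using bd[of x y] nn[of x] by (simp add: abs_mult)
 qed
qed

lemma Fubini_bound:
 fixes k :: "'a::euclidean_space => 'b::euclidean_space => 'c::{banach, second_countable_topology}"
 assumes "integrable lborel (f :: 'a => real)" "integrable lborel (g :: 'b => real)"
  and "case_prod k \<in> borel_measurable (lborel \<Otimes>\<^sub>M lborel)" "\<And>x y. norm (k x y) \<le> f x * g y"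
  and "\<And>x. f x \<ge> 0"
 shows "(LINT x|lborel. LINT y|lborel. k x y) = (LINT y|lborel. LINT x|lborel. k x y)"
 using lborel_pair.Fubini_integral[OF integrable_pair_bound[OF assms]] by simp

text \<open>Gaussian regularisation. A damping factor \<open>E m\<close> is inserted; removing it
  (\<open>L1\<close>) gives the left side, while exchanging the integrals (\<open>L2\<close>) turns
  the expression into an average of \<open>f\<close> against a Gaussian of width \<open>d m\<close>
  about \<open>x\<close>, which tends to \<open>f x\<close> (\<open>L3\<close>).\<close>

lemma fourier_inversion:
 fixes f :: "real^'n => real"
 assumes f: "test_function f"
 shows "(LINT \<xi>|lborel. cis (- (\<xi> \<bullet> x)) * inv_fourier f \<xi>) = complex_of_real (f x)"
proof -
 let ?n = "CARD('n)" and ?c = "complex_of_real (1 / (2 * pi) ^ CARD('n))"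
 define d where "d m = inverse (real (Suc m))" for m
 have d: "d m > 0" for m by (simp add: d_def)
 have d0: "d \<longlonglongrightarrow> 0" unfolding d_def by (rule LIMSEQ_inverse_real_of_nat)
 note G = inv_fourier_integrable[OF f]
 note [measurable] = test_function_integrable(2)[OF f]
 define E where "E m \<xi> = exp (- ((d m)\<^sup>2 * (\<xi> \<bullet> \<xi>)) / 2)" for m and \<xi> :: "real^'n"
 have [measurable]: "E m \<in> borel_measurable borel" for m unfolding E_def by measurable
 have Ele: "0 < E m \<xi>" "E m \<xi> \<le> 1" for m \<xi> by (auto simp: E_def)
 have cm: "(\<lambda>\<xi>. cis (- (\<xi> \<bullet> x))) \<in> borel_measurable borel" unfolding cis_conv_exp by measurable
 note [measurable] = cm
 have L1: "(\<lambda>m. LINT \<xi>|lborel. cis (- (\<xi> \<bullet> x)) * inv_fourier f \<xi> * of_real (E m \<xi>))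
  \<longlonglongrightarrow> (LINT \<xi>|lborel. cis (- (\<xi> \<bullet> x)) * inv_fourier f \<xi>)"
 proof (rule integral_dominated_convergence[where w="\<lambda>\<xi>. norm (inv_fourier f \<xi>)"])
  show "AE \<xi> in lborel. (\<lambda>m. cis (- (\<xi> \<bullet> x)) * inv_fourier f \<xi> * of_real (E m \<xi>)) \<longlonglongrightarrow> cis (- (\<xi> \<bullet> x)) * inv_fourier f \<xi>"
  proof (intro AE_I2)
   fix \<xi> :: "real^'n"
   have "(\<lambda>m. E m \<xi>) \<longlonglongrightarrow> exp (- (0\<^sup>2 * (\<xi> \<bullet> \<xi>)) / 2)"
    unfolding E_def by (intro tendsto_intros d0) auto
   then have "(\<lambda>m. complex_of_real (E m \<xi>)) \<longlonglongrightarrow> complex_of_real 1"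
    by (intro tendsto_of_real) simp
   from tendsto_mult[OF tendsto_const[of "cis (- (\<xi> \<bullet> x)) * inv_fourier f \<xi>"] this]
   show "(\<lambda>m. cis (- (\<xi> \<bullet> x)) * inv_fourier f \<xi> * of_real (E m \<xi>)) \<longlonglongrightarrow> cis (- (\<xi> \<bullet> x)) * inv_fourier f \<xi>"
    by simp
  qed
  show "AE \<xi> in lborel. norm (cis (- (\<xi> \<bullet> x)) * inv_fourier f \<xi> * of_real (E m \<xi>)) \<le> norm (inv_fourier f \<xi>)" for m
   using Ele by (intro AE_I2) (simp add: norm_mult mult_left_le less_imp_le)
 qed (use G in auto)
 have L2: "(LINT \<xi>|lborel. cis (- (\<xi> \<bullet> x)) * inv_fourier f \<xi> * of_real (E m \<xi>)) =
  of_real (LINT z|lborel. f (x + d m *\<^sub>R z) * gauss z)" for m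
 proof -
  let ?k = "\<lambda>\<xi> y. ?c * (cis ((y - x) \<bullet> \<xi>) * of_real (f y * E m \<xi>))"
  have "cis (- (\<xi> \<bullet> x)) * inv_fourier f \<xi> * of_real (E m \<xi>) = (LINT y|lborel. ?k \<xi> y)" for \<xi>
  proof -
   have "cis (- (\<xi> \<bullet> x)) * inv_fourier f \<xi> * of_real (E m \<xi>) =
    ?c * (cis (- (\<xi> \<bullet> x)) * of_real (E m \<xi>)) * (LINT y|lborel. cis (\<xi> \<bullet> y) * of_real (f y))"
    by (simp add: inv_fourier_lborel)
   also have "\<dots> = (LINT y|lborel. ?c * (cis (- (\<xi> \<bullet> x)) * of_real (E m \<xi>)) * (cis (\<xi> \<bullet> y) * of_real (f y)))"
    by simp
   also have "\<dots> = (LINT y|lborel. ?k \<xi> y)"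
   proof (intro Bochner_Integration.integral_cong refl)
    fix y
    have "cis ((y - x) \<bullet> \<xi>) = cis (- (\<xi> \<bullet> x)) * cis (\<xi> \<bullet> y)"
     by (simp add: cis_mult inner_diff_right inner_commute)
    then show "?c * (cis (- (\<xi> \<bullet> x)) * of_real (E m \<xi>)) * (cis (\<xi> \<bullet> y) * of_real (f y)) = ?k \<xi> y"
     by (simp only: of_real_mult mult_ac)
   qed
   finally show ?thesis .
  qed
  then have "(LINT \<xi>|lborel. cis (- (\<xi> \<bullet> x)) * inv_fourier f \<xi> * of_real (E m \<xi>)) = (LINT \<xi>|lborel. LINT y|lborel. ?k \<xi> y)"
   by simp
  also have "\<dots> = (LINT y|lborel. LINT \<xi>|lborel. ?k \<xi> y)"
  proof (rule Fubini_bound[where f="E m" and g="\<lambda>y. norm ?c * \<bar>f y\<bar>"])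
   \<comment> \<open>Integrability of the damping factor is read off its integral: a function that
     is not integrable has integral \<open>0\<close> by convention, whereas the value given by
     \<open>gauss_fourier_scaled\<close> is positive.\<close>
   have "integrable lborel (\<lambda>\<xi>. cis (0 \<bullet> \<xi>) * complex_of_real (E m \<xi>))"
   proof (rule ccontr)
    assume "\<not> ?thesis"
    then have "(LINT \<xi>|lborel. cis (0 \<bullet> \<xi>) * complex_of_real (E m \<xi>)) = 0" by (rule not_integrable_integral_eq)
    moreover have "(2 * pi / d m) ^ DIM(real^'n) * gauss (0 /\<^sub>R d m :: real^'n) \<noteq> 0"
     using d[of m] gauss_pos[of "0 :: real^'n"] by simp
    ultimately show False using gauss_fourier_scaled[OF d[of m], of "0 :: real^'n"]
     unfolding E_def by simp
   qed
   then have "integrable lborel (\<lambda>\<xi>. Re (cis (0 \<bullet> \<xi>) * complex_of_real (E m \<xi>)))" by (rule integrable_Re)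
   then show "integrable lborel (E m)" by simp
   show "integrable lborel (\<lambda>y. norm ?c * \<bar>f y\<bar>)" using test_function_integrable(1)[OF f] by auto
   show "case_prod ?k \<in> borel_measurable (lborel \<Otimes>\<^sub>M lborel)" unfolding cis_conv_exp by measurable
   show "norm (?k \<xi> y) \<le> E m \<xi> * (norm ?c * \<bar>f y\<bar>)" for \<xi> y
    using Ele[of m \<xi>] by (simp add: norm_mult norm_divide abs_mult mult.commute)
   show "0 \<le> E m \<xi>" for \<xi> using Ele[of m \<xi>] by simp
  qed
  also have "\<dots> = (LINT y|lborel. of_real ((1 / d m) ^ ?n * (f y * gauss ((y - x) /\<^sub>R d m))))"
  proof (intro Bochner_Integration.integral_cong refl)
   fix y
   have "(LINT \<xi>|lborel. ?k \<xi> y) = (LINT \<xi>|lborel. (?c * of_real (f y)) * (cis ((y - x) \<bullet> \<xi>) * complex_of_real (E m \<xi>)))"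
    by (simp only: of_real_mult mult_ac)
   also have "\<dots> = ?c * of_real (f y) * of_real ((2 * pi / d m) ^ ?n * gauss ((y - x) /\<^sub>R d m))"
    unfolding E_def integral_mult_right_zero gauss_fourier_scaled[OF d[of m]] by simp
   also have "\<dots> = of_real ((1 / d m) ^ ?n * (f y * gauss ((y - x) /\<^sub>R d m)))"
    by (simp add: power_divide power_mult_distrib)
   finally show "(LINT \<xi>|lborel. ?k \<xi> y) = of_real ((1 / d m) ^ ?n * (f y * gauss ((y - x) /\<^sub>R d m)))" .
  qed
  also have "\<dots> = of_real (LINT y|lborel. (1 / d m) ^ ?n * (f y * gauss ((y - x) /\<^sub>R d m)))"
   by (rule integral_complex_of_real)
  also have "(LINT y|lborel. (1 / d m) ^ ?n * (f y * gauss ((y - x) /\<^sub>R d m))) =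
    d m ^ DIM(real^'n) *\<^sub>R (LINT z|lborel. (1 / d m) ^ ?n * (f (x + d m *\<^sub>R z) * gauss ((x + d m *\<^sub>R z - x) /\<^sub>R d m)))"
   by (rule integral_lborel_affine) (use d in measurable)
  also have "\<dots> = (LINT z|lborel. f (x + d m *\<^sub>R z) * gauss z)"
   using d[of m] by (simp add: power_divide)
  finally show ?thesis .
 qed
 have "bounded (range f)"
 proof -
  obtain R where R: "\<And>y. f y \<noteq> 0 ==> norm y \<le> R"
   using f unfolding test_function_iff_bounded bounded_iff by auto
  have "range f \<subseteq> f ` cball 0 R \<union> {0}" using R by force
  moreover have "compact (f ` cball 0 R)"
   by (intro compact_continuous_image smooth_imp_continuous) (use f in \<open>auto simp: test_function_iff_bounded\<close>)
  ultimately show ?thesis by (meson bounded_Un bounded_subset compact_imp_bounded finite_imp_bounded finite.intros)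
 qed
 then obtain B where B: "\<And>y. \<bar>f y\<bar> \<le> B" unfolding bounded_iff by auto
 have L3: "(\<lambda>m. LINT z|lborel. f (x + d m *\<^sub>R z) * gauss z) \<longlonglongrightarrow> (LINT z|lborel. f x * gauss (z :: real^'n))"
 proof (rule integral_dominated_convergence[where w="\<lambda>z. B * gauss z"])
  have "isCont f y" for y
   using f smooth_imp_continuous[of f UNIV] by (simp add: test_function_iff_bounded continuous_on_eq_continuous_at)
  moreover have "(\<lambda>m. x + d m *\<^sub>R z) \<longlonglongrightarrow> x" for z
   using tendsto_add[OF tendsto_const[of x] tendsto_scaleR[OF d0 tendsto_const[of z]]] by simp
  ultimately show "AE z in lborel. (\<lambda>m. f (x + d m *\<^sub>R z) * gauss z) \<longlonglongrightarrow> f x * gauss z"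
   by (intro AE_I2 tendsto_mult tendsto_const isCont_tendsto_compose[of x f]) auto
  show "AE z in lborel. norm (f (x + d m *\<^sub>R z) * gauss z) \<le> B * gauss z" for m
   using B by (intro AE_I2) (simp add: abs_mult mult_right_mono abs_of_pos[OF gauss_pos] less_imp_le[OF gauss_pos])
 qed (auto intro: integrable_gauss)
 have "(\<lambda>m. LINT \<xi>|lborel. cis (- (\<xi> \<bullet> x)) * inv_fourier f \<xi> * of_real (E m \<xi>)) \<longlonglongrightarrow> of_real (f x)"
  unfolding L2 using tendsto_of_real[OF L3] by (simp add: integral_gauss)
 with L1 show ?thesis by (rule LIMSEQ_unique)
qed

text \<open>The definitions integrate with respect to the completed measure, while Fubini arguments
  run on \<open>lborel\<close>. The Borel version \<open>g\<close> replaces \<open>f\<close> in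
  integrals against any Borel weight \<open>h\<close>.\<close>

lemma lebesgue_integrable_borel_representative:
 fixes f :: "'a::euclidean_space => real"
 assumes "integrable lebesgue f"
 obtains g where "g \<in> borel_measurable borel" "integrable lborel g" "AE x in lborel. f x = g x"
  "\<And>h :: 'a => 'b::{banach, second_countable_topology, real_normed_field}. h \<in> borel_measurable borel ==>
   (LINT x|lebesgue. h x * of_real (f x)) = (LINT x|lborel. h x * of_real (g x))"
proof -
 obtain g where g: "g \<in> borel_measurable lborel" "AE x in lborel. f x = g x"
  using completion_ex_borel_measurable_real[of f lborel] assms by auto
 have [measurable]: "g \<in> borel_measurable borel" using g(1) by simp
 have ae: "AE x in lebesgue. f x = g x" using g(2) by (rule AE_completion)
 have fm: "f \<in> borel_measurable lebesgue" using assms by auto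
 have gl: "g \<in> borel_measurable lebesgue" using g(1) by (rule measurable_completion)
 have "integrable lebesgue g" using assms integrable_cong_AE[OF fm gl ae] by simp
 then have i: "integrable lborel g" using g(1) by (simp add: integrable_completion)
 have eq: "(LINT x|lebesgue. h x * of_real (f x)) = (LINT x|lborel. h x * of_real (g x))"
  if [measurable]: "h \<in> borel_measurable borel" for h :: "'a => 'b"
 proof -
  have hl: "h \<in> borel_measurable lebesgue" by (rule measurable_completion) simp
  have o: "(of_real :: real => 'b) \<in> borel_measurable borel"
   by (intro borel_measurable_continuous_onI continuous_intros)
  have m1: "(\<lambda>x. h x * of_real (f x)) \<in> borel_measurable lebesgue"
   by (intro borel_measurable_times hl measurable_compose[OF fm o])
  have m2: "(\<lambda>x. h x * of_real (g x)) \<in> borel_measurable lebesgue"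
   by (intro borel_measurable_times hl measurable_compose[OF gl o])
  have m3: "(\<lambda>x. h x * of_real (g x)) \<in> borel_measurable lborel"
   using o by measurable
  have "AE x in lebesgue. h x * of_real (f x) = h x * of_real (g x)"
   using ae by eventually_elim simp
  then have "(LINT x|lebesgue. h x * of_real (f x)) = (LINT x|lebesgue. h x * of_real (g x))"
   by (rule integral_cong_AE[OF m1 m2])
  then show ?thesis unfolding integral_completion[OF m3] .
 qed
 show ?thesis by (rule that[OF _ i g(2) eq]) simp_all
qed

text \<open>The multiplication formula. The transform of \<open>f\<close> is merely bounded, so all
  decay comes from \<open>\<phi>\<close>; after the integrals are exchanged, inversion restores
  \<open>\<phi>\<close>.\<close>

lemma fourier_pairing:
 fixes f \<phi> :: "real^'n => real"
 assumes f: "integrable lebesgue f" and \<phi>: "test_function \<phi>"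
 shows "integrable lborel (\<lambda>\<xi>. fourier f \<xi> * inv_fourier \<phi> \<xi>)"
  and "(LINT \<xi>|lborel. fourier f \<xi> * inv_fourier \<phi> \<xi>) = of_real (LINT x|lebesgue. f x * \<phi> x)"
  and "fourier f \<in> borel_measurable borel"
proof -
 obtain g where [measurable]: "g \<in> borel_measurable borel" and g: "integrable lborel g" "AE x in lborel. f x = g x"
  and eq: "\<And>h :: real^'n => complex. h \<in> borel_measurable borel ==>
   (LINT x|lebesgue. h x * of_real (f x)) = (LINT x|lborel. h x * of_real (g x))"
  by (rule lebesgue_integrable_borel_representative[OF f, where 'b=complex]) (rule that)
 note [measurable] = test_function_integrable(2)[OF \<phi>]
 have F: "fourier f \<xi> = (LINT x|lborel. exp (\<i> * of_real (- (\<xi> \<bullet> x))) * of_real (g x))" for \<xi>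
  unfolding fourier_def cis_conv_exp by (intro eq) measurable
 have Fm: "fourier f \<in> borel_measurable borel" unfolding F[abs_def] by measurable
 then show "fourier f \<in> borel_measurable borel" .
 note [measurable] = Fm
 have Fle: "norm (fourier f \<xi>) \<le> (LINT x|lborel. \<bar>g x\<bar>)" for \<xi>
  unfolding F by (rule integral_norm_bound[THEN order_trans]) (simp add: norm_mult)
 note G = inv_fourier_integrable[OF \<phi>]
 show "integrable lborel (\<lambda>\<xi>. fourier f \<xi> * inv_fourier \<phi> \<xi>)"
 proof (rule Bochner_Integration.integrable_bound)
  show "integrable lborel (\<lambda>\<xi>. (LINT x|lborel. \<bar>g x\<bar>) * norm (inv_fourier \<phi> \<xi>))" using G by auto
  show "AE \<xi> in lborel. norm (fourier f \<xi> * inv_fourier \<phi> \<xi>) \<le> norm ((LINT x|lborel. \<bar>g x\<bar>) * norm (inv_fourier \<phi> \<xi>))"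
   using Fle by (intro AE_I2) (simp add: norm_mult abs_mult mult_right_mono)
 qed simp
 have "(LINT \<xi>|lborel. fourier f \<xi> * inv_fourier \<phi> \<xi>) =
  (LINT \<xi>|lborel. LINT x|lborel. (cis (- (\<xi> \<bullet> x)) * inv_fourier \<phi> \<xi>) * of_real (g x))"
 proof (intro Bochner_Integration.integral_cong refl)
  fix \<xi>
  have "fourier f \<xi> * inv_fourier \<phi> \<xi> = inv_fourier \<phi> \<xi> * (LINT x|lborel. cis (- (\<xi> \<bullet> x)) * of_real (g x))"
   by (simp add: F cis_conv_exp)
  also have "\<dots> = (LINT x|lborel. inv_fourier \<phi> \<xi> * (cis (- (\<xi> \<bullet> x)) * of_real (g x)))" by simp
  finally show "fourier f \<xi> * inv_fourier \<phi> \<xi> = (LINT x|lborel. (cis (- (\<xi> \<bullet> x)) * inv_fourier \<phi> \<xi>) * of_real (g x))"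
   by (simp only: mult_ac)
 qed
 also have "\<dots> = (LINT x|lborel. LINT \<xi>|lborel. (cis (- (\<xi> \<bullet> x)) * inv_fourier \<phi> \<xi>) * of_real (g x))"
 proof (rule Fubini_bound[where f="\<lambda>\<xi>. norm (inv_fourier \<phi> \<xi>)" and g="\<lambda>x. \<bar>g x\<bar>"])
  show "(\<lambda>(\<xi>, x). (cis (- (\<xi> \<bullet> x)) * inv_fourier \<phi> \<xi>) * of_real (g x)) \<in> borel_measurable (lborel \<Otimes>\<^sub>M lborel)"
   unfolding cis_conv_exp by measurable
 qed (use G g in \<open>auto simp: norm_mult\<close>)
 also have "\<dots> = (LINT x|lborel. of_real (\<phi> x * g x))"
  by (simp add: fourier_inversion[OF \<phi>])
 also have "\<dots> = (LINT x|lebesgue. of_real (\<phi> x) * of_real (f x))"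
  by (subst eq) auto
 also have "\<dots> = (LINT x|lebesgue. complex_of_real (f x * \<phi> x))"
  by (simp add: mult.commute)
 finally show "(LINT \<xi>|lborel. fourier f \<xi> * inv_fourier \<phi> \<xi>) = of_real (LINT x|lebesgue. f x * \<phi> x)"
  unfolding integral_complex_of_real .
qed

lemma L2_product_integrable:
 fixes v :: "real^'n => real^'n"
 assumes "L2 v"
 shows "integrable lebesgue (\<lambda>x. v x $ l * v x $ k)"
proof (rule Bochner_Integration.integrable_bound)
 have vm: "v \<in> borel_measurable lebesgue" and "integrable lebesgue (\<lambda>x. (norm (v x))\<^sup>2)"
  using assms by (auto simp: L2_def)
 then show "integrable lebesgue (\<lambda>x. (norm (v x))\<^sup>2)" by simp
 have [measurable]: "(\<lambda>x. v x $ l) \<in> borel_measurable lebesgue" for l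
  using vm by (rule measurable_compose) simp
 show "(\<lambda>x. v x $ l * v x $ k) \<in> borel_measurable lebesgue" by measurable
 show "AE x in lebesgue. norm (v x $ l * v x $ k) \<le> norm ((norm (v x))\<^sup>2)"
 proof (intro AE_I2)
  fix x
  have "\<bar>v x $ l\<bar> * \<bar>v x $ k\<bar> \<le> norm (v x) * norm (v x)"
   by (intro mult_mono component_le_norm_cart) auto
  then show "norm (v x $ l * v x $ k) \<le> norm ((norm (v x))\<^sup>2)" by (simp add: abs_mult power2_eq_square)
 qed
qed

text \<open>The distributional equation \<open>- \<Delta>p = \<Sum>\<^sub>l\<^sub>,\<^sub>k \<partial>\<^sub>l\<partial>\<^sub>k (v\<^sub>l v\<^sub>k)\<close>.\<close>

lemma pressure_distribution_laplacian:
 fixes v :: "real^'n => real^'n"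
 assumes v: "L2 v" and \<phi>: "test_function \<phi>"
 shows "pressure_distribution v (laplacian \<phi>) = - of_real (\<Sum>l\<in>UNIV. \<Sum>k\<in>UNIV.
  (LINT x|lebesgue. v x $ l * v x $ k * second_derivative \<phi> (axis l 1) (axis k 1) x))"
proof -
 let ?F = "\<lambda>l k. fourier (\<lambda>x. v x $ l * v x $ k)"
 let ?D = "\<lambda>l k. second_derivative \<phi> (axis l 1) (axis k 1)"
 have tD: "test_function (?D l k)" for l k
  by (intro test_function_second_derivative \<phi>) (auto simp: axis_in_Basis_iff)
 note P = fourier_pairing[OF L2_product_integrable[OF v] tD]
 have eq: "pressure_fourier v \<xi> * inv_fourier (laplacian \<phi>) \<xi> = - (\<Sum>l\<in>UNIV. \<Sum>k\<in>UNIV. ?F l k \<xi> * inv_fourier (?D l k) \<xi>)" for \<xi>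
 \<comment> \<open>At \<open>\<xi> = 0\<close> the Riesz symbols are \<open>0\<close> by the
   division convention; both sides vanish there because the transforms of second derivatives carry
   the factor \<open>\<xi> $ l * \<xi> $ k\<close>.\<close>
 proof (cases "\<xi> = 0")
  case True
  then show ?thesis by (simp add: inv_fourier_laplacian \<phi> inv_fourier_second_derivative)
 next
  case False
  then have "riesz_symbol l \<xi> * riesz_symbol k \<xi> * (\<xi> \<bullet> \<xi>) = \<xi> $ l * \<xi> $ k" for l k
   by (simp add: riesz_symbol_def dot_square_norm power2_eq_square)
  then have "of_real (riesz_symbol l \<xi>) * of_real (riesz_symbol k \<xi>) * of_real (\<xi> \<bullet> \<xi>) = complex_of_real (\<xi> $ l * \<xi> $ k)" for l k
   by (simp only: of_real_mult[symmetric])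
  then have *: "of_real (riesz_symbol l \<xi>) * (of_real (riesz_symbol k \<xi>) * F) * (of_real (\<xi> \<bullet> \<xi>) * z) = F * (complex_of_real (\<xi> $ l * \<xi> $ k) * z)" for l k F z
   by (metis (no_types, opaque_lifting) mult.assoc mult.commute)
  show ?thesis
   unfolding pressure_fourier_def inv_fourier_laplacian[OF \<phi>] inv_fourier_second_derivative[OF \<phi>]
   by (simp only: mult_minus_left mult_minus_right minus_minus sum_negf sum_distrib_right *)
 qed
 have Pm: "(\<lambda>\<xi>. ?F l k \<xi> * inv_fourier (?D l k) \<xi>) \<in> borel_measurable borel" for l k
  using borel_measurable_integrable[OF P(1)] by simp
 have "pressure_distribution v (laplacian \<phi>) = (LINT \<xi>|lebesgue. - (\<Sum>l\<in>UNIV. \<Sum>k\<in>UNIV. ?F l k \<xi> * inv_fourier (?D l k) \<xi>))"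
  unfolding pressure_distribution_def eq ..
 also have "\<dots> = (LINT \<xi>|lborel. - (\<Sum>l\<in>UNIV. \<Sum>k\<in>UNIV. ?F l k \<xi> * inv_fourier (?D l k) \<xi>))"
  by (rule integral_completion) (use Pm in \<open>auto intro!: borel_measurable_uminus borel_measurable_sum\<close>)
 also have "\<dots> = - (\<Sum>l\<in>UNIV. \<Sum>k\<in>UNIV. (LINT \<xi>|lborel. ?F l k \<xi> * inv_fourier (?D l k) \<xi>))"
  by (simp add: Bochner_Integration.integral_sum P(1) Bochner_Integration.integrable_sum)
 finally show ?thesis by (simp add: P(2))
qed

section \<open>Half spaces\<close>

lemma test_function_translate:
 fixes f :: "'a::euclidean_space => 'b::real_normed_vector"
 assumes "test_function f" shows "test_function (\<lambda>x. f (x + c))"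
 using test_function_affine_compose[OF assms, of "\<lambda>x. x" c] by (simp add: linear_id[unfolded id_def])

lemma pderivative_translate:
 assumes "smooth f" shows "pderivative (\<lambda>x. f (x + c)) b x = pderivative f b (x + c)"
proof (rule pderivative_eq)
 have "((\<lambda>x. x + c) has_derivative (\<lambda>h. h)) (at x)" by (auto intro!: derivative_eq_intros)
 from has_derivative_compose[OF this smooth_imp_differentiable[OF assms]]
 show "((\<lambda>x. f (x + c)) has_derivative (\<lambda>h. pderivative f h (x + c))) (at x)" .
qed

context
 fixes N :: "'a::euclidean_space"
 assumes N: "N \<noteq> 0"
begin

definition "half = {z. N \<bullet> z > 0}"

lemma half_borel: "half \<in> sets borel"
 unfolding half_def by measurable

text \<open>The half space is invariant under translations in a tangential direction, so the
  integral of a translated \<open>g\<close> over it is constant in the translation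
  parameter.\<close>

lemma half_tangential:
 fixes g :: "'a => real"
 assumes g: "test_function g" and t: "N \<bullet> v = 0"
 shows "(LINT z|lborel. indicator half z * pderivative g v z) = 0"
proof -
 have sg: "smooth g" and bg: "bounded {x. g x \<noteq> 0}" using g by (auto simp: test_function_iff_bounded)
 note [measurable] = test_function_integrable(2)[OF g] half_borel
 have lin: "linear (\<lambda>h. pderivative g h x)" for x
  using smooth_imp_differentiable[OF sg] has_derivative_linear by blast
 have "pderivative g v x = (\<Sum>b\<in>Basis. (v \<bullet> b) * pderivative g b x)" for x
  using linear_sum[OF lin[of x], of "\<lambda>b. (v \<bullet> b) *\<^sub>R b" Basis] linear_cmul[OF lin[of x]]
  by (simp add: euclidean_representation)
 then have c: "continuous_on UNIV (\<lambda>x. pderivative g v x)"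
  by (simp, intro continuous_intros smooth_imp_continuous smooth_pderivative sg)
 have "(LINT x|lborel. indicator half x * g (x + s *\<^sub>R v)) = (LINT x|lborel. indicator half x * g x)" for s
 proof -
  have "(LINT x|lborel. indicator half (s *\<^sub>R v + x) * g (s *\<^sub>R v + x)) = (LINT x|lborel. indicator half x * g x)"
   by (rule integral_lborel_translation) measurable
  moreover have "(indicator half (s *\<^sub>R v + x) :: real) = indicator half x" for x
   using t by (simp add: half_def indicator_def inner_add_right)
  ultimately show ?thesis by (simp add: add.commute)
 qed
 then have "((\<lambda>s::real. LINT x|lborel. indicator half x * g x) has_real_derivative (LINT x|lborel. indicator half x * pderivative g v x)) (at 0)"
  using integral_translation_has_derivative[OF smooth_imp_differentiable[OF sg] c bg half_borel, of 0] by simp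
 then show ?thesis using DERIV_unique DERIV_const by metis
qed

text \<open>The vector \<open>a - r *\<^sub>R c\<close> is tangential for
  \<open>r = (N \<bullet> a) / (N \<bullet> c)\<close>, so every first derivative reduces to the one
  in a fixed transversal basis direction \<open>c\<close>.\<close>

lemma half_pderivative:
 fixes g :: "'a => real"
 assumes g: "test_function g" and ab: "a \<in> Basis" "c \<in> Basis" and c: "N \<bullet> c \<noteq> 0"
 shows "(LINT z|lborel. indicator half z * pderivative g a z) = (N \<bullet> a) / (N \<bullet> c) * (LINT z|lborel. indicator half z * pderivative g c z)"
proof -
 define r where "r = (N \<bullet> a) / (N \<bullet> c)"
 have sg: "smooth g" using g by (auto simp: test_function_iff_bounded)
 note [measurable] = half_borel
 have lin: "linear (\<lambda>h. pderivative g h x)" for x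
  using smooth_imp_differentiable[OF sg] has_derivative_linear by blast
 have eq: "pderivative g (a - r *\<^sub>R c) x = pderivative g a x - r * pderivative g c x" for x
  using linear_diff[OF lin[of x], of a "r *\<^sub>R c"] linear_cmul[OF lin[of x], of r c] by simp
 have int: "integrable lborel (\<lambda>z. indicator half z * pderivative g b z)" if "b \<in> Basis" for b
  using integrable_mult_indicator[of half lborel "pderivative g b"] test_function_integrable(1)[OF test_function_pderivative[OF g that]]
  by simp
 have "(LINT z|lborel. indicator half z * pderivative g (a - r *\<^sub>R c) z) = 0"
  by (rule half_tangential[OF g]) (use c in \<open>simp add: inner_diff_right r_def\<close>)
 also have "(\<lambda>z. indicator half z * pderivative g (a - r *\<^sub>R c) z) =
  (\<lambda>z. indicator half z * pderivative g a z - r * (indicator half z * pderivative g c z))"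
  unfolding eq by (simp add: fun_eq_iff algebra_simps)
 finally show ?thesis
  unfolding r_def[symmetric]
  using int[OF ab(1)] int[OF ab(2)] by (simp add: Bochner_Integration.integral_diff)
qed

text \<open>Two reductions to the direction \<open>c\<close>. Between them the Hessian must be
  symmetric, so that \<open>a\<close> becomes the outer derivative.\<close>

lemma half_second_derivative:
 fixes g :: "'a => real"
 assumes g: "test_function g" and ab: "a \<in> Basis" "b \<in> Basis" "c \<in> Basis" and c: "N \<bullet> c \<noteq> 0"
  and sym: "second_derivative g a c = second_derivative g c a"
 shows "(LINT z|lborel. indicator half z * second_derivative g a b z) =
  (N \<bullet> a) * (N \<bullet> b) / (N \<bullet> c)\<^sup>2 * (LINT z|lborel. indicator half z * second_derivative g c c z)"
proof -
 have "(LINT z|lborel. indicator half z * second_derivative g a b z) =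
   (N \<bullet> b) / (N \<bullet> c) * (LINT z|lborel. indicator half z * second_derivative g a c z)"
  unfolding second_derivative_def by (intro half_pderivative test_function_pderivative g ab c)
 also have "(LINT z|lborel. indicator half z * second_derivative g a c z) =
   (N \<bullet> a) / (N \<bullet> c) * (LINT z|lborel. indicator half z * second_derivative g c c z)"
  unfolding sym unfolding second_derivative_def
  by (intro half_pderivative test_function_pderivative g ab c)
 finally show ?thesis by (simp add: power2_eq_square)
qed

lemma second_derivative_translate:
 assumes "smooth f" "a \<in> Basis"
 shows "second_derivative (\<lambda>x. f (x + c)) a b = (\<lambda>x. second_derivative f a b (x + c))"
proof -
 have "pderivative (\<lambda>x. f (x + c)) a = (\<lambda>x. pderivative f a (x + c))"
  using pderivative_translate[OF assms(1)] by auto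
 then show ?thesis
  unfolding second_derivative_def using pderivative_translate[OF smooth_pderivative[OF assms]] by auto
qed

text \<open>As a function of \<open>s\<close> the integral of \<open>bump 0 (z + s c)\<close> over the half space is bounded but
 not constant, so its second derivative does not vanish at all rational \<open>s\<close>.\<close>

lemma half_space_second_derivative_nonzero:
 assumes c: "c \<in> Basis" "N \<bullet> c \<noteq> 0"
 shows "\<exists>s\<in>\<rat>. (LINT z|lborel. indicator half z * second_derivative (bump 0) c c (z + s *\<^sub>R c)) \<noteq> 0"
proof (rule ccontr)
 define F where "F f s = (LINT z|lborel. indicator half z * f (z + s *\<^sub>R c))" for f :: "'a => real" and s :: real
 let ?\<eta> = "bump 0 :: 'a => real"
 note [measurable] = half_borel
 have dF: "(F f has_real_derivative F (pderivative f c) s) (at s)" if f: "test_function f" for f s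
  unfolding F_def[abs_def]
 proof (rule integral_translation_has_derivative)
  have sf: "smooth f" using f by (simp add: test_function_iff_bounded)
  show "(f has_derivative (\<lambda>h. pderivative f h x)) (at x)" for x by (rule smooth_imp_differentiable[OF sf])
  show "continuous_on UNIV (\<lambda>x. pderivative f c x)" using smooth_imp_continuous[OF smooth_pderivative[OF sf c(1)]] by simp
 qed (use f half_borel in \<open>auto simp: test_function_iff_bounded\<close>)
 have t0: "test_function ?\<eta>" by (rule test_function_bump)
 have t1: "test_function (pderivative ?\<eta> c)" by (rule test_function_pderivative[OF t0 c(1)])
 have t2: "test_function (second_derivative ?\<eta> c c)" unfolding second_derivative_def by (rule test_function_pderivative[OF t1 c(1)])
 assume "\<not> ?thesis"
 then have rat: "F (second_derivative ?\<eta> c c) s = 0" if "s \<in> \<rat>" for s using that by (auto simp: F_def)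
 \<comment> \<open>A continuous function that vanishes at the rationals vanishes everywhere.\<close>
 have zero: "F (second_derivative ?\<eta> c c) s = 0" for s
 proof -
  have "continuous_on UNIV (F (second_derivative ?\<eta> c c))"
   using dF[OF t2] DERIV_continuous continuous_at_imp_continuous_on by blast
  then have "continuous_on (closure \<rat>) (F (second_derivative ?\<eta> c c))" by (rule continuous_on_subset) auto
  from continuous_constant_on_closure[OF this rat] show ?thesis by (simp add: Rats_closure_real)
 qed
 have d2: "(F (pderivative ?\<eta> c) has_real_derivative 0) (at s)" for s
  using dF[OF t1, of s] zero by (simp add: second_derivative_def)
 \<comment> \<open>With vanishing second derivative, \<open>F ?\<eta>\<close> is affine with slope
   \<open>k\<close>.\<close>
 obtain k where k: "F (pderivative ?\<eta> c) s = k" for s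
  using DERIV_isconst_all[of "F (pderivative ?\<eta> c)"] d2 by metis
 have "((\<lambda>s. F ?\<eta> s - k * s) has_real_derivative 0) (at s)" for s
  using dF[OF t0, of s] k by (auto intro!: derivative_eq_intros)
 then have aff: "F ?\<eta> s - k * s = F ?\<eta> 0 - k * 0" for s
  using DERIV_isconst_all[of "\<lambda>s. F ?\<eta> s - k * s"] by blast
 have supp: "norm z \<le> 1" if "?\<eta> z \<noteq> 0" for z
 proof -
  have "z \<bullet> z \<le> 1" using that by (auto simp: bump_def flat_exp_def split: if_splits)
  then show ?thesis by (simp add: norm_eq_sqrt_inner)
 qed
 have \<eta>m: "?\<eta> \<in> borel_measurable borel" by (rule test_function_integrable(2)[OF t0])
 note [measurable] = \<eta>m
 have far: "\<bar>N \<bullet> z - N \<bullet> (z + s *\<^sub>R c)\<bar> = \<bar>s\<bar> * \<bar>N \<bullet> c\<bar>" for z s by (simp add: inner_add_right abs_mult)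
 \<comment> \<open>For such \<open>s\<close> the support of the translated bump has left the half
   space; far in the opposite direction (\<open>Ffull\<close>) it lies inside.\<close>
 have Fzero: "F ?\<eta> s = 0" if "s * (N \<bullet> c) > norm N" for s
 proof -
  have "indicator half z * ?\<eta> (z + s *\<^sub>R c) = 0" for z
  proof (rule ccontr)
   assume "indicator half z * ?\<eta> (z + s *\<^sub>R c) \<noteq> 0"
   then have z: "N \<bullet> z > 0" "?\<eta> (z + s *\<^sub>R c) \<noteq> 0" by (auto simp: half_def indicator_def split: if_splits)
   have "N \<bullet> (z + s *\<^sub>R c) \<le> norm N * norm (z + s *\<^sub>R c)" by (rule norm_cauchy_schwarz)
   also have "\<dots> \<le> norm N * 1" using supp[OF z(2)] by (intro mult_left_mono) auto
   finally show False using z(1) that by (simp add: inner_add_right)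
  qed
  then show ?thesis unfolding F_def by (simp only: integral_zero)
 qed
 have Ffull: "F ?\<eta> s = (LINT z|lborel. ?\<eta> z)" if "s * (N \<bullet> c) < - norm N" for s
 proof -
  have "indicator half z * ?\<eta> (z + s *\<^sub>R c) = ?\<eta> (s *\<^sub>R c + z)" for z
  proof (cases "?\<eta> (z + s *\<^sub>R c) = 0")
   case False
   have "- (N \<bullet> (z + s *\<^sub>R c)) \<le> norm N * norm (z + s *\<^sub>R c)"
    using norm_cauchy_schwarz[of "-N" "z + s *\<^sub>R c"] by simp
   also have "\<dots> \<le> norm N * 1" using supp[OF False] by (intro mult_left_mono) auto
   finally have "N \<bullet> z > 0" using that by (simp add: inner_add_right)
   then show ?thesis by (simp add: half_def add.commute)
  qed (simp add: add.commute)
  then show ?thesis unfolding F_def using integral_lborel_translation[OF \<eta>m, of "s *\<^sub>R c"] by simp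
 qed
 \<comment> \<open>\<open>A\<close> lies beyond the threshold \<open>norm N\<close>. The values at
   \<open>A\<close> and \<open>2 * A\<close> are both \<open>0\<close>, so the slope is
   \<open>0\<close>, and comparison with \<open>- A\<close> makes the total integral of the bump
   vanish.\<close>
 define A where "A = (norm N + 1) / (N \<bullet> c)"
 have A: "A * (N \<bullet> c) = norm N + 1" using c by (simp add: A_def)
 have "F ?\<eta> A = 0" "F ?\<eta> (2 * A) = 0" using A norm_ge_zero[of N] by (auto intro!: Fzero simp: mult.assoc simp del: norm_ge_zero)
 then have "k * A = 0" using aff[of A] aff[of "2 * A"] mult.left_commute[of k 2 A] by linarith
 moreover have "A \<noteq> 0" using A by (metis add_nonneg_eq_0_iff mult_zero_left norm_ge_zero zero_le_one zero_neq_one)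
 ultimately have "k = 0" by simp
 then have "F ?\<eta> A = F ?\<eta> (- A)" using aff[of A] aff[of "-A"] by simp
 moreover have "F ?\<eta> (- A) = (LINT z|lborel. ?\<eta> z)" using A norm_ge_zero[of N] by (intro Ffull) (auto simp del: norm_ge_zero)
 ultimately have I0: "(LINT z|lborel. ?\<eta> z) = 0" using \<open>F ?\<eta> A = 0\<close> by simp
 then have "AE z in lborel. ?\<eta> z = 0"
  by (subst (asm) integral_nonneg_eq_0_iff_AE) (auto simp: bump_nonneg test_function_integrable(1)[OF t0])
 then have "AE z in lebesgue. z \<in> {z. ?\<eta> z = 0}" by (intro AE_completion) simp
 moreover have "closed {z. ?\<eta> z = 0}"
  using t0 by (intro closed_Collect_eq smooth_imp_continuous continuous_on_const) (simp add: test_function_iff_bounded)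
 ultimately have "(0::'a) \<in> {z. ?\<eta> z = 0}" using mem_closed_if_AE_lebesgue by blast
 then show False using bump_zero_pos[of 0] by (metis (mono_tags, lifting) mem_Collect_eq less_irrefl)
qed

text \<open>All integrals of second derivatives are the multiples
  \<open>(N \<bullet> a) * (N \<bullet> b)\<close> of one common number, and some rational translate
  of the bump makes that number nonzero.\<close>

lemma half_space_jump:
 assumes J: "\<And>s c. s \<in> \<rat> ==> c \<in> Basis ==>
  (\<Sum>a\<in>Basis. \<Sum>b\<in>Basis. J a b * (LINT z|lborel. indicator half z * second_derivative (bump 0) a b (z + s *\<^sub>R c))) = 0"
 shows "(\<Sum>a\<in>Basis. \<Sum>b\<in>Basis. J a b * ((N \<bullet> a) * (N \<bullet> b))) = 0"
proof -
 obtain c where c: "c \<in> Basis" "N \<bullet> c \<noteq> 0" using N by (metis euclidean_all_zero_iff)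
 from half_space_second_derivative_nonzero[OF c] obtain s where s: "s \<in> \<rat>"
  and nz: "(LINT z|lborel. indicator half z * second_derivative (bump 0) c c (z + s *\<^sub>R c)) \<noteq> 0" (is "?I \<noteq> 0") by blast
 have sb: "smooth (bump 0 :: 'a => real)" using test_function_bump[of 0, where 'a='a] by (simp add: test_function_iff_bounded)
 define g where "g = (\<lambda>z::'a. bump 0 (z + s *\<^sub>R c))"
 have g: "test_function g" unfolding g_def by (intro test_function_translate test_function_bump)
 have sd: "second_derivative g a b = (\<lambda>z. second_derivative (bump 0) a b (z + s *\<^sub>R c))" if "a \<in> Basis" for a b
  unfolding g_def by (rule second_derivative_translate[OF sb that])
 have sym: "second_derivative g a c = second_derivative g c a" if "a \<in> Basis" for a
  unfolding sd[OF that] sd[OF c(1)] using bump_hessian_symmetric[of 0 a c] by (simp add: second_derivative_def)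
 have "(\<Sum>a\<in>Basis. \<Sum>b\<in>Basis. J a b * ((N \<bullet> a) * (N \<bullet> b) / (N \<bullet> c)\<^sup>2 * ?I)) = 0"
 proof (rule trans[OF _ J[OF s c(1)]], intro sum.cong refl)
  fix a b :: 'a assume ab: "a \<in> Basis" "b \<in> Basis"
  show "J a b * ((N \<bullet> a) * (N \<bullet> b) / (N \<bullet> c)\<^sup>2 * ?I) = J a b * (LINT z|lborel. indicator half z * second_derivative (bump 0) a b (z + s *\<^sub>R c))"
   using half_second_derivative[OF g ab c sym[OF ab(1)]] unfolding sd[OF ab(1)] sd[OF c(1)] by simp
 qed
 also have "(\<Sum>a\<in>Basis. \<Sum>b\<in>Basis. J a b * ((N \<bullet> a) * (N \<bullet> b) / (N \<bullet> c)\<^sup>2 * ?I)) =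
  (\<Sum>a\<in>Basis. \<Sum>b\<in>Basis. J a b * ((N \<bullet> a) * (N \<bullet> b))) * (?I / (N \<bullet> c)\<^sup>2)"
  by (simp add: sum_distrib_right sum_divide_distrib mult.assoc)
 finally show ?thesis using nz c by simp
qed

end

section \<open>Fubini and slices\<close>

lemma lborel_nn_integral_snd:
 fixes f :: "'a::euclidean_space \<times> 'b::euclidean_space => ennreal"
 assumes "f \<in> borel_measurable borel"
 shows "(\<integral>\<^sup>+z. f z \<partial>lborel) = (\<integral>\<^sup>+t. \<integral>\<^sup>+x. f (x, t) \<partial>lborel \<partial>lborel)"
 using lborel_pair.nn_integral_snd[of f] assms by (simp add: lborel_prod)

lemma lborel_nn_integral_fst:
 fixes f :: "'a::euclidean_space \<times> 'b::euclidean_space => ennreal"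
 assumes "f \<in> borel_measurable borel"
 shows "(\<integral>\<^sup>+z. f z \<partial>lborel) = (\<integral>\<^sup>+x. \<integral>\<^sup>+t. f (x, t) \<partial>lborel \<partial>lborel)"
 using lborel.nn_integral_fst[of f lborel] assms by (simp add: lborel_prod)

lemma lborel_integral_snd:
 fixes f :: "'a::euclidean_space \<times> 'b::euclidean_space => real"
 assumes "integrable lborel f"
 shows "(LINT z|lborel. f z) = (LINT t|lborel. LINT x|lborel. f (x, t))"
 using lborel_pair.integral_snd[of "\<lambda>x t. f (x, t)"] assms by (simp add: lborel_prod)

lemma lborel_integral_fst:
 fixes f :: "'a::euclidean_space \<times> 'b::euclidean_space => real"
 assumes "integrable lborel f"
 shows "(LINT z|lborel. f z) = (LINT x|lborel. LINT t|lborel. f (x, t))"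
 using lborel_pair.integral_fst[of "\<lambda>x t. f (x, t)"] assms by (simp add: lborel_prod)

lemma AE_lborel_snd:
 fixes P :: "'a::euclidean_space \<times> 'b::euclidean_space => bool"
 assumes "AE z in lborel. P z"
 shows "AE t in lborel. AE x in lborel. P (x, t)"
proof -
 obtain E where E: "{z. \<not> P z} \<subseteq> E" "E \<in> null_sets lborel"
  using assms by (auto simp: eventually_ae_filter)
 then have [measurable]: "E \<in> sets borel" by auto
 have "0 = (\<integral>\<^sup>+z. indicator E z \<partial>(lborel :: ('a \<times> 'b) measure))" using null_setsD1[OF E(2)] by simp
 also have "\<dots> = (\<integral>\<^sup>+t. \<integral>\<^sup>+x. indicator E (x, t) \<partial>lborel \<partial>lborel)"
  by (rule lborel_nn_integral_snd) simp
 finally have "AE t in lborel. (\<integral>\<^sup>+x. indicator E (x, t) \<partial>(lborel::'a measure)) = 0"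
  by (subst (asm) eq_commute, subst (asm) nn_integral_0_iff_AE) auto
 then show ?thesis
 proof eventually_elim
  case (elim t)
  then have "AE x in (lborel::'a measure). indicator E (x, t) = (0::ennreal)"
   by (subst (asm) nn_integral_0_iff_AE) auto
  then show ?case by (rule eventually_mono) (use E(1) in \<open>auto simp: indicator_def split: if_splits\<close>)
 qed
qed

text \<open>The limit \<open>f\<close> carries no measurability assumption: an almost everywhere
  limit of Borel functions is Lebesgue measurable. Normal limits enter the iterated integrals in
  this way, which is why the conclusions are stated for \<open>lebesgue\<close>.\<close>

lemma lebesgue_dominated_convergence:
 fixes s :: "nat => 'a::euclidean_space => real"
 assumes s: "\<And>i. s i \<in> borel_measurable borel" and w: "integrable lborel w"
  and lim: "AE x in lborel. (\<lambda>i. s i x) \<longlonglongrightarrow> f x" and bd: "\<And>i. AE x in lborel. \<bar>s i x\<bar> \<le> w x"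
 shows "f \<in> borel_measurable lebesgue" "integrable lebesgue f"
  "(\<lambda>i. LINT x|lborel. s i x) \<longlonglongrightarrow> (LINT x|lebesgue. f x)"
proof -
 note [measurable] = s
 define g where "g x = lim (\<lambda>i. s i x)" for x
 have [measurable]: "g \<in> borel_measurable borel" unfolding g_def by measurable
 have ae: "AE x in lborel. g x = f x" using lim by eventually_elim (simp add: g_def limI)
 then have ae': "AE x in lebesgue. g x = f x" by (rule AE_completion)
 have gl: "g \<in> borel_measurable lebesgue" by (rule measurable_completion) simp
 have lim': "AE x in lborel. (\<lambda>i. s i x) \<longlonglongrightarrow> g x" using lim ae by eventually_elim simp
 obtain N where N: "N \<in> null_sets lborel" "{x. g x \<noteq> f x} \<subseteq> N" using ae by (auto simp: eventually_ae_filter)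
 show fl: "f \<in> borel_measurable lebesgue"
  by (rule borel_measurable_AE[OF gl ae'])
 have gi: "integrable lborel g" by (rule integrable_dominated_convergence[OF _ _ w lim']) (use bd in auto)
 then have "integrable lebesgue g" by (simp add: integrable_completion)
 then show "integrable lebesgue f" using integrable_cong_AE[OF gl fl ae'] by simp
 have "(\<lambda>i. LINT x|lborel. s i x) \<longlonglongrightarrow> (LINT x|lborel. g x)"
  by (rule integral_dominated_convergence[OF _ _ w lim']) (use bd in auto)
 also have "(LINT x|lborel. g x) = (LINT x|lebesgue. g x)" by (rule integral_completion[symmetric]) simp
 also have "\<dots> = (LINT x|lebesgue. f x)" by (rule integral_cong_AE[OF gl fl ae'])
 finally show "(\<lambda>i. LINT x|lborel. s i x) \<longlonglongrightarrow> (LINT x|lebesgue. f x)" .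
qed

text \<open>A countable basis of the topology that is stable under intersection: it generates the
  Borel sets, and its members share one exceptional null set.\<close>

definition rational_boxes :: "'a::euclidean_space set set" where
 "rational_boxes = (\<lambda>f. box (\<Sum>i\<in>Basis. fst (f i) *\<^sub>R i) (\<Sum>i\<in>Basis. snd (f i) *\<^sub>R i)) ` (Basis \<rightarrow>\<^sub>E \<rat> \<times> \<rat>)"

lemma countable_rational_boxes: "countable (rational_boxes :: 'a::euclidean_space set set)"
 unfolding rational_boxes_def by (intro countable_image countable_PiE countable_SIGMA countable_rat) auto

lemma rational_boxesE:
 assumes "B \<in> rational_boxes"
 obtains a b where "B = box a b" "\<And>i. i \<in> Basis ==> a \<bullet> i \<in> \<rat>" "\<And>i. i \<in> Basis ==> b \<bullet> i \<in> \<rat>"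
 using assms unfolding rational_boxes_def by (force simp: PiE_iff mem_Times_iff)

lemma rational_boxesI:
 assumes "\<And>i. i \<in> Basis ==> a \<bullet> i \<in> \<rat>" "\<And>i. i \<in> Basis ==> b \<bullet> i \<in> \<rat>"
 shows "box a b \<in> rational_boxes"
 unfolding rational_boxes_def
 by (rule image_eqI[of _ _ "\<lambda>i\<in>Basis. (a \<bullet> i, b \<bullet> i)"]) (use assms in \<open>auto simp: euclidean_representation\<close>)

lemma rational_boxes_Int:
 assumes "A \<in> rational_boxes" "B \<in> rational_boxes" shows "A \<inter> B \<in> rational_boxes"
proof -
 from assms obtain a b c d where *: "A = box a b" "B = box c d"
  "\<And>i. i \<in> Basis ==> a \<bullet> i \<in> \<rat>" "\<And>i. i \<in> Basis ==> b \<bullet> i \<in> \<rat>"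
  "\<And>i. i \<in> Basis ==> c \<bullet> i \<in> \<rat>" "\<And>i. i \<in> Basis ==> d \<bullet> i \<in> \<rat>"
  by (metis rational_boxesE)
 then show ?thesis
  unfolding * box_Int_box by (intro rational_boxesI) (auto simp: max_def min_def)
qed

lemma rational_box_inside:
 assumes "open U" "x \<in> U"
 obtains a b where "box a b \<in> rational_boxes" "x \<in> box a b" "cbox a b \<subseteq> U"
proof -
 obtain e where e: "e > 0" "ball x e \<subseteq> U" using assms openE by blast
 from rational_boxes[of "e/2" x] e(1) obtain a b where
  ab: "\<forall>i\<in>Basis. a \<bullet> i \<in> \<rat> \<and> b \<bullet> i \<in> \<rat>" "x \<in> box a b" "box a b \<subseteq> ball x (e/2)" by auto
 have "cbox a b = closure (box a b)" using ab(2) by (subst closure_box) auto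
 also have "\<dots> \<subseteq> closure (ball x (e/2))" by (rule closure_mono[OF ab(3)])
 also have "\<dots> \<subseteq> ball x e" using e(1) by auto
 finally show ?thesis using that[of a b] ab e(2) rational_boxesI[of a b] by blast
qed

lemma borel_eq_rational_boxes: "sets borel = sigma_sets UNIV (rational_boxes :: 'a::euclidean_space set set)"
proof -
 have "topological_basis (rational_boxes :: 'a set set)"
 proof (rule topological_basisI)
  show "open B" if "B \<in> rational_boxes" for B :: "'a set"
   using that by (auto elim!: rational_boxesE simp: open_box)
  show "\<exists>B'\<in>rational_boxes. x \<in> B' \<and> B' \<subseteq> O'" if "open O'" "x \<in> O'" for O' and x :: 'a
   using rational_box_inside[OF that] box_subset_cbox by (metis order_trans)
 qed
 then have "(borel :: 'a measure) = sigma UNIV rational_boxes"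
  by (rule borel_eq_countable_basis[OF countable_rational_boxes])
 then have "sets (borel :: 'a measure) = sets (sigma UNIV rational_boxes)" by (rule arg_cong)
 then show ?thesis by (simp add: sets_measure_of)
qed

text \<open>The positive and the negative part of \<open>h\<close> are densities of measures that
  agree on an intersection-stable generator. The argument is run inside a single box, where
  \<open>h\<close> is integrable.\<close>

lemma AE_zero_if_integral_rational_boxes_zero:
 fixes h :: "'a::euclidean_space => real"
 assumes U: "open U"
  and int: "\<And>a b. box a b \<in> rational_boxes ==> cbox a b \<subseteq> U ==> integrable lebesgue (\<lambda>x. indicator (box a b) x * h x)"
  and zero: "\<And>a b. box a b \<in> rational_boxes ==> cbox a b \<subseteq> U ==> (LINT x|lebesgue. indicator (box a b) x * h x) = 0"
 shows "AE x in lborel. x \<in> U --> h x = 0"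
proof -
 have loc: "AE x in lborel. x \<in> box a b --> h x = 0" if ab: "box a b \<in> rational_boxes" "cbox a b \<subseteq> U" for a b
 proof -
  let ?h = "\<lambda>x. indicator (box a b) x * h x"
  obtain g where [measurable]: "g \<in> borel_measurable borel" and g: "integrable lborel g" "AE x in lborel. ?h x = g x"
   and eq: "\<And>k :: 'a => real. k \<in> borel_measurable borel ==>
   (LINT x|lebesgue. k x * of_real (?h x)) = (LINT x|lborel. k x * of_real (g x))"
   by (rule lebesgue_integrable_borel_representative[OF int[OF ab], where 'b=real]) (rule that)
  have g0: "(LINT x|lborel. indicator B x * g x) = 0" if B: "B \<in> rational_boxes" for B
  proof -
   have BB: "B \<inter> box a b \<in> rational_boxes" by (rule rational_boxes_Int[OF B ab(1)])
   obtain c d where cd: "B \<inter> box a b = box c d" using rational_boxesE[OF BB] by metis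
   have Bm: "B \<in> sets borel" using B by (auto elim!: rational_boxesE simp: open_box)
   have "(LINT x|lborel. indicator B x * g x) = (LINT x|lebesgue. indicator B x * ?h x)"
    using eq[of "indicator B"] Bm by simp
   also have "\<dots> = (LINT x|lebesgue. indicator (box c d) x * h x)"
    unfolding cd[symmetric] by (intro Bochner_Integration.integral_cong) (auto simp: indicator_def)
   also have "\<dots> = 0"
   \<comment> \<open>An empty \<open>box c d\<close> is split off because its
     \<open>cbox c d\<close> may be nonempty and leave \<open>U\<close>.\<close>
   proof (cases "box c d = {}")
    case False
    have "cbox c d = closure (box c d)" using False by (simp add: closure_box)
    also have "\<dots> \<subseteq> closure (box a b)" by (rule closure_mono) (use cd in auto)
    also have "\<dots> \<subseteq> cbox a b" using closure_minimal[OF box_subset_cbox closed_cbox] .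
    finally show ?thesis using zero[of c d] BB cd ab(2) by auto
   qed simp
   finally show ?thesis .
  qed
  have nn: "(\<integral>\<^sup>+x. ennreal (k x) * indicator B x \<partial>lborel) = ennreal (LINT x|lborel. indicator B x * k x)"
   if "integrable lborel k" "\<And>x. k x \<ge> 0" "B \<in> sets borel" for k and B :: "'a set"
   using that integrable_mult_indicator[OF _ that(1), of B]
   by (subst nn_integral_eq_integral[symmetric]) (auto simp: ennreal_mult' mult.commute indicator_def intro!: nn_integral_cong)
  have em: "emeasure (density lborel (\<lambda>x. ennreal (k x))) B = ennreal (LINT x|lborel. indicator B x * k x)"
   if "integrable lborel k" "\<And>x. k x \<ge> 0" "B \<in> sets borel" for k and B :: "'a set"
   using nn[OF that] that borel_measurable_integrable[OF that(1)] by (subst emeasure_density) auto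
  let ?p = "\<lambda>x. max 0 (g x)" and ?n = "\<lambda>x. max 0 (- g x)"
  have pn: "integrable lborel ?p" "integrable lborel ?n" using g by auto
  have "density lborel (\<lambda>x. ennreal (?p x)) = density lborel (\<lambda>x. ennreal (?n x))"
  proof (rule measure_eqI_generator_eq[where E=rational_boxes and \<Omega>=UNIV and A="\<lambda>n::nat. box (- (real n *\<^sub>R One)) (real n *\<^sub>R One)"])
   show "Int_stable (rational_boxes :: 'a set set)" by (simp add: Int_stable_def rational_boxes_Int)
   show "sets (density lborel (\<lambda>x. ennreal (?p x))) = sigma_sets UNIV rational_boxes"
    "sets (density lborel (\<lambda>x. ennreal (?n x))) = sigma_sets UNIV rational_boxes"
    by (simp_all add: borel_eq_rational_boxes)
   show "range (\<lambda>n::nat. box (- (real n *\<^sub>R One)) (real n *\<^sub>R One) :: 'a set) \<subseteq> rational_boxes"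
    by (auto intro!: rational_boxesI simp: inner_sum_left inner_Basis if_distrib sum.delta cong: if_cong)
   show "(\<Union>n. box (- (real n *\<^sub>R One)) (real n *\<^sub>R One) :: 'a set) = UNIV" by (rule UN_box_eq_UNIV)
   show "emeasure (density lborel (\<lambda>x. ennreal (?p x))) (box (- (real n *\<^sub>R One)) (real n *\<^sub>R One)) \<noteq> \<infinity>" for n
    by (subst em[OF pn(1) max.cobounded1]) auto
   show "emeasure (density lborel (\<lambda>x. ennreal (?p x))) B = emeasure (density lborel (\<lambda>x. ennreal (?n x))) B"
    if B: "B \<in> rational_boxes" for B
   proof -
    have Bm: "B \<in> sets borel" using B by (auto elim!: rational_boxesE simp: open_box)
    have i: "integrable lborel (\<lambda>x. indicator B x * ?p x)" "integrable lborel (\<lambda>x. indicator B x * ?n x)"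
     using integrable_mult_indicator[OF _ pn(1), of B] integrable_mult_indicator[OF _ pn(2), of B] Bm by auto
    have "(LINT x|lborel. indicator B x * ?p x) - (LINT x|lborel. indicator B x * ?n x) = (LINT x|lborel. indicator B x * g x)"
     by (subst Bochner_Integration.integral_diff[OF i, symmetric]) (auto intro!: Bochner_Integration.integral_cong simp: max_def algebra_simps)
    then show ?thesis using g0[OF B] unfolding em[OF pn(1) max.cobounded1 Bm] em[OF pn(2) max.cobounded1 Bm] by simp
   qed
  qed auto
  then have "AE x in lborel. ennreal (?p x) = ennreal (?n x)"
   by (intro sigma_finite_measure.density_unique[OF sigma_finite_lborel]) auto
  with g(2) show ?thesis
  proof eventually_elim
   case (elim x)
   then have "g x = 0" by (auto simp: max_def split: if_splits)
   then show ?case using elim by auto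
  qed
 qed
 have "AE x in lborel. \<forall>B\<in>{B\<in>rational_boxes. \<exists>a b. B = box a b \<and> cbox a b \<subseteq> U}. x \<in> B --> h x = 0"
  by (subst AE_ball_countable) (auto intro: countable_subset[OF _ countable_rational_boxes] loc)
 then show ?thesis
 proof eventually_elim
  case (elim x)
  show ?case
  proof
   assume "x \<in> U"
   then obtain a b where "box a b \<in> rational_boxes" "x \<in> box a b" "cbox a b \<subseteq> U" using rational_box_inside[OF U] by metis
   with elim show "h x = 0" by blast
  qed
 qed
qed

text \<open>\<open>\<Psi>\<close> keeps the time coordinate, so the change of variables in space is
  applied on each time slice and Fubini does the rest. Only the spatial Jacobian appears.\<close>

lemma
 fixes \<Phi> :: "(real^'n) \<times> real => real^'n"
 defines "\<Psi> q \<equiv> (\<Phi> q, snd q)"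
 assumes Q: "open Q" and cont: "continuous_on Q \<Phi>"
  and der: "\<And>y t. (y, t) \<in> Q ==> ((\<lambda>y. \<Phi> (y, t)) has_derivative \<Phi>' (y, t)) (at y)"
  and inj: "inj_on \<Psi> Q" and contj: "continuous_on Q (\<lambda>q. jac (\<Phi>' q))"
 shows open_spacetime_image: "open (\<Psi> ` Q)"
  and integral_spacetime_image: "\<And>f. f \<in> borel_measurable borel ==>
   (LINT z|lborel. indicator (\<Psi> ` Q) z * f z) = (LINT q|lborel. indicator Q q * jac (\<Phi>' q) * f (\<Psi> q))"
  and nn_integral_spacetime_image: "\<And>f. f \<in> borel_measurable borel ==>
   (\<integral>\<^sup>+z. indicator (\<Psi> ` Q) z * f z \<partial>lborel) = (\<integral>\<^sup>+q. ennreal (indicator Q q * jac (\<Phi>' q)) * f (\<Psi> q) \<partial>lborel)"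
proof -
 have cont\<Psi>: "continuous_on Q \<Psi>"
  unfolding \<Psi>_def by (intro continuous_intros cont)
 show op: "open (\<Psi> ` Q)" by (rule invariance_of_domain[OF cont\<Psi> Q inj])
 define F where "F q = (if q \<in> Q then \<Psi> q else 0)" for q
 have Q': "Q \<in> sets borel" using Q by simp
 have Fm [measurable]: "F \<in> borel_measurable borel"
  unfolding F_def by (rule borel_measurable_continuous_on_if[OF Q' cont\<Psi>]) auto
 have [measurable]: "(\<lambda>q. indicator Q q * jac (\<Phi>' q)) \<in> borel_measurable borel"
  using borel_measurable_continuous_on_indicator[OF Q' contj] by simp
 note [measurable] = Q'
 have opm [measurable]: "\<Psi> ` Q \<in> sets borel" using op by simp
 have nn: "(\<integral>\<^sup>+z. indicator (\<Psi> ` Q) z * f z \<partial>lborel) = (\<integral>\<^sup>+q. ennreal (indicator Q q * jac (\<Phi>' q)) * f (F q) \<partial>lborel)"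
  if [measurable]: "f \<in> borel_measurable borel" for f :: "(real^'n) \<times> real => ennreal"
 proof -
  have "(\<integral>\<^sup>+x. indicator (\<Psi> ` Q) (x, t) * f (x, t) \<partial>lborel) =
   (\<integral>\<^sup>+y. ennreal (indicator Q (y, t) * jac (\<Phi>' (y, t))) * f (F (y, t)) \<partial>lborel)" for t
  proof -
   let ?Q = "{y. (y, t) \<in> Q}"
   have oQ: "open ?Q" using open_vimage[OF Q, of "\<lambda>y. (y, t)"] by (simp add: vimage_def continuous_on_Pair)
   have img: "(x, t) \<in> \<Psi> ` Q \<longleftrightarrow> x \<in> (\<lambda>y. \<Phi> (y, t)) ` ?Q" for x
    by (auto simp: \<Psi>_def image_iff)
   have "(\<integral>\<^sup>+x. indicator (\<Psi> ` Q) (x, t) * f (x, t) \<partial>lborel) = (\<integral>\<^sup>+x. indicator ((\<lambda>y. \<Phi> (y, t)) ` ?Q) x * f (x, t) \<partial>lborel)"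
    by (intro nn_integral_cong) (simp add: indicator_def img)
   also have "\<dots> = (\<integral>\<^sup>+y. ennreal (indicator ?Q y * jac (\<Phi>' (y, t))) * f (\<Phi> (y, t), t) \<partial>lborel)"
   proof (rule nn_integral_diffeomorphic_image[OF oQ])
    show "inj_on (\<lambda>y. \<Phi> (y, t)) ?Q"
     by (rule inj_onI) (use inj_onD[OF inj, of "(x, t)" "(y, t)" for x y] in \<open>auto simp: \<Psi>_def\<close>)
    show "continuous_on ?Q (\<lambda>y. jac (\<Phi>' (y, t)))"
     by (rule continuous_on_compose2[OF contj]) (auto intro!: continuous_intros)
   qed (auto intro: der)
   also have "\<dots> = (\<integral>\<^sup>+y. ennreal (indicator Q (y, t) * jac (\<Phi>' (y, t))) * f (F (y, t)) \<partial>lborel)"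
    by (intro nn_integral_cong) (auto simp: indicator_def F_def \<Psi>_def)
   finally show ?thesis .
  qed
  then show ?thesis by (subst (1 2) lborel_nn_integral_snd) (auto simp: mult.assoc)
 qed
 then show "(\<integral>\<^sup>+z. indicator (\<Psi> ` Q) z * f z \<partial>lborel) = (\<integral>\<^sup>+q. ennreal (indicator Q q * jac (\<Phi>' q)) * f (\<Psi> q) \<partial>lborel)"
  if "f \<in> borel_measurable borel" for f :: "(real^'n) \<times> real => ennreal"
  using that by (auto simp: F_def indicator_def intro!: nn_integral_cong)
 have M: "density lborel (\<lambda>z. ennreal (indicator (\<Psi> ` Q) z)) =
   distr (density lborel (\<lambda>q. ennreal (indicator Q q * jac (\<Phi>' q)))) borel F" (is "?L = ?R")
 proof (rule measure_eqI)
  fix B assume "B \<in> sets ?L"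
  then have [measurable]: "B \<in> sets borel" by simp
  have "emeasure ?L B = (\<integral>\<^sup>+z. indicator (\<Psi> ` Q) z * indicator B z \<partial>lborel)"
   by (subst emeasure_density) (auto simp: ennreal_indicator)
  also have "\<dots> = (\<integral>\<^sup>+q. ennreal (indicator Q q * jac (\<Phi>' q)) * indicator B (F q) \<partial>lborel)"
   by (rule nn) simp
  also have "\<dots> = emeasure ?R B"
   using measurable_sets[OF Fm, of B]
   by (subst emeasure_distr, simp, simp, subst emeasure_density, simp, simp)
    (auto simp: indicator_def intro!: nn_integral_cong)
  finally show "emeasure ?L B = emeasure ?R B" .
 qed simp
 show "(LINT z|lborel. indicator (\<Psi> ` Q) z * f z) = (LINT q|lborel. indicator Q q * jac (\<Phi>' q) * f (\<Psi> q))"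
  if [measurable]: "f \<in> borel_measurable borel" for f :: "(real^'n) \<times> real => real"
 proof -
  have "(LINT z|lborel. indicator (\<Psi> ` Q) z * f z) = (LINT z|?L. f z)"
   by (subst integral_density) auto
  also have "\<dots> = (LINT q|lborel. indicator Q q * jac (\<Phi>' q) * f (F q))"
   unfolding M by (subst integral_distr, simp, simp, subst integral_density) (auto simp: jac_nonneg)
  finally show ?thesis by (auto simp: F_def indicator_def intro!: Bochner_Integration.integral_cong)
 qed
qed

section \<open>Blow-up at a surface\<close>

lemma lborel_integrable_swap:
 fixes f :: "'a::euclidean_space \<times> 'b::euclidean_space => 'c::{banach, second_countable_topology}"
 assumes "integrable lborel f"
 shows "integrable lborel (\<lambda>(x, y). f (y, x))"
 using lborel_pair.integrable_product_swap[of f] assms by (simp add: lborel_prod)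

lemma lborel_integrable_fst:
 fixes f :: "'a::euclidean_space \<times> 'b::euclidean_space => real"
 assumes "integrable lborel f"
 shows "AE x in lborel. integrable lborel (\<lambda>t. f (x, t))" "integrable lborel (\<lambda>x. LINT t|lborel. f (x, t))"
 using lborel_pair.AE_integrable_fst'[of f] lborel_pair.integrable_fst'[of f] assms by (simp_all add: lborel_prod)

lemma lborel_integrable_snd:
 fixes f :: "'a::euclidean_space \<times> 'b::euclidean_space => real"
 assumes "integrable lborel f"
 shows "AE t in lborel. integrable lborel (\<lambda>x. f (x, t))" "integrable lborel (\<lambda>t. LINT x|lborel. f (x, t))"
 using lborel_integrable_fst[OF lborel_integrable_swap[OF assms]] by simp_all

lemma linear_flatten: "linear (flatten k)"
 by (auto intro!: linearI simp: flatten_def vec_eq_iff)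

lemma flatten_flatten [simp]: "flatten k (flatten k y) = flatten k y"
 by (simp add: flatten_def vec_eq_iff)

lemma flatten_decomp: "flatten k y + (y $ k) *\<^sub>R axis k 1 = y"
 by (auto simp: flatten_def vec_eq_iff axis_def)

lemma norm_flatten_le: "norm (flatten k y) \<le> norm y"
 by (rule norm_le_componentwise_cart) (simp add: flatten_def)

text \<open>In a tubular chart these are the parameters of the foot of the normal line on which the
  point with parameters \<open>q\<close> lies, at the same time.\<close>

definition proj :: "'n => (real^'n) \<times> real => (real^'n) \<times> real" where
 "proj k q = (flatten k (fst q), snd q)"

definition normal_axis :: "'n => (real^'n) \<times> real" where
 "normal_axis k = (axis k 1, 0)"

lemma linear_proj: "linear (proj k)"
 using linear_flatten[of k] by (auto intro!: linearI simp: proj_def linear_add linear_cmul)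

lemma proj_proj [simp]: "proj k (proj k q) = proj k q"
 by (simp add: proj_def)

lemma proj_decomp: "proj k q + (fst q $ k) *\<^sub>R normal_axis k = q"
 by (simp add: proj_def normal_axis_def flatten_decomp prod_eq_iff)

lemma norm_proj_le: "norm (proj k q) \<le> norm q"
 unfolding proj_def norm_prod_def
 by (intro real_sqrt_le_mono add_mono power_mono) (auto simp: norm_flatten_le)

lemma continuous_on_proj: "continuous_on S (proj k)"
 using linear_proj linear_continuous_on linear_linear by blast

lemma borel_measurable_proj [measurable]: "proj k \<in> borel_measurable borel"
 by (intro borel_measurable_continuous_onI continuous_on_proj)

lemma borel_measurable_fst_snd:
 "(fst :: 'a::euclidean_space \<times> 'b::euclidean_space => 'a) \<in> borel_measurable borel"
 "(snd :: 'a::euclidean_space \<times> 'b::euclidean_space => 'b) \<in> borel_measurable borel"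
 by (intro borel_measurable_continuous_onI continuous_intros)+

lemma norm_le_if_scaled:
 fixes x :: "'a::real_normed_vector"
 assumes "norm (x /\<^sub>R d) \<le> R" "d > 0" shows "norm x \<le> d * R"
 using assms by (simp add: divide_inverse[symmetric] inverse_eq_divide pos_divide_le_eq mult.commute)

lemma integral_abs_bound_AE:
 fixes f w :: "'a => real"
 assumes "f \<in> borel_measurable M" "integrable M w" "AE x in M. \<bar>f x\<bar> \<le> w x"
 shows "\<bar>LINT x|M. f x\<bar> \<le> (LINT x|M. w x)"
proof -
 have "AE x in M. norm (f x) \<le> norm (w x)" using assms(3) by (rule eventually_mono) simp
 then have f: "integrable M f" by (rule Bochner_Integration.integrable_bound[OF assms(2,1)])
 have "\<bar>LINT x|M. f x\<bar> \<le> (LINT x|M. \<bar>f x\<bar>)" using integral_norm_bound[of M f] by simp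
 also have "\<dots> \<le> (LINT x|M. w x)" by (rule integral_mono_AE) (use f assms in auto)
 finally show ?thesis .
qed

text \<open>The scales form a sequence, so that null sets belonging to single scales can be
  united.\<close>

definition eps :: "nat => real" where "eps m = inverse (real (Suc m))"

lemma eps_pos: "eps m > 0" by (simp add: eps_def)

lemma eps_tendsto: "eps \<longlonglongrightarrow> 0" unfolding eps_def by (rule LIMSEQ_inverse_real_of_nat)

lemma eventually_eps_less: "d > 0 ==> \<forall>\<^sub>F m in sequentially. eps m < d"
 using eps_tendsto by (rule order_tendstoD)

text \<open>Together with \<open>minus_part\<close>: the masses of a kernel on the two sides of the
  hyperplane orthogonal to \<open>n\<close>. They weight the two one-sided limits in the
  blow-up.\<close>

definition plus_part :: "('a::euclidean_space => real) => 'a => real" where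
 "plus_part ka n = (LINT z|lborel. indicator {z. n \<bullet> z > 0} z * ka z)"

definition minus_part :: "('a::euclidean_space => real) => 'a => real" where
 "minus_part ka n = (LINT z|lborel. indicator {z. n \<bullet> z < 0} z * ka z)"

lemma has_derivative_eps_quotient:
 assumes "(h has_derivative h') (at p)"
 shows "(\<lambda>m. (h (p + eps m *\<^sub>R v) - h p) /\<^sub>R eps m) \<longlonglongrightarrow> h' v"
proof (cases "v = 0")
 case True
 then show ?thesis using linear_0[OF has_derivative_linear[OF assms]] by simp
next
 case False
 have lin: "linear h'" by (rule has_derivative_linear[OF assms])
 have "filterlim (\<lambda>m. eps m *\<^sub>R v) (at 0) sequentially"
  using tendsto_scaleR[OF eps_tendsto tendsto_const[of v]] False eps_pos
  by (auto simp: filterlim_at less_imp_neq[OF eps_pos, symmetric])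
 moreover have "((\<lambda>d. norm (h (p + d) - h p - h' d) / norm d) \<longlongrightarrow> 0) (at 0)"
  using assms by (simp add: has_derivative_at)
 ultimately have "(\<lambda>m. norm (h (p + eps m *\<^sub>R v) - h p - h' (eps m *\<^sub>R v)) / norm (eps m *\<^sub>R v)) \<longlonglongrightarrow> 0"
  by (rule filterlim_compose[rotated])
 then have "(\<lambda>m. norm (h (p + eps m *\<^sub>R v) - h p - h' (eps m *\<^sub>R v)) / norm (eps m *\<^sub>R v) * norm v) \<longlonglongrightarrow> 0 * norm v"
  by (rule tendsto_mult_right)
 moreover have "norm (h (p + eps m *\<^sub>R v) - h p - h' (eps m *\<^sub>R v)) / norm (eps m *\<^sub>R v) * norm v
   = norm ((h (p + eps m *\<^sub>R v) - h p) /\<^sub>R eps m - h' v)" for m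
 proof -
  have "(h (p + eps m *\<^sub>R v) - h p) /\<^sub>R eps m - h' v = (h (p + eps m *\<^sub>R v) - h p - h' (eps m *\<^sub>R v)) /\<^sub>R eps m"
   using eps_pos[of m] by (simp add: linear_cmul[OF lin] scaleR_diff_right)
  then show ?thesis using eps_pos[of m] False by (simp add: divide_inverse)
 qed
 ultimately have "(\<lambda>m. norm ((h (p + eps m *\<^sub>R v) - h p) /\<^sub>R eps m - h' v)) \<longlonglongrightarrow> 0" by simp
 then have "(\<lambda>m. (h (p + eps m *\<^sub>R v) - h p) /\<^sub>R eps m - h' v) \<longlonglongrightarrow> 0" by (rule tendsto_norm_zero_cancel)
 then show ?thesis by (rule LIM_zero_cancel)
qed

lemma AE_lborel_not_in_negligible:
 assumes "negligible S" "S \<in> sets borel"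
 shows "AE x in lborel. x \<notin> S"
proof (rule AE_not_in)
 have "S \<in> null_sets lebesgue" using assms(1) by (simp add: negligible_iff_null_sets)
 then show "S \<in> null_sets lborel" using null_sets_completion_iff[of S lborel] assms(2) by simp
qed

text \<open>A tubular chart in space-time: \<open>\<Psi> q = (\<Phi> q, snd q)\<close> maps \<open>Q\<close> diffeomorphically, the moving
 surface is the image of the points with \<open>y $ k = 0\<close>, and \<open>P\<close> is the part of the parameter
 domain where the constants are uniform. \<open>N\<close> is a space-time conormal.\<close>

locale tube =
 fixes k :: "'n::finite" and \<Phi> :: "(real^'n) \<times> real => real^'n"
  and \<Phi>' :: "(real^'n) \<times> real => ((real^'n) \<times> real) \<Rightarrow>\<^sub>L (real^'n)"
  and Q P :: "((real^'n) \<times> real) set" and N :: "(real^'n) \<times> real => (real^'n) \<times> real"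
  and e \<rho> c s0 Jmax :: real
 fixes \<Psi> :: "(real^'n) \<times> real => (real^'n) \<times> real"
 defines "\<Psi> q \<equiv> (\<Phi> q, snd q)"
 fixes J :: "(real^'n) \<times> real => real"
 defines "J q \<equiv> jac (\<lambda>w. \<Phi>' q (w, 0))"
 assumes open_Q: "open Q" and open_P: "open P"
  and der: "q \<in> Q ==> (\<Phi> has_derivative \<Phi>' q) (at q)"
  and cont': "continuous_on Q \<Phi>'"
  and inj: "inj_on \<Psi> Q"
  and nonsing: "q \<in> Q ==> \<Phi>' q (w, 0) = 0 ==> w = 0"
  and proj_P: "q \<in> P ==> proj k q \<in> Q"
  and local_inverse: "q \<in> P ==> dist z (\<Psi> (proj k q)) < \<rho> ==>
   \<exists>q'\<in>Q. \<Psi> q' = z \<and> dist q' (proj k q) \<le> c * dist z (\<Psi> (proj k q))"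
  and Jmax: "q \<in> P ==> q' \<in> Q ==> dist q' (proj k q) \<le> c * \<rho> ==> J q' \<le> Jmax"
  and conormal: "q \<in> P ==> N q \<bullet> (\<Phi>' (proj k q) om, snd om) = e * (fst om $ k)"
  and pos: "e > 0" "\<rho> > 0" "c > 0" "s0 > 0"
begin

lemma J_nonneg: "J q \<ge> 0" by (simp add: J_def jac_nonneg)

lemma cont_\<Phi>: "continuous_on Q \<Phi>"
 using der has_derivative_continuous continuous_at_imp_continuous_on by blast

lemma cont_\<Psi>: "continuous_on Q \<Psi>"
 unfolding \<Psi>_def by (intro continuous_intros cont_\<Phi>)

definition slice_derivative :: "(real^'n) \<times> real => (real^'n) \<Rightarrow>\<^sub>L (real^'n)" where
 "slice_derivative q = \<Phi>' q o\<^sub>L Blinfun (\<lambda>w. (w, 0))"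

lemma slice_derivative_apply: "blinfun_apply (slice_derivative q) = (\<lambda>w. \<Phi>' q (w, 0))"
 unfolding slice_derivative_def
 by (simp add: fun_eq_iff bounded_linear_Blinfun_apply bounded_linear_Pair bounded_linear_ident bounded_linear_zero)

lemma cont_J: "continuous_on Q J"
proof -
 have "continuous_on Q slice_derivative"
  unfolding slice_derivative_def by (intro continuous_intros cont')
 from continuous_on_jac[OF this] show ?thesis unfolding J_def slice_derivative_apply .
qed

lemma der_\<Psi>: "q \<in> Q ==> (\<Psi> has_derivative (\<lambda>om. (\<Phi>' q om, snd om))) (at q)"
 unfolding \<Psi>_def by (intro has_derivative_Pair der has_derivative_snd has_derivative_ident)

lemma slice_der: "(y, t) \<in> Q ==> ((\<lambda>y. \<Phi> (y, t)) has_derivative (\<lambda>w. \<Phi>' (y, t) (w, 0))) (at y)"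
proof -
 assume q: "(y, t) \<in> Q"
 have "((\<lambda>y. (y, t)) has_derivative (\<lambda>w. (w, 0))) (at y)" by (auto intro!: derivative_eq_intros)
 from has_derivative_compose[OF this der[OF q]] show ?thesis .
qed

text \<open>An extension by \<open>0\<close> off \<open>Q\<close>, so that integrands built from it
  are Borel everywhere.\<close>

definition \<Psi>0 :: "(real^'n) \<times> real => (real^'n) \<times> real" where "\<Psi>0 q = (if q \<in> Q then \<Psi> q else 0)"

lemma \<Psi>0_measurable [measurable]: "\<Psi>0 \<in> borel_measurable borel"
 unfolding \<Psi>0_def by (rule borel_measurable_continuous_on_if[OF _ cont_\<Psi>]) (auto simp: open_Q)

lemma Q_J_measurable [measurable]: "(\<lambda>q. indicator Q q * J q) \<in> borel_measurable borel"
 using borel_measurable_continuous_on_indicator[OF _ cont_J] open_Q by simp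

lemma integral_image:
 assumes "f \<in> borel_measurable borel"
 shows "(LINT z|lborel. indicator (\<Psi> ` Q) z * f z) = (LINT q|lborel. indicator Q q * J q * f (\<Psi>0 q))"
proof -
 have "(LINT z|lborel. indicator (\<Psi> ` Q) z * f z) = (LINT q|lborel. indicator Q q * J q * f (\<Psi> q))"
  using integral_spacetime_image[OF open_Q cont_\<Phi> slice_der inj[unfolded \<Psi>_def] cont_J[unfolded J_def] assms]
  unfolding \<Psi>_def J_def by simp
 also have "\<dots> = (LINT q|lborel. indicator Q q * J q * f (\<Psi>0 q))"
  by (intro Bochner_Integration.integral_cong) (auto simp: indicator_def \<Psi>0_def)
 finally show ?thesis .
qed

text \<open>The linear map that sends \<open>om\<close> to
  \<open>(\<Phi>' (proj k q) om, snd om)\<close> has Jacobian \<open>J (proj k q)\<close>, and by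
  \<open>conormal\<close> it carries the sign of \<open>fst om $ k\<close> to the sign of the
  pairing with \<open>N q\<close>.\<close>

lemma linear_half_space:
 assumes q: "q \<in> P" and ka: "ka \<in> borel_measurable borel"
 shows "J (proj k q) * (LINT om|lborel. indicator {om. fst om $ k > 0} om * ka (\<Phi>' (proj k q) om, snd om)) = plus_part ka (N q)"
  and "J (proj k q) * (LINT om|lborel. indicator {om. fst om $ k < 0} om * ka (\<Phi>' (proj k q) om, snd om)) = minus_part ka (N q)"
proof -
 let ?p = "proj k q" let ?D = "\<lambda>om. (\<Phi>' ?p om, snd om)"
 note pQ = proj_P[OF q]
 have lin: "linear ?D"
  by (intro linearI) (auto simp: blinfun.add_right blinfun.scaleR_right)
 have injD: "inj ?D"
 proof (rule linear_injective_0[THEN iffD2, OF lin, rule_format])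
  fix om assume "?D om = 0"
  then have "snd om = 0" "\<Phi>' ?p (fst om, 0) = 0" by (auto simp: zero_prod_def) (metis prod.collapse)
  then show "om = 0" using nonsing[OF pQ] by (simp add: prod_eq_iff)
 qed
 have surjD: "range ?D = UNIV" using linear_injective_imp_surjective[OF lin injD] by simp
 \<comment> \<open>\<open>integral_spacetime_image\<close> for the derivative itself, a linear
   bijection of the whole of space-time.\<close>
 have "(LINT z|lborel. indicator (range ?D) z * h z) = (LINT om|lborel. indicator UNIV om * J ?p * h (?D om))"
  if "h \<in> borel_measurable borel" for h
  unfolding J_def
 proof (rule integral_spacetime_image[where \<Phi>="blinfun_apply (\<Phi>' ?p)" and \<Phi>'="\<lambda>_ w. \<Phi>' ?p (w, 0)", OF _ _ _ _ _ that])
  show "((\<lambda>y. blinfun_apply (\<Phi>' ?p) (y, t)) has_derivative (\<lambda>w. \<Phi>' ?p (w, 0))) (at y)" for y t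
  proof -
   have "((\<lambda>y. (y, t)) has_derivative (\<lambda>w. (w, 0))) (at y)" by (auto intro!: derivative_eq_intros)
   from bounded_linear.has_derivative[OF blinfun.bounded_linear_right this] show ?thesis .
  qed
 qed (use injD in \<open>auto intro!: continuous_intros\<close>)
 then have I: "(LINT z|lborel. h z) = J ?p * (LINT om|lborel. h (?D om))" if "h \<in> borel_measurable borel" for h
  using that unfolding surjD by simp
 note [measurable] = ka
 have sgn: "N q \<bullet> ?D om > 0 \<longleftrightarrow> fst om $ k > 0" "N q \<bullet> ?D om < 0 \<longleftrightarrow> fst om $ k < 0" for om
  unfolding conormal[OF q] using pos(1) by (auto simp: zero_less_mult_iff mult_less_0_iff)
 have "(\<lambda>z. indicator {z. N q \<bullet> z > 0} z * ka z) \<in> borel_measurable borel" by measurable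
 from I[OF this] show "J ?p * (LINT om|lborel. indicator {om. fst om $ k > 0} om * ka (?D om)) = plus_part ka (N q)"
  unfolding plus_part_def by (simp add: indicator_def sgn)
 have "(\<lambda>z. indicator {z. N q \<bullet> z < 0} z * ka z) \<in> borel_measurable borel" by measurable
 from I[OF this] show "J ?p * (LINT om|lborel. indicator {om. fst om $ k < 0} om * ka (?D om)) = minus_part ka (N q)"
  unfolding minus_part_def by (simp add: indicator_def sgn)
qed

text \<open>The derivative is injective and hence bounded below, so the composed kernel still has
  bounded support.\<close>

lemma conormal_map_integrable:
 assumes q: "q \<in> P" and ka: "continuous_on UNIV ka" "\<And>z. ka z \<noteq> 0 ==> norm z \<le> R"
 shows "integrable lborel (\<lambda>om. ka (\<Phi>' (proj k q) om, snd om) :: real)"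
proof (rule integrable_compact_support)
 let ?p = "proj k q" let ?D = "\<lambda>om. (\<Phi>' ?p om, snd om)"
 note pQ = proj_P[OF q]
 have lin: "linear ?D"
  by (intro linearI) (auto simp: blinfun.add_right blinfun.scaleR_right)
 have injD: "inj ?D"
 proof (rule linear_injective_0[THEN iffD2, OF lin, rule_format])
  fix om assume "?D om = 0"
  then have "snd om = 0" "\<Phi>' ?p (fst om, 0) = 0" by (auto simp: zero_prod_def) (metis prod.collapse)
  then show "om = 0" using nonsing[OF pQ] by (simp add: prod_eq_iff)
 qed
 obtain b where b: "b > 0" "\<And>om. b * norm om \<le> norm (?D om)"
  using linear_inj_bounded_below_pos[OF lin injD] by blast
 show "continuous_on UNIV (\<lambda>om. ka (?D om))"
  by (rule continuous_on_compose2[OF ka(1)]) (auto intro!: continuous_intros)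
 have "norm om \<le> R / b" if "ka (?D om) \<noteq> 0" for om
  using b(2)[of om] ka(2)[OF that] b(1) by (simp add: pos_le_divide_eq mult.commute)
 then show "bounded {om. ka (?D om) \<noteq> 0}" unfolding bounded_iff by blast
qed

text \<open>The point sampled at scale \<open>eps m\<close> lies on the normal through the base
  point at height \<open>eps m * fst om $ k\<close>, and \<open>s0\<close> limits the admissible
  heights. The bound \<open>G q\<close> depends on the base point alone, as a maximal function
  does.\<close>

definition dominated_at :: "((real^'n) \<times> real => real) => ((real^'n) \<times> real => real) =>
  (real^'n) \<times> real => (real^'n) \<times> real => bool" where
 "dominated_at f G q om \<longleftrightarrow> (\<forall>m. eps m * \<bar>fst om $ k\<bar> \<le> s0 -->
  \<bar>f (\<Psi> (proj k q + (eps m * fst om $ k) *\<^sub>R normal_axis k))\<bar> \<le> G q)"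

text \<open>The directions with \<open>fst om $ k = 0\<close> form a null set, so no limit is
  prescribed for them.\<close>

definition converges_at :: "((real^'n) \<times> real => real) => real => real =>
  (real^'n) \<times> real => (real^'n) \<times> real => bool" where
 "converges_at f l l' q om \<longleftrightarrow>
  (0 < fst om $ k --> (\<lambda>m. f (\<Psi> (proj k q + (eps m * fst om $ k) *\<^sub>R normal_axis k))) \<longlonglongrightarrow> l) \<and>
  (fst om $ k < 0 --> (\<lambda>m. f (\<Psi> (proj k q + (eps m * fst om $ k) *\<^sub>R normal_axis k))) \<longlonglongrightarrow> l')"

text \<open>The limits \<open>fp\<close> and \<open>fm\<close> carry no measurability assumption, so
  exceptional sets are nested: almost every time, almost every \<open>y\<close>, almost every
  \<open>om\<close>. The last one is needed because \<open>f\<close> will be built from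
  representatives that are correct only off a null set of space-time.\<close>

definition one_sided :: "((real^'n) \<times> real => real) => ((real^'n) \<times> real => real) =>
  (real^'n => real => real) => (real^'n => real => real) => bool" where
 "one_sided f G fp fm \<longleftrightarrow> f \<in> borel_measurable borel \<and> G \<in> borel_measurable borel \<and> (\<forall>q. 0 \<le> G q) \<and>
  integrable lborel (\<lambda>q. indicator P q * G q) \<and>
  (AE t in lborel. AE y in lborel. (y, t) \<in> P -->
   (AE om in lborel. dominated_at f G (y, t) om \<and> converges_at f (fp y t) (fm y t) (y, t) om))"

section \<open>Blow-up averaged over a box of base points\<close>

context
 fixes f G ka :: "(real^'n) \<times> real => real" and fp fm :: "real^'n => real => real" and a b t1 t2 R
  and cut :: "(real^'n) \<times> real => real"
  and E :: "nat => (real^'n) \<times> real => real" and g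
 assumes os: "one_sided f G fp fm"
  and kac: "continuous_on UNIV ka" and kas: "\<And>z. ka z \<noteq> 0 ==> norm z \<le> R" and R0: "R \<ge> 0"
  and box: "cbox a b \<times> {t1..t2} \<subseteq> P"
 defines "cut \<equiv> indicator (box a b \<times> {t1<..<t2})"
  and "E \<equiv> \<lambda>m q. LINT z|lborel. f z * ka ((z - \<Psi> (proj k q)) /\<^sub>R eps m)"
  and "g \<equiv> \<lambda>y t. fp y t * plus_part ka (N (y, t)) + fm y t * minus_part ka (N (y, t))"
begin

private lemma os':
 shows f_meas: "f \<in> borel_measurable borel" and G_meas: "G \<in> borel_measurable borel" and G_nonneg: "0 \<le> G q"
  and G_int: "integrable lborel (\<lambda>q. indicator P q * G q)"
 using os unfolding one_sided_def by blast+

private lemma box_P: "q \<in> box a b \<times> {t1<..<t2} ==> q \<in> P"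
 using box box_subset_cbox[of a b] by (auto 0 3)

private lemma ka_meas: "ka \<in> borel_measurable borel"
 using kac by (rule borel_measurable_continuous_onI)

private lemma cut_meas: "cut \<in> borel_measurable borel"
 unfolding cut_def by (intro borel_measurable_indicator) (simp add: borel_open open_Times open_box)

private lemma P_meas: "P \<in> sets borel" using open_P by simp

lemmas [measurable] = f_meas G_meas ka_meas cut_meas P_meas

text \<open>The function \<open>f\<close> pulled back to parameters, with the Jacobian of the
  chart.\<close>

private definition "F p = indicator Q p * J p * f (\<Psi>0 p)"

text \<open>The integrand of the scaled test integral at the base point \<open>q\<close> after
  \<open>z\<close> has been replaced by \<open>\<Psi> (proj k q + eps m *\<^sub>R om)\<close>; the
  cut-off in the base point is included.\<close>

private definition "Hpre m q om = cut q * F (proj k q + eps m *\<^sub>R om) *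
 ka ((\<Psi>0 (proj k q + eps m *\<^sub>R om) - \<Psi>0 (proj k q)) /\<^sub>R eps m)"

text \<open>The central device. For fixed \<open>om\<close> the base point is shifted by
  \<open>- eps m *\<^sub>R proj k om\<close>, so the sampled point becomes \<open>proj k q\<close>
  plus a multiple of \<open>normal_axis k\<close>: it sits on the normal through \<open>q\<close>
  itself. Integration over \<open>q\<close> does not see the shift.\<close>

private definition "H m q om = Hpre m (q - eps m *\<^sub>R proj k om) om"

private lemma F_meas [measurable]: "F \<in> borel_measurable borel"
 unfolding F_def by measurable

lemmas [measurable] = borel_measurable_fst_snd

private lemma Hpre_meas: "(\<lambda>(q, om). Hpre m q om) \<in> borel_measurable borel"
 unfolding Hpre_def case_prod_beta by measurable

private lemma H_meas: "(\<lambda>(q, om). H m q om) \<in> borel_measurable borel"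
 unfolding H_def Hpre_def case_prod_beta by measurable

private lemma shift: "proj k (q - eps m *\<^sub>R proj k om) = proj k q - eps m *\<^sub>R proj k om"
 "proj k (q - eps m *\<^sub>R proj k om) + eps m *\<^sub>R om = proj k q + (eps m * fst om $ k) *\<^sub>R normal_axis k"
proof -
 show 1: "proj k (q - eps m *\<^sub>R proj k om) = proj k q - eps m *\<^sub>R proj k om"
  using linear_proj[of k] by (simp add: linear_diff linear_cmul)
 have "eps m *\<^sub>R om = eps m *\<^sub>R proj k om + (eps m * fst om $ k) *\<^sub>R normal_axis k"
  using arg_cong[OF proj_decomp[of k om], of "\<lambda>z. eps m *\<^sub>R z"] by (simp add: scaleR_add_right)
 then show "proj k (q - eps m *\<^sub>R proj k om) + eps m *\<^sub>R om = proj k q + (eps m * fst om $ k) *\<^sub>R normal_axis k"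
  unfolding 1 by simp
qed

text \<open>Where the kernel does not vanish, \<open>z\<close> is within \<open>\<rho>\<close> of
  \<open>\<Psi> (proj k q)\<close> and hence in the image of \<open>Q\<close>, so the integral can
  be pulled back to parameters and rescaled. The power of \<open>eps m\<close> is the Jacobian of
  the rescaling.\<close>

private lemma E_eq:
 assumes m: "eps m * R < \<rho>"
 shows "cut q * E m q = eps m ^ DIM((real^'n) \<times> real) * (LINT om|lborel. Hpre m q om)"
proof (cases "cut q = 0")
 case False
 then have qP: "q \<in> P" by (intro box_P) (auto simp: cut_def indicator_def split: if_splits)
 let ?p = "proj k q"
 note pQ = proj_P[OF qP]
 have \<Psi>p: "\<Psi>0 ?p = \<Psi> ?p" using pQ by (simp add: \<Psi>0_def)
 let ?h = "\<lambda>z. f z * ka ((z - \<Psi> ?p) /\<^sub>R eps m)"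
 have hm: "?h \<in> borel_measurable borel" by measurable
 have "E m q = (LINT z|lborel. indicator (\<Psi> ` Q) z * ?h z)"
  unfolding E_def
 proof (intro Bochner_Integration.integral_cong refl)
  fix z
  show "?h z = indicator (\<Psi> ` Q) z * ?h z"
  proof (cases "ka ((z - \<Psi> ?p) /\<^sub>R eps m) = 0")
   case False
   from kas[OF this] have "norm (z - \<Psi> ?p) \<le> eps m * R" using eps_pos[of m] by (rule norm_le_if_scaled)
   then have "z \<in> \<Psi> ` Q" using local_inverse[OF qP, of z] m by (auto simp: dist_norm)
   then show ?thesis by simp
  qed simp
 qed
 also have "\<dots> = (LINT p|lborel. indicator Q p * J p * ?h (\<Psi>0 p))" by (rule integral_image[OF hm])
 also have "\<dots> = (LINT p|lborel. F p * ka ((\<Psi>0 p - \<Psi>0 ?p) /\<^sub>R eps m))"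
  by (simp add: F_def \<Psi>p mult.assoc)
 also have "\<dots> = eps m ^ DIM((real^'n) \<times> real) *\<^sub>R (LINT om|lborel. F (?p + eps m *\<^sub>R om) * ka ((\<Psi>0 (?p + eps m *\<^sub>R om) - \<Psi>0 ?p) /\<^sub>R eps m))"
  by (rule integral_lborel_affine[OF _ eps_pos]) measurable
 finally show ?thesis unfolding Hpre_def by (simp add: mult.assoc)
qed (simp add: Hpre_def)

private definition "C = c * R"

text \<open>A nonzero kernel value bounds the distance of the two image points by
  \<open>eps m * R\<close>; \<open>local_inverse\<close> turns this into a bound
  \<open>c * (eps m * R)\<close> in parameters, and this is the origin of \<open>C\<close>.\<close>

private lemma H_support:
 assumes m: "eps m * R < \<rho>" and nz: "H m q om \<noteq> 0"
 shows "norm om \<le> C" "q - eps m *\<^sub>R proj k om \<in> box a b \<times> {t1<..<t2}"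
  "proj k q + (eps m * fst om $ k) *\<^sub>R normal_axis k \<in> Q" "J (proj k q + (eps m * fst om $ k) *\<^sub>R normal_axis k) \<le> Jmax"
proof -
 let ?q = "q - eps m *\<^sub>R proj k om"
 let ?p = "proj k ?q + eps m *\<^sub>R om"
 have nz': "cut ?q \<noteq> 0" "F ?p \<noteq> 0" "ka ((\<Psi>0 ?p - \<Psi>0 (proj k ?q)) /\<^sub>R eps m) \<noteq> 0"
  using nz by (auto simp: H_def Hpre_def)
 show qb: "?q \<in> box a b \<times> {t1<..<t2}" using nz'(1) by (simp add: cut_def indicator_def split: if_splits)
 then have qP: "?q \<in> P" by (rule box_P)
 have p: "?p \<in> Q" using nz'(2) by (simp add: F_def indicator_def split: if_splits)
 have le: "dist (\<Psi> ?p) (\<Psi> (proj k ?q)) \<le> eps m * R"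
  using norm_le_if_scaled[OF kas[OF nz'(3)] eps_pos] p proj_P[OF qP] by (simp add: \<Psi>0_def dist_norm)
 then obtain q' where q': "q' \<in> Q" "\<Psi> q' = \<Psi> ?p" "dist q' (proj k ?q) \<le> c * dist (\<Psi> ?p) (\<Psi> (proj k ?q))"
  using local_inverse[OF qP, of "\<Psi> ?p"] m by auto
 \<comment> \<open>By injectivity the preimage supplied by \<open>local_inverse\<close> is the
   sampled parameter itself.\<close>
 have "q' = ?p" using inj_onD[OF inj q'(2) q'(1) p] .
 then have d: "dist ?p (proj k ?q) \<le> c * (eps m * R)"
  using q'(3) le pos by (meson order_trans mult_left_mono less_imp_le)
 then have "eps m * norm om \<le> eps m * C" using eps_pos[of m] by (simp add: dist_norm C_def mult.left_commute)
 then show "norm om \<le> C" using eps_pos[of m] by simp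
 have "c * (eps m * R) \<le> c * \<rho>" using m pos by (intro mult_left_mono) auto
 with d have "J ?p \<le> Jmax" by (intro Jmax[OF qP p]) auto
 then show "J (proj k q + (eps m * fst om $ k) *\<^sub>R normal_axis k) \<le> Jmax" unfolding shift(2) .
 show "proj k q + (eps m * fst om $ k) *\<^sub>R normal_axis k \<in> Q" using p unfolding shift(2) .
qed

text \<open>The cut-off controls the shifted base point, while the majorant concerns
  \<open>q\<close> itself. The closed box has positive distance from the complement of
  \<open>P\<close>, so for small \<open>eps m\<close> the shift cannot lead out of
  \<open>P\<close>.\<close>

private lemma eventually_good:
 "\<forall>\<^sub>F m in sequentially. eps m * R < \<rho> \<and> eps m * C \<le> s0 \<and> (\<forall>q om. H m q om \<noteq> 0 --> q \<in> P)"
proof -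
 have C0: "C \<ge> 0" using pos R0 by (simp add: C_def)
 have "compact (cbox a b \<times> {t1..t2})" by (intro compact_Times) auto
 moreover have "closed (- P)" using open_P by (simp add: closed_Compl)
 moreover have "cbox a b \<times> {t1..t2} \<inter> - P = {}" using box by blast
 ultimately have "\<exists>d>0. \<forall>x\<in>cbox a b \<times> {t1..t2}. \<forall>y\<in>- P. d \<le> dist x y"
  by (rule separate_compact_closed)
 then obtain d where d: "d > 0" "\<And>x y. x \<in> cbox a b \<times> {t1..t2} ==> y \<in> - P ==> d \<le> dist x y"
  by blast
 have "\<forall>\<^sub>F m in sequentially. eps m < \<rho> / (R + 1)" "\<forall>\<^sub>F m in sequentially. eps m < s0 / (C + 1)"
  "\<forall>\<^sub>F m in sequentially. eps m < d / (C + 1)"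
  using pos d C0 R0 by (auto intro!: eventually_eps_less divide_pos_pos)
 then show ?thesis
 proof eventually_elim
  case (elim m)
  have e: "eps m * (R + 1) < \<rho>" "eps m * (C + 1) < s0" "eps m * (C + 1) < d"
   using elim C0 R0 by (simp_all add: pos_less_divide_eq)
  have e': "eps m * R < \<rho>" "eps m * C \<le> s0" "eps m * C < d"
   using e eps_pos[of m] by (auto simp: distrib_left)
  have "q \<in> P" if nz: "H m q om \<noteq> 0" for q om
  proof (rule ccontr)
   assume "q \<notin> P"
   note s = H_support[OF e'(1) nz]
   have "q - eps m *\<^sub>R proj k om \<in> cbox a b \<times> {t1..t2}" using s(2) box_subset_cbox by (auto simp: mem_Times_iff)
   then have "d \<le> dist (q - eps m *\<^sub>R proj k om) q" using \<open>q \<notin> P\<close> by (intro d(2)) auto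
   also have "\<dots> = eps m * norm (proj k om)" using eps_pos[of m] by (simp add: dist_norm)
   also have "\<dots> \<le> eps m * C" using s(1) norm_proj_le[of k om] eps_pos[of m] by (intro mult_left_mono) auto
   finally show False using e'(3) by simp
  qed
  with e' show ?case by blast
 qed
qed

private lemma ka_bounded: obtains K where "K > 0" "\<And>z. \<bar>ka z\<bar> \<le> K"
proof -
 have "compact (ka ` cball 0 R)" by (intro compact_continuous_image continuous_on_subset[OF kac]) auto
 then have "bounded (ka ` cball 0 R)" by (rule compact_imp_bounded)
 then obtain K where K: "K > 0" "\<And>z. z \<in> cball 0 R ==> \<bar>ka z\<bar> \<le> K" unfolding bounded_pos by auto
 have "\<bar>ka z\<bar> \<le> K" for z using K kas[of z] by (cases "ka z = 0") auto
 then show ?thesis using that K(1) by blast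
qed

text \<open>The Jacobian bound times some bound of the kernel; the latter exists by
  \<open>ka_bounded\<close>.\<close>

private definition "B = Jmax * (SOME K. K > 0 \<and> (\<forall>z. \<bar>ka z\<bar> \<le> K))"

private lemma H_bound:
 assumes m: "eps m * R < \<rho>" "eps m * C \<le> s0" and P: "\<And>om. H m q om \<noteq> 0 ==> q \<in> P"
  and G: "\<And>om. eps m * \<bar>fst om $ k\<bar> \<le> s0 ==> good om ==> q \<in> P ==> \<bar>f (\<Psi> (proj k q + (eps m * fst om $ k) *\<^sub>R normal_axis k))\<bar> \<le> G q"
  and "good om"
 shows "\<bar>H m q om\<bar> \<le> B * (indicator P q * G q) * indicator (cball 0 C) om"
proof (cases "H m q om = 0")
 case True
 have "\<exists>K. K > 0 \<and> (\<forall>z. \<bar>ka z\<bar> \<le> K)" using ka_bounded by metis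
 from someI_ex[OF this] have K: "0 < (SOME K. K > 0 \<and> (\<forall>z. \<bar>ka z\<bar> \<le> K))" by blast
 have "0 \<le> B * (indicator P q * G q) * indicator (cball 0 C) om"
 proof (cases "q \<in> P")
  case qP: True
  have "J (proj k q) \<le> Jmax" by (rule Jmax[OF qP proj_P[OF qP]]) (use pos in auto)
  then have "0 \<le> Jmax" using J_nonneg order_trans by blast
  then show ?thesis using K G_nonneg unfolding B_def by (intro mult_nonneg_nonneg) auto
 qed simp
 then show ?thesis using True by simp
next
 case False
 let ?K = "SOME K. K > 0 \<and> (\<forall>z. \<bar>ka z\<bar> \<le> K)"
 have "\<exists>K. K > 0 \<and> (\<forall>z. \<bar>ka z\<bar> \<le> K)" using ka_bounded by metis
 from someI_ex[OF this] have K: "0 < ?K" "\<And>z. \<bar>ka z\<bar> \<le> ?K" by blast+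
 note s = H_support[OF m(1) False]
 let ?p = "proj k q + (eps m * fst om $ k) *\<^sub>R normal_axis k"
 have qP: "q \<in> P" by (rule P[OF False])
 have "\<bar>fst om $ k\<bar> \<le> norm om" using component_le_norm_cart[of "fst om" k] norm_fst_le[of "fst om" "snd om"] by simp
 then have "eps m * \<bar>fst om $ k\<bar> \<le> eps m * C" using s(1) eps_pos[of m] by (intro mult_left_mono) auto
 then have fG: "\<bar>f (\<Psi> ?p)\<bar> \<le> G q" using m(2) \<open>good om\<close> qP by (intro G) auto
 have "\<bar>H m q om\<bar> \<le> 1 * (Jmax * G q) * ?K"
  unfolding H_def Hpre_def abs_mult shift(2)
 proof (intro mult_mono)
  show "\<bar>F ?p\<bar> \<le> Jmax * G q"
   unfolding F_def abs_mult using s(3,4) fG J_nonneg[of ?p] by (auto simp: \<Psi>0_def intro!: mult_mono)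
  have "0 \<le> Jmax" using s(4) J_nonneg[of ?p] by simp
  then show "0 \<le> 1 * (Jmax * G q)" using G_nonneg[of q] by auto
 qed (use K in \<open>auto simp: cut_def indicator_def\<close>)
 then show ?thesis using s(1) qP unfolding B_def by (simp add: mult_ac)
qed

private definition "good m \<longleftrightarrow> eps m * R < \<rho> \<and> eps m * C \<le> s0 \<and> (\<forall>q om. H m q om \<noteq> 0 --> q \<in> P)"

private definition "V = measure lborel (cball (0 :: (real^'n) \<times> real) C)"

private definition "W q = B * (indicator P q * G q) * V"

private definition "K m q = (LINT om|lborel. H m q om)"

private lemma B_nonneg_at: "0 \<le> B * (indicator P q * G q)"
proof (cases "q \<in> P")
 case True
 have "\<exists>K. K > 0 \<and> (\<forall>z. \<bar>ka z\<bar> \<le> K)" using ka_bounded by metis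
 from someI_ex[OF this] have K: "0 < (SOME K. K > 0 \<and> (\<forall>z. \<bar>ka z\<bar> \<le> K))" by blast
 have "J (proj k q) \<le> Jmax" by (rule Jmax[OF True proj_P[OF True]]) (use pos in auto)
 then have "0 \<le> Jmax" using J_nonneg order_trans by blast
 then show ?thesis using K G_nonneg unfolding B_def by (intro mult_nonneg_nonneg) auto
qed simp

private lemma H_bound_at:
 assumes "good m"
  and ae: "(y, t) \<in> P --> (AE om in lborel. dominated_at f G (y, t) om)"
 shows "AE om in lborel. \<bar>H m (y, t) om\<bar> \<le> B * (indicator P (y, t) * G (y, t)) * indicator (cball 0 C) om"
proof (cases "(y, t) \<in> P")
 case True
 have m: "eps m * R < \<rho>" "eps m * C \<le> s0" "\<And>om. H m (y, t) om \<noteq> 0 ==> (y, t) \<in> P"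
  using assms(1) by (auto simp: good_def)
 from ae True have "AE om in lborel. dominated_at f G (y, t) om" by blast
 then show ?thesis
 proof (rule eventually_mono)
  fix om assume *: "dominated_at f G (y, t) om"
  show "\<bar>H m (y, t) om\<bar> \<le> B * (indicator P (y, t) * G (y, t)) * indicator (cball 0 C) om"
   by (rule H_bound[OF m, where good="\<lambda>om. dominated_at f G (y, t) om"]) (use * in \<open>auto simp: dominated_at_def\<close>)
 qed
next
 case False
 then have "H m (y, t) om = 0" for om using assms(1) unfolding good_def by blast
 then show ?thesis using False by simp
qed

private lemma os_bound: "AE t in lborel. AE y in lborel. (y, t) \<in> P --> (AE om in lborel. dominated_at f G (y, t) om)"
proof -
 have "AE t in lborel. AE y in lborel. (y, t) \<in> P --> (AE om in lborel.
   dominated_at f G (y, t) om \<and>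
   converges_at f (fp y t) (fm y t) (y, t) om)"
  using os unfolding one_sided_def by (elim conjE)
 then show ?thesis
  by (rule eventually_mono, elim eventually_mono) (auto elim: eventually_mono)
qed

private lemma integrable_W: "integrable lborel W"
 unfolding W_def[abs_def] by (intro integrable_mult_left integrable_mult_right G_int)

text \<open>The majorant is known for almost every \<open>t\<close>, then \<open>y\<close>, then
  \<open>om\<close>, so the integral is estimated in this order; the integral over \<open>om\<close>
  contributes the volume of the ball of radius \<open>C\<close>.\<close>

private lemma nn_H_finite:
 assumes "good m"
 shows "(\<integral>\<^sup>+q. \<integral>\<^sup>+om. ennreal \<bar>H m q om\<bar> \<partial>lborel \<partial>lborel) < \<infinity>"
proof -
 have [measurable]: "(\<lambda>(q, om). H m q om) \<in> borel_measurable (lborel \<Otimes>\<^sub>M lborel)"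
  using H_meas by (simp add: lborel_prod)
 have "(\<integral>\<^sup>+q. \<integral>\<^sup>+om. ennreal \<bar>H m q om\<bar> \<partial>lborel \<partial>lborel) = (\<integral>\<^sup>+t. \<integral>\<^sup>+y. \<integral>\<^sup>+om. ennreal \<bar>H m (y, t) om\<bar> \<partial>lborel \<partial>lborel \<partial>lborel)"
  by (rule lborel_nn_integral_snd) measurable
 also have "\<dots> \<le> (\<integral>\<^sup>+t. \<integral>\<^sup>+y. ennreal (W (y, t)) \<partial>lborel \<partial>lborel)"
 proof (rule nn_integral_mono_AE, rule eventually_mono[OF os_bound], rule nn_integral_mono_AE, elim eventually_mono)
  fix t y
  assume "(y, t) \<in> P --> (AE om in lborel. dominated_at f G (y, t) om)"
  from H_bound_at[OF assms this]
  have "AE om in lborel. ennreal \<bar>H m (y, t) om\<bar> \<le> ennreal (B * (indicator P (y, t) * G (y, t))) * indicator (cball 0 C) om"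
   by (rule eventually_mono) (auto simp: indicator_def intro: ennreal_leI split: if_splits)
  then have "(\<integral>\<^sup>+om. ennreal \<bar>H m (y, t) om\<bar> \<partial>lborel) \<le>
   (\<integral>\<^sup>+om. ennreal (B * (indicator P (y, t) * G (y, t))) * indicator (cball (0 :: (real^'n) \<times> real) C) om \<partial>lborel)"
   by (rule nn_integral_mono_AE)
  also have "\<dots> = ennreal (B * (indicator P (y, t) * G (y, t))) * emeasure lborel (cball (0 :: (real^'n) \<times> real) C)"
   by (rule nn_integral_cmult_indicator) simp
  also have "emeasure lborel (cball (0 :: (real^'n) \<times> real) C) = ennreal V"
   unfolding V_def using emeasure_lborel_cball_finite by (intro emeasure_eq_ennreal_measure) (auto simp: less_top)
  also have "ennreal (B * (indicator P (y, t) * G (y, t))) * ennreal V = ennreal (W (y, t))"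
   unfolding W_def by (subst ennreal_mult[OF B_nonneg_at]) (auto simp: V_def)
  finally show "(\<integral>\<^sup>+om. ennreal \<bar>H m (y, t) om\<bar> \<partial>lborel) \<le> ennreal (W (y, t))" .
 qed
 also have "\<dots> = (\<integral>\<^sup>+q. ennreal (W q) \<partial>lborel)"
  using borel_measurable_integrable[OF integrable_W] by (intro lborel_nn_integral_snd[symmetric]) simp
 also have "\<dots> < \<infinity>"
 proof -
  have "(\<integral>\<^sup>+q. ennreal (W q) \<partial>lborel) \<le> (\<integral>\<^sup>+q. ennreal (norm (W q)) \<partial>lborel)"
   by (intro nn_integral_mono ennreal_leI) simp
  then show ?thesis using integrable_W unfolding integrable_iff_bounded by (meson le_less_trans)
 qed
 finally show ?thesis .
qed

private lemma H_integrable: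
 assumes "good m" shows "integrable lborel (\<lambda>(q, om). H m q om)"
proof (rule integrableI_bounded)
 have "(\<integral>\<^sup>+z. ennreal (norm (case z of (q, om) => H m q om)) \<partial>lborel) = (\<integral>\<^sup>+q. \<integral>\<^sup>+om. ennreal \<bar>H m q om\<bar> \<partial>lborel \<partial>lborel)"
  using H_meas[of m] by (subst lborel_nn_integral_fst) auto
 then show "(\<integral>\<^sup>+z. ennreal (norm (case z of (q, om) => H m q om)) \<partial>lborel) < \<infinity>"
  using nn_H_finite[OF assms] by simp
qed (use H_meas in simp)

private lemma Hpre_shift:
 fixes om :: "(real^'n) \<times> real"
 shows "H m q om = Hpre m (- (eps m *\<^sub>R proj k om) + q) om"
 unfolding H_def by simp

private lemma Hpre_slice_meas: "(\<lambda>q. Hpre m q om) \<in> borel_measurable borel"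
 unfolding Hpre_def by measurable

text \<open>For each fixed \<open>om\<close> the functions \<open>Hpre\<close> and \<open>H\<close>
  are translates of each other in \<open>q\<close>, so integrability passes from the dominated one
  to the other.\<close>

private lemma Hpre_integrable:
 assumes "good m" shows "integrable lborel (\<lambda>(q, om). Hpre m q om)"
proof (rule integrableI_bounded)
 have "(\<integral>\<^sup>+z. ennreal (norm (case z of (q, om) => Hpre m q om)) \<partial>lborel) = (\<integral>\<^sup>+om. \<integral>\<^sup>+q. ennreal \<bar>Hpre m q om\<bar> \<partial>lborel \<partial>lborel)"
  using Hpre_meas[of m] by (subst lborel_nn_integral_snd) auto
 also have "\<dots> = (\<integral>\<^sup>+om. \<integral>\<^sup>+q. ennreal \<bar>H m q om\<bar> \<partial>lborel \<partial>lborel)"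
 proof (rule nn_integral_cong)
  fix om :: "(real^'n) \<times> real"
  show "(\<integral>\<^sup>+q. ennreal \<bar>Hpre m q om\<bar> \<partial>lborel) = (\<integral>\<^sup>+q. ennreal \<bar>H m q om\<bar> \<partial>lborel)"
   unfolding Hpre_shift using Hpre_slice_meas[of m om]
   by (intro nn_integral_lborel_translation[symmetric, where f="\<lambda>q. ennreal \<bar>Hpre m q om\<bar>"]) simp
 qed
 also have "\<dots> = (\<integral>\<^sup>+z. ennreal (norm (case z of (q, om) => H m q om)) \<partial>lborel)"
  using H_meas[of m] by (subst lborel_nn_integral_snd) auto
 also have "\<dots> < \<infinity>" using H_integrable[OF assms] by (simp add: integrable_iff_bounded)
 finally show "(\<integral>\<^sup>+z. ennreal (norm (case z of (q, om) => Hpre m q om)) \<partial>lborel) < \<infinity>" .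
qed (use Hpre_meas in simp)

private lemma K_integrable: assumes "good m" shows "integrable lborel (K m)"
 using lborel_integrable_fst(2)[OF H_integrable[OF assms]] by (simp add: K_def[abs_def])

text \<open>The integrals are exchanged, the base point is translated for fixed \<open>om\<close>,
  and the integrals are exchanged back; in this way \<open>Hpre\<close> is replaced by the dominated
  integrand \<open>H\<close>.\<close>

lemma cut_E_integrable_good:
 assumes "good m"
 shows "integrable lborel (\<lambda>q. cut q * E m q)"
  and "(LINT q|lborel. cut q * E m q) = eps m ^ DIM((real^'n) \<times> real) * (LINT t|lborel. LINT y|lborel. K m (y, t))"
proof -
 have m: "eps m * R < \<rho>" using assms by (simp add: good_def)
 show "integrable lborel (\<lambda>q. cut q * E m q)"
  unfolding E_eq[OF m]
  using lborel_integrable_fst(2)[OF Hpre_integrable[OF assms]] by (intro integrable_mult_right) simp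
 have "(LINT q|lborel. LINT om|lborel. Hpre m q om) = (LINT z|lborel. (\<lambda>(q, om). Hpre m q om) z)"
  using lborel_integral_fst[OF Hpre_integrable[OF assms]] by simp
 also have "\<dots> = (LINT om|lborel. LINT q|lborel. Hpre m q om)"
  using lborel_integral_snd[OF Hpre_integrable[OF assms]] by simp
 also have "\<dots> = (LINT om|lborel. LINT q|lborel. H m q om)"
  unfolding Hpre_shift
  by (intro Bochner_Integration.integral_cong refl integral_lborel_translation[symmetric] Hpre_slice_meas)
 also have "\<dots> = (LINT z|lborel. (\<lambda>(q, om). H m q om) z)"
  using lborel_integral_snd[OF H_integrable[OF assms]] by simp
 also have "\<dots> = (LINT q|lborel. K m q)"
  using lborel_integral_fst[OF H_integrable[OF assms]] by (simp add: K_def)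
 also have "\<dots> = (LINT t|lborel. LINT y|lborel. K m (y, t))"
  by (rule lborel_integral_snd[OF K_integrable[OF assms]])
 finally show "(LINT q|lborel. cut q * E m q) = eps m ^ DIM((real^'n) \<times> real) * (LINT t|lborel. LINT y|lborel. K m (y, t))"
  unfolding E_eq[OF m] by simp
qed

text \<open>The indicator is locally constant off the boundary of the box; the excluded
  \<open>y\<close> and \<open>t\<close> form null sets.\<close>

private lemma cut_tendsto:
 assumes "y \<notin> cbox a b - box a b" "t \<noteq> t1" "t \<noteq> t2"
 shows "(\<lambda>m. cut ((y, t) - eps m *\<^sub>R v)) \<longlonglongrightarrow> cut (y, t)"
proof -
 have lim: "(\<lambda>m. (y, t) - eps m *\<^sub>R v) \<longlonglongrightarrow> (y, t)"
  using tendsto_diff[OF tendsto_const tendsto_scaleR[OF eps_tendsto tendsto_const[of v]], of "(y, t)"] by simp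
 have "\<forall>\<^sub>F m in sequentially. cut ((y, t) - eps m *\<^sub>R v) = cut (y, t)"
 proof (cases "(y, t) \<in> box a b \<times> {t1<..<t2}")
  case True
  have "open (box a b \<times> {t1<..<t2})" by (intro open_Times open_box) auto
  from topological_tendstoD[OF lim this True] show ?thesis
   by eventually_elim (use True in \<open>auto simp: cut_def indicator_def\<close>)
 next
  case False
  have "closed (cbox a b \<times> {t1..t2})" by (intro closed_Times closed_cbox) auto
  then have "open (- (cbox a b \<times> {t1..t2}))" by (simp add: open_Compl)
  moreover have "(y, t) \<in> - (cbox a b \<times> {t1..t2})" using False assms by auto
  ultimately have "\<forall>\<^sub>F m in sequentially. (y, t) - eps m *\<^sub>R v \<in> - (cbox a b \<times> {t1..t2})"
   by (rule topological_tendstoD[OF lim])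
  then show ?thesis
  proof eventually_elim
   case (elim m)
   then have "(y, t) - eps m *\<^sub>R v \<notin> box a b \<times> {t1<..<t2}"
    using box_subset_cbox[of a b] by (auto simp: mem_Times_iff less_imp_le)
   then show ?case using False by (simp add: cut_def)
  qed
 qed
 then show ?thesis by (rule tendsto_eventually)
qed

text \<open>The argument of the kernel is the difference of two difference quotients of
  \<open>\<Psi>\<close> at \<open>proj k q\<close>, in the direction of the normal part of
  \<open>om\<close> and in the direction \<open>- proj k om\<close>. By linearity its limit is the
  derivative in the direction \<open>om\<close>.\<close>

private lemma H_tendsto:
 assumes q: "(y, t) \<in> P" and y: "y \<notin> cbox a b - box a b" "t \<noteq> t1" "t \<noteq> t2"
  and lim: "(\<lambda>m. f (\<Psi> (proj k (y, t) + (eps m * fst om $ k) *\<^sub>R normal_axis k))) \<longlonglongrightarrow> l"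
 shows "(\<lambda>m. H m (y, t) om) \<longlonglongrightarrow> cut (y, t) * (J (proj k (y, t)) * l) * ka (\<Phi>' (proj k (y, t)) om, snd om)"
proof -
 let ?p = "proj k (y, t)"
 let ?v1 = "(fst om $ k) *\<^sub>R normal_axis k" and ?v2 = "- proj k om"
 have pQ: "?p \<in> Q" by (rule proj_P[OF q])
 have lim_v: "(\<lambda>m. ?p + eps m *\<^sub>R v) \<longlonglongrightarrow> ?p" for v
  using tendsto_add[OF tendsto_const tendsto_scaleR[OF eps_tendsto tendsto_const[of v]], of ?p] by simp
 have ev: "\<forall>\<^sub>F m in sequentially. ?p + eps m *\<^sub>R v \<in> Q" for v
  by (rule topological_tendstoD[OF lim_v open_Q pQ])
 have "isCont J ?p" using cont_J open_Q pQ continuous_on_eq_continuous_at by blast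
 then have "(\<lambda>m. J (?p + eps m *\<^sub>R ?v1)) \<longlonglongrightarrow> J ?p" using lim_v by (rule isCont_tendsto_compose)
 then have "(\<lambda>m. J (?p + eps m *\<^sub>R ?v1) * f (\<Psi> (?p + (eps m * fst om $ k) *\<^sub>R normal_axis k))) \<longlonglongrightarrow> J ?p * l"
  using lim by (rule tendsto_mult)
 moreover have "\<forall>\<^sub>F m in sequentially. J (?p + eps m *\<^sub>R ?v1) * f (\<Psi> (?p + (eps m * fst om $ k) *\<^sub>R normal_axis k))
  = F (?p + eps m *\<^sub>R ?v1)"
  using ev[of ?v1] by eventually_elim (simp add: F_def \<Psi>0_def)
 ultimately have Flim: "(\<lambda>m. F (?p + eps m *\<^sub>R ?v1)) \<longlonglongrightarrow> J ?p * l" by (rule Lim_transform_eventually)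
 let ?D = "\<lambda>om. (\<Phi>' ?p om, snd om)"
 note d = has_derivative_eps_quotient[OF der_\<Psi>[OF pQ]]
 have "(\<lambda>m. (\<Psi> (?p + eps m *\<^sub>R ?v1) - \<Psi> ?p) /\<^sub>R eps m - (\<Psi> (?p + eps m *\<^sub>R ?v2) - \<Psi> ?p) /\<^sub>R eps m) \<longlonglongrightarrow> ?D ?v1 - ?D ?v2"
  by (intro tendsto_diff d)
 also have "?D ?v1 - ?D ?v2 = ?D (proj k om + ?v1)"
  by (simp add: blinfun.add_right blinfun.minus_right add.commute)
 also have "proj k om + ?v1 = om" by (rule proj_decomp)
 finally have "(\<lambda>m. (\<Psi> (?p + eps m *\<^sub>R ?v1) - \<Psi> ?p) /\<^sub>R eps m - (\<Psi> (?p + eps m *\<^sub>R ?v2) - \<Psi> ?p) /\<^sub>R eps m) \<longlonglongrightarrow> ?D om" .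
 moreover have "\<forall>\<^sub>F m in sequentially. (\<Psi> (?p + eps m *\<^sub>R ?v1) - \<Psi> ?p) /\<^sub>R eps m - (\<Psi> (?p + eps m *\<^sub>R ?v2) - \<Psi> ?p) /\<^sub>R eps m
  = (\<Psi>0 (?p + eps m *\<^sub>R ?v1) - \<Psi>0 (?p + eps m *\<^sub>R ?v2)) /\<^sub>R eps m"
  using ev[of ?v1] ev[of ?v2] by eventually_elim (simp add: \<Psi>0_def scaleR_diff_right)
 ultimately have "(\<lambda>m. (\<Psi>0 (?p + eps m *\<^sub>R ?v1) - \<Psi>0 (?p + eps m *\<^sub>R ?v2)) /\<^sub>R eps m) \<longlonglongrightarrow> ?D om"
  by (rule Lim_transform_eventually)
 moreover have "isCont ka (?D om)" using kac by (simp add: continuous_on_eq_continuous_at)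
 ultimately have kalim: "(\<lambda>m. ka ((\<Psi>0 (?p + eps m *\<^sub>R ?v1) - \<Psi>0 (?p + eps m *\<^sub>R ?v2)) /\<^sub>R eps m)) \<longlonglongrightarrow> ka (?D om)"
  by (rule isCont_tendsto_compose[rotated])
 have Heq: "H m (y, t) om = cut ((y, t) - eps m *\<^sub>R proj k om) * F (?p + eps m *\<^sub>R ?v1) *
  ka ((\<Psi>0 (?p + eps m *\<^sub>R ?v1) - \<Psi>0 (?p + eps m *\<^sub>R ?v2)) /\<^sub>R eps m)" for m
  unfolding H_def Hpre_def shift(2) unfolding shift(1) by simp
 show ?thesis
  unfolding Heq by (intro tendsto_mult cut_tendsto y Flim kalim)
qed

private lemma AE_normal_coordinate_nonzero: "AE om in (lborel :: ((real^'n) \<times> real) measure). fst om $ k \<noteq> 0"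
proof -
 let ?a = "(axis k 1, 0) :: (real^'n) \<times> real"
 have eq: "{om :: (real^'n) \<times> real. fst om $ k = 0} = {om. ?a \<bullet> om = 0}"
  by (auto simp: inner_prod_def inner_axis inner_axis')
 have "negligible {om. ?a \<bullet> om = 0}" by (rule negligible_hyperplane) (simp add: zero_prod_def axis_eq_0_iff)
 moreover have "{om. ?a \<bullet> om = 0} \<in> sets borel" using closed_hyperplane[of ?a 0] by simp
 ultimately have "AE om in lborel. om \<notin> {om. ?a \<bullet> om = 0}" by (rule AE_lborel_not_in_negligible)
 then show ?thesis unfolding eq[symmetric] by simp
qed

text \<open>Dominated convergence in \<open>om\<close> at a fixed base point;
  \<open>linear_half_space\<close> then moves the two half-space integrals from parameters to
  space-time.\<close>

private lemma K_tendsto_at: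
 assumes m0: "\<And>m. m \<ge> m0 ==> good m"
  and y: "y \<notin> cbox a b - box a b" "t \<noteq> t1" "t \<noteq> t2"
  and ae: "(y, t) \<in> P --> (AE om in lborel.
   dominated_at f G (y, t) om \<and>
   converges_at f (fp y t) (fm y t) (y, t) om)"
 shows "(\<lambda>i. K (i + m0) (y, t)) \<longlonglongrightarrow> cut (y, t) * g y t" and "\<bar>K (i + m0) (y, t)\<bar> \<le> W (y, t)"
proof -
 have [measurable]: "(\<lambda>om. H m (y, t) om) \<in> borel_measurable borel" for m
  unfolding H_def Hpre_def by measurable
 have wint: "integrable lborel (\<lambda>om. B * (indicator P (y, t) * G (y, t)) * indicator (cball (0 :: (real^'n) \<times> real) C) om)"
  by (intro integrable_mult_right integrable_real_indicator emeasure_lborel_cball_finite) simp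
 have bound: "AE om in lborel. \<bar>H (i + m0) (y, t) om\<bar> \<le> B * (indicator P (y, t) * G (y, t)) * indicator (cball 0 C) om" for i
  by (rule H_bound_at[OF m0]) (use ae in \<open>auto elim: eventually_mono\<close>)
 show "\<bar>K (i + m0) (y, t)\<bar> \<le> W (y, t)"
 proof -
  have "\<bar>K (i + m0) (y, t)\<bar> \<le> (LINT om|lborel. B * (indicator P (y, t) * G (y, t)) * indicator (cball (0 :: (real^'n) \<times> real) C) om)"
   unfolding K_def by (rule integral_abs_bound_AE[OF _ wint bound]) measurable
  also have "\<dots> = W (y, t)" unfolding W_def V_def by simp
  finally show ?thesis by simp
 qed
 show "(\<lambda>i. K (i + m0) (y, t)) \<longlonglongrightarrow> cut (y, t) * g y t"
 proof (cases "(y, t) \<in> P")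
  case False
  have "H (i + m0) (y, t) om = 0" for i om using m0[of "i + m0"] False unfolding good_def by (metis le_add2)
  moreover have "cut (y, t) = 0" using False box_P[of "(y, t)"] by (auto simp: cut_def indicator_def)
  ultimately show ?thesis by (simp add: K_def)
 next
  case True
  let ?l = "\<lambda>om. fp y t * indicator {om. fst om $ k > 0} om + fm y t * indicator {om. fst om $ k < 0} om"
  let ?ka = "\<lambda>om. ka (\<Phi>' (proj k (y, t)) om, snd om)"
  have cD: "continuous_on UNIV (\<lambda>om. (\<Phi>' (proj k (y, t)) om, snd om))" by (intro continuous_intros)
  have [measurable]: "?ka \<in> borel_measurable borel"
   by (rule borel_measurable_continuous_onI, rule continuous_on_compose2[OF kac cD]) auto
  have sets [measurable]: "{om :: (real^'n) \<times> real. fst om $ k > 0} \<in> sets borel" "{om :: (real^'n) \<times> real. fst om $ k < 0} \<in> sets borel"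
   by (auto intro!: borel_open open_Collect_less continuous_intros)
  have "(\<lambda>i. LINT om|lborel. H (i + m0) (y, t) om) \<longlonglongrightarrow> (LINT om|lborel. cut (y, t) * (J (proj k (y, t)) * ?l om) * ?ka om)"
  proof (rule integral_dominated_convergence[OF _ _ wint])
   from ae True have "AE om in lborel. dominated_at f G (y, t) om \<and> converges_at f (fp y t) (fm y t) (y, t) om" by blast
   then show "AE om in lborel. (\<lambda>i. H (i + m0) (y, t) om) \<longlonglongrightarrow> cut (y, t) * (J (proj k (y, t)) * ?l om) * ?ka om"
    using AE_normal_coordinate_nonzero
   proof (eventually_elim)
    case (elim om)
    then have "(\<lambda>m. f (\<Psi> (proj k (y, t) + (eps m * fst om $ k) *\<^sub>R normal_axis k))) \<longlonglongrightarrow> ?l om"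
     by (cases "fst om $ k > 0") (auto simp: indicator_def converges_at_def)
    from H_tendsto[OF True y this] show ?case by (rule LIMSEQ_ignore_initial_segment)
   qed
  qed (use bound in auto)
  also have "(LINT om|lborel. cut (y, t) * (J (proj k (y, t)) * ?l om) * ?ka om) = cut (y, t) * g y t"
  proof -
   note ki = conormal_map_integrable[OF True kac kas]
   have i: "integrable lborel (\<lambda>om. indicator {om. fst om $ k > 0} om * ?ka om)" "integrable lborel (\<lambda>om. indicator {om. fst om $ k < 0} om * ?ka om)"
    using integrable_mult_indicator[OF _ ki, of "{om. fst om $ k > 0}"] integrable_mult_indicator[OF _ ki, of "{om. fst om $ k < 0}"] sets by auto
   have "(LINT om|lborel. cut (y, t) * (J (proj k (y, t)) * ?l om) * ?ka om) =
    (LINT om|lborel. cut (y, t) * J (proj k (y, t)) * fp y t * (indicator {om. fst om $ k > 0} om * ?ka om) +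
     cut (y, t) * J (proj k (y, t)) * fm y t * (indicator {om. fst om $ k < 0} om * ?ka om))"
    by (intro Bochner_Integration.integral_cong refl) (simp add: algebra_simps)
   also have "\<dots> = cut (y, t) * J (proj k (y, t)) * fp y t * (LINT om|lborel. indicator {om. fst om $ k > 0} om * ?ka om) +
     cut (y, t) * J (proj k (y, t)) * fm y t * (LINT om|lborel. indicator {om. fst om $ k < 0} om * ?ka om)"
    by (subst Bochner_Integration.integral_add) (use i in \<open>auto intro: integrable_mult_right\<close>)
   also have "\<dots> = cut (y, t) * g y t"
    unfolding g_def linear_half_space[OF True ka_meas, symmetric] by (simp add: algebra_simps)
   finally show ?thesis .
  qed
  finally show ?thesis unfolding K_def .
 qed
qed

text \<open>Two further dominated convergences, in \<open>y\<close> for almost every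
  \<open>t\<close> and then in \<open>t\<close>, with majorants \<open>W\<close> and its integral
  over \<open>y\<close>. As \<open>g\<close> is not known to be jointly measurable, the limit is an
  iterated integral.\<close>

lemma blowup_limit:
 shows "\<forall>\<^sub>F m in sequentially. integrable lborel (\<lambda>q. cut q * E m q)"
  and "AE t in lborel. integrable lebesgue (\<lambda>y. cut (y, t) * g y t)"
  and "integrable lebesgue (\<lambda>t. LINT y|lebesgue. cut (y, t) * g y t)"
  and "(\<lambda>m. (LINT q|lborel. cut q * E m q) / eps m ^ DIM((real^'n) \<times> real)) \<longlonglongrightarrow>
   (LINT t|lebesgue. LINT y|lebesgue. cut (y, t) * g y t)"
proof -
 obtain m0 where m0: "\<And>m. m \<ge> m0 ==> good m"
  using eventually_good unfolding eventually_sequentially good_def by blast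
 show "\<forall>\<^sub>F m in sequentially. integrable lborel (\<lambda>q. cut q * E m q)"
  unfolding eventually_sequentially using cut_E_integrable_good(1)[OF m0] by blast
 have Km: "K m \<in> borel_measurable borel" if "m \<ge> m0" for m
  using borel_measurable_integrable[OF K_integrable[OF m0[OF that]]] by simp
 have Ks: "(\<lambda>y. K m (y, t)) \<in> borel_measurable borel" if "m \<ge> m0" for m t
  by (rule measurable_compose[OF _ Km[OF that]]) simp
 have osAE: "AE t in lborel. AE y in lborel. (y, t) \<in> P --> (AE om in lborel.
   dominated_at f G (y, t) om \<and>
   converges_at f (fp y t) (fm y t) (y, t) om)"
  using os unfolding one_sided_def by (elim conjE)
 have bdry: "AE y in lborel. y \<notin> cbox a b - box a b"
  by (rule AE_lborel_not_in_negligible[OF negligible_frontier_interval]) simp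
 have tt: "AE t in lborel. t \<noteq> t1 \<and> t \<noteq> t2"
  using AE_lborel_singleton[of t1] AE_lborel_singleton[of t2] by eventually_elim auto
 have key: "AE t in lborel. (AE y in lborel. (\<lambda>i. K (i + m0) (y, t)) \<longlonglongrightarrow> cut (y, t) * g y t) \<and>
  (\<forall>i. AE y in lborel. \<bar>K (i + m0) (y, t)\<bar> \<le> W (y, t)) \<and> integrable lborel (\<lambda>y. W (y, t))"
  using osAE tt lborel_integrable_snd(1)[OF integrable_W]
 proof eventually_elim
  case (elim t)
  have t: "t \<noteq> t1" "t \<noteq> t2" using elim(2) by auto
  have "AE y in lborel. (\<lambda>i. K (i + m0) (y, t)) \<longlonglongrightarrow> cut (y, t) * g y t \<and> (\<forall>i. \<bar>K (i + m0) (y, t)\<bar> \<le> W (y, t))"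
   using elim(1) bdry
   by eventually_elim (use K_tendsto_at[OF m0 _ t] in blast)
  then show ?case using elim(3) by (auto elim: eventually_mono)
 qed
 have dct: "AE t in lborel. integrable lebesgue (\<lambda>y. cut (y, t) * g y t) \<and>
  (\<lambda>i. LINT y|lborel. K (i + m0) (y, t)) \<longlonglongrightarrow> (LINT y|lebesgue. cut (y, t) * g y t) \<and>
  (\<forall>i. \<bar>LINT y|lborel. K (i + m0) (y, t)\<bar> \<le> (LINT y|lborel. W (y, t)))"
  using key
 proof eventually_elim
  case (elim t)
  have Ks': "(\<lambda>y. K (i + m0) (y, t)) \<in> borel_measurable borel" for i by (rule Ks) simp
  note l = lebesgue_dominated_convergence[of "\<lambda>i y. K (i + m0) (y, t)" "\<lambda>y. W (y, t)" "\<lambda>y. cut (y, t) * g y t", OF Ks']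
  have "\<bar>LINT y|lborel. K (i + m0) (y, t)\<bar> \<le> (LINT y|lborel. W (y, t))" for i
   by (rule integral_abs_bound_AE) (use elim Ks' in auto)
  then show ?case using l elim by auto
 qed
 then show "AE t in lborel. integrable lebesgue (\<lambda>y. cut (y, t) * g y t)" by (auto elim: eventually_mono)
 have meas: "(\<lambda>t. LINT y|lborel. K (i + m0) (y, t)) \<in> borel_measurable borel" for i
  using borel_measurable_integrable[OF lborel_integrable_snd(2)[OF K_integrable[OF m0[of "i + m0"]]]] by simp
 note L = lebesgue_dominated_convergence[of "\<lambda>i t. LINT y|lborel. K (i + m0) (y, t)" "\<lambda>t. LINT y|lborel. W (y, t)"
  "\<lambda>t. LINT y|lebesgue. cut (y, t) * g y t", OF meas lborel_integrable_snd(2)[OF integrable_W]]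
 have L1: "AE t in lborel. (\<lambda>i. LINT y|lborel. K (i + m0) (y, t)) \<longlonglongrightarrow> (LINT y|lebesgue. cut (y, t) * g y t)"
  using dct by (auto elim: eventually_mono)
 have L2: "AE t in lborel. \<bar>LINT y|lborel. K (i + m0) (y, t)\<bar> \<le> (LINT y|lborel. W (y, t))" for i
  using dct by (auto elim: eventually_mono)
 show "integrable lebesgue (\<lambda>t. LINT y|lebesgue. cut (y, t) * g y t)" by (rule L(2)[OF L1 L2])
 have "(\<lambda>i. LINT t|lborel. LINT y|lborel. K (i + m0) (y, t)) \<longlonglongrightarrow> (LINT t|lebesgue. LINT y|lebesgue. cut (y, t) * g y t)"
  by (rule L(3)[OF L1 L2])
 moreover have "(LINT t|lborel. LINT y|lborel. K (i + m0) (y, t)) =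
  (LINT q|lborel. cut q * E (i + m0) q) / eps (i + m0) ^ DIM((real^'n) \<times> real)" for i
  unfolding cut_E_integrable_good(2)[OF m0[OF le_add2]] using eps_pos[of "i + m0"] by simp
 ultimately have "(\<lambda>i. (LINT q|lborel. cut q * E (i + m0) q) / eps (i + m0) ^ DIM((real^'n) \<times> real))
  \<longlonglongrightarrow> (LINT t|lebesgue. LINT y|lebesgue. cut (y, t) * g y t)" by simp
 then show "(\<lambda>m. (LINT q|lborel. cut q * E m q) / eps m ^ DIM((real^'n) \<times> real)) \<longlonglongrightarrow>
   (LINT t|lebesgue. LINT y|lebesgue. cut (y, t) * g y t)"
  by (rule LIMSEQ_offset)
qed

end

end

context tube begin

text \<open>The test integrals add up to zero at every base point in \<open>P\<close> and every
  small scale, so their limits have zero average over all boxes.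
  \<open>AE_zero_if_integral_rational_boxes_zero\<close> is used twice: in time for each spatial
  box, and in space for each time off one null set.\<close>

theorem jump_ae:
 fixes I :: "'i set" and f G ka :: "'i => (real^'n) \<times> real => real" and fp fm :: "'i => real^'n => real => real"
 assumes fin: "finite I" and os: "\<And>i. i \<in> I ==> one_sided (f i) (G i) (fp i) (fm i)"
  and kac: "\<And>i. i \<in> I ==> continuous_on UNIV (ka i)"
  and kas: "\<And>i z. i \<in> I ==> ka i z \<noteq> 0 ==> norm z \<le> R" and R0: "R \<ge> 0"
  and zero: "\<And>q m. q \<in> P ==> eps m < d ==>
   (\<Sum>i\<in>I. (LINT z|lborel. f i z * ka i ((z - \<Psi> (proj k q)) /\<^sub>R eps m))) = 0" and d: "d > 0"
  and P: "P = Bx \<times> It" "open Bx" "open It"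
 shows "AE t in lborel. AE y in lborel. (y, t) \<in> P -->
  (\<Sum>i\<in>I. fp i y t * plus_part (ka i) (N (y, t)) + fm i y t * minus_part (ka i) (N (y, t))) = 0"
proof -
 define g where "g i y t = fp i y t * plus_part (ka i) (N (y, t)) + fm i y t * minus_part (ka i) (N (y, t))" for i y t
 define E where "E i m q = (LINT z|lborel. f i z * ka i ((z - \<Psi> (proj k q)) /\<^sub>R eps m))" for i m q
 let ?c = "\<lambda>A s. indicator (A \<times> {fst s<..<snd s}) :: (real^'n) \<times> real => real"
 define \<gamma> where "\<gamma> A t = (\<Sum>i\<in>I. LINT y|lebesgue. indicator A y * g i y t)" for A t
 have main: "(AE t in lborel. t \<in> box t1 t2 --> (\<forall>i\<in>I. integrable lebesgue (\<lambda>y. indicator (box a b) y * g i y t))) \<and>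
   integrable lebesgue (\<lambda>t. indicator (box t1 t2) t * \<gamma> (box a b) t) \<and>
   (LINT t|lebesgue. indicator (box t1 t2) t * \<gamma> (box a b) t) = 0"
  if ab: "cbox a b \<subseteq> Bx" "cbox t1 t2 \<subseteq> It" for a b and t1 t2 :: real
 proof -
  have sub: "cbox a b \<times> {t1..t2} \<subseteq> P" using ab by (auto simp: P(1))
  let ?cut = "indicator (box a b \<times> {t1<..<t2}) :: (real^'n) \<times> real => real"
  have lim1: "\<forall>\<^sub>F m in sequentially. integrable lborel (\<lambda>q. ?cut q * E i m q)"
   and lim2: "AE t in lborel. integrable lebesgue (\<lambda>y. ?cut (y, t) * g i y t)"
   and lim3: "integrable lebesgue (\<lambda>t. LINT y|lebesgue. ?cut (y, t) * g i y t)"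
   and lim4: "(\<lambda>m. (LINT q|lborel. ?cut q * E i m q) / eps m ^ DIM((real^'n) \<times> real)) \<longlonglongrightarrow>
    (LINT t|lebesgue. LINT y|lebesgue. ?cut (y, t) * g i y t)" if "i \<in> I" for i
   using blowup_limit[OF os[OF that] kac[OF that] kas[OF that] R0 sub] unfolding g_def E_def by blast+
  have cut: "?cut (y, t) * x = indicator (box t1 t2) t * (indicator (box a b) y * x)" for y t x
   by (auto simp: indicator_def box_real)
  have inner: "(LINT y|lebesgue. ?cut (y, t) * g i y t) = indicator (box t1 t2) t * (LINT y|lebesgue. indicator (box a b) y * g i y t)" for i t
   unfolding cut by (cases "t \<in> box t1 t2") simp_all
  have int: "AE t in lborel. t \<in> box t1 t2 --> integrable lebesgue (\<lambda>y. indicator (box a b) y * g i y t)" if "i \<in> I" for i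
   using lim2[OF that] by (rule eventually_mono) (auto simp: cut)
  have int_t: "integrable lebesgue (\<lambda>t. indicator (box t1 t2) t * (LINT y|lebesgue. indicator (box a b) y * g i y t))" if "i \<in> I" for i
   using lim3[OF that] unfolding inner .
  have gam: "indicator (box t1 t2) t * \<gamma> (box a b) t = (\<Sum>i\<in>I. indicator (box t1 t2) t * (LINT y|lebesgue. indicator (box a b) y * g i y t))" for t
   unfolding \<gamma>_def by (rule sum_distrib_left)
  have "(\<lambda>m. \<Sum>i\<in>I. (LINT q|lborel. ?cut q * E i m q) / eps m ^ DIM((real^'n) \<times> real)) \<longlonglongrightarrow>
   (\<Sum>i\<in>I. LINT t|lebesgue. LINT y|lebesgue. ?cut (y, t) * g i y t)"
   by (intro tendsto_sum lim4)
  moreover have "\<forall>\<^sub>F m in sequentially. (\<Sum>i\<in>I. (LINT q|lborel. ?cut q * E i m q) / eps m ^ DIM((real^'n) \<times> real)) = 0"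
  proof -
   have "\<forall>\<^sub>F m in sequentially. \<forall>i\<in>I. integrable lborel (\<lambda>q. ?cut q * E i m q)"
    using fin by (intro eventually_ball_finite ballI lim1)
   then show ?thesis using eventually_eps_less[OF d]
   proof eventually_elim
    case (elim m)
    have "(\<Sum>i\<in>I. (LINT q|lborel. ?cut q * E i m q)) = (LINT q|lborel. (\<Sum>i\<in>I. ?cut q * E i m q))"
     using elim by (intro Bochner_Integration.integral_sum[symmetric]) auto
    also have "\<dots> = (LINT q|lborel. ?cut q * (\<Sum>i\<in>I. E i m q))" by (simp add: sum_distrib_left)
    also have "\<dots> = (LINT (q :: (real^'n) \<times> real)|lborel. 0)"
    proof (intro Bochner_Integration.integral_cong refl)
     fix q :: "(real^'n) \<times> real"
     show "?cut q * (\<Sum>i\<in>I. E i m q) = 0"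
     proof (cases "?cut q = 0")
      case False
      then have "q \<in> P" using sub box_subset_cbox[of a b] by (auto simp: indicator_def less_imp_le split: if_splits)
      then show ?thesis using zero[OF _ elim(2)] unfolding E_def by simp
     qed simp
    qed
    finally show ?case by (simp add: sum_divide_distrib[symmetric])
   qed
  qed
  ultimately have "(\<Sum>i\<in>I. LINT t|lebesgue. LINT y|lebesgue. ?cut (y, t) * g i y t) = 0"
   by (rule LIMSEQ_unique[OF _ tendsto_eventually])
  then have "(LINT t|lebesgue. indicator (box t1 t2) t * \<gamma> (box a b) t) = 0"
   unfolding gam inner using int_t by (subst Bochner_Integration.integral_sum) auto
  moreover have "integrable lebesgue (\<lambda>t. indicator (box t1 t2) t * \<gamma> (box a b) t)"
   unfolding gam using int_t by (intro Bochner_Integration.integrable_sum) auto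
  moreover have "AE t in lborel. \<forall>i\<in>I. t \<in> box t1 t2 --> integrable lebesgue (\<lambda>y. indicator (box a b) y * g i y t)"
   using fin int by (subst AE_ball_countable) (auto intro: countable_finite)
  ultimately show ?thesis by (auto elim: eventually_mono)
 qed
 let ?RB = "{p :: (real^'n) \<times> (real^'n). box (fst p) (snd p) \<in> rational_boxes \<and> cbox (fst p) (snd p) \<subseteq> Bx}"
 let ?BB = "{A \<in> rational_boxes. \<exists>a b :: real^'n. A = box a b \<and> cbox a b \<subseteq> Bx}"
 let ?TT = "{A \<in> rational_boxes. \<exists>a b :: real. A = box a b \<and> cbox a b \<subseteq> It}"
 have cB: "countable ?BB" "countable ?TT"
  by (auto intro: countable_subset[OF _ countable_rational_boxes])
 have ae1: "AE t in lborel. t \<in> It --> \<gamma> A t = 0" if "A \<in> ?BB" for A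
  using that main by (intro AE_zero_if_integral_rational_boxes_zero[OF P(3)]) auto
 \<comment> \<open>Integrability in \<open>y\<close> is known only for almost every time in a box
   whose closure lies in \<open>It\<close>, hence the second countable family of boxes.\<close>
 have ae2: "AE t in lborel. \<forall>T\<in>?TT. t \<in> T --> (\<forall>i\<in>I. integrable lebesgue (\<lambda>y. indicator A y * g i y t))" if A: "A \<in> ?BB" for A
 proof (subst AE_ball_countable[OF cB(2)], intro ballI)
  fix T assume "T \<in> ?TT"
  with A show "AE t in lborel. t \<in> T --> (\<forall>i\<in>I. integrable lebesgue (\<lambda>y. indicator A y * g i y t))"
   using main by auto
 qed
 have "AE t in lborel. \<forall>A\<in>?BB. (t \<in> It --> \<gamma> A t = 0) \<and> (\<forall>T\<in>?TT. t \<in> T --> (\<forall>i\<in>I. integrable lebesgue (\<lambda>y. indicator A y * g i y t)))"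
 proof (subst AE_ball_countable[OF cB(1)], intro ballI)
  fix A assume A: "A \<in> ?BB"
  show "AE t in lborel. (t \<in> It --> \<gamma> A t = 0) \<and> (\<forall>T\<in>?TT. t \<in> T --> (\<forall>i\<in>I. integrable lebesgue (\<lambda>y. indicator A y * g i y t)))"
   using ae1[OF A] ae2[OF A] by eventually_elim blast
 qed
 then show ?thesis
 proof (rule eventually_mono)
  fix t
  assume *: "\<forall>A\<in>?BB. (t \<in> It --> \<gamma> A t = 0) \<and> (\<forall>T\<in>?TT. t \<in> T --> (\<forall>i\<in>I. integrable lebesgue (\<lambda>y. indicator A y * g i y t)))"
  show "AE y in lborel. (y, t) \<in> P -->
   (\<Sum>i\<in>I. fp i y t * plus_part (ka i) (N (y, t)) + fm i y t * minus_part (ka i) (N (y, t))) = 0"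
  proof (cases "t \<in> It")
   case True
   obtain t1 t2 where T: "box t1 t2 \<in> rational_boxes" "t \<in> box t1 t2" "cbox t1 t2 \<subseteq> It"
    using rational_box_inside[OF P(3) True] by metis
   have i: "integrable lebesgue (\<lambda>y. indicator (box a b) y * g i y t)" and z: "\<gamma> (box a b) t = 0"
    if "box a b \<in> rational_boxes" "cbox a b \<subseteq> Bx" "i \<in> I" for a b i
    using * that T True by blast+
   have "AE y in lborel. y \<in> Bx --> (\<Sum>i\<in>I. g i y t) = 0"
   proof (rule AE_zero_if_integral_rational_boxes_zero[OF P(2)])
    fix a b assume ab: "box a b \<in> rational_boxes" "cbox a b \<subseteq> Bx"
    show "integrable lebesgue (\<lambda>y. indicator (box a b) y * (\<Sum>i\<in>I. g i y t))"
     unfolding sum_distrib_left by (intro Bochner_Integration.integrable_sum i ab)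
    have "(LINT y|lebesgue. indicator (box a b) y * (\<Sum>i\<in>I. g i y t)) = \<gamma> (box a b) t"
     unfolding sum_distrib_left \<gamma>_def by (intro Bochner_Integration.integral_sum i ab)
    also have "\<dots> = 0" using * ab True by blast
    finally show "(LINT y|lebesgue. indicator (box a b) y * (\<Sum>i\<in>I. g i y t)) = 0" .
   qed
   then show ?thesis unfolding g_def by (rule eventually_mono) (auto simp: P(1))
  qed (simp add: P(1))
 qed
qed

end

section \<open>Charts of a moving surface\<close>

lemma open_cube: "open (cube :: (real^'n) set)"
proof -
 have eq: "cube = (\<Inter>i\<in>UNIV. {y :: real^'n. \<bar>y $ i\<bar> < 1})" by (auto simp: cube_def)
 show ?thesis unfolding eq by (intro open_INT ballI open_Collect_less continuous_intros) simp
qed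

lemma flatten_cube: "y \<in> cube ==> flatten k y \<in> flat_cube k"
 by (auto simp: cube_def flat_cube_def flatten_def)

lemma flat_cube_flatten: "y \<in> flat_cube k ==> flatten k y = y"
 by (auto simp: flat_cube_def flatten_def vec_eq_iff)

lemma flat_cube_subset: "flat_cube k \<subseteq> cube"
 by (auto simp: flat_cube_def)

text \<open>The end points \<open>0\<close> and \<open>T\<close> form a null set of times; once they
  are removed, relative openness in \<open>{0..T}\<close> is openness.\<close>

lemma open_time_interval_interior:
 assumes "time_interval T I" shows "open (I \<inter> {0<..<T})"
proof -
 obtain A where "open A" "I = {0..T} \<inter> A" using assms by (auto simp: time_interval_def openin_open)
 moreover from this have "I \<inter> {0<..<T} = A \<inter> {0<..<T}" by auto
 ultimately show ?thesis by auto
qed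

locale chart =
 fixes T :: real and S :: "((real^'n::finite) \<times> real) set" and \<nu> :: "real^'n => real => real^'n"
  and U :: "(real^'n) set" and I :: "real set" and k :: 'n and r :: "real^'n => real => real^'n" and e :: real
 assumes lp: "local_parametrization T S U I k r"
  and unit: "(x, t) \<in> S ==> norm (\<nu> x t) = 1"
  and ortho: "y \<in> cube ==> t \<in> I ==> \<nu> (r y t) t \<bullet> tangent r y t i = 0"
  and e_pos: "e > 0"
  and C1: "C1_on (cube \<times> I) (\<lambda>(y, t). tubular_map \<nu> e k r y t)"
  and diffeo: "t \<in> I ==> C1_diffeomorphism cube ((\<lambda>y. tubular_map \<nu> e k r y t) ` cube) (\<lambda>y. tubular_map \<nu> e k r y t)"
begin

text \<open>The end points of the time interval are dropped so that \<open>Q\<close> is open and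
  time derivatives are two-sided.\<close>

definition Io :: "real set" where "Io = I \<inter> {0<..<T}"
definition Q :: "((real^'n) \<times> real) set" where "Q = cube \<times> Io"
definition \<Phi> :: "(real^'n) \<times> real => real^'n" where "\<Phi> q = tubular_map \<nu> e k r (fst q) (snd q)"
definition \<Psi> :: "(real^'n) \<times> real => (real^'n) \<times> real" where "\<Psi> q = (\<Phi> q, snd q)"
definition D :: "(real^'n) \<times> real => ((real^'n) \<times> real) \<Rightarrow>\<^sub>L (real^'n)" where
 "D = (SOME f'. (\<forall>z\<in>cube \<times> I. (\<Phi> has_derivative blinfun_apply (f' z)) (at z within cube \<times> I)) \<and> continuous_on (cube \<times> I) f')"
definition normal :: "(real^'n) \<times> real => real^'n" where "normal q = \<nu> (r (fst q) (snd q)) (snd q)"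
text \<open>\<open>D (proj k q) (0, 1)\<close> is the velocity of the surface parametrization (see
  \<open>r_time_der\<close>), so the time component is the density of \<open>\<mu>\<^sub>t\<close>
  with respect to surface measure.\<close>

definition N :: "(real^'n) \<times> real => (real^'n) \<times> real" where
 "N q = (normal q, - (normal q \<bullet> D (proj k q) (0, 1)))"

lemma time_interval_I: "time_interval T I" and open_U: "open U" and r_flatten: "r (flatten k y) t = r y t"
 and r_hom: "t \<in> I ==> \<exists>g. homeomorphism (flat_cube k) (slice S t \<inter> U) (\<lambda>y. r y t) g"
 using lp unfolding local_parametrization_def by metis+

lemma open_Io: "open Io" unfolding Io_def by (rule open_time_interval_interior[OF time_interval_I])

lemma open_Q: "open Q" unfolding Q_def by (intro open_Times open_cube open_Io)

lemma Q_subset: "Q \<subseteq> cube \<times> I" by (auto simp: Q_def Io_def)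

lemma D_spec: "z \<in> cube \<times> I ==> (\<Phi> has_derivative blinfun_apply (D z)) (at z within cube \<times> I)"
 and D_cont: "continuous_on (cube \<times> I) D"
proof -
 have "(\<lambda>(y, t). tubular_map \<nu> e k r y t) = \<Phi>" by (auto simp: \<Phi>_def)
 then have "\<exists>f'. (\<forall>z\<in>cube \<times> I. (\<Phi> has_derivative blinfun_apply (f' z)) (at z within cube \<times> I)) \<and> continuous_on (cube \<times> I) f'"
  using C1 unfolding C1_on_def by simp
 from someI_ex[OF this] show "z \<in> cube \<times> I ==> (\<Phi> has_derivative blinfun_apply (D z)) (at z within cube \<times> I)"
  "continuous_on (cube \<times> I) D" unfolding D_def by blast+
qed

lemma der: "q \<in> Q ==> (\<Phi> has_derivative D q) (at q)"
proof -
 assume q: "q \<in> Q"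
 have "(\<Phi> has_derivative D q) (at q within Q)"
  using D_spec[of q] q Q_subset by (blast intro: has_derivative_subset)
 then show ?thesis using at_within_open[OF q open_Q] by simp
qed

lemma cont_D: "continuous_on Q D" using D_cont Q_subset by (rule continuous_on_subset)

lemma \<Phi>_flat: "\<Phi> (proj k q) = r (fst q) (snd q)"
 by (simp add: \<Phi>_def proj_def tubular_map_def r_flatten) (simp add: flatten_def)

lemma \<Psi>_flat: "\<Psi> (proj k q) = (r (fst q) (snd q), snd q)"
 unfolding \<Psi>_def \<Phi>_flat by (simp add: proj_def)

lemma proj_Q: "q \<in> Q ==> proj k q \<in> Q"
 using flatten_cube flat_cube_subset by (fastforce simp: Q_def proj_def)

lemma normal_proj [simp]: "normal (proj k q) = normal q"
 by (simp add: normal_def proj_def r_flatten)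

lemma surface_point:
 assumes "y \<in> cube" "t \<in> I" shows "(r y t, t) \<in> S" "r y t \<in> U"
proof -
 obtain g where "homeomorphism (flat_cube k) (slice S t \<inter> U) (\<lambda>y. r y t) g" using r_hom[OF assms(2)] by blast
 then have "r (flatten k y) t \<in> slice S t \<inter> U"
  using flatten_cube[OF assms(1)] by (auto simp: homeomorphism_def)
 then show "(r y t, t) \<in> S" "r y t \<in> U" by (auto simp: r_flatten slice_def)
qed

lemma norm_normal: "q \<in> Q ==> norm (normal q) = 1"
 unfolding normal_def using Q_subset by (intro unit surface_point) auto

lemma inj_slice: "t \<in> I ==> inj_on (\<lambda>y. \<Phi> (y, t)) cube"
 using diffeo[of t] unfolding C1_diffeomorphism_def \<Phi>_def
 by (auto simp: homeomorphism_def inj_on_def) metis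

lemma inj: "inj_on \<Psi> Q"
proof (rule inj_onI)
 fix p q assume *: "p \<in> Q" "q \<in> Q" "\<Psi> p = \<Psi> q"
 then show "p = q" using inj_onD[OF inj_slice[of "snd p"], of "fst p" "fst q"]
  by (auto simp: \<Psi>_def Q_def Io_def prod_eq_iff)
qed

lemma slice_der: "(y, t) \<in> Q ==> ((\<lambda>y. \<Phi> (y, t)) has_derivative (\<lambda>w. D (y, t) (w, 0))) (at y)"
proof -
 assume q: "(y, t) \<in> Q"
 have "((\<lambda>y. (y, t)) has_derivative (\<lambda>w. (w, 0))) (at y)" by (auto intro!: derivative_eq_intros)
 from has_derivative_compose[OF this der[OF q]] show ?thesis .
qed

text \<open>By the chain rule, the derivative of the inverse of the tubular map is a left inverse of
  the spatial derivative.\<close>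

lemma nonsing:
 assumes q: "q \<in> Q" and w: "D q (w, 0) = 0" shows "w = 0"
proof -
 obtain y t where yt: "q = (y, t)" "y \<in> cube" "t \<in> I" using q Q_subset by auto
 have "C1_diffeomorphism cube ((\<lambda>y. \<Phi> (y, t)) ` cube) (\<lambda>y. \<Phi> (y, t))"
  using diffeo[OF yt(3)] by (simp add: \<Phi>_def)
 then obtain g g' where op: "open ((\<lambda>y. \<Phi> (y, t)) ` cube)" and hom: "homeomorphism cube ((\<lambda>y. \<Phi> (y, t)) ` cube) (\<lambda>y. \<Phi> (y, t)) g"
  and g': "\<forall>z\<in>(\<lambda>y. \<Phi> (y, t)) ` cube. (g has_derivative blinfun_apply (g' z)) (at z within (\<lambda>y. \<Phi> (y, t)) ` cube)"
  unfolding C1_diffeomorphism_def C1_on_def by blast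
 have z: "\<Phi> (y, t) \<in> (\<lambda>y. \<Phi> (y, t)) ` cube" using yt by blast
 have "(g has_derivative g' (\<Phi> (y, t))) (at (\<Phi> (y, t)))"
  using g' z at_within_open[OF z op] by force
 from has_derivative_compose[OF slice_der this]
 have "((\<lambda>y. g (\<Phi> (y, t))) has_derivative (\<lambda>w. g' (\<Phi> (y, t)) (D (y, t) (w, 0)))) (at y)" using q yt by simp
 moreover have "((\<lambda>y. g (\<Phi> (y, t))) has_derivative (\<lambda>w. w)) (at y)"
  by (rule has_derivative_transform_within_open[OF has_derivative_ident open_cube yt(2)])
   (use hom in \<open>auto simp: homeomorphism_def\<close>)
 ultimately have "(\<lambda>w. g' (\<Phi> (y, t)) (D (y, t) (w, 0))) = (\<lambda>w. w)" by (rule has_derivative_unique)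
 then have "w = g' (\<Phi> (y, t)) (D (y, t) (w, 0))" by metis
 then show ?thesis using w yt by simp
qed

lemma D_line:
 assumes q: "q \<in> Q" and g: "((\<lambda>s. \<Phi> (q + s *\<^sub>R v)) has_vector_derivative d) (at 0)"
 shows "D q v = d"
proof -
 have "((\<lambda>s. q + s *\<^sub>R v) has_vector_derivative v) (at 0)" by (auto intro!: derivative_eq_intros)
 then have "((\<lambda>s. q + s *\<^sub>R v) has_derivative (\<lambda>s. s *\<^sub>R v)) (at 0)" by (simp add: has_vector_derivative_def)
 from has_derivative_compose[OF this] der[OF q]
 have "((\<lambda>s. \<Phi> (q + s *\<^sub>R v)) has_derivative (\<lambda>s. D q (s *\<^sub>R v))) (at 0)" by simp
 then have "((\<lambda>s. \<Phi> (q + s *\<^sub>R v)) has_vector_derivative D q v) (at 0)"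
  by (simp add: has_vector_derivative_def blinfun.scaleR_right)
 then show ?thesis using g by (rule vector_derivative_unique_at)
qed

lemma D_normal: "q \<in> Q ==> D (proj k q) (axis k 1, 0) = e *\<^sub>R normal q"
proof (rule D_line)
 assume "q \<in> Q" then show "proj k q \<in> Q" by (rule proj_Q)
 have "\<Phi> (proj k q + s *\<^sub>R (axis k 1, 0)) = r (fst q) (snd q) + (e * s) *\<^sub>R normal q" for s
 proof -
  have f: "flatten k (flatten k (fst q) + s *\<^sub>R axis k 1) = flatten k (fst q)"
   by (auto simp: flatten_def vec_eq_iff axis_def)
  have "r (flatten k (fst q) + s *\<^sub>R axis k 1) t = r (fst q) t" for t
   using r_flatten[of "flatten k (fst q) + s *\<^sub>R axis k 1" t] unfolding f by (simp add: r_flatten)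
  moreover have "(flatten k (fst q) + s *\<^sub>R axis k 1) $ k = s" by (simp add: flatten_def)
  ultimately show ?thesis by (simp add: \<Phi>_def proj_def tubular_map_def normal_def)
 qed
 moreover have "((\<lambda>s. r (fst q) (snd q) + (e * s) *\<^sub>R normal q) has_vector_derivative e *\<^sub>R normal q) (at 0)"
  by (auto intro!: derivative_eq_intros simp: has_vector_derivative_def mult.commute)
 ultimately show "((\<lambda>s. \<Phi> (proj k q + s *\<^sub>R (axis k 1, 0))) has_vector_derivative e *\<^sub>R normal q) (at 0)" by simp
qed

lemma r_slice_der: "(y, t) \<in> Q ==> ((\<lambda>y. r y t) has_derivative (\<lambda>w. D (proj k (y, t)) (flatten k w, 0))) (at y)"
proof -
 assume q: "(y, t) \<in> Q"
 have "(flatten k has_derivative flatten k) (at y)" using linear_flatten by (rule linear_imp_has_derivative)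
 moreover have "((\<lambda>y. \<Phi> (y, t)) has_derivative (\<lambda>w. D (flatten k y, t) (w, 0))) (at (flatten k y))"
  by (rule slice_der) (use proj_Q[OF q] in \<open>simp add: proj_def\<close>)
 ultimately have "((\<lambda>y. \<Phi> (flatten k y, t)) has_derivative (\<lambda>w. D (flatten k y, t) (flatten k w, 0))) (at y)"
  by (rule has_derivative_compose)
 moreover have "\<Phi> (flatten k y, t) = r y t" for y using \<Phi>_flat[of "(y, t)"] by (simp add: proj_def)
 ultimately show ?thesis by (simp add: proj_def)
qed

lemma tangent_eq: "(y, t) \<in> Q ==> tangent r y t i = D (proj k (y, t)) (flatten k (axis i 1), 0)"
 unfolding tangent_def using frechet_derivative_at[OF r_slice_der, of y t] by metis

text \<open>Flattened directions are combinations of the tangent vectors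
  \<open>tangent r y t i\<close>, to which \<open>normal\<close> is orthogonal.\<close>

lemma normal_tangential:
 assumes q: "q \<in> Q" shows "normal q \<bullet> D (proj k q) (flatten k w, 0) = 0"
proof -
 obtain y t where yt: "q = (y, t)" "y \<in> cube" "t \<in> I" using q Q_subset by auto
 have lin: "linear (\<lambda>w. D (proj k q) (flatten k w, 0))"
  using linear_flatten[of k]
  by (intro linearI) (simp_all add: linear_add linear_cmul blinfun.add_right[symmetric] blinfun.scaleR_right[symmetric])
 have "D (proj k q) (flatten k w, 0) = (\<Sum>i\<in>UNIV. (w $ i) *\<^sub>R D (proj k q) (flatten k (axis i 1), 0))"
  using linear_sum[OF lin, of "\<lambda>i. (w $ i) *\<^sub>R axis i 1" UNIV] linear_cmul[OF lin] basis_expansion[of w]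
  by (simp add: scalar_mult_eq_scaleR)
 moreover have "normal q \<bullet> D (proj k q) (flatten k (axis i 1), 0) = 0" for i
  using ortho[OF yt(2,3), of i] tangent_eq[of y t i] q yt by (simp add: normal_def)
 ultimately show ?thesis by (simp add: inner_sum_right)
qed

lemma D_split: "D p om = D p (flatten k (fst om), 0) + (fst om $ k) *\<^sub>R D p (axis k 1, 0) + snd om *\<^sub>R D p (0, 1)"
proof -
 have "om = (flatten k (fst om), 0) + (fst om $ k) *\<^sub>R (axis k 1, 0) + snd om *\<^sub>R (0, 1)"
  by (simp add: prod_eq_iff flatten_decomp)
 then have "D p om = D p ((flatten k (fst om), 0) + (fst om $ k) *\<^sub>R (axis k 1, 0) + snd om *\<^sub>R (0, 1))" by simp
 then show ?thesis by (simp only: blinfun.add_right blinfun.scaleR_right)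
qed

text \<open>A direction splits into a tangential part orthogonal to \<open>normal\<close>, a normal
  part of length \<open>e * (fst om $ k)\<close>, and the motion in time, whose normal component is
  cancelled by the second component of \<open>N\<close>.\<close>

lemma conormal:
 assumes q: "q \<in> Q" shows "N q \<bullet> (D (proj k q) om, snd om) = e * (fst om $ k)"
proof -
 have nn: "normal q \<bullet> normal q = 1" using norm_normal[OF q] by (simp add: dot_square_norm)
 have "normal q \<bullet> D (proj k q) om = e * (fst om $ k) + snd om * (normal q \<bullet> D (proj k q) (0, 1))"
  unfolding D_split[of "proj k q" om] D_normal[OF q] by (simp add: inner_add_right normal_tangential[OF q] nn)
 then show ?thesis by (simp add: N_def inner_prod_def mult.commute)
qed

text \<open>On flat parameters the tube map is \<open>r\<close>, so the velocity is a partial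
  derivative of the tube map.\<close>

lemma r_time_der: "(y, t) \<in> Q ==> ((\<lambda>s. r y s) has_vector_derivative D (proj k (y, t)) (0, 1)) (at t)"
proof -
 assume q: "(y, t) \<in> Q"
 have "((\<lambda>s. (flatten k y, s)) has_derivative (\<lambda>s. s *\<^sub>R (0, 1))) (at t)"
  by (auto intro!: derivative_eq_intros)
 moreover have "(\<Phi> has_derivative D (flatten k y, t)) (at (flatten k y, t))"
  by (rule der) (use proj_Q[OF q] in \<open>simp add: proj_def\<close>)
 ultimately have "((\<lambda>s. \<Phi> (flatten k y, s)) has_derivative (\<lambda>s. D (flatten k y, t) (s *\<^sub>R (0, 1)))) (at t)"
  by (rule has_derivative_compose)
 moreover have "\<Phi> (flatten k y, s) = r y s" for s using \<Phi>_flat[of "(y, s)"] by (simp add: proj_def)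
 ultimately show ?thesis by (simp add: has_vector_derivative_def proj_def blinfun.scaleR_right del: scaleR_Pair)
qed

definition frame :: "(real^'n) \<times> real => real^'n^'n" where
 "frame q = (\<chi> i j. (if j = k then normal q else D (proj k q) (axis j 1, 0)) $ i)"

text \<open>The normal is a unit vector orthogonal to the tangent vectors, so the Gram matrix
  bordered by row and column \<open>k\<close> of the identity is
  \<open>transpose (frame q) ** frame q\<close>, whose determinant is a square.\<close>

lemma volume_element_eq:
 assumes q: "(y, t) \<in> Q" shows "volume_element k r y t = \<bar>det (frame (y, t))\<bar>"
proof -
 let ?q = "(y, t)"
 have fa: "flatten k (axis j 1) = axis j 1" if "j \<noteq> k" for j using that by (auto simp: flatten_def vec_eq_iff axis_def)
 have nn: "normal ?q \<bullet> normal ?q = 1" using norm_normal[OF q] by (simp add: dot_square_norm)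
 have nt: "normal ?q \<bullet> D (proj k ?q) (axis j 1, 0) = 0" if "j \<noteq> k" for j
  using normal_tangential[OF q, of "axis j 1"] fa[OF that] by simp
 have nt': "D (proj k ?q) (axis j 1, 0) \<bullet> normal ?q = 0" if "j \<noteq> k" for j
  using nt[OF that] by (simp only: inner_commute)
 have "(\<chi> i j. if i = k \<or> j = k then (if i = j then 1 else 0) else tangent r y t i \<bullet> tangent r y t j) = transpose (frame ?q) ** frame ?q"
  unfolding vec_eq_iff
 proof (intro allI)
  fix i j
  have col: "(transpose (frame ?q) ** frame ?q) $ i $ j = (if i = k then normal ?q else D (proj k ?q) (axis i 1, 0)) \<bullet> (if j = k then normal ?q else D (proj k ?q) (axis j 1, 0))"
   by (simp add: matrix_matrix_mult_def transpose_def frame_def inner_vec_def)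
  show "(\<chi> i j. if i = k \<or> j = k then (if i = j then 1 else 0) else tangent r y t i \<bullet> tangent r y t j) $ i $ j = (transpose (frame ?q) ** frame ?q) $ i $ j"
   unfolding col by (cases "i = k"; cases "j = k") (simp_all add: nn nt nt' tangent_eq[OF q] fa)
 qed
 then show ?thesis by (simp add: volume_element_def det_mul det_transpose real_sqrt_mult_self flip: power2_eq_square)
qed

text \<open>A kernel vector of the frame would, after rescaling of its coordinate \<open>k\<close>,
  be a kernel vector of the spatial derivative.\<close>

lemma frame_det_nonzero:
 assumes q: "q \<in> Q" shows "det (frame q) \<noteq> 0"
proof
 assume "det (frame q) = 0"
 then have "\<not> inj ((*v) (frame q))"
  using det_nz_iff_inj[OF matrix_vector_mul_linear, of "frame q"] by simp
 then obtain v where v: "v \<noteq> 0" "frame q *v v = 0"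
  using linear_injective_0[OF matrix_vector_mul_linear, of "frame q"] by auto
 have nn: "D (proj k q) (axis k 1, 0) = e *\<^sub>R normal q" by (rule D_normal[OF q])
 \<comment> \<open>The derivative sends \<open>axis k 1\<close> to \<open>e\<close> times the
   normal, hence the division by \<open>e\<close>.\<close>
 let ?w = "\<chi> j. if j = k then v $ k / e else v $ j"
 have lin: "linear (\<lambda>w. D (proj k q) (w, 0))"
  by (intro linearI) (simp_all add: blinfun.add_right[symmetric] blinfun.scaleR_right[symmetric])
 have "D (proj k q) (?w, 0) = (\<Sum>j\<in>UNIV. (?w $ j) *\<^sub>R D (proj k q) (axis j 1, 0))"
  using linear_sum[OF lin, of "\<lambda>j. (?w $ j) *\<^sub>R axis j 1" UNIV] linear_cmul[OF lin] basis_expansion[of ?w]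
  by (simp add: scalar_mult_eq_scaleR)
 also have "\<dots> = (\<Sum>j\<in>UNIV. (v $ j) *\<^sub>R (if j = k then normal q else D (proj k q) (axis j 1, 0)))"
  using e_pos by (intro sum.cong) (auto simp: nn)
 also have "\<dots> = frame q *v v"
  by (simp add: frame_def matrix_vector_mult_def vec_eq_iff mult.commute)
 finally have "?w = 0" using nonsing[OF proj_Q[OF q]] v by simp
 then have w0: "?w $ j = 0" for j by (simp only: zero_index)
 have "v $ j = 0" for j using w0[of j] e_pos by (simp split: if_splits)
 then show False using v(1) by (simp add: vec_eq_iff)
qed

lemma volume_element_pos: "(y, t) \<in> Q ==> volume_element k r y t > 0"
 using volume_element_eq frame_det_nonzero by simp

lemma cont_D_proj: "continuous_on Q (\<lambda>q. D (proj k q))"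
 by (rule continuous_on_compose2[OF cont_D continuous_on_proj]) (auto intro: proj_Q)

text \<open>The definition of the family states continuity of the normal on each slice only; joint
  continuity in \<open>(y, t)\<close> comes from the derivative of the tubular map in the direction
  \<open>axis k 1\<close>.\<close>

lemma cont_normal: "continuous_on Q normal"
proof -
 have "continuous_on Q (\<lambda>q. (1 / e) *\<^sub>R D (proj k q) (axis k 1, 0))" by (intro continuous_intros cont_D_proj)
 then show ?thesis by (rule continuous_on_eq) (use e_pos in \<open>simp add: D_normal\<close>)
qed

lemma cont_volume_element: "continuous_on Q (\<lambda>(y, t). volume_element k r y t)"
proof -
 have "continuous_on Q (\<lambda>q. if j = k then normal q else D (proj k q) (axis j 1, 0))" for j
  by (cases "j = k") (auto intro!: continuous_intros cont_D_proj cont_normal)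
 then have "continuous_on Q (\<lambda>q. \<bar>det (frame q)\<bar>)"
  unfolding frame_def det_def by (auto intro!: continuous_intros)
 then show ?thesis by (rule continuous_on_eq) (auto simp: volume_element_eq)
qed

lemma cont_surface_map: "continuous_on Q (\<lambda>(y, t). (r y t, t))"
proof -
 have "continuous_on Q \<Phi>"
  using der has_derivative_continuous continuous_at_imp_continuous_on by blast
 then have "continuous_on Q (\<lambda>q. \<Phi> (proj k q))"
  by (rule continuous_on_compose2[OF _ continuous_on_proj]) (auto intro: proj_Q)
 then have "continuous_on Q (\<lambda>q. (\<Phi> (proj k q), snd q))" by (intro continuous_intros)
 then show ?thesis by (simp add: \<Phi>_flat case_prod_beta)
qed

lemma open_image: "A \<subseteq> Q ==> open A ==> open (\<Psi> ` A)"
proof (rule invariance_of_domain)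
 have "continuous_on Q \<Phi>"
  using der has_derivative_continuous continuous_at_imp_continuous_on by blast
 then have "continuous_on Q \<Psi>" unfolding \<Psi>_def by (intro continuous_intros)
 then show "A \<subseteq> Q ==> continuous_on A \<Psi>" by (rule continuous_on_subset)
 show "A \<subseteq> Q ==> inj_on \<Psi> A" using inj by (rule inj_on_subset)
qed

lemma surface_point_flat:
 assumes "(x, t) \<in> S" "x \<in> U" "t \<in> I"
 obtains y where "y \<in> flat_cube k" "r y t = x"
proof -
 obtain g where "homeomorphism (flat_cube k) (slice S t \<inter> U) (\<lambda>y. r y t) g" using r_hom[OF assms(3)] by blast
 then have "x \<in> (\<lambda>y. r y t) ` flat_cube k" using assms by (auto simp: homeomorphism_def slice_def)
 then show ?thesis using that by auto
qed

text \<open>The chart supplies a flat parameter of the surface point and membership in the image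
  supplies another one; injectivity of \<open>\<Psi>\<close> identifies them.\<close>

lemma surface_in_image:
 assumes "A \<subseteq> Q" "(x, t) \<in> S" "x \<in> U" "(x, t) \<in> \<Psi> ` A"
 obtains y where "(y, t) \<in> A" "y \<in> flat_cube k" "x = r y t"
proof -
 obtain p where p: "p \<in> A" "\<Psi> p = (x, t)" using assms(4) by auto
 then have t: "t = snd p" "t \<in> I" using assms(1) by (auto simp: \<Psi>_def Q_def Io_def)
 obtain y where y: "y \<in> flat_cube k" "r y t = x" using surface_point_flat[OF assms(2,3) t(2)] by blast
 have yQ: "(y, t) \<in> Q" using y(1) flat_cube_subset p t assms(1) by (auto simp: Q_def)
 have "\<Psi> (y, t) = (x, t)" using \<Psi>_flat[of "(y, t)"] y by (simp add: proj_def flat_cube_flatten)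
 then have "p = (y, t)" using inj_onD[OF inj, of p "(y, t)"] p yQ assms(1) by auto
 then show ?thesis using that p y by auto
qed

text \<open>A product set, as \<open>jump_ae\<close> requires. Within the cube the spatial condition
  involves \<open>flatten k y\<close> only, so whole normal columns are included; this matches a
  surface measure that is computed over the full cube.\<close>

definition nbhd :: "real^'n => real => real => ((real^'n) \<times> real) set" where
 "nbhd y0 t0 d = {y \<in> cube. dist (flatten k y) y0 < d} \<times> ({t0 - d<..<t0 + d} \<inter> Io)"

lemma open_nbhd: "open {y \<in> cube. dist (flatten k y) y0 < d}" "open ({t0 - d<..<t0 + d} \<inter> Io)" "open (nbhd y0 t0 d)"
proof -
 have "continuous_on UNIV (flatten k)" using linear_flatten linear_continuous_on linear_linear by blast
 then have "open {y. dist (flatten k y) y0 < d}" by (intro open_Collect_less continuous_intros)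
 then have "open (cube \<inter> {y. dist (flatten k y) y0 < d})" using open_cube by (rule open_Int[rotated])
 then show 1: "open {y \<in> cube. dist (flatten k y) y0 < d}" by (simp add: Int_def)
 show 2: "open ({t0 - d<..<t0 + d} \<inter> Io)" using open_Io by auto
 show "open (nbhd y0 t0 d)" unfolding nbhd_def using 1 2 by (rule open_Times)
qed

lemma nbhd_subset: "nbhd y0 t0 d \<subseteq> Q"
 by (auto simp: nbhd_def Q_def)

text \<open>The derivative at \<open>q0\<close> is bounded below by \<open>B\<close>, and nearby
  derivatives differ from it by at most \<open>B / 2\<close>. The mean value inequality for
  \<open>\<Psi>\<close> minus its derivative at \<open>q0\<close> yields the same constant for
  \<open>\<Psi>\<close> itself.\<close>

lemma lower_Lipschitz:
 assumes q0: "q0 \<in> Q"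
 obtains \<theta> \<eta> where "\<theta> > 0" "\<eta> > 0" "cball q0 \<eta> \<subseteq> Q"
  "\<And>a b. a \<in> cball q0 \<eta> ==> b \<in> cball q0 \<eta> ==> \<theta> * dist a b \<le> dist (\<Psi> a) (\<Psi> b)"
  "\<And>a v. a \<in> cball q0 \<eta> ==> \<theta> * norm v \<le> norm (D a v, snd v)"
proof -
 let ?L = "\<lambda>q v. (D q v, snd v)"
 have lin: "linear (?L q)" for q
  by (intro linearI) (auto simp: blinfun.add_right blinfun.scaleR_right)
 have "inj (?L q0)"
 proof (rule linear_injective_0[THEN iffD2, OF lin, rule_format])
  fix v assume "?L q0 v = 0"
  then have "snd v = 0" "D q0 (fst v, 0) = 0" by (auto simp: zero_prod_def) (metis prod.collapse)
  then show "v = 0" using nonsing[OF q0] by (simp add: prod_eq_iff)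
 qed
 then obtain B where B: "B > 0" "\<And>v. B * norm v \<le> norm (?L q0 v)"
  using linear_inj_bounded_below_pos[OF lin] by blast
 define \<theta> where "\<theta> = B / 2"
 obtain \<eta>1 where e1: "\<eta>1 > 0" "cball q0 \<eta>1 \<subseteq> Q" using open_Q q0 open_contains_cball by blast
 have "isCont D q0" using cont_D open_Q q0 continuous_on_eq_continuous_at by blast
 then obtain \<eta>2 where e2: "\<eta>2 > 0" "\<And>q. dist q q0 < \<eta>2 ==> dist (D q) (D q0) < \<theta>"
  unfolding continuous_at_eps_delta using B(1) by (metis \<theta>_def half_gt_zero)
 define \<eta> where "\<eta> = min \<eta>1 (\<eta>2 / 2)"
 have e: "\<eta> > 0" "cball q0 \<eta> \<subseteq> Q" using e1 e2 by (auto simp: \<eta>_def)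
 have close: "norm (D q - D q0) \<le> \<theta>" if "q \<in> cball q0 \<eta>" for q
 proof -
  have "dist q q0 < \<eta>2" using that e2(1) by (auto simp: \<eta>_def dist_commute)
  then show ?thesis using e2(2)[of q] by (simp add: dist_norm)
 qed
 have diff: "norm (?L q v - ?L q0 v) \<le> \<theta> * norm v" if "q \<in> cball q0 \<eta>" for q v
 proof -
  have "?L q v - ?L q0 v = ((D q - D q0) v, 0)" by (simp add: blinfun.diff_left)
  then have "norm (?L q v - ?L q0 v) = norm ((D q - D q0) v)" by (simp add: norm_prod_def)
  also have "\<dots> \<le> norm (D q - D q0) * norm v" by (rule norm_blinfun)
  also have "\<dots> \<le> \<theta> * norm v" using close[OF that] by (intro mult_right_mono) auto
  finally show ?thesis .
 qed
 show ?thesis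
 proof (rule that)
  show "\<theta> > 0" using B by (simp add: \<theta>_def)
  show "\<eta> > 0" "cball q0 \<eta> \<subseteq> Q" by (rule e)+
  show "\<theta> * norm v \<le> norm (?L a v)" if "a \<in> cball q0 \<eta>" for a v
  proof -
   have "B * norm v \<le> norm (?L q0 v)" by (rule B(2))
   also have "\<dots> \<le> norm (?L a v) + norm (?L a v - ?L q0 v)" by (metis norm_triangle_sub norm_minus_commute)
   finally show ?thesis using diff[OF that, of v] by (simp add: \<theta>_def)
  qed
  show "\<theta> * dist a b \<le> dist (\<Psi> a) (\<Psi> b)" if "a \<in> cball q0 \<eta>" "b \<in> cball q0 \<eta>" for a b
  proof -
   let ?h = "\<lambda>q. \<Psi> q - ?L q0 q"
   have "norm (?h a - ?h b) \<le> \<theta> * norm (a - b)"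
   proof (rule differentiable_bound[OF convex_cball _ _ that])
    fix q assume q: "q \<in> cball q0 \<eta>"
    then have "q \<in> Q" using e by blast
    then have "(\<Psi> has_derivative ?L q) (at q)"
     unfolding \<Psi>_def by (intro has_derivative_Pair der has_derivative_snd has_derivative_ident)
    moreover have "(?L q0 has_derivative ?L q0) (at q)" by (rule linear_imp_has_derivative[OF lin])
    ultimately show "(?h has_derivative (\<lambda>v. ?L q v - ?L q0 v)) (at q within cball q0 \<eta>)"
     by (rule has_derivative_at_withinI[OF has_derivative_diff])
    show "onorm (\<lambda>v. ?L q v - ?L q0 v) \<le> \<theta>" by (rule onorm_le) (rule diff[OF q])
   qed
   moreover have "?h a - ?h b = (\<Psi> a - \<Psi> b) - ?L q0 (a - b)"
    by (rule prod_eqI) (simp_all add: blinfun.diff_right algebra_simps)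
   ultimately have h: "norm ((\<Psi> a - \<Psi> b) - ?L q0 (a - b)) \<le> \<theta> * norm (a - b)" by (simp only:)
   have "norm (?L q0 (a - b)) \<le> norm (\<Psi> a - \<Psi> b) + norm (?L q0 (a - b) - (\<Psi> a - \<Psi> b))" by (rule norm_triangle_sub)
   then have "norm (?L q0 (a - b)) \<le> norm (\<Psi> a - \<Psi> b) + \<theta> * norm (a - b)"
    using h by (simp only: norm_minus_commute[of "?L q0 (a - b)"])
   then show ?thesis using B(2)[of "a - b"] by (simp add: \<theta>_def dist_norm)
  qed
 qed
qed

text \<open>All constants of the locale \<open>tube\<close> are found on one ball around
  \<open>(y0, t0)\<close>, with \<open>c = 1 / \<theta>\<close> from \<open>lower_Lipschitz\<close>.
  The open set \<open>O'\<close> prescribes a region in which the test balls must lie.\<close>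

lemma tube_exists:
 assumes y0: "y0 \<in> flat_cube k" "t0 \<in> Io" and O: "open O'" "(r y0 t0, t0) \<in> O'"
 obtains d \<rho> c Jmax where "d > 0" "\<rho> > 0" "\<And>s0. s0 > 0 ==> tube k \<Phi> D Q (nbhd y0 t0 d) N e \<rho> c s0 Jmax"
  "\<And>q. q \<in> nbhd y0 t0 d ==> ball (\<Psi> (proj k q)) \<rho> \<subseteq> O'"
proof -
 let ?q0 = "(y0, t0)"
 have q0: "?q0 \<in> Q" using y0 flat_cube_subset by (auto simp: Q_def)
 have pq0: "proj k ?q0 = ?q0" using y0 by (simp add: proj_def flat_cube_flatten)
 obtain \<theta> \<eta> where \<theta>: "\<theta> > 0" "\<eta> > 0" "cball ?q0 \<eta> \<subseteq> Q"
  "\<And>a b. a \<in> cball ?q0 \<eta> ==> b \<in> cball ?q0 \<eta> ==> \<theta> * dist a b \<le> dist (\<Psi> a) (\<Psi> b)"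
  "\<And>a v. a \<in> cball ?q0 \<eta> ==> \<theta> * norm v \<le> norm (D a v, snd v)"
  by (rule lower_Lipschitz[OF q0]) (rule that)
 have "open (\<Psi> ` ball ?q0 \<eta> \<inter> O')"
  using \<theta> ball_subset_cball[of ?q0 \<eta>] by (intro open_Int open_image O) auto
 moreover have "\<Psi> ?q0 \<in> \<Psi> ` ball ?q0 \<eta> \<inter> O'"
  using O(2) \<Psi>_flat[of ?q0] pq0 imageI[of ?q0 "ball ?q0 \<eta>" \<Psi>] \<theta>(2) by simp
 ultimately obtain \<rho>1 where \<rho>1: "\<rho>1 > 0" "ball (\<Psi> ?q0) \<rho>1 \<subseteq> \<Psi> ` ball ?q0 \<eta> \<inter> O'"
  using openE by blast
 \<comment> \<open>Half of \<open>\<rho>1\<close> leaves room for base points other than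
   \<open>(y0, t0)\<close>; the second bound makes \<open>\<rho> / \<theta>\<close> at most
   \<open>\<eta> / 2\<close>, which keeps the Jacobian bound on the ball of radius
   \<open>\<eta>\<close>.\<close>
 define \<rho> where "\<rho> = min (\<rho>1 / 2) (\<theta> * \<eta> / 2)"
 have \<rho>: "\<rho> > 0" "2 * \<rho> \<le> \<rho>1" "(1 / \<theta>) * \<rho> \<le> \<eta> / 2" using \<rho>1 \<theta> by (auto simp: \<rho>_def field_simps min_def)
 have "continuous_on Q \<Phi>"
  using der has_derivative_continuous continuous_at_imp_continuous_on by blast
 then have cont\<Psi>: "continuous_on Q \<Psi>" unfolding \<Psi>_def by (intro continuous_intros)
 then have "isCont \<Psi> ?q0" using open_Q q0 continuous_on_eq_continuous_at by blast
 then obtain \<delta> where \<delta>: "\<delta> > 0" "\<And>q. dist q ?q0 < \<delta> ==> dist (\<Psi> q) (\<Psi> ?q0) < \<rho>"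
  unfolding continuous_at_eps_delta using \<rho>(1) by blast
 \<comment> \<open>The distance in the product is at most the sum of two distances below
   \<open>d\<close>, hence the outer division by \<open>2\<close>.\<close>
 define d where "d = min \<delta> (\<eta> / 2) / 2"
 have d: "d > 0" using \<delta> \<theta> by (simp add: d_def)
 have near: "dist (proj k q) ?q0 < \<delta>" "dist (proj k q) ?q0 < \<eta> / 2" if "q \<in> nbhd y0 t0 d" for q
 proof -
  have "dist (proj k q) ?q0 \<le> dist (flatten k (fst q)) y0 + dist (snd q) t0"
   unfolding proj_def dist_Pair_Pair by (rule sqrt_sum_squares_le_sum_abs[THEN order_trans]) simp
  also have "\<dots> < d + d" using that by (intro add_strict_mono) (auto simp: nbhd_def dist_real_def)
  finally show "dist (proj k q) ?q0 < \<delta>" "dist (proj k q) ?q0 < \<eta> / 2" by (auto simp: d_def)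
 qed
 have "compact ((\<lambda>q. jac (\<lambda>w. D q (w, 0))) ` cball ?q0 \<eta>)"
 proof (intro compact_continuous_image compact_cball)
  have "bounded_linear (\<lambda>w :: real^'n. (w, 0 :: real))"
   by (intro bounded_linear_Pair bounded_linear_ident bounded_linear_zero)
  then have eq: "blinfun_apply (D q o\<^sub>L Blinfun (\<lambda>w. (w, 0))) = (\<lambda>w. D q (w, 0))" for q
   by (simp add: fun_eq_iff bounded_linear_Blinfun_apply)
  have "continuous_on (cball ?q0 \<eta>) (\<lambda>q. D q o\<^sub>L Blinfun (\<lambda>w. (w, 0)))"
   by (intro continuous_intros continuous_on_subset[OF cont_D \<theta>(3)])
  from continuous_on_jac[OF this] show "continuous_on (cball ?q0 \<eta>) (\<lambda>q. jac (\<lambda>w. D q (w, 0)))" unfolding eq .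
 qed
 then have "bounded ((\<lambda>q. jac (\<lambda>w. D q (w, 0))) ` cball ?q0 \<eta>)" by (rule compact_imp_bounded)
 then obtain Jmax where Jm: "\<forall>x\<in>(\<lambda>q. jac (\<lambda>w. D q (w, 0))) ` cball ?q0 \<eta>. norm x \<le> Jmax"
  unfolding bounded_iff by blast
 have Jmax: "\<bar>jac (\<lambda>w. D q (w, 0))\<bar> \<le> Jmax" if "q \<in> cball ?q0 \<eta>" for q
  using bspec[OF Jm imageI[OF that]] by simp
 show ?thesis
 proof (rule that[of d \<rho> "1 / \<theta>" Jmax])
  show "d > 0" "\<rho> > 0" by (rule d, rule \<rho>)
  have ball: "ball (\<Psi> (proj k q)) \<rho> \<subseteq> ball (\<Psi> ?q0) \<rho>1" if q: "q \<in> nbhd y0 t0 d" for q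
  proof
   fix z assume "z \<in> ball (\<Psi> (proj k q)) \<rho>"
   then show "z \<in> ball (\<Psi> ?q0) \<rho>1"
    using \<delta>(2)[OF near(1)[OF q]] dist_triangle2[of "\<Psi> ?q0" z "\<Psi> (proj k q)"] \<rho>(2) by (simp add: dist_commute)
  qed
  then show "ball (\<Psi> (proj k q)) \<rho> \<subseteq> O'" if "q \<in> nbhd y0 t0 d" for q using that \<rho>1 by blast
  show "tube k \<Phi> D Q (nbhd y0 t0 d) N e \<rho> (1 / \<theta>) s0 Jmax" if "s0 > 0" for s0
  proof
   show "open Q" "open (nbhd y0 t0 d)" by (rule open_Q, rule open_nbhd)
   show "(\<Phi> has_derivative D q) (at q)" if "q \<in> Q" for q by (rule der[OF that])
   show "continuous_on Q D" by (rule cont_D)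
   show "inj_on (\<lambda>q. (\<Phi> q, snd q)) Q" using inj unfolding \<Psi>_def .
   show "w = 0" if "q \<in> Q" "D q (w, 0) = 0" for q w by (rule nonsing[OF that])
   show "proj k q \<in> Q" if "q \<in> nbhd y0 t0 d" for q using that nbhd_subset by (blast intro: proj_Q)
   show "\<exists>q'\<in>Q. (\<Phi> q', snd q') = z \<and> dist q' (proj k q) \<le> 1 / \<theta> * dist z (\<Phi> (proj k q), snd (proj k q))"
    if q: "q \<in> nbhd y0 t0 d" and z: "dist z (\<Phi> (proj k q), snd (proj k q)) < \<rho>" for q z
   proof -
    have "z \<in> ball (\<Psi> (proj k q)) \<rho>" using z by (simp add: \<Psi>_def dist_commute)
    then obtain q' where q': "q' \<in> ball ?q0 \<eta>" "z = \<Psi> q'" using ball[OF q] \<rho>1(2) by blast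
    have "proj k q \<in> cball ?q0 \<eta>" using near(2)[OF q] \<theta>(2) by (simp add: dist_commute)
    then have "\<theta> * dist q' (proj k q) \<le> dist z (\<Psi> (proj k q))" using \<theta>(4)[of q' "proj k q"] q' by simp
    then have "dist q' (proj k q) \<le> 1 / \<theta> * dist z (\<Psi> (proj k q))" using \<theta>(1) by (simp add: field_simps)
    moreover have "q' \<in> Q" using q' \<theta>(3) by auto
    ultimately show ?thesis using q'(2) by (auto simp: \<Psi>_def)
   qed
   show "jac (\<lambda>w. D q' (w, 0)) \<le> Jmax" if q: "q \<in> nbhd y0 t0 d" and "q' \<in> Q" "dist q' (proj k q) \<le> 1 / \<theta> * \<rho>" for q q'
   proof -
    have "dist q' ?q0 \<le> \<eta>" using dist_triangle[of q' ?q0 "proj k q"] that(3) near(2)[OF q] \<rho>(3) by linarith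
    then show ?thesis using Jmax[of q'] by (simp add: dist_commute)
   qed
   show "N q \<bullet> (D (proj k q) om, snd om) = e * fst om $ k" if "q \<in> nbhd y0 t0 d" for q om
    using that nbhd_subset by (blast intro: conormal)
  qed (use e_pos \<rho> \<theta> that in auto)
 qed
qed

end

section \<open>Local defining functions and the density of mu\<close>

context chart begin

text \<open>Differentiating \<open>H (r y s) s = 0\<close> at \<open>s = t\<close> expresses the
  time derivative of \<open>H\<close> through its gradient, which is a positive multiple of
  \<open>\<nu>\<close>; the multiple cancels in the quotient.\<close>

lemma mu_quotient:
 assumes q: "(y, t) \<in> Q" and H: "local_defining_function T S \<nu> U1 I1 H" and x: "r y t \<in> U1" "t \<in> I1"
 shows "vector_derivative (\<lambda>s. H (r y t) s) (at t within {0..T}) / norm (gradient (\<lambda>x. H x t) (r y t)) = snd (N (y, t))"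
proof -
 let ?F = "\<lambda>(x, t). H x t" and ?z = "(r y t, t)" and ?b = "D (proj k (y, t)) (0, 1)"
 have t: "t \<in> Io" "0 < t" "t < T" "y \<in> cube" "t \<in> I" using q by (auto simp: Q_def Io_def)
 have H': "open U1" "time_interval T I1" "C1_on (U1 \<times> I1) ?F"
  and zero: "\<And>s. s \<in> I1 ==> {x\<in>U1. H x s = 0} = slice S s \<inter> U1"
  and grad: "\<And>x s. s \<in> I1 ==> x \<in> slice S s \<inter> U1 ==> \<exists>c>0. gradient (\<lambda>x. H x s) x = c *\<^sub>R \<nu> x s"
  using H unfolding local_defining_function_def by blast+
 let ?O = "U1 \<times> (I1 \<inter> {0<..<T})"
 have O: "open ?O" "?z \<in> ?O" using H' t x open_time_interval_interior by (auto intro: open_Times)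
 obtain F' where "\<forall>z\<in>U1 \<times> I1. (?F has_derivative blinfun_apply (F' z)) (at z within U1 \<times> I1)"
  using H'(3) unfolding C1_on_def by blast
 then have "(?F has_derivative F' ?z) (at ?z within U1 \<times> I1)" by (rule bspec) (use x in simp)
 then have "(?F has_derivative F' ?z) (at ?z within ?O)" by (rule has_derivative_subset) blast
 then have dF: "(?F has_derivative F' ?z) (at ?z)" using at_within_open[OF O(2,1)] by simp
 have dpath: "((\<lambda>s. (r y s, s)) has_derivative (\<lambda>s. s *\<^sub>R (?b, 1))) (at t)"
  using has_derivative_Pair[OF r_time_der[OF q, unfolded has_vector_derivative_def] has_derivative_ident] by simp
 have "((\<lambda>s. ?F (r y s, s)) has_derivative (\<lambda>s. F' ?z (s *\<^sub>R (?b, 1)))) (at t)"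
  by (rule has_derivative_compose[OF dpath dF])
 moreover have "((\<lambda>s. ?F (r y s, s)) has_derivative (\<lambda>s. 0)) (at t)"
 proof (rule has_derivative_transform_eventually[OF has_derivative_const])
  have "isCont (\<lambda>s. (r y s, s)) t" using dpath by (rule has_derivative_continuous)
  then have "((\<lambda>s. (r y s, s)) \<longlongrightarrow> ?z) (at t)" by (simp add: isCont_def)
  from topological_tendstoD[OF this O]
  have e1: "\<forall>\<^sub>F s in at t. (r y s, s) \<in> ?O" .
  have e2: "\<forall>\<^sub>F s in at t. s \<in> Io" using open_Io t(1) by (rule eventually_at_in_open')
  have z: "?F (r y s, s) = 0" if "(r y s, s) \<in> ?O" "s \<in> Io" for s
  proof -
   have "(r y s, s) \<in> S" using that t by (intro surface_point) (auto simp: Io_def)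
   then have "r y s \<in> {x\<in>U1. H x s = 0}" using that zero[of s] by (auto simp: slice_def)
   then show ?thesis by simp
  qed
  show "\<forall>\<^sub>F s in at t. 0 = ?F (r y s, s)" using e1 e2 by eventually_elim (use z in simp)
  show "0 = ?F (r y t, t)" using z[OF O(2) t(1)] by simp
 qed auto
 ultimately have "(\<lambda>s. F' ?z (s *\<^sub>R (?b, 1))) = (\<lambda>s. 0)" by (rule has_derivative_unique)
 then have "F' ?z (1 *\<^sub>R (?b, 1)) = 0" by metis
 then have "F' ?z ((?b, 0) + (0, 1)) = 0" by simp
 then have F0: "F' ?z (0, 1) = - F' ?z (?b, 0)" by (simp only: blinfun.add_right)
 have "((\<lambda>x. (x, t)) has_derivative (\<lambda>v. (v, 0))) (at (r y t))" by (auto intro!: derivative_eq_intros)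
 from has_derivative_compose[OF this dF]
 have dx: "((\<lambda>x. H x t) has_derivative (\<lambda>v. F' ?z (v, 0))) (at (r y t))" by simp
 have gr: "gradient (\<lambda>x. H x t) (r y t) \<bullet> v = F' ?z (v, 0)" for v
 proof -
  have lin: "linear (\<lambda>v. F' ?z (v, 0))" using dx by (rule has_derivative_linear)
  have "F' ?z (v, 0) = (\<Sum>i\<in>UNIV. (v $ i) *\<^sub>R F' ?z (axis i 1, 0))"
   using linear_sum[OF lin, of "\<lambda>i. (v $ i) *\<^sub>R axis i 1" UNIV] linear_cmul[OF lin] basis_expansion[of v]
   by (simp add: scalar_mult_eq_scaleR)
  moreover have "gradient (\<lambda>x. H x t) (r y t) $ i = F' ?z (axis i 1, 0)" for i
   unfolding gradient_def using frechet_derivative_at[OF dx] by (simp add: fun_eq_iff)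
  ultimately show ?thesis by (simp add: inner_vec_def mult.commute)
 qed
 have "(r y t, t) \<in> S" using t by (intro surface_point)
 then obtain c where c: "c > 0" "gradient (\<lambda>x. H x t) (r y t) = c *\<^sub>R \<nu> (r y t) t"
  using grad[of t "r y t"] x by (auto simp: slice_def)
 have "((\<lambda>s. (r y t, s)) has_derivative (\<lambda>s. s *\<^sub>R (0, 1))) (at t)" by (auto intro!: derivative_eq_intros)
 from has_derivative_compose[OF this dF]
 have "((\<lambda>s. H (r y t) s) has_derivative (\<lambda>s. F' ?z (s *\<^sub>R (0, 1)))) (at t)" by simp
 then have "((\<lambda>s. H (r y t) s) has_vector_derivative F' ?z (0, 1)) (at t)"
  by (simp add: has_vector_derivative_def blinfun.scaleR_right del: scaleR_Pair)
 \<comment> \<open>\<open>t\<close> is an interior time, so the derivative within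
   \<open>{0..T}\<close> is the two-sided one.\<close>
 then have vd: "vector_derivative (\<lambda>s. H (r y t) s) (at t within {0..T}) = F' ?z (0, 1)"
  using t by (intro vector_derivative_at_within_ivl) auto
 have n1: "norm (\<nu> (r y t) t) = 1" using \<open>(r y t, t) \<in> S\<close> by (rule unit)
 have "F' ?z (0, 1) = - (c * (\<nu> (r y t) t \<bullet> ?b))"
  unfolding F0 gr[symmetric] c(2) by simp
 then show ?thesis unfolding vd c(2) using c(1) n1 by (simp add: N_def normal_def)
qed

text \<open>As \<open>mu_density\<close> is defined by \<open>THE\<close>, it is meaningful only if
  some defining function exists. The normal coordinate of the inverse tube map is one; its gradient
  on the surface is \<open>\<nu>\<close> divided by \<open>e\<close>.\<close>

lemma local_defining_function_exists:
 assumes q: "(y, t) \<in> Q"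
 shows "\<exists>U1 I1 H. local_defining_function T S \<nu> U1 I1 H \<and> r y t \<in> U1 \<and> t \<in> I1"
proof -
 let ?q0 = "proj k (y, t)"
 have q0: "?q0 \<in> Q" by (rule proj_Q[OF q])
 obtain \<theta> \<eta> where \<theta>: "\<theta> > 0" "\<eta> > 0" "cball ?q0 \<eta> \<subseteq> Q"
  and lip: "\<And>a b. a \<in> cball ?q0 \<eta> ==> b \<in> cball ?q0 \<eta> ==> \<theta> * dist a b \<le> dist (\<Psi> a) (\<Psi> b)"
  and low: "\<And>a v. a \<in> cball ?q0 \<eta> ==> \<theta> * norm v \<le> norm (D a v, snd v)"
  by (rule lower_Lipschitz[OF q0]) (rule that)
 define B where "B = ball ?q0 \<eta>"
 have B: "B \<subseteq> cball ?q0 \<eta>" "B \<subseteq> Q" "open B" "?q0 \<in> B" using \<theta> by (auto simp: B_def)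
 define V where "V = \<Psi> ` B"
 have V: "open V" unfolding V_def using B by (intro open_image)
 define g where "g = inv_into B \<Psi>"
 have injB: "inj_on \<Psi> B" using inj B(2) by (rule inj_on_subset)
 have gB: "g z \<in> B" and \<Psi>g: "\<Psi> (g z) = z" if "z \<in> V" for z
  using that unfolding g_def V_def by (auto intro: inv_into_into f_inv_into_f)
 have g\<Psi>: "g (\<Psi> p) = p" if "p \<in> B" for p unfolding g_def using that injB by (rule inv_into_f_f[rotated])
 have gcont: "continuous_on V g"
 proof (rule continuous_on_iff[THEN iffD2], intro ballI allI impI)
  fix z d assume z: "z \<in> V" and d: "(0::real) < d"
  show "\<exists>\<delta>>0. \<forall>z'\<in>V. dist z' z < \<delta> --> dist (g z') (g z) < d"
  proof (intro exI[of _ "\<theta> * d"] conjI ballI impI)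
   fix z' assume z': "z' \<in> V" "dist z' z < \<theta> * d"
   have "\<theta> * dist (g z') (g z) \<le> dist z' z"
    using lip[OF subsetD[OF B(1) gB[OF z'(1)]] subsetD[OF B(1) gB[OF z]]] \<Psi>g[OF z'(1)] \<Psi>g[OF z] by simp
   then have "\<theta> * dist (g z') (g z) < \<theta> * d" using z' by simp
   then show "dist (g z') (g z) < d" using \<theta>(1) by simp
  qed (use \<theta> d in simp)
 qed
 let ?L = "\<lambda>p v. (D p v, snd v)"
 \<comment> \<open>\<open>M p\<close> inverts the space-time derivative at \<open>p\<close>, and its
   norm is at most \<open>1 / \<theta>\<close> throughout \<open>B\<close>.\<close>
 define M where "M p = inv (?L p)" for p
 have lin: "linear (?L p)" for p
  by (intro linearI) (auto simp: blinfun.add_right blinfun.scaleR_right)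
 have injL: "inj (?L p)" if "p \<in> B" for p
 proof (rule linear_injective_0[THEN iffD2, OF lin, rule_format])
  fix v assume "?L p v = 0"
  then have "\<theta> * norm v \<le> 0" using low[of p v] that B(1) by auto
  then show "v = 0" using \<theta>(1) by (simp add: mult_le_0_iff)
 qed
 have M_left: "M p (?L p v) = v" if "p \<in> B" for p v unfolding M_def by (rule inv_f_f[OF injL[OF that]])
 have M_right: "?L p (M p v) = v" if "p \<in> B" for p v
  unfolding M_def by (rule surj_f_inv_f[OF linear_inj_imp_surj[OF lin injL[OF that]]])
 have linM: "linear (M p)" if "p \<in> B" for p
 proof (rule linearI)
  show "M p (u + v) = M p u + M p v" for u v
   using M_left[OF that, of "M p u + M p v"] M_right[OF that, of u] M_right[OF that, of v] linear_add[OF lin[of p], of "M p u" "M p v"] by metis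
  show "M p (c *\<^sub>R v) = c *\<^sub>R M p v" for c v
   using M_left[OF that, of "c *\<^sub>R M p v"] M_right[OF that, of v] linear_cmul[OF lin[of p], of c "M p v"] by metis
 qed
 have Mnorm: "\<theta> * norm (M p v) \<le> norm v" if "p \<in> B" for p v
  using low[of p "M p v"] M_right[OF that, of v] that B(1) by auto
 have dg: "(g has_derivative M (g z)) (at z)" if z: "z \<in> V" for z
 proof (rule has_derivative_inverse_basic)
  show "(\<Psi> has_derivative ?L (g z)) (at (g z))"
   unfolding \<Psi>_def using gB[OF z] B(2) by (intro has_derivative_Pair der has_derivative_snd has_derivative_ident) auto
  show "bounded_linear (M (g z))" using linM[OF gB[OF z]] by (simp add: linear_linear)
  show "M (g z) \<circ> ?L (g z) = id" using M_left[OF gB[OF z]] by (simp add: fun_eq_iff)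
  show "continuous (at z) g" using gcont V z continuous_on_eq_continuous_at by blast
  show "open V" "z \<in> V" by (rule V, rule z)
  show "\<Psi> (g z') = z'" if "z' \<in> V" for z' by (rule \<Psi>g[OF that])
 qed
 define h' where "h' z = Blinfun (\<lambda>v. fst (M (g z) v) $ k)" for z
 have h': "blinfun_apply (h' z) = (\<lambda>v. fst (M (g z) v) $ k)" if "z \<in> V" for z
 proof -
  have "bounded_linear (M (g z))" using linM[OF gB[OF that]] by (simp add: linear_linear)
  from bounded_linear_compose[OF bounded_linear_vec_nth bounded_linear_compose[OF bounded_linear_fst this]]
  have "bounded_linear (\<lambda>v. fst (M (g z) v) $ k)" .
  then show ?thesis unfolding h'_def by (rule bounded_linear_Blinfun_apply)
 qed
 have dh: "((\<lambda>z. fst (g z) $ k) has_derivative h' z) (at z)" if "z \<in> V" for z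
  unfolding h'[OF that] by (intro bounded_linear.has_derivative[OF bounded_linear_vec_nth] has_derivative_fst dg that)
 have "continuous_on V (\<lambda>z. D (g z))"
  by (rule continuous_on_compose2[OF cont_D gcont]) (use gB B(2) in blast)
 have contM: "continuous_on V h'"
 proof (rule continuous_on_iff[THEN iffD2], intro ballI allI impI)
  fix z d assume z: "z \<in> V" and d: "(0::real) < d"
  from \<open>continuous_on V (\<lambda>z. D (g z))\<close> z obtain \<delta> where \<delta>: "\<delta> > 0"
   "\<And>z'. z' \<in> V ==> dist z' z < \<delta> ==> dist (D (g z')) (D (g z)) < d / 2 * \<theta>\<^sup>2"
   using continuous_on_iff[THEN iffD1, rule_format, of V "\<lambda>z. D (g z)" z "d / 2 * \<theta>\<^sup>2"] \<theta>(1) d by auto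
  show "\<exists>\<delta>>0. \<forall>z'\<in>V. dist z' z < \<delta> --> dist (h' z') (h' z) < d"
  proof (intro exI[of _ \<delta>] conjI ballI impI)
   fix z' assume z': "z' \<in> V" "dist z' z < \<delta>"
   have "norm (h' z' - h' z) \<le> d / 2"
   proof (rule norm_blinfun_bound)
    fix u
    let ?a = "M (g z') u" and ?b = "M (g z) u"
    note p = gB[OF z] gB[OF z'(1)]
    \<comment> \<open>The difference of two inverses is an inverse applied to the difference of the
      derivatives, so continuity of \<open>D\<close> passes to \<open>h'\<close>.\<close>
    have "?L (g z') (?a - ?b) = ((D (g z) - D (g z')) ?b, 0)"
     using M_right[OF p(2), of u] M_right[OF p(1), of u] by (auto simp: blinfun.diff_right blinfun.diff_left prod_eq_iff)
    then have "\<theta> * norm (?a - ?b) \<le> norm ((D (g z) - D (g z')) ?b)"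
     using low[of "g z'" "?a - ?b"] p(2) B(1) by (auto simp: norm_prod_def)
    also have "\<dots> \<le> norm (D (g z) - D (g z')) * norm ?b" by (rule norm_blinfun)
    finally have "\<theta> * (\<theta> * norm (?a - ?b)) \<le> norm (D (g z) - D (g z')) * (\<theta> * norm ?b)"
     using \<theta>(1) by (simp add: mult.left_commute mult_left_mono)
    also have "\<dots> \<le> (d / 2 * \<theta>\<^sup>2) * norm u"
     using \<delta>(2)[OF z'] Mnorm[OF p(1), of u] \<theta>(1) d by (intro mult_mono) (auto simp: dist_norm norm_minus_commute)
    finally have "\<theta>\<^sup>2 * norm (?a - ?b) \<le> \<theta>\<^sup>2 * (d / 2 * norm u)" by (simp add: power2_eq_square mult_ac)
    then have ab: "norm (?a - ?b) \<le> d / 2 * norm u" using \<theta>(1) by simp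
    have "norm ((h' z' - h' z) u) = \<bar>fst (?a - ?b) $ k\<bar>"
     using h'[OF z] h'[OF z'(1)] by (simp add: blinfun.diff_left)
    also have "\<dots> \<le> norm (?a - ?b)"
     by (rule order_trans[OF component_le_norm_cart]) (metis norm_fst_le prod.collapse)
    finally show "norm ((h' z' - h' z) u) \<le> d / 2 * norm u" using ab by simp
   qed (use d in simp)
   then show "dist (h' z') (h' z) < d" using d by (simp add: dist_norm)
  qed (rule \<delta>)
 qed
 have zV: "(r y t, t) \<in> V" unfolding V_def using \<Psi>_flat[of "(y, t)"] B(4) by (metis fst_conv imageI snd_conv)
 obtain A A' where A: "open A" "open A'" "(r y t, t) \<in> A \<times> A'" "A \<times> A' \<subseteq> V"
  using V zV by (rule open_prod_elim)
 have "open (A' \<inter> Io)" "t \<in> A' \<inter> Io" using A open_Io q by (auto simp: Q_def)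
 then obtain d where d: "d > 0" "ball t d \<subseteq> A' \<inter> Io" using openE by blast
 \<comment> \<open>The intersection with \<open>U\<close> ensures that surface points in
   \<open>U1\<close> belong to this chart.\<close>
 define U1 where "U1 = A \<inter> U"
 have U1: "open U1" "r y t \<in> U1"
  using A open_U surface_point[of y t] q Q_subset by (auto simp: U1_def)
 have sub: "U1 \<times> ball t d \<subseteq> V" using A(4) d(2) by (auto simp: U1_def)
 let ?H = "\<lambda>x s. fst (g (x, s)) $ k"
 have "local_defining_function T S \<nu> U1 (ball t d) ?H"
  unfolding local_defining_function_def
 proof (intro conjI ballI)
  show "open U1" by (rule U1)
  have "ball t d \<subseteq> {0..T}" using d(2) by (auto simp: Io_def)
  moreover have "openin (top_of_set {0..T}) ({0..T} \<inter> ball t d)" by (rule openin_open_Int) simp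
  ultimately show "time_interval T (ball t d)"
   unfolding time_interval_def by (simp add: is_interval_ball_real Int_absorb1)
  show "C1_on (U1 \<times> ball t d) (\<lambda>(x, t). ?H x t)"
   unfolding C1_on_def
  proof (intro exI[of _ h'] conjI ballI)
   show "((\<lambda>(x, t). ?H x t) has_derivative h' z) (at z within U1 \<times> ball t d)" if "z \<in> U1 \<times> ball t d" for z
   proof -
    have "(\<lambda>(x, t). ?H x t) = (\<lambda>z. fst (g z) $ k)" by auto
    then show ?thesis using has_derivative_at_withinI[OF dh[of z]] that sub by auto
   qed
   show "continuous_on (U1 \<times> ball t d) h'" using contM sub by (rule continuous_on_subset)
  qed
  \<comment> \<open>Surface points in the neighbourhood have flat parameters, so their normal
    coordinate vanishes.\<close>
  have point: "\<exists>y'. (y', s) \<in> B \<and> y' \<in> flat_cube k \<and> x = r y' s \<and> g (x, s) = (y', s)"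
   if "s \<in> ball t d" "x \<in> slice S s \<inter> U1" for s x
  proof -
   have "(x, s) \<in> \<Psi> ` B" using that sub by (auto simp: V_def)
   moreover have "(x, s) \<in> S" "x \<in> U" using that by (auto simp: slice_def U1_def)
   ultimately obtain y' where y': "(y', s) \<in> B" "y' \<in> flat_cube k" "x = r y' s"
    using surface_in_image[OF B(2)] by metis
   have "\<Psi> (y', s) = (x, s)" using \<Psi>_flat[of "(y', s)"] y' by (simp add: proj_def flat_cube_flatten)
   then show ?thesis using g\<Psi>[OF y'(1)] y' by auto
  qed
  fix s assume s: "s \<in> ball t d"
  show "{x \<in> U1. ?H x s = 0} = slice S s \<inter> U1"
  proof (intro equalityI subsetI)
   fix x assume x: "x \<in> {x \<in> U1. ?H x s = 0}"
   then have xV: "(x, s) \<in> V" using sub s by auto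
   let ?p = "g (x, s)"
   have p: "?p \<in> Q" "\<Psi> ?p = (x, s)" using gB[OF xV] B(2) \<Psi>g[OF xV] by auto
   \<comment> \<open>A vanishing normal coordinate means that the parameter is its own foot; its
     image therefore lies on the surface.\<close>
   have "proj k ?p = ?p" using proj_decomp[of k ?p] x by simp
   then have "\<Psi> (proj k ?p) = (x, s)" using p(2) by (simp only:)
   then have "(r (fst ?p) (snd ?p), snd ?p) = (x, s)" unfolding \<Psi>_flat .
   moreover have "(r (fst ?p) (snd ?p), snd ?p) \<in> S"
    using p(1) Q_subset by (intro surface_point) auto
   ultimately show "x \<in> slice S s \<inter> U1" using x by (auto simp: slice_def)
  next
   fix x assume x: "x \<in> slice S s \<inter> U1"
   then show "x \<in> {x \<in> U1. ?H x s = 0}" using point[OF s x] by (auto simp: flat_cube_def)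
  qed
  fix x assume x: "x \<in> slice S s \<inter> U1"
  obtain y' where y': "(y', s) \<in> B" "y' \<in> flat_cube k" "x = r y' s" "g (x, s) = (y', s)"
   using point[OF s x] by blast
  have xV: "(x, s) \<in> V" using sub s x by auto
  let ?p = "(y', s)"
  have pp: "proj k ?p = ?p" using y' by (simp add: proj_def flat_cube_flatten)
  have "((\<lambda>x. (x, s)) has_derivative (\<lambda>v. (v, 0))) (at x)" by (auto intro!: derivative_eq_intros)
  from has_derivative_compose[OF this dh[OF xV]]
  have dx: "((\<lambda>x. ?H x s) has_derivative (\<lambda>v. h' (x, s) (v, 0))) (at x)" .
  have "gradient (\<lambda>x. ?H x s) x $ i = ((1 / e) *\<^sub>R \<nu> x s) $ i" for i
  proof -
   have "gradient (\<lambda>x. ?H x s) x $ i = fst (M ?p (axis i 1, 0)) $ k"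
    unfolding gradient_def using frechet_derivative_at[OF dx, symmetric] h'[OF xV] y'(4) by simp
   \<comment> \<open>\<open>conormal\<close> reads off the normal coordinate of the inverse
     derivative.\<close>
   moreover have "e * fst (M ?p (axis i 1, 0)) $ k = N ?p \<bullet> (axis i 1, 0)"
    using conormal[of ?p "M ?p (axis i 1, 0)"] M_right[OF y'(1), of "(axis i 1, 0)"] y'(1) B(2) unfolding pp by auto
   ultimately show ?thesis using e_pos y'(3) by (simp add: N_def normal_def inner_axis field_simps)
  qed
  then have "gradient (\<lambda>x. ?H x s) x = (1 / e) *\<^sub>R \<nu> x s" by (simp add: vec_eq_iff)
  then show "\<exists>c>0. gradient (\<lambda>x. ?H x s) x = c *\<^sub>R \<nu> x s" using e_pos by (intro exI[of _ "1 / e"]) simp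
 qed
 then show ?thesis using U1(2) d(1) by (intro exI[of _ U1] exI[of _ "ball t d"]) auto
qed

lemma mu_density_eq:
 assumes q: "(y, t) \<in> Q" shows "mu_density T S \<nu> (r y t) t = snd (N (y, t))"
 unfolding mu_density_def
proof (rule the_equality)
 obtain U1 I1 H where "local_defining_function T S \<nu> U1 I1 H" "r y t \<in> U1" "t \<in> I1"
  using local_defining_function_exists[OF q] by blast
 then show "\<exists>U I H. local_defining_function T S \<nu> U I H \<and> r y t \<in> U \<and> t \<in> I \<and>
  snd (N (y, t)) = vector_derivative (\<lambda>s. H (r y t) s) (at t within {0..T}) / norm (gradient (\<lambda>x. H x t) (r y t))"
  using mu_quotient[OF q] by metis
next
 fix c assume "\<exists>U I H. local_defining_function T S \<nu> U I H \<and> r y t \<in> U \<and> t \<in> I \<and>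
  c = vector_derivative (\<lambda>s. H (r y t) s) (at t within {0..T}) / norm (gradient (\<lambda>x. H x t) (r y t))"
 then show "c = snd (N (y, t))" using mu_quotient[OF q] by blast
qed

end

section \<open>Surface measures\<close>

text \<open>The end points form a null set and the completion has the same almost everywhere
  statements, so time can run through the open interval with \<open>lborel\<close>.\<close>

lemma AE_lebesgue_on_Icc_iff:
 fixes T :: real
 shows "(AE t in lebesgue_on {0..T}. P t) \<longleftrightarrow> (AE t in lborel. 0 < t \<and> t < T --> P t)"
proof -
 have "(AE t in lebesgue_on {0..T}. P t) \<longleftrightarrow> (AE t in lebesgue. t \<in> {0..T} --> P t)"
  by (rule AE_restrict_space_iff) auto
 also have "\<dots> \<longleftrightarrow> (AE t in lborel. t \<in> {0..T} --> P t)" by (rule AE_completion_iff)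
 also have "\<dots> \<longleftrightarrow> (AE t in lborel. 0 < t \<and> t < T --> P t)"
 proof
  assume "AE t in lborel. t \<in> {0..T} --> P t"
  then show "AE t in lborel. 0 < t \<and> t < T --> P t" by eventually_elim auto
 next
  assume "AE t in lborel. 0 < t \<and> t < T --> P t"
  then show "AE t in lborel. t \<in> {0..T} --> P t"
   using AE_lborel_singleton[of 0] AE_lborel_singleton[of T] by eventually_elim auto
 qed
 finally show ?thesis .
qed

lemma AE_null_setE:
 assumes "AE x in M. P x"
 obtains Z where "Z \<in> null_sets M" "\<And>x. x \<in> space M ==> x \<notin> Z ==> P x"
proof -
 obtain Z where "{x\<in>space M. \<not> P x} \<subseteq> Z" "Z \<in> null_sets M"
  using assms by (auto simp: eventually_ae_filter)
 then show ?thesis by (intro that[of Z]) auto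
qed

lemma borel_measurable_Pair_const [measurable]:
 "(\<lambda>y::'a::euclidean_space. (y, t::'b::euclidean_space)) \<in> borel_measurable borel"
 by (intro borel_measurable_continuous_onI continuous_intros)

text \<open>Surface points see a parameter only through \<open>flatten k y\<close>, so a null set in
  the cube has to be tested on whole lines in the direction \<open>k\<close>.\<close>

definition line_measure :: "(real^'n) set => 'n => real^'n => ennreal" where
 "line_measure Z k y = (\<integral>\<^sup>+s. indicator Z (y + s *\<^sub>R axis k 1) \<partial>lborel)"

lemma line_integrand_measurable:
 fixes Z :: "(real^'n) set"
 assumes [measurable]: "Z \<in> sets borel"
 shows "(\<lambda>z. indicator Z (fst z + snd z *\<^sub>R axis k 1) :: ennreal) \<in> borel_measurable (borel :: ((real^'n) \<times> real) measure)"
proof -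
 note [measurable] = borel_measurable_fst_snd
 show ?thesis by measurable
qed

lemma line_measure_measurable:
 fixes Z :: "(real^'n) set"
 assumes [measurable]: "Z \<in> sets borel"
 shows "line_measure Z k \<in> borel_measurable borel"
proof -
 have "(\<lambda>z. indicator Z (fst z + snd z *\<^sub>R axis k 1) :: ennreal) \<in> borel_measurable ((lborel :: (real^'n) measure) \<Otimes>\<^sub>M (lborel :: real measure))"
  using line_integrand_measurable[OF assms, of k] by (simp add: lborel_prod)
 then have "(\<lambda>y. \<integral>\<^sup>+s. indicator Z (fst (y, s) + snd (y, s) *\<^sub>R axis k 1) \<partial>lborel) \<in> borel_measurable (lborel :: (real^'n) measure)"
  by (rule lborel.borel_measurable_nn_integral_fst)
 then show ?thesis unfolding line_measure_def[abs_def] by simp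
qed

lemma line_measure_flatten: "Z \<in> sets borel ==> line_measure Z k (flatten k y) = line_measure Z k y"
proof -
 assume [measurable]: "Z \<in> sets borel"
 have m: "(\<lambda>s. indicator Z (flatten k y + s *\<^sub>R axis k 1) :: ennreal) \<in> borel_measurable borel" by measurable
 have "line_measure Z k y = (\<integral>\<^sup>+s. indicator Z (flatten k y + (y $ k + s) *\<^sub>R axis k 1) \<partial>lborel)"
  unfolding line_measure_def by (subst (1) flatten_decomp[of k y, symmetric]) (simp only: scaleR_left_distrib add.assoc)
 also have "\<dots> = line_measure Z k (flatten k y)"
  unfolding line_measure_def using nn_integral_lborel_translation[OF m, of "y $ k"] by simp
 finally show ?thesis by simp
qed

text \<open>The indicator of \<open>Z\<close> at \<open>y + s *\<^sub>R axis k 1\<close> is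
  integrated over \<open>(y, s)\<close>: for each \<open>s\<close> the integral over
  \<open>y\<close> is the measure of a translate of \<open>Z\<close>, hence \<open>0\<close>, and
  Fubini gives the statement on lines.\<close>

lemma AE_line_measure_zero:
 assumes Z: "Z \<in> null_sets (lborel :: (real^'n) measure)"
 shows "AE y in lborel. line_measure Z k y = 0"
proof -
 have [measurable]: "Z \<in> sets borel" using null_setsD2[OF Z] by simp
 let ?F = "\<lambda>z :: (real^'n) \<times> real. indicator Z (fst z + snd z *\<^sub>R axis k 1) :: ennreal"
 have F: "?F \<in> borel_measurable borel" by (rule line_integrand_measurable) simp
 have "(\<integral>\<^sup>+y. line_measure Z k y \<partial>lborel) = (\<integral>\<^sup>+z. ?F z \<partial>lborel)"
  unfolding lborel_nn_integral_fst[OF F] line_measure_def by simp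
 also have "\<dots> = (\<integral>\<^sup>+s. \<integral>\<^sup>+y. ?F (y, s) \<partial>lborel \<partial>lborel)" by (rule lborel_nn_integral_snd[OF F])
 also have "\<dots> = (\<integral>\<^sup>+(s::real). 0 \<partial>lborel)"
 proof (rule nn_integral_cong)
  fix s :: real
  have m: "(indicator Z :: real^'n => ennreal) \<in> borel_measurable borel" by simp
  show "(\<integral>\<^sup>+y. ?F (y, s) \<partial>lborel) = 0"
   using nn_integral_lborel_translation[OF m, of "s *\<^sub>R axis k 1"] null_setsD1[OF Z] by (simp add: add.commute)
 qed
 finally have "(\<integral>\<^sup>+y. line_measure Z k y \<partial>lborel) = 0" by simp
 then show ?thesis using line_measure_measurable[of Z k] by (subst (asm) nn_integral_0_iff_AE) simp_all
qed

lemma AE_lines: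
 fixes P :: "real^'n => bool"
 assumes "AE y in lborel. P y"
 shows "AE y in lborel. AE s in lborel. P (flatten k y + s *\<^sub>R axis k 1)"
proof -
 obtain Z where Z: "Z \<in> null_sets lborel" "\<And>y. y \<notin> Z ==> P y" using AE_null_setE[OF assms] by auto
 have [measurable]: "Z \<in> sets borel" using null_setsD2[OF Z(1)] by simp
 show ?thesis using AE_line_measure_zero[OF Z(1), of k]
 proof (rule eventually_mono)
  fix y assume "line_measure Z k y = 0"
  then have "line_measure Z k (flatten k y) = 0" by (simp add: line_measure_flatten)
  then have "AE s in lborel. indicator Z (flatten k y + s *\<^sub>R axis k 1) = (0::ennreal)"
   unfolding line_measure_def by (subst (asm) nn_integral_0_iff_AE) simp_all
  then show "AE s in lborel. P (flatten k y + s *\<^sub>R axis k 1)"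
   by (rule eventually_mono) (use Z(2) in \<open>auto simp: indicator_def split: if_splits\<close>)
 qed
qed

text \<open>The indicator of the bad set is averaged over shifts \<open>s\<close> in
  \<open>{0..1}\<close> along \<open>b\<close>. Integrating over \<open>s\<close> first gives
  \<open>0\<close>; integrating over \<open>om\<close> first gives the measure of the bad set,
  because the interval has length \<open>1\<close>.\<close>

lemma AE_coordinate:
 fixes b :: "'a::euclidean_space"
 assumes "AE s in lborel. R (s::real)" and b: "b \<in> Basis"
 shows "AE om in lborel. R (om \<bullet> b)"
proof -
 obtain Y where Y: "Y \<in> null_sets lborel" "\<And>s. s \<notin> Y ==> R s" using AE_null_setE[OF assms(1)] by auto
 have [measurable]: "Y \<in> sets borel" using null_setsD2[OF Y(1)] by simp
 note [measurable] = borel_measurable_fst_snd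
 let ?F = "\<lambda>z :: 'a \<times> real. indicator {0..1} (snd z) * indicator Y ((fst z + snd z *\<^sub>R b) \<bullet> b) :: ennreal"
 have F: "?F \<in> borel_measurable borel" by measurable
 let ?A = "\<integral>\<^sup>+(om::'a). indicator Y (om \<bullet> b) \<partial>lborel :: ennreal"
 have mA: "(\<lambda>om::'a. indicator Y (om \<bullet> b) :: ennreal) \<in> borel_measurable borel" by measurable
 have "(\<integral>\<^sup>+z. ?F z \<partial>lborel) = (\<integral>\<^sup>+om. \<integral>\<^sup>+s. ?F (om, s) \<partial>lborel \<partial>lborel)" by (rule lborel_nn_integral_fst[OF F])
 also have "\<dots> = (\<integral>\<^sup>+(om::'a). 0 \<partial>lborel)"
 proof (rule nn_integral_cong)
  fix om :: 'a
  have m: "(indicator Y :: real => ennreal) \<in> borel_measurable borel" by simp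
  have "(\<integral>\<^sup>+s. ?F (om, s) \<partial>lborel) \<le> (\<integral>\<^sup>+s. indicator Y (om \<bullet> b + s) \<partial>lborel)"
   using b by (intro nn_integral_mono) (auto simp: indicator_def inner_add_left)
  also have "\<dots> = 0" using nn_integral_lborel_translation[OF m, of "om \<bullet> b"] null_setsD1[OF Y(1)] by simp
  finally show "(\<integral>\<^sup>+s. ?F (om, s) \<partial>lborel) = 0" by simp
 qed
 finally have 0: "(\<integral>\<^sup>+z. ?F z \<partial>lborel) = 0" by simp
 have "(\<integral>\<^sup>+z. ?F z \<partial>lborel) = (\<integral>\<^sup>+s. \<integral>\<^sup>+om. ?F (om, s) \<partial>lborel \<partial>lborel)" by (rule lborel_nn_integral_snd[OF F])
 also have "\<dots> = (\<integral>\<^sup>+s. indicator {0..1} s * ?A \<partial>(lborel :: real measure))"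
 proof (rule nn_integral_cong)
  fix s :: real
  have "(\<integral>\<^sup>+om. ?F (om, s) \<partial>lborel) = indicator {0..1} s * (\<integral>\<^sup>+om. indicator Y ((om + s *\<^sub>R b) \<bullet> b) \<partial>lborel)"
   by (simp add: nn_integral_cmult)
  also have "(\<integral>\<^sup>+om. indicator Y ((om + s *\<^sub>R b) \<bullet> b) \<partial>lborel) = ?A"
   using nn_integral_lborel_translation[OF mA, of "s *\<^sub>R b"] by (simp add: add.commute)
  finally show "(\<integral>\<^sup>+om. ?F (om, s) \<partial>lborel) = indicator {0..1} s * ?A" .
 qed
 also have "\<dots> = ?A" by (simp add: nn_integral_multc)
 finally have "?A = 0" using 0 by simp
 then have "AE om in lborel. indicator Y ((om::'a) \<bullet> b) = (0::ennreal)"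
  by (subst (asm) nn_integral_0_iff_AE) simp_all
 then show ?thesis by (rule eventually_mono) (use Y(2) in \<open>auto simp: indicator_def split: if_splits\<close>)
qed

section \<open>Surface measure in a chart\<close>

context chart begin

definition R0 :: "(real^'n) \<times> real => (real^'n) \<times> real" where
 "R0 q = (if q \<in> Q then (case q of (y, t) => (r y t, t)) else 0)"

text \<open>The division by \<open>2\<close> compensates for integration over the whole cube, where
  \<open>y $ k\<close> runs through an interval of length \<open>2\<close>.\<close>

definition weight :: "(real^'n) \<times> real => real" where
 "weight q = indicator Q q *\<^sub>R ((case q of (y, t) => volume_element k r y t) / 2)"

lemma R0_eq: "(y, t) \<in> Q ==> R0 (y, t) = (r y t, t)" by (simp add: R0_def)

lemma R0_measurable [measurable]: "R0 \<in> borel_measurable borel"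
 unfolding R0_def[abs_def] using open_Q
 by (intro borel_measurable_continuous_on_if cont_surface_map continuous_on_const borel_open)

lemma weight_measurable [measurable]: "weight \<in> borel_measurable borel"
 unfolding weight_def[abs_def] using open_Q
 by (intro borel_measurable_continuous_on_indicator continuous_on_divide cont_volume_element continuous_on_const borel_open) auto

lemma weight_pos: "q \<in> Q ==> weight q > 0" using volume_element_pos by (cases q) (auto simp: weight_def)

lemma weight_zero: "q \<notin> Q ==> weight q = 0" by (simp add: weight_def)

lemma R0_in: "q \<in> Q ==> R0 q \<in> (U \<times> Io) \<inter> S"
 using surface_point Q_subset by (cases q) (auto simp: R0_eq Q_def Io_def)

context
 fixes \<sigma> :: "real => (real^'n) measure"
 assumes sm: "surface_measures T S \<sigma>" and closed_all: "\<forall>t\<in>{0..T}. closed (slice S t)"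
begin

lemma sets_\<sigma>: "t \<in> Io ==> sets (\<sigma> t) = sets borel" and space_\<sigma>: "t \<in> Io ==> space (\<sigma> t) = UNIV"
proof -
 assume "t \<in> Io"
 then show *: "sets (\<sigma> t) = sets borel" using sm by (auto simp: surface_measures_def Io_def)
 show "space (\<sigma> t) = UNIV" using sets_eq_imp_space_eq[OF *] by simp
qed

lemma surface_measure_eq:
 assumes t: "t \<in> Io" and A: "A \<in> sets borel" "A \<subseteq> U"
 shows "emeasure (\<sigma> t) A = (\<integral>\<^sup>+y. ennreal (weight (y, t)) * indicator A (fst (R0 (y, t))) \<partial>lborel)"
proof -
 note [measurable] = A(1) borel_measurable_fst_snd
 have "t \<in> {0..T}" "t \<in> I" using t by (auto simp: Io_def)
 with sm lp A have "emeasure (\<sigma> t) A = (\<integral>\<^sup>+y\<in>cube. ennreal (volume_element k r y t) * indicator A (r y t) \<partial>lborel) / 2"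
  unfolding surface_measures_def by blast
 also have "(\<integral>\<^sup>+y\<in>cube. ennreal (volume_element k r y t) * indicator A (r y t) \<partial>lborel) =
  (\<integral>\<^sup>+y. (ennreal (weight (y, t)) * indicator A (fst (R0 (y, t)))) * 2 \<partial>lborel)"
 proof (rule nn_integral_cong)
  fix y
  have "ennreal (volume_element k r y t) = ennreal (volume_element k r y t / 2) * 2" if "(y, t) \<in> Q"
   using volume_element_pos[OF that] by (simp flip: ennreal_numeral ennreal_mult)
  then show "ennreal (volume_element k r y t) * indicator A (r y t) * indicator cube y =
   (ennreal (weight (y, t)) * indicator A (fst (R0 (y, t)))) * 2"
   using t by (cases "y \<in> cube") (auto simp: weight_def R0_def Q_def indicator_def mult_ac)
 qed
 also have "\<dots> = (\<integral>\<^sup>+y. ennreal (weight (y, t)) * indicator A (fst (R0 (y, t))) \<partial>lborel) * 2"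
  by (rule nn_integral_multc) measurable
 finally show ?thesis by (simp add: mult_divide_eq_ennreal)
qed

text \<open>In a chart the surface measure is the image of Lebesgue measure with the positive
  density \<open>weight\<close>, so null sets of the surface have null preimages in the
  cube.\<close>

lemma chart_AE:
 assumes t: "t \<in> Io" and P: "AE x in \<sigma> t. x \<in> slice S t --> P x"
 shows "AE y in lborel. y \<in> cube --> P (r y t)"
proof -
 obtain Z where Z: "Z \<in> null_sets (\<sigma> t)" "\<And>x. x \<notin> Z ==> x \<in> slice S t --> P x"
  using AE_null_setE[OF P] space_\<sigma>[OF t] by auto
 have Zb [measurable]: "Z \<inter> U \<in> sets borel" using null_setsD2[OF Z(1)] sets_\<sigma>[OF t] open_U by auto
 note [measurable] = borel_measurable_fst_snd
 have "emeasure (\<sigma> t) (Z \<inter> U) \<le> emeasure (\<sigma> t) Z" using null_setsD2[OF Z(1)] by (intro emeasure_mono) auto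
 then have "emeasure (\<sigma> t) (Z \<inter> U) = 0" using null_setsD1[OF Z(1)] by simp
 then have "AE y in lborel. ennreal (weight (y, t)) * indicator (Z \<inter> U) (fst (R0 (y, t))) = 0"
  by (subst (asm) surface_measure_eq[OF t Zb], simp, subst (asm) nn_integral_0_iff_AE) simp_all
 then show ?thesis
 proof (rule eventually_mono, intro impI)
  fix y assume *: "ennreal (weight (y, t)) * indicator (Z \<inter> U) (fst (R0 (y, t))) = 0" and "y \<in> cube"
  then have q: "(y, t) \<in> Q" using t by (auto simp: Q_def)
  then have "r y t \<notin> Z \<inter> U" using * weight_pos[OF q] by (auto simp: R0_eq ennreal_eq_0_iff)
  then show "P (r y t)" using Z(2)[of "r y t"] surface_point[of y t] q Q_subset by (auto simp: slice_def)
 qed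
qed

text \<open>A bad surface point is the image of a whole normal segment of bad parameters, so the
  null set \<open>Z\<close> has positive measure on that line, which happens for almost no
  \<open>y\<close>.\<close>

lemma surface_AE:
 assumes t: "t \<in> Io" and P: "AE y in lborel. y \<in> cube \<and> flatten k y \<in> B --> P (r y t)"
 shows "AE x in \<sigma> t. x \<in> (\<lambda>y. r y t) ` {y \<in> cube. flatten k y \<in> B} --> P x"
proof -
 have tI: "t \<in> I" "t \<in> {0..T}" using t by (auto simp: Io_def)
 obtain Z where Z: "Z \<in> null_sets lborel" "\<And>y. y \<notin> Z ==> y \<in> cube \<and> flatten k y \<in> B --> P (r y t)"
  using AE_null_setE[OF P] by auto
 have Zb: "Z \<in> sets borel" using null_setsD2[OF Z(1)] by simp
 note [measurable] = Zb borel_measurable_fst_snd line_measure_measurable[OF Zb, of k]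
 obtain g where g: "homeomorphism (flat_cube k) (slice S t \<inter> U) (\<lambda>y. r y t) g" using r_hom[OF tI(1)] by blast
 have gr: "g (r y t) = flatten k y" if "y \<in> cube" for y
  using homeomorphism_apply1[OF g flatten_cube[OF that, of k]] by (simp add: r_flatten)
 define C where "C = slice S t \<inter> U"
 have [measurable]: "C \<in> sets borel" unfolding C_def using bspec[OF closed_all tI(2)] open_U by auto
 define g' where "g' x = (if x \<in> C then g x else 0)" for x
 have [measurable]: "g' \<in> borel_measurable borel"
 proof -
  have Cb: "C \<in> sets borel" by simp
  have gc: "continuous_on C g" using g by (simp add: homeomorphism_def C_def)
  show ?thesis unfolding g'_def by (rule borel_measurable_continuous_on_if[OF Cb gc continuous_on_const])
 qed
 \<comment> \<open>The image of \<open>Z\<close> need not be Borel; \<open>A\<close> is a Borel set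
   that contains the bad points, defined through the inverse chart.\<close>
 define A where "A = {x. x \<in> C \<and> line_measure Z k (g' x) \<noteq> 0}"
 have A: "A \<in> sets borel" unfolding A_def by measurable
 have AU: "A \<subseteq> U" by (auto simp: A_def C_def)
 have "emeasure (\<sigma> t) A = (\<integral>\<^sup>+(y::real^'n). 0 \<partial>lborel)"
  unfolding surface_measure_eq[OF t A AU]
 proof (rule nn_integral_cong_AE, rule eventually_mono[OF AE_line_measure_zero[OF Z(1), of k]])
  fix y assume y: "line_measure Z k y = 0"
  show "ennreal (weight (y, t)) * indicator A (fst (R0 (y, t))) = 0"
  proof (cases "(y, t) \<in> Q")
   case True
   then have yc: "y \<in> cube" by (simp add: Q_def)
   have "r y t \<notin> A"
    using y line_measure_flatten[OF Zb, of k y] gr[OF yc] by (auto simp: A_def g'_def)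
   then show ?thesis using True by (simp add: R0_eq)
  qed (simp add: weight_zero)
 qed
 then have "A \<in> null_sets (\<sigma> t)" using A sets_\<sigma>[OF t] by auto
 moreover have "{x \<in> space (\<sigma> t). \<not> (x \<in> (\<lambda>y. r y t) ` {y \<in> cube. flatten k y \<in> B} --> P x)} \<subseteq> A"
 proof
  fix x assume "x \<in> {x \<in> space (\<sigma> t). \<not> (x \<in> (\<lambda>y. r y t) ` {y \<in> cube. flatten k y \<in> B} --> P x)}"
  then obtain y where y: "y \<in> cube" "flatten k y \<in> B" "x = r y t" "\<not> P (r y t)" by auto
  have xC: "x \<in> C" using surface_point[OF y(1) tI(1)] y(3) by (auto simp: C_def slice_def)
  have "(\<integral>\<^sup>+s. indicator {-1<..<1::real} s \<partial>lborel) \<le> line_measure Z k (flatten k y)"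
   unfolding line_measure_def
  proof (rule nn_integral_mono)
   fix s :: real
   let ?y = "flatten k y + s *\<^sub>R axis k 1"
   show "indicator {-1<..<1} s \<le> (indicator Z ?y :: ennreal)"
   proof (cases "s \<in> {-1<..<1}")
    case True
    have f: "flatten k ?y = flatten k y" by (auto simp: flatten_def vec_eq_iff axis_def)
    have "?y \<in> cube" using True y(1) by (auto simp: cube_def flatten_def axis_def)
    moreover have "r ?y t = r y t" using f r_flatten[of ?y t] r_flatten[of y t] by simp
    ultimately have "?y \<in> Z" using Z(2)[of ?y] f y by auto
    then show ?thesis by (simp add: indicator_def)
   qed simp
  qed
  then have "line_measure Z k (flatten k y) \<noteq> 0" by auto
  then show "x \<in> A" using xC gr[OF y(1)] y(3) by (auto simp: A_def g'_def)
 qed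
 ultimately show ?thesis by (rule AE_I')
qed

lemma chart_slice_measure:
 assumes A: "A \<in> sets borel" "A \<subseteq> U \<times> Io"
 shows "indicator {0<..<T} t * emeasure (\<sigma> t) (slice A t) = (\<integral>\<^sup>+y. ennreal (weight (y, t)) * indicator A (R0 (y, t)) \<partial>lborel)"
proof (cases "t \<in> Io")
 case True
 have s: "slice A t = (\<lambda>x. (x, t)) -` A \<inter> space borel" by (auto simp: slice_def)
 have "slice A t \<in> sets borel" unfolding s using A(1) by (intro measurable_sets[OF borel_measurable_Pair_const]) auto
 moreover have "slice A t \<subseteq> U" using A(2) by (auto simp: slice_def)
 ultimately have "emeasure (\<sigma> t) (slice A t) = (\<integral>\<^sup>+y. ennreal (weight (y, t)) * indicator (slice A t) (fst (R0 (y, t))) \<partial>lborel)"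
  by (rule surface_measure_eq[OF True])
 also have "\<dots> = (\<integral>\<^sup>+y. ennreal (weight (y, t)) * indicator A (R0 (y, t)) \<partial>lborel)"
 proof (rule nn_integral_cong)
  fix y show "ennreal (weight (y, t)) * indicator (slice A t) (fst (R0 (y, t))) = ennreal (weight (y, t)) * indicator A (R0 (y, t))"
   by (cases "(y, t) \<in> Q") (auto simp: weight_zero R0_eq slice_def indicator_def)
 qed
 finally show ?thesis using True by (simp add: Io_def)
next
 case False
 then have "slice A t = {}" using A(2) by (auto simp: slice_def)
 moreover have "weight (y, t) = 0" for y using False by (intro weight_zero) (auto simp: Q_def)
 ultimately show ?thesis by simp
qed

lemma chart_integrand_measurable:
 assumes [measurable]: "A \<in> sets borel"
 shows "(\<lambda>q. ennreal (weight q) * indicator A (R0 q)) \<in> borel_measurable borel"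
 by measurable

lemma chart_slice_measure_measurable:
 assumes A: "A \<in> sets borel" "A \<subseteq> U \<times> Io"
 shows "(\<lambda>t. indicator {0<..<T} t * emeasure (\<sigma> t) (slice A t)) \<in> borel_measurable borel"
proof -
 have "(\<lambda>q. ennreal (weight q) * indicator A (R0 q)) \<in> borel_measurable ((lborel :: (real^'n) measure) \<Otimes>\<^sub>M (lborel :: real measure))"
  using chart_integrand_measurable[OF A(1)] by (simp add: lborel_prod)
 from lborel.borel_measurable_nn_integral_fst[OF measurable_pair_swap[OF this]]
 have "(\<lambda>t. \<integral>\<^sup>+y. ennreal (weight (y, t)) * indicator A (R0 (y, t)) \<partial>lborel) \<in> borel_measurable (lborel :: real measure)"
  by simp
 then show ?thesis unfolding chart_slice_measure[OF A, abs_def] by simp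
qed

end
end

section \<open>The space-time surface measure\<close>

locale surfaces =
 fixes T :: real and S :: "((real^'n::finite) \<times> real) set" and \<nu> :: "real^'n => real => real^'n"
  and \<sigma> :: "real => (real^'n) measure"
 assumes family: "C1_family_of_surfaces T S \<nu>" and sm: "surface_measures T S \<sigma>"
begin

lemma closed_all: "\<forall>t\<in>{0..T}. closed (slice S t)" using family unfolding C1_family_of_surfaces_def by blast

lemma closed_S: "t \<in> {0..T} ==> closed (slice S t)" using closed_all by blast

lemma chart_at:
 assumes "(x, t) \<in> S"
 shows "\<exists>U I k r e. chart T S \<nu> U I k r e \<and> x \<in> U \<and> t \<in> I"
proof -
 have unit: "norm (\<nu> x t) = 1" if "(x, t) \<in> S" for x t using family that unfolding C1_family_of_surfaces_def by blast
 have "\<exists>U I k r. x \<in> U \<and> t \<in> I \<and>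
    local_parametrization T S U I k r \<and>
    (\<forall>y\<in>cube. \<forall>t\<in>I. \<forall>i. \<nu> (r y t) t \<bullet> tangent r y t i = 0) \<and>
    (\<exists>\<epsilon>>0. C1_on (cube \<times> I) (\<lambda>(y, t). tubular_map \<nu> \<epsilon> k r y t) \<and>
     (\<forall>t\<in>I. C1_diffeomorphism cube ((\<lambda>y. tubular_map \<nu> \<epsilon> k r y t) ` cube)
          (\<lambda>y. tubular_map \<nu> \<epsilon> k r y t)))"
  using family assms unfolding C1_family_of_surfaces_def by blast
 then obtain U I k r e where c: "x \<in> U" "t \<in> I" "local_parametrization T S U I k r"
  "\<And>y t i. y \<in> cube ==> t \<in> I ==> \<nu> (r y t) t \<bullet> tangent r y t i = 0" "e > 0"
  "C1_on (cube \<times> I) (\<lambda>(y, t). tubular_map \<nu> e k r y t)"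
  "\<And>t. t \<in> I ==> C1_diffeomorphism cube ((\<lambda>y. tubular_map \<nu> e k r y t) ` cube) (\<lambda>y. tubular_map \<nu> e k r y t)"
  by metis
 have "chart T S \<nu> U I k r e" by (rule chart.intro) (fact c unit)+
 then show ?thesis using c by blast
qed

lemma slice_borel: "A \<in> sets borel ==> slice A t \<in> sets (borel :: (real^'n) measure)" for A :: "((real^'n) \<times> real) set"
proof -
 assume A: "A \<in> sets borel"
 have s: "slice A t = (\<lambda>x. (x, t)) -` A \<inter> space borel" by (auto simp: slice_def)
 show "slice A t \<in> sets borel" unfolding s using A by (intro measurable_sets[OF borel_measurable_Pair_const]) auto
qed

definition slice_measure :: "((real^'n) \<times> real) set => real => ennreal" where
 "slice_measure A t = indicator {0<..<T} t * emeasure (\<sigma> t) (slice A t)"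

lemma \<sigma>_time: assumes "0 < t" "t < T" shows "sets (\<sigma> t) = sets borel" "emeasure (\<sigma> t) (- slice S t) = 0"
 using sm assms by (auto simp: surface_measures_def)

lemma slice_measure_UN:
 assumes "\<And>i::nat. A i \<in> sets borel" "disjoint_family A"
 shows "(\<Sum>i. slice_measure (A i) t) = slice_measure (\<Union>i. A i) t"
proof (cases "0 < t \<and> t < T")
 case True
 have "disjoint_family (\<lambda>i. slice (A i) t)" using assms(2) by (auto simp: disjoint_family_on_def slice_def)
 moreover have "range (\<lambda>i. slice (A i) t) \<subseteq> sets (\<sigma> t)" using \<sigma>_time True slice_borel assms(1) by auto
 moreover have "slice (\<Union>i. A i) t = (\<Union>i. slice (A i) t)" by (auto simp: slice_def)
 ultimately show ?thesis using suminf_emeasure[of "\<lambda>i. slice (A i) t" "\<sigma> t"] True by (simp add: slice_measure_def)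
qed (simp add: slice_measure_def)

text \<open>No regularity of \<open>\<sigma> t\<close> in \<open>t\<close> is postulated. In a chart
  it is a parameter integral and thus measurable in \<open>t\<close>; countably many charts, made
  disjoint, cover the surface at interior times, and the rest is null for each
  \<open>\<sigma> t\<close>.\<close>

lemma slice_measure_measurable:
 assumes A: "A \<in> sets borel"
 shows "slice_measure A \<in> borel_measurable borel"
proof -
 let ?F = "{X. \<exists>U I k r e. chart T S \<nu> U I k r e \<and> X = U \<times> (I \<inter> {0<..<T})}"
 have opn: "open X" if "X \<in> ?F" for X
 proof -
  obtain U I k r e where ch: "chart T S \<nu> U I k r e" "X = U \<times> (I \<inter> {0<..<T})" using \<open>X \<in> ?F\<close> by blast
  show ?thesis unfolding ch(2) using chart.open_U[OF ch(1)] chart.open_Io[OF ch(1)] chart.Io_def[OF ch(1)] by (simp add: open_Times)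
 qed
 obtain F' where F': "F' \<subseteq> ?F" "countable F'" "\<Union>F' = \<Union>?F" by (rule Lindelof[of ?F], rule opn, assumption, rule that)
 have cover: "(x, t) \<in> \<Union>F'" if "(x, t) \<in> S" "0 < t" "t < T" for x t
 proof -
  obtain U I k r e where ch: "chart T S \<nu> U I k r e" "x \<in> U" "t \<in> I" using chart_at[OF \<open>(x, t) \<in> S\<close>] by blast
  then have "U \<times> (I \<inter> {0<..<T}) \<in> ?F" by blast
  moreover have "(x, t) \<in> U \<times> (I \<inter> {0<..<T})" using ch \<open>0 < t\<close> \<open>t < T\<close> by simp
  ultimately show ?thesis unfolding F'(3) by (rule UnionI)
 qed
 \<comment> \<open>The empty set is inserted so that the family can be enumerated even when it is
   empty.\<close>
 define c where "c = from_nat_into (insert {} F')"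
 have rc: "range c = insert {} F'" unfolding c_def by (rule range_from_nat_into) (simp_all add: F'(2))
 have copen: "open (c i)" for i
 proof (cases "c i = {}")
  case False
  then have "c i \<in> F'" using rc rangeI[of c i] by blast
  then show ?thesis using opn F'(1) by blast
 qed simp
 define B where "B i = A \<inter> disjointed c i" for i
 have dc: "disjointed c i \<in> sets borel" for i using copen by (auto simp: disjointed_def)
 have B: "B i \<in> sets borel" for i unfolding B_def using A dc by auto
 have Bm: "slice_measure (B i) \<in> borel_measurable borel" for i
 proof (cases "c i = {}")
  case True
  then have "B i = {}" using disjointed_subset[of c i] by (auto simp: B_def)
  then show ?thesis by (simp add: slice_measure_def[abs_def] slice_def)
 next
  case False
  then have "c i \<in> ?F" using rc F'(1) by blast
  then obtain U I k r e where ch: "chart T S \<nu> U I k r e" "c i = U \<times> (I \<inter> {0<..<T})" by blast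
  have "B i \<subseteq> U \<times> chart.Io T I" using disjointed_subset[of c i] ch by (auto simp: B_def chart.Io_def)
  then show ?thesis unfolding slice_measure_def[abs_def]
   by (rule chart.chart_slice_measure_measurable[OF ch(1) sm closed_all B])
 qed
 \<comment> \<open>At interior times, what the charts miss is disjoint from the surface.\<close>
 have rest: "slice_measure (A - (\<Union>i. c i)) t = 0" for t
 proof (cases "0 < t \<and> t < T")
  case True
  have "slice (A - (\<Union>i. c i)) t \<subseteq> - slice S t"
  proof
   fix x assume x: "x \<in> slice (A - (\<Union>i. c i)) t"
   have "(\<Union>i. c i) = \<Union>F'" using rc by auto
   then show "x \<in> - slice S t" using x cover[of x t] True by (auto simp: slice_def)
  qed
  moreover have "- slice S t \<in> sets (\<sigma> t)" using \<sigma>_time True closed_S[of t] by auto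
  ultimately have "emeasure (\<sigma> t) (slice (A - (\<Union>i. c i)) t) \<le> emeasure (\<sigma> t) (- slice S t)" by (rule emeasure_mono)
  then show ?thesis using \<sigma>_time True by (simp add: slice_measure_def)
 qed (simp add: slice_measure_def)
 have "slice_measure A t = (\<Sum>i. slice_measure (B i) t)" for t
 proof -
  have eq: "(\<Union>i. B i) = A \<inter> (\<Union>i. c i)" unfolding B_def using UN_disjointed_eq[of c] by auto
  have dj: "disjoint_family B" using disjoint_family_disjointed[of c] by (auto simp: B_def disjoint_family_on_def)
  have 1: "(\<Sum>i. slice_measure (B i) t) = slice_measure (A \<inter> (\<Union>i. c i)) t"
   using slice_measure_UN[of B t, OF B dj] unfolding eq .
  have cs: "(\<Union>i. c i) \<in> sets borel" using copen by auto
  show ?thesis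
  proof (cases "0 < t \<and> t < T")
   case True
   have "slice A t = slice (A \<inter> (\<Union>i. c i)) t \<union> slice (A - (\<Union>i. c i)) t" by (auto simp: slice_def)
   moreover have "slice (A \<inter> (\<Union>i. c i)) t \<inter> slice (A - (\<Union>i. c i)) t = {}" by (auto simp: slice_def)
   moreover have "slice (A \<inter> (\<Union>i. c i)) t \<in> sets (\<sigma> t)" "slice (A - (\<Union>i. c i)) t \<in> sets (\<sigma> t)"
    using \<sigma>_time True slice_borel A cs by auto
   ultimately have "emeasure (\<sigma> t) (slice A t) = emeasure (\<sigma> t) (slice (A \<inter> (\<Union>i. c i)) t) + emeasure (\<sigma> t) (slice (A - (\<Union>i. c i)) t)"
    using plus_emeasure[of "slice (A \<inter> (\<Union>i. c i)) t" "\<sigma> t" "slice (A - (\<Union>i. c i)) t"] by simp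
   then show ?thesis using 1 rest[of t] True by (simp add: slice_measure_def)
  next
   case False
   then show ?thesis using 1 by (simp add: slice_measure_def)
  qed
 qed
 then have "slice_measure A = (\<lambda>t. \<Sum>i. slice_measure (B i) t)" by auto
 then show ?thesis using Bm by simp
qed

abbreviation "STM \<equiv> spacetime_surface_measure T \<sigma>"

lemma sets_STM: "sets STM = sets borel" and space_STM: "space STM = UNIV"
 unfolding spacetime_surface_measure_def
 using sets.sets_measure_of_eq[of borel] by (simp_all add: space_measure_of_conv)

text \<open>\<open>measure_of\<close> is \<open>0\<close> everywhere unless the given set function
  is countably additive; the proof of additivity relies on the measurability of
  \<open>slice_measure A\<close>.\<close>

lemma emeasure_STM:
 assumes "A \<in> sets borel" shows "emeasure STM A = (\<integral>\<^sup>+t. slice_measure A t \<partial>lborel)"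
proof -
 let ?m = "\<lambda>A. \<integral>\<^sup>+t\<in>{0..T}. emeasure (\<sigma> t) (slice A t) \<partial>lborel"
 have eq: "?m A = (\<integral>\<^sup>+t. slice_measure A t \<partial>lborel)" for A
 proof (rule nn_integral_cong_AE)
  show "AE t in lborel. emeasure (\<sigma> t) (slice A t) * indicator {0..T} t = slice_measure A t"
   using AE_lborel_singleton[of 0] AE_lborel_singleton[of T]
   by eventually_elim (auto simp: slice_measure_def indicator_def)
 qed
 have "emeasure STM A = ?m A"
  unfolding spacetime_surface_measure_def
 proof (rule emeasure_measure_of_sigma)
  show "sigma_algebra UNIV (sets (borel :: ((real^'n) \<times> real) measure))"
   using sets.sigma_algebra_axioms[of "borel :: ((real^'n) \<times> real) measure"] by simp
  show "positive (sets borel) ?m" by (simp add: positive_def slice_def)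
  show "countably_additive (sets borel) ?m"
   unfolding eq
  proof (rule countably_additiveI)
   fix A :: "nat => ((real^'n) \<times> real) set"
   assume A: "range A \<subseteq> sets borel" "disjoint_family A" "(\<Union>i. A i) \<in> sets borel"
   have "(\<Sum>i. \<integral>\<^sup>+t. slice_measure (A i) t \<partial>lborel) = (\<integral>\<^sup>+t. (\<Sum>i. slice_measure (A i) t) \<partial>lborel)"
    using A slice_measure_measurable by (intro nn_integral_suminf[symmetric]) auto
   then show "(\<Sum>i. \<integral>\<^sup>+t. slice_measure (A i) t \<partial>lborel) = (\<integral>\<^sup>+t. slice_measure (\<Union>i. A i) t \<partial>lborel)"
    using slice_measure_UN[of A] A by auto
  qed
 qed (rule assms)
 then show ?thesis unfolding eq .
qed

end

locale surface_chart = surfaces T S \<nu> \<sigma> + chart T S \<nu> U I k r e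
 for T :: real and S :: "((real^'n::finite) \<times> real) set" and \<nu> \<sigma> U I k r e
begin

lemma chart_STM:
 assumes A: "A \<in> sets borel" "A \<subseteq> U \<times> Io"
 shows "emeasure STM A = (\<integral>\<^sup>+q. ennreal (weight q) * indicator A (R0 q) \<partial>lborel)"
 unfolding emeasure_STM[OF A(1)] slice_measure_def chart_slice_measure[OF sm closed_all A]
 by (rule lborel_nn_integral_snd[symmetric], rule chart_integrand_measurable[OF sm closed_all A(1)])

text \<open>An inequality only, because the chart covers a part of \<open>S\<close>: the image of
  the weighted Lebesgue measure is dominated by the whole surface measure.\<close>

lemma chart_nn_integral_le:
 assumes [measurable]: "h \<in> borel_measurable borel"
 shows "(\<integral>\<^sup>+q. ennreal (weight q) * h (R0 q) \<partial>lborel) \<le> (\<integral>\<^sup>+z. h z \<partial>STM)"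
proof -
 let ?\<mu> = "distr (density lborel (\<lambda>q. ennreal (weight q))) borel R0"
 have "(\<integral>\<^sup>+q. ennreal (weight q) * h (R0 q) \<partial>lborel) = (\<integral>\<^sup>+z. h z \<partial>?\<mu>)"
  by (subst nn_integral_distr, simp, simp, subst nn_integral_density) simp_all
 also have "\<dots> \<le> (\<integral>\<^sup>+z. h z \<partial>STM)"
 proof (rule nn_integral_mono_measure)
  show "sets ?\<mu> = sets STM" by (simp add: sets_STM)
  show "?\<mu> \<le> STM"
  proof (subst le_measure)
   show "\<forall>A\<in>sets ?\<mu>. emeasure ?\<mu> A \<le> emeasure STM A"
   proof
    fix A assume "A \<in> sets ?\<mu>"
    then have [measurable]: "A \<in> sets borel" by simp
    have Io [measurable]: "Io \<in> sets borel" "U \<in> sets borel" using open_Io open_U by auto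
    have AU: "A \<inter> (U \<times> Io) \<in> sets borel" using open_Times[OF open_U open_Io] by auto
    have "emeasure ?\<mu> A = (\<integral>\<^sup>+z. indicator A z \<partial>?\<mu>)" by simp
    also have "\<dots> = (\<integral>\<^sup>+q. ennreal (weight q) * indicator A (R0 q) \<partial>lborel)"
     by (subst nn_integral_distr, simp, simp, subst nn_integral_density) simp_all
    also have "\<dots> = (\<integral>\<^sup>+q. ennreal (weight q) * indicator (A \<inter> (U \<times> Io)) (R0 q) \<partial>lborel)"
    proof (rule nn_integral_cong)
     fix q show "ennreal (weight q) * indicator A (R0 q) = ennreal (weight q) * indicator (A \<inter> (U \<times> Io)) (R0 q)"
      using R0_in[of q] by (cases "q \<in> Q") (auto simp: weight_zero indicator_def)
    qed
    also have "\<dots> = emeasure STM (A \<inter> (U \<times> Io))" by (rule chart_STM[OF AU, symmetric]) auto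
    also have "\<dots> \<le> emeasure STM A" by (intro emeasure_mono) (auto simp: sets_STM)
    finally show "emeasure ?\<mu> A \<le> emeasure STM A" .
   qed
  qed (simp add: sets_STM)
 qed
 finally show ?thesis .
qed

text \<open>The maximal functions are measurable for the completion only. A Borel function
  \<open>h\<close> that agrees almost everywhere is pulled back along the chart; by
  \<open>chart_nn_integral_le\<close> the exceptional set has a null preimage in \<open>Q\<close>
  and the integral stays finite.\<close>

lemma Lq_on_chart:
 assumes "Lq_on STM A n g" and n: "n > 0"
 obtains G where "G \<in> borel_measurable borel" "\<And>q. 0 \<le> G q" "integrable lborel (\<lambda>q. weight q * G q)"
  "AE q in lborel. q \<in> Q --> R0 q \<in> A --> g (R0 q) ^ n \<le> ennreal (G q)"
proof -
 let ?f = "\<lambda>z. g z ^ n * indicator A z"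
 have "(\<lambda>z. (g z * indicator A z) ^ n) \<in> borel_measurable (completion STM)"
  using assms(1) unfolding Lq_on_def by (intro borel_measurable_power_ennreal) auto
 moreover have "(g z * indicator A z) ^ n = ?f z" for z using n by (auto simp: indicator_def)
 ultimately have fm: "?f \<in> borel_measurable (completion STM)" by simp
 have fin: "(\<integral>\<^sup>+z. ?f z \<partial>completion STM) < \<infinity>" using assms(1) unfolding Lq_on_def by simp
 obtain h where h: "h \<in> borel_measurable STM" and ae: "AE z in STM. ?f z = h z"
  using completion_ex_borel_measurable[OF fm] by auto
 have hb [measurable]: "h \<in> borel_measurable borel" using h by (simp add: measurable_cong_sets[OF sets_STM refl])
 have hfin: "(\<integral>\<^sup>+z. h z \<partial>STM) < \<infinity>"
  using fin nn_integral_cong_AE[OF ae] by (simp add: nn_integral_completion)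
 let ?G = "\<lambda>q. enn2real (h (R0 q))"
 have le: "(\<integral>\<^sup>+q. ennreal (weight q) * h (R0 q) \<partial>lborel) < \<infinity>"
  using chart_nn_integral_le[OF hb] hfin by (rule le_less_trans)
 \<comment> \<open>\<open>enn2real\<close> sends infinity to \<open>0\<close>, so finiteness of
   \<open>h\<close> along the chart has to be secured almost everywhere.\<close>
 have "AE q in lborel. ennreal (weight q) * h (R0 q) \<noteq> \<infinity>"
  by (rule nn_integral_noteq_infinite) (use le in auto)
 then have hf: "AE q in lborel. q \<in> Q --> ennreal (?G q) = h (R0 q)"
 proof (rule eventually_mono, intro impI)
  fix q assume "ennreal (weight q) * h (R0 q) \<noteq> \<infinity>" "q \<in> Q"
  then have "h (R0 q) \<noteq> \<infinity>" using weight_pos[of q] by (auto simp: ennreal_mult_top)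
  then show "ennreal (?G q) = h (R0 q)" by (simp add: less_top)
 qed
 obtain Z where Z: "Z \<in> null_sets STM" "\<And>z. z \<notin> Z ==> ?f z = h z" using AE_null_setE[OF ae] space_STM by auto
 have [measurable]: "Z \<in> sets borel" using null_setsD2[OF Z(1)] sets_STM by simp
 have "(\<integral>\<^sup>+q. ennreal (weight q) * indicator Z (R0 q) \<partial>lborel) \<le> (\<integral>\<^sup>+z. indicator Z z \<partial>STM)"
  by (rule chart_nn_integral_le) simp
 also have "\<dots> = 0" using Z(1) by (simp add: null_setsD1 null_setsD2)
 finally have "AE q in lborel. ennreal (weight q) * indicator Z (R0 q) = 0"
  by (simp add: nn_integral_0_iff_AE)
 then have "AE q in lborel. q \<in> Q --> R0 q \<in> A --> g (R0 q) ^ n \<le> ennreal (?G q)"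
  using hf
 proof eventually_elim
  case (elim q)
  show ?case
  proof (intro impI)
   assume q: "q \<in> Q" "R0 q \<in> A"
   then have "R0 q \<notin> Z" using elim(1) weight_pos[of q] by (auto simp: indicator_def ennreal_eq_0_iff split: if_splits)
   then show "g (R0 q) ^ n \<le> ennreal (?G q)" using elim(2) q Z(2)[of "R0 q"] by simp
  qed
 qed
 moreover have "integrable lborel (\<lambda>q. weight q * ?G q)"
 proof (rule integrableI_bounded)
  have "(\<integral>\<^sup>+q. ennreal (norm (weight q * ?G q)) \<partial>lborel) \<le> (\<integral>\<^sup>+q. ennreal (weight q) * h (R0 q) \<partial>lborel)"
  proof (rule nn_integral_mono)
   fix q
   have w: "weight q \<ge> 0" using weight_pos[of q] weight_zero[of q] by (cases "q \<in> Q") auto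
   have "ennreal (?G q) \<le> h (R0 q)" by (cases "h (R0 q)") auto
   then show "ennreal (norm (weight q * ?G q)) \<le> ennreal (weight q) * h (R0 q)"
    using w by (auto simp: abs_mult ennreal_mult intro!: mult_left_mono)
  qed
  then show "(\<integral>\<^sup>+q. ennreal (norm (weight q * ?G q)) \<partial>lborel) < \<infinity>" using le by (rule le_less_trans)
 qed measurable
 moreover have "?G \<in> borel_measurable borel" by measurable
 ultimately show ?thesis by (intro that[of ?G]) auto
qed

end

section \<open>The weak equations against second derivatives\<close>

lemma LINT_lebesgue_AE_eq:
 fixes f g :: "'a::euclidean_space => real"
 assumes f: "f \<in> borel_measurable borel" and ae: "AE x in lborel. f x = g x"
 shows "(LINT x|lebesgue. g x) = (LINT x|lborel. f x)"
proof -
 have fl: "f \<in> borel_measurable lebesgue" using f by (intro measurable_completion) simp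
 have ael: "AE x in lebesgue. f x = g x" using ae by (rule AE_completion)
 have gl: "g \<in> borel_measurable lebesgue" by (rule borel_measurable_AE[OF fl ael])
 have "(LINT x|lebesgue. g x) = (LINT x|lebesgue. f x)"
  using integral_cong_AE[OF fl gl ael] by simp
 also have "\<dots> = (LINT x|lborel. f x)" by (rule integral_completion) (use f in simp)
 finally show ?thesis .
qed

text \<open>The weak formulation contains iterated integrals of functions that are not Borel; on
  almost every slice they agree with a Borel integrand, to which Fubini applies.\<close>

lemma spacetime_LINT:
 fixes f :: "'a::euclidean_space \<times> real => real"
 assumes f: "integrable lborel f" and ae: "AE t in lborel. t \<in> {0..T} --> (AE x in lborel. f (x, t) = g x t)"
  and zero: "\<And>x t. t \<notin> {0..T} ==> f (x, t) = 0"
 shows "(LINT s:{0..T}|lebesgue. LINT x|lebesgue. g x s) = (LINT z|lborel. f z)"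
proof -
 have fm: "f \<in> borel_measurable borel" using f by auto
 have fs: "(\<lambda>x. f (x, t)) \<in> borel_measurable borel" for t
 proof -
  have "(\<lambda>x. (x, t)) \<in> borel_measurable borel" by (intro borel_measurable_continuous_onI continuous_intros)
  from measurable_compose[OF this fm] show ?thesis .
 qed
 have m: "(\<lambda>t. LINT x|lborel. f (x, t)) \<in> borel_measurable borel"
  using lborel_integrable_snd(2)[OF f] by auto
 have "AE t in lborel. (LINT x|lborel. f (x, t)) = indicator {0..T} t *\<^sub>R (LINT x|lebesgue. g x t)"
  using ae
 proof eventually_elim
  case (elim t)
  show ?case
  proof (cases "t \<in> {0..T}")
   case True
   then show ?thesis using LINT_lebesgue_AE_eq[OF fs[of t], of "\<lambda>x. g x t"] elim by simp
  qed (simp add: zero)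
 qed
 from LINT_lebesgue_AE_eq[OF m this] show ?thesis
  unfolding set_lebesgue_integral_def lborel_integral_snd[OF f] .
qed

lemma pderivative_zero_outside:
 assumes "x \<notin> closure {x. f x \<noteq> 0}" shows "pderivative f b x = 0"
proof -
 have "f y = 0" if "y \<in> - closure {x. f x \<noteq> 0}" for y
  using that closure_subset[of "{x. f x \<noteq> 0}"] by blast
 then have "(f has_derivative (\<lambda>_. 0)) (at x)"
  using has_derivative_transform_within_open[OF has_derivative_const[of 0], of "- closure {x. f x \<noteq> 0}" x f] assms
  by (metis ComplI closed_closure open_Compl)
 then show ?thesis by (rule pderivative_eq)
qed

lemma second_derivative_zero_outside:
 assumes "x \<notin> closure {x. f x \<noteq> 0}" shows "second_derivative f a b x = 0"
proof -
 have "{x. pderivative f a x \<noteq> 0} \<subseteq> closure {x. f x \<noteq> 0}" using pderivative_zero_outside by blast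
 then have "closure {x. pderivative f a x \<noteq> 0} \<subseteq> closure {x. f x \<noteq> 0}" by (rule closure_minimal) simp
 then show ?thesis unfolding second_derivative_def using assms by (intro pderivative_zero_outside) blast
qed

lemma pderivative_affine:
 fixes f :: "'a::euclidean_space => real"
 assumes "smooth f" shows "pderivative (\<lambda>z. c * f (l *\<^sub>R z + d)) b z = c * (l * pderivative f b (l *\<^sub>R z + d))"
proof -
 have "((\<lambda>z. l *\<^sub>R z + d) has_derivative (\<lambda>h. l *\<^sub>R h)) (at z)" by (auto intro!: derivative_eq_intros)
 from has_derivative_compose[OF this smooth_imp_differentiable[OF assms]]
 have "((\<lambda>z. f (l *\<^sub>R z + d)) has_derivative (\<lambda>h. pderivative f (l *\<^sub>R h) (l *\<^sub>R z + d))) (at z)" .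
 then have "((\<lambda>z. c * f (l *\<^sub>R z + d)) has_derivative (\<lambda>h. c * pderivative f (l *\<^sub>R h) (l *\<^sub>R z + d))) (at z)"
  by (rule has_derivative_mult_right)
 from pderivative_eq[OF this, of b]
 show ?thesis using linear_cmul[OF has_derivative_linear[OF smooth_imp_differentiable[OF assms]], of l b] by simp
qed

lemma second_derivative_affine:
 fixes f :: "'a::euclidean_space => real"
 assumes f: "smooth f" and a: "a \<in> Basis"
 shows "second_derivative (\<lambda>z. f (l *\<^sub>R z + d)) a b z = l\<^sup>2 * second_derivative f a b (l *\<^sub>R z + d)"
proof -
 have "pderivative (\<lambda>z. f (l *\<^sub>R z + d)) a = (\<lambda>z. l * pderivative f a (l *\<^sub>R z + d))"
  using pderivative_affine[OF f, of 1] by (auto simp: fun_eq_iff)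
 then show ?thesis
  unfolding second_derivative_def using pderivative_affine[OF smooth_pderivative[OF f a]] by (simp add: power2_eq_square)
qed

lemma test_function_slice:
 fixes f :: "'a::euclidean_space \<times> real => 'b::real_normed_vector"
 assumes "test_function f" shows "test_function (\<lambda>x. f (x, t))"
proof -
 have "linear (\<lambda>x::'a. (x, 0::real))" "inj (\<lambda>x::'a. (x, 0::real))" by (auto intro!: linearI injI)
 from test_function_affine_compose[OF assms this, of "(0, t)"] show ?thesis by simp
qed

lemma pderivative_slice:
 fixes f :: "'a::euclidean_space \<times> real => 'b::real_normed_vector"
 assumes "smooth f" shows "pderivative (\<lambda>x. f (x, t)) b x = pderivative f (b, 0) (x, t)"
proof (rule pderivative_eq)
 have "((\<lambda>x. (x, t)) has_derivative (\<lambda>h. (h, 0))) (at x)" by (auto intro!: derivative_eq_intros)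
 from has_derivative_compose[OF this smooth_imp_differentiable[OF assms]]
 show "((\<lambda>x. f (x, t)) has_derivative (\<lambda>h. pderivative f (h, 0) (x, t))) (at x)" .
qed

lemma vector_derivative_slice:
 fixes f :: "'a::euclidean_space \<times> real => 'b::real_normed_vector"
 assumes "smooth f" shows "vector_derivative (\<lambda>s. f (x, s)) (at t) = pderivative f (0, 1) (x, t)"
proof (rule vector_derivative_at, unfold has_vector_derivative_def)
 note d = smooth_imp_differentiable[OF assms, of "(x, t)"]
 have "((\<lambda>s. (x, s)) has_derivative (\<lambda>h. h *\<^sub>R (0, 1))) (at t)" by (auto intro!: derivative_eq_intros)
 from has_derivative_compose[OF this d]
 show "((\<lambda>s. f (x, s)) has_derivative (\<lambda>h. h *\<^sub>R pderivative f (0, 1) (x, t))) (at t)"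
  unfolding linear_cmul[OF has_derivative_linear[OF d]] .
qed

lemma axis_prod_Basis: "(axis i (1::real), 0::real) \<in> Basis" "(0 :: real^'n, 1::real) \<in> Basis"
 by (auto simp: Basis_prod_def axis_in_Basis_iff)

lemma second_derivative_slice:
 fixes f :: "(real^'n) \<times> real => real"
 assumes f: "smooth f"
 shows "second_derivative (\<lambda>x. f (x, t)) (axis l 1) (axis k 1) x = second_derivative f (axis l 1, 0) (axis k 1, 0) (x, t)"
proof -
 have "pderivative (\<lambda>x. f (x, t)) (axis l 1) = (\<lambda>x. pderivative f (axis l 1, 0) (x, t))"
  using pderivative_slice[OF f] by auto
 then show ?thesis unfolding second_derivative_def
  using pderivative_slice[OF smooth_pderivative[OF f axis_prod_Basis(1)[of l]]] by simp
qed

lemma sum_Basis_axis: "(\<Sum>a\<in>Basis. h (a :: real^'n)) = (\<Sum>i\<in>UNIV. h (axis i 1))"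
proof -
 have B: "(Basis :: (real^'n) set) = range (\<lambda>i. axis i 1)" by (auto simp: Basis_vec_def)
 show ?thesis unfolding B by (subst sum.reindex) (auto simp: inj_on_def axis_eq_axis)
qed

lemma sum_Basis_spacetime:
 "(\<Sum>a\<in>Basis. h (a :: (real^'n) \<times> real)) = (\<Sum>i\<in>UNIV. h (axis i 1, 0)) + h (0, 1)"
proof -
 have B: "(Basis :: ((real^'n) \<times> real) set) = (\<lambda>i. (i, 0)) ` Basis \<union> {(0, 1)}" by (auto simp: Basis_prod_def)
 have "sum h ((\<lambda>i. (i, 0)) ` Basis \<union> {(0, 1)}) = sum h ((\<lambda>i. (i, 0)) ` Basis) + h (0, 1)"
  by (subst sum.union_disjoint) auto
 also have "sum h ((\<lambda>i. (i, 0)) ` Basis) = (\<Sum>i\<in>Basis. h (i, 0))" by (subst sum.reindex) (auto simp: inj_on_def)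
 finally show ?thesis unfolding B using sum_Basis_axis[of "\<lambda>i. h (i, 0)"] by simp
qed

section \<open>The bilinear forms of the Euler system\<close>

type_synonym 'n form = "real^'n => real => (real^'n) \<times> real => (real^'n) \<times> real => real"

text \<open>The divergence relation tested with the derivative of \<open>\<eta>\<close> in a
  space-time direction \<open>c\<close>: \<open>a\<close> stands for the gradient and
  \<open>b\<close> is selected by \<open>c\<close>. On the diagonal \<open>a = b = N\<close> the
  value is \<open>(v \<bullet> fst N) * (N \<bullet> c)\<close>.\<close>

definition divergence_form :: "(real^('n::finite)) \<times> real => 'n form" where
 "divergence_form c v p a b = (v \<bullet> fst a) * (b \<bullet> c)"

text \<open>From the distributional equation for the Laplacian of the pressure. On the diagonal at a
  conormal with unit spatial part \<open>\<nu>\<close> the value is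
  \<open>(v \<bullet> \<nu>)\<^sup>2 + p\<close>.\<close>

definition pressure_form :: "('n::finite) form" where
 "pressure_form v p a b = (v \<bullet> fst a) * (v \<bullet> fst b) + p * (fst a \<bullet> fst b)"

text \<open>The slot \<open>b\<close> carries the derivative along the flow, in time and space, and
  \<open>a\<close> the derivative that defines the test field. The diagonal value at
  \<open>(\<nu>, m)\<close> is the flux \<open>m + v \<bullet> \<nu>\<close> times a component of
  the wedge product of \<open>v\<close> and \<open>\<nu>\<close>.\<close>

definition momentum_form :: "'n::finite => 'n => 'n form" where
 "momentum_form i j v p a b = (snd b + v \<bullet> fst b) * (v $ i * fst a $ j - v $ j * fst a $ i)"

definition euler_forms :: "('n::finite) form set" where
 "euler_forms = divergence_form ` Basis \<union> {pressure_form} \<union> (\<lambda>(i, j). momentum_form i j) ` UNIV"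

lemma euler_formsE:
 assumes "F \<in> euler_forms"
 obtains c where "c \<in> Basis" "F = divergence_form c" | "F = pressure_form" | i j where "F = momentum_form i j"
 using assms unfolding euler_forms_def by auto

lemma finite_euler_forms: "finite (euler_forms :: ('n::finite) form set)"
 unfolding euler_forms_def by (auto intro!: finite_imageI)

lemma norm_Basis_parts:
 assumes "a \<in> (Basis :: ((real^'n) \<times> real) set)" shows "norm (fst a) \<le> 1" "\<bar>snd a\<bar> \<le> 1"
 using norm_fst_le[of "fst a" "snd a"] norm_snd_le[of "snd a" "fst a"] norm_Basis[OF assms] by auto

lemma two_norm_le: "2 * norm v \<le> 1 + (norm v)\<^sup>2"
 using zero_le_power2[of "norm v - 1"] by (simp add: power2_diff)

text \<open>The alternatives are the bounds that occur for the three kinds of forms;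
  \<open>2 * n \<le> 1 + a\<close> absorbs the terms linear in the velocity.\<close>

lemma growth_arith:
 fixes x y n a b :: real
 assumes "x \<le> y" "2 * n \<le> 1 + a" "0 \<le> a" "0 \<le> b" "y \<le> n \<or> y \<le> a + b \<or> y \<le> 2 * n + 2 * a"
 shows "x \<le> 4 * (1 + a + b)"
 using assms by auto

text \<open>Quadratic growth in the velocity and linear growth in the pressure are what maximal
  functions in \<open>L\<^sup>2\<close> and \<open>L\<^sup>1\<close> can dominate.\<close>

lemma euler_form_growth:
 assumes F: "F \<in> euler_forms" and a: "a \<in> Basis" and b: "b \<in> Basis"
 shows "\<bar>F v p a b\<bar> \<le> 4 * (1 + (norm v)\<^sup>2 + \<bar>p\<bar>)"
proof -
 note n = norm_Basis_parts[OF a] norm_Basis_parts[OF b]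
 have va: "\<bar>v \<bullet> fst a\<bar> \<le> norm v" "\<bar>v \<bullet> fst b\<bar> \<le> norm v"
  using Cauchy_Schwarz_ineq2[of v "fst a"] Cauchy_Schwarz_ineq2[of v "fst b"] n
   mult_left_mono[OF n(1), of "norm v"] mult_left_mono[OF n(3), of "norm v"] by auto
 have v2: "norm v * norm v = (norm v)\<^sup>2" by (simp add: power2_eq_square)
 note tn = two_norm_le[of v]
 from F show ?thesis
 proof (cases rule: euler_formsE)
  case (1 c)
  have "\<bar>b \<bullet> c\<bar> \<le> 1" using inner_Basis[OF b 1(1)] by simp
  then have "\<bar>v \<bullet> fst a\<bar> * \<bar>b \<bullet> c\<bar> \<le> norm v * 1" using va by (intro mult_mono) auto
  then have "\<bar>F v p a b\<bar> \<le> norm v" unfolding 1 divergence_form_def by (simp add: abs_mult)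
  then show ?thesis by (rule growth_arith[OF _ tn]) simp_all
 next
  case 2
  have "\<bar>v \<bullet> fst a\<bar> * \<bar>v \<bullet> fst b\<bar> \<le> norm v * norm v" using va by (intro mult_mono) auto
  moreover have "\<bar>fst a \<bullet> fst b\<bar> \<le> 1"
   using Cauchy_Schwarz_ineq2[of "fst a" "fst b"] mult_mono[OF n(1) n(3)] by simp
  then have "\<bar>p\<bar> * \<bar>fst a \<bullet> fst b\<bar> \<le> \<bar>p\<bar> * 1" by (intro mult_left_mono) auto
  ultimately have "\<bar>F v p a b\<bar> \<le> (norm v)\<^sup>2 + \<bar>p\<bar>"
   unfolding 2 pressure_form_def v2[symmetric] abs_mult[symmetric] by linarith
  then show ?thesis by (rule growth_arith[OF _ tn]) simp_all
 next
  case (3 i j)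
  have c: "\<bar>fst a $ m\<bar> \<le> 1" "\<bar>v $ m\<bar> \<le> norm v" for m
   using component_le_norm_cart[of "fst a" m] component_le_norm_cart[of v m] n by auto
  have "\<bar>v $ i * fst a $ j\<bar> \<le> norm v * 1" "\<bar>v $ j * fst a $ i\<bar> \<le> norm v * 1"
   using mult_mono[OF c(2)[of i] c(1)[of j] norm_ge_zero abs_ge_zero] mult_mono[OF c(2)[of j] c(1)[of i] norm_ge_zero abs_ge_zero]
   by (simp_all add: abs_mult)
  then have "\<bar>v $ i * fst a $ j - v $ j * fst a $ i\<bar> \<le> 2 * norm v" by linarith
  moreover have "\<bar>snd b + v \<bullet> fst b\<bar> \<le> 1 + norm v" using n va by linarith
  ultimately have "\<bar>F v p a b\<bar> \<le> (1 + norm v) * (2 * norm v)"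
   unfolding 3 momentum_form_def abs_mult by (intro mult_mono) auto
  also have "\<dots> = 2 * norm v + 2 * (norm v)\<^sup>2" unfolding v2[symmetric] by (simp add: algebra_simps)
  finally show ?thesis by (rule growth_arith[OF _ tn]) simp_all
 qed
qed

lemma euler_form_continuous:
 assumes F: "F \<in> euler_forms"
 shows "continuous_on UNIV (\<lambda>z. F (fst z) (snd z) a b)"
 using F by (cases rule: euler_formsE)
  (auto simp: divergence_form_def pressure_form_def momentum_form_def intro!: continuous_intros)

text \<open>Each form is bilinear in \<open>(a, b)\<close>, so expanding \<open>N\<close> in the
  basis twice collapses the coefficient sum.\<close>

lemma euler_form_quadratic:
 fixes N :: "(real^'n) \<times> real"
 assumes F: "F \<in> euler_forms"
 shows "(\<Sum>a\<in>Basis. \<Sum>b\<in>Basis. F v p a b * ((N \<bullet> a) * (N \<bullet> b))) = F v p N N"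
proof -
 have la: "linear (\<lambda>a. F v p a b)" and lb: "linear (\<lambda>b. F v p a b)" for a b
  using F by (cases rule: euler_formsE;
   auto intro!: linearI simp: divergence_form_def pressure_form_def momentum_form_def inner_add_left inner_add_right algebra_simps)+
 have "(\<Sum>b\<in>Basis. F v p a b * (N \<bullet> b)) = F v p a (\<Sum>b\<in>Basis. (N \<bullet> b) *\<^sub>R b)" for a
  unfolding linear_sum[OF lb] linear_cmul[OF lb] by (simp add: mult.commute)
 then have i: "(\<Sum>b\<in>Basis. F v p a b * (N \<bullet> b)) = F v p a N" for a by (simp add: euclidean_representation)
 have "(\<Sum>a\<in>Basis. \<Sum>b\<in>Basis. F v p a b * ((N \<bullet> a) * (N \<bullet> b))) = (\<Sum>a\<in>Basis. (\<Sum>b\<in>Basis. F v p a b * (N \<bullet> b)) * (N \<bullet> a))"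
  unfolding sum_distrib_right by (simp add: mult_ac)
 also have "\<dots> = F v p (\<Sum>a\<in>Basis. (N \<bullet> a) *\<^sub>R a) N"
  unfolding i linear_sum[OF la] linear_cmul[OF la] by (simp add: mult.commute)
 finally show ?thesis by (simp add: euclidean_representation)
qed

text \<open>\<open>u\<close> and \<open>p\<close> have pointwise meaning along normals, while Fubini
  and the change of variables act on the Borel versions \<open>v\<close> and \<open>\<pi>\<close>.
  Keeping \<open>\<Omega>\<close> off the times \<open>0\<close> and \<open>T\<close> removes the
  boundary terms of the weak formulation.\<close>

locale euler_representative =
 fixes T :: real and u :: "real^'n::finite => real => real^'n" and u0 :: "real^'n => real^'n"
  and p :: "real^'n => real => real" and W \<Omega> :: "((real^'n) \<times> real) set"
  and v :: "(real^'n) \<times> real => real^'n" and \<pi> :: "(real^'n) \<times> real => real"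
 assumes T: "T > 0" and weak: "weak_solution T u0 u" and press: "associated_pressure_on T W u p"
  and \<Omega>: "open \<Omega>" "\<Omega> \<subseteq> W" "\<Omega> \<subseteq> UNIV \<times> {0<..<T}"
  and v_meas [measurable]: "v \<in> borel_measurable borel" and \<pi>_meas [measurable]: "\<pi> \<in> borel_measurable borel"
  and rep: "AE z in lborel. z \<in> \<Omega> --> v z = u (fst z) (snd z) \<and> \<pi> z = p (fst z) (snd z)"
  and int: "integrable lborel (\<lambda>z. indicator \<Omega> z * (1 + (norm (v z))\<^sup>2 + \<bar>\<pi> z\<bar>))"
begin

context
 fixes \<eta> :: "(real^'n) \<times> real => real"
 assumes \<eta>: "test_function \<eta>" and supp: "closure {z. \<eta> z \<noteq> 0} \<subseteq> \<Omega>"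
  and sym: "\<And>a b. a \<in> Basis ==> b \<in> Basis ==> second_derivative \<eta> a b = second_derivative \<eta> b a"
begin

definition ka where "ka = second_derivative \<eta>"
definition ex :: "'n => (real^'n) \<times> real" where "ex i = (axis i 1, 0)"
definition et :: "(real^'n) \<times> real" where "et = (0, 1)"

lemma smooth_\<eta>: "smooth \<eta>" using \<eta> by (simp add: test_function_iff_bounded)
lemma ex_Basis: "ex i \<in> Basis" and et_Basis: "et \<in> Basis" by (simp_all add: ex_def et_def axis_prod_Basis)
lemma ka_zero: "z \<notin> \<Omega> ==> ka a b z = 0"
 unfolding ka_def using supp by (intro second_derivative_zero_outside) blast
lemma \<eta>'_zero: "z \<notin> \<Omega> ==> pderivative \<eta> b z = 0"
 using supp by (intro pderivative_zero_outside) blast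
lemma ka_sym: "a \<in> Basis ==> b \<in> Basis ==> ka a b = ka b a" unfolding ka_def by (rule sym)

lemma v_nth [measurable]: "(\<lambda>z. v z $ l) \<in> borel_measurable borel"
proof -
 have "(\<lambda>x. x $ l) \<in> borel_measurable (borel :: (real^'n) measure)"
  by (intro borel_measurable_continuous_onI continuous_intros)
 from measurable_compose[OF v_meas this] show ?thesis .
qed

lemma integrable_bounded_form:
 assumes f: "f \<in> borel_measurable borel" "\<And>z. \<bar>f z\<bar> \<le> 4 * (1 + (norm (v z))\<^sup>2 + \<bar>\<pi> z\<bar>)" and ab: "a \<in> Basis" "b \<in> Basis"
 shows "integrable lborel (\<lambda>z. f z * ka a b z)"
proof -
 have tf: "test_function (ka a b)" unfolding ka_def using \<eta> ab by (rule test_function_second_derivative)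
 have [measurable]: "ka a b \<in> borel_measurable borel" using test_function_integrable(2)[OF tf] .
 note [measurable] = f(1)
 have "bounded (range (ka a b))"
 proof -
  have c: "continuous_on (closure {z. ka a b z \<noteq> 0}) (ka a b)"
   using tf smooth_imp_continuous by (auto simp: test_function_def)
  have "bounded (ka a b ` closure {z. ka a b z \<noteq> 0})"
   using compact_continuous_image[OF c] tf by (intro compact_imp_bounded) (auto simp: test_function_def)
  then have "bounded (insert 0 (ka a b ` closure {z. ka a b z \<noteq> 0}))" by simp
  moreover have "range (ka a b) \<subseteq> insert 0 (ka a b ` closure {z. ka a b z \<noteq> 0})"
   using closure_subset[of "{z. ka a b z \<noteq> 0}"] by auto
  ultimately show ?thesis by (rule bounded_subset)
 qed
 then obtain C where C: "\<And>z. \<bar>ka a b z\<bar> \<le> C" unfolding bounded_iff by auto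
 have C0: "C \<ge> 0" using C[of 0] by linarith
 show ?thesis
 proof (rule Bochner_Integration.integrable_bound)
  show "integrable lborel (\<lambda>z. (4 * C) * (indicator \<Omega> z * (1 + (norm (v z))\<^sup>2 + \<bar>\<pi> z\<bar>)))"
   using int by (rule integrable_mult_right)
  show "AE z in lborel. norm (f z * ka a b z) \<le> norm ((4 * C) * (indicator \<Omega> z * (1 + (norm (v z))\<^sup>2 + \<bar>\<pi> z\<bar>)))"
  proof (rule AE_I2)
   fix z
   have n0: "0 \<le> 1 + (norm (v z))\<^sup>2 + \<bar>\<pi> z\<bar>" by (intro add_nonneg_nonneg) auto
   show "norm (f z * ka a b z) \<le> norm ((4 * C) * (indicator \<Omega> z * (1 + (norm (v z))\<^sup>2 + \<bar>\<pi> z\<bar>)))"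
   proof (cases "z \<in> \<Omega>")
    case True
    have "\<bar>f z\<bar> * \<bar>ka a b z\<bar> \<le> (4 * (1 + (norm (v z))\<^sup>2 + \<bar>\<pi> z\<bar>)) * C"
     using f(2)[of z] C[of z] n0 by (intro mult_mono) auto
    then show ?thesis using True n0 C0 by (simp add: abs_mult mult_ac)
   qed (simp add: ka_zero)
  qed
 qed measurable
qed

lemma form_measurable:
 assumes "F \<in> euler_forms" shows "(\<lambda>z. F (v z) (\<pi> z) a b) \<in> borel_measurable borel"
proof -
 have "(\<lambda>z. (v z, \<pi> z)) \<in> borel_measurable borel" by measurable
 from measurable_compose[OF this borel_measurable_continuous_onI[OF euler_form_continuous[OF assms, of a b]]]
 show ?thesis by simp
qed

lemma form_integrable:
 assumes "F \<in> euler_forms" "a \<in> Basis" "b \<in> Basis"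
 shows "integrable lborel (\<lambda>z. F (v z) (\<pi> z) a b * ka a b z)"
 by (intro integrable_bounded_form form_measurable euler_form_growth assms)

lemma form_sum:
 assumes "F \<in> euler_forms"
 shows "(\<Sum>a\<in>Basis. \<Sum>b\<in>Basis. LINT z|lborel. F (v z) (\<pi> z) a b * ka a b z) =
  (LINT z|lborel. (\<Sum>a\<in>Basis. \<Sum>b\<in>Basis. F (v z) (\<pi> z) a b * ka a b z))"
  "integrable lborel (\<lambda>z. \<Sum>a\<in>Basis. \<Sum>b\<in>Basis. F (v z) (\<pi> z) a b * ka a b z)"
 using form_integrable[OF assms] by (simp_all add: Bochner_Integration.integral_sum Bochner_Integration.integrable_sum)

lemma rep_slice: "AE t in lborel. AE x in lborel. (x, t) \<in> \<Omega> --> v (x, t) = u x t \<and> \<pi> (x, t) = p x t"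
 using AE_lborel_snd[OF rep] by simp

lemma slice_meas: "f \<in> borel_measurable borel ==> (\<lambda>x. f (x, t)) \<in> borel_measurable borel"
 for f :: "(real^'n) \<times> real => real"
proof -
 assume f: "f \<in> borel_measurable borel"
 have "(\<lambda>x::real^'n. (x, t)) \<in> borel_measurable borel" by (intro borel_measurable_continuous_onI continuous_intros)
 from measurable_compose[OF this f] show ?thesis .
qed

lemma ka_meas: "a \<in> Basis ==> b \<in> Basis ==> ka a b \<in> borel_measurable borel"
 using test_function_integrable(2)[OF test_function_second_derivative[OF \<eta>]] unfolding ka_def .

lemma L2_slice: "t \<in> {0..T} ==> L2 (\<lambda>x. u x t)"
 using weak unfolding weak_solution_def weakly_continuous_L2_def by blast

lemma LINT_zero_if_slices_zero:
 fixes f :: "(real^'n) \<times> real => real"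
 assumes "integrable lborel f" "AE t in lborel. (LINT x|lborel. f (x, t)) = 0"
 shows "(LINT z|lborel. f z) = 0"
proof -
 have "(LINT t|lborel. LINT x|lborel. f (x, t)) = (LINT (t::real)|lborel. (0::real))"
 proof (rule integral_cong_AE)
  show "(\<lambda>t. LINT x|lborel. f (x, t)) \<in> borel_measurable lborel"
   using lborel_integrable_snd(2)[OF assms(1)] by (rule borel_measurable_integrable)
 qed (use assms(2) in simp_all)
 then show ?thesis by (simp add: lborel_integral_snd[OF assms(1)])
qed

text \<open>At each fixed time the test function is the slice of the derivative of
  \<open>\<eta>\<close> in the direction \<open>c\<close>; by \<open>ka_sym\<close> its spatial
  gradient consists of the second derivatives that the form asks for.\<close>

lemma weak_divergence:
 assumes c: "c \<in> Basis"
 shows "(LINT z|lborel. (\<Sum>a\<in>Basis. \<Sum>b\<in>Basis. divergence_form c (v z) (\<pi> z) a b * ka a b z)) = 0"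
proof -
 let ?f = "\<lambda>z. \<Sum>a\<in>Basis. \<Sum>b\<in>Basis. divergence_form c (v z) (\<pi> z) a b * ka a b z"
 have F: "divergence_form c \<in> euler_forms" using c by (auto simp: euler_forms_def)
 have f: "?f z = (\<Sum>i\<in>UNIV. v z $ i * ka (ex i) c z)" for z
 proof -
  have "(\<Sum>b\<in>Basis. divergence_form c (v z) (\<pi> z) a b * ka a b z) = (v z \<bullet> fst a) * ka a c z" for a
  proof -
   have "(\<Sum>b\<in>Basis. divergence_form c (v z) (\<pi> z) a b * ka a b z) = (\<Sum>b\<in>Basis. if b = c then (v z \<bullet> fst a) * ka a c z else 0)"
    using c by (intro sum.cong refl) (auto simp: divergence_form_def inner_Basis)
   then show ?thesis using c by simp
  qed
  then show ?thesis by (simp add: sum_Basis_spacetime inner_axis ex_def)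
 qed
 show ?thesis
 proof (rule LINT_zero_if_slices_zero[OF form_sum(2)[OF F]])
  show "AE t in lborel. (LINT x|lborel. ?f (x, t)) = 0"
   using rep_slice
  proof eventually_elim
   case (elim t)
   show ?case
   proof (cases "t \<in> {0..T}")
    case True
    let ?\<phi> = "\<lambda>x. pderivative \<eta> c (x, t)"
    have tf: "test_function ?\<phi>" by (rule test_function_slice[OF test_function_pderivative[OF \<eta> c]])
    have g: "gradient ?\<phi> x $ i = ka (ex i) c (x, t)" for x i
     unfolding gradient_def ka_sym[OF ex_Basis c] using pderivative_slice[OF smooth_pderivative[OF smooth_\<eta> c], of t "axis i 1" x]
     by (simp add: pderivative_def[symmetric] ka_def second_derivative_def ex_def)
    have "(LINT x|lebesgue. u x t \<bullet> gradient ?\<phi> x) = 0"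
     using weak True tf unfolding weak_solution_def by blast
    moreover have "(LINT x|lebesgue. u x t \<bullet> gradient ?\<phi> x) = (LINT x|lborel. ?f (x, t))"
    proof (rule LINT_lebesgue_AE_eq)
     show "(\<lambda>x. ?f (x, t)) \<in> borel_measurable borel"
      by (rule slice_meas) (use form_sum(2)[OF F] in auto)
     show "AE x in lborel. ?f (x, t) = u x t \<bullet> gradient ?\<phi> x"
      using elim
     proof (rule eventually_mono)
      fix x assume "(x, t) \<in> \<Omega> --> v (x, t) = u x t \<and> \<pi> (x, t) = p x t"
      then show "?f (x, t) = u x t \<bullet> gradient ?\<phi> x"
       unfolding f inner_vec_def g by (cases "(x, t) \<in> \<Omega>") (simp_all add: ka_zero)
     qed
    qed
    ultimately show ?thesis by simp
   next
    case False
    then have "(x, t) \<notin> \<Omega>" for x using \<Omega>(3) by auto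
    then have "?f (x, t) = 0" for x by (simp add: ka_zero)
    then show ?thesis by simp
   qed
  qed
 qed
qed

lemma product_bound: "\<bar>v z $ l * v z $ k\<bar> \<le> 4 * (1 + (norm (v z))\<^sup>2 + \<bar>\<pi> z\<bar>)"
proof -
 have "\<bar>v z $ l * v z $ k\<bar> \<le> norm (v z) * norm (v z)"
  unfolding abs_mult by (intro mult_mono component_le_norm_cart) auto
 then show ?thesis using zero_le_power2[of "norm (v z)"] abs_ge_zero[of "\<pi> z"] by (simp add: power2_eq_square)
qed

lemma pressure_bound: "\<bar>\<pi> z\<bar> \<le> 4 * (1 + (norm (v z))\<^sup>2 + \<bar>\<pi> z\<bar>)"
 by (rule growth_arith[OF order_refl two_norm_le]) simp_all

text \<open>At almost every time the pressure is tested with the spatial Laplacian of the slice of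
  \<open>\<eta>\<close>, and \<open>pressure_distribution_laplacian\<close> evaluates the
  distribution.\<close>

lemma weak_pressure: "(LINT z|lborel. (\<Sum>a\<in>Basis. \<Sum>b\<in>Basis. pressure_form (v z) (\<pi> z) a b * ka a b z)) = 0"
proof -
 let ?f = "\<lambda>z. \<Sum>a\<in>Basis. \<Sum>b\<in>Basis. pressure_form (v z) (\<pi> z) a b * ka a b z"
 let ?g = "\<lambda>l k z. v z $ l * v z $ k * ka (ex l) (ex k) z" and ?h = "\<lambda>l z. \<pi> z * ka (ex l) (ex l) z"
 have F: "pressure_form \<in> euler_forms" by (auto simp: euler_forms_def)
 have f: "?f z = (\<Sum>l\<in>UNIV. \<Sum>k\<in>UNIV. ?g l k z) + (\<Sum>l\<in>UNIV. ?h l z)" for z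
 proof -
  have d: "(\<Sum>k\<in>UNIV. \<pi> z * (axis l (1::real) \<bullet> axis k (1::real)) * ka (ex l) (ex k) z) = ?h l z" for l
   by (subst sum.remove[of _ l]) (auto simp: inner_axis_axis inner_real_def)
  have fe: "fst (ex i) = axis i 1" for i by (simp add: ex_def)
  \<comment> \<open>The time direction drops out because its spatial part is
    \<open>0\<close>.\<close>
  have "?f z = (\<Sum>l\<in>UNIV. \<Sum>k\<in>UNIV. pressure_form (v z) (\<pi> z) (ex l) (ex k) * ka (ex l) (ex k) z)"
   unfolding sum_Basis_spacetime ex_def[symmetric] by (simp add: pressure_form_def)
  also have "\<dots> = (\<Sum>l\<in>UNIV. (\<Sum>k\<in>UNIV. ?g l k z) + (\<Sum>k\<in>UNIV. \<pi> z * (axis l (1::real) \<bullet> axis k (1::real)) * ka (ex l) (ex k) z))"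
   unfolding sum.distrib[symmetric] pressure_form_def fe by (intro sum.cong refl) (simp add: inner_axis inner_real_def distrib_right)
  finally show ?thesis unfolding d sum.distrib .
 qed
 have vm: "(\<lambda>z. v z $ l * v z $ k) \<in> borel_measurable borel" for l k by measurable
 have gi: "integrable lborel (?g l k)" for l k by (intro integrable_bounded_form vm product_bound ex_Basis)
 have hi: "integrable lborel (?h l)" for l by (intro integrable_bounded_form \<pi>_meas pressure_bound ex_Basis)
 have gs: "AE t in lborel. \<forall>l k. integrable lborel (\<lambda>x. ?g l k (x, t))"
  unfolding AE_all_countable by (intro allI lborel_integrable_snd(1) gi)
 have hs: "AE t in lborel. \<forall>l. integrable lborel (\<lambda>x. ?h l (x, t))"
  unfolding AE_all_countable by (intro allI lborel_integrable_snd(1) hi)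
 have "AE t in lebesgue. t \<in> {0..T} --> (\<forall>\<phi>. test_function \<phi> \<and> closure {x. \<phi> x \<noteq> 0} \<subseteq> slice W t -->
     complex_of_real (LINT x|lebesgue. p x t * \<phi> x) = pressure_distribution (\<lambda>x. u x t) \<phi>)"
  using press unfolding associated_pressure_on_def by (subst (asm) AE_restrict_space_iff) (auto elim: eventually_mono)
 then have pr: "AE t in lborel. t \<in> {0..T} --> (\<forall>\<phi>. test_function \<phi> \<and> closure {x. \<phi> x \<noteq> 0} \<subseteq> slice W t -->
     complex_of_real (LINT x|lebesgue. p x t * \<phi> x) = pressure_distribution (\<lambda>x. u x t) \<phi>)"
  by (simp add: AE_completion_iff)
 show ?thesis
 proof (rule LINT_zero_if_slices_zero[OF form_sum(2)[OF F]])
  show "AE t in lborel. (LINT x|lborel. ?f (x, t)) = 0"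
   using rep_slice pr gs hs
  proof eventually_elim
   case (elim t)
   show ?case
   proof (cases "t \<in> {0..T}")
    case True
    let ?ff = "\<lambda>x. \<eta> (x, t)"
    let ?\<phi> = "laplacian ?ff"
    have tf0: "test_function ?ff" by (rule test_function_slice[OF \<eta>])
    have sd: "second_derivative ?ff (axis l 1) (axis k 1) x = ka (ex l) (ex k) (x, t)" for l k x
     unfolding ka_def ex_def by (rule second_derivative_slice[OF smooth_\<eta>])
    have lap: "?\<phi> x = (\<Sum>l\<in>UNIV. ka (ex l) (ex l) (x, t))" for x unfolding laplacian_def sd ..
    have tf: "test_function ?\<phi>" by (rule test_function_laplacian[OF tf0])
    \<comment> \<open>The Laplacian is supported where \<open>\<eta>\<close> is, hence in the slice
      of \<open>W\<close>, where the pressure is a function.\<close>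
    let ?K = "{x. (x, t) \<in> closure {z. \<eta> z \<noteq> 0}}"
    have "closed ((\<lambda>x. (x, t)) -` closure {z. \<eta> z \<noteq> 0})"
     by (intro closed_vimage closed_closure continuous_intros)
    then have "closed ?K" by (simp add: vimage_def)
    moreover have "{x. ?\<phi> x \<noteq> 0} \<subseteq> ?K"
    proof
     fix x assume "x \<in> {x. ?\<phi> x \<noteq> 0}"
     then have "(\<Sum>l\<in>UNIV. ka (ex l) (ex l) (x, t)) \<noteq> 0" unfolding lap by simp
     then obtain l where "ka (ex l) (ex l) (x, t) \<noteq> 0" by (rule sum.not_neutral_contains_not_neutral)
     then show "x \<in> ?K"
      using second_derivative_zero_outside[of "(x, t)" \<eta> "ex l" "ex l"] unfolding ka_def by blast
    qed
    ultimately have "closure {x. ?\<phi> x \<noteq> 0} \<subseteq> ?K" by (intro closure_minimal)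
    also have "?K \<subseteq> slice W t" using supp \<Omega>(2) by (auto simp: slice_def)
    finally have "complex_of_real (LINT x|lebesgue. p x t * ?\<phi> x) = pressure_distribution (\<lambda>x. u x t) ?\<phi>"
     using elim(2) True tf by blast
    also have "\<dots> = - of_real (\<Sum>l\<in>UNIV. \<Sum>k\<in>UNIV. LINT x|lebesgue. u x t $ l * u x t $ k * ka (ex l) (ex k) (x, t))"
     using pressure_distribution_laplacian[OF L2_slice[OF True] tf0] unfolding sd .
    finally have e: "(LINT x|lebesgue. p x t * ?\<phi> x) =
      - (\<Sum>l\<in>UNIV. \<Sum>k\<in>UNIV. LINT x|lebesgue. u x t $ l * u x t $ k * ka (ex l) (ex k) (x, t))"
     unfolding of_real_minus[symmetric] of_real_eq_iff .
    have m1: "(\<lambda>x. ?g l k (x, t)) \<in> borel_measurable borel" for l k by (rule slice_meas) (use gi in auto)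
    have m2: "(\<lambda>x. \<Sum>l\<in>UNIV. ?h l (x, t)) \<in> borel_measurable borel"
     by (rule slice_meas[of "\<lambda>z. \<Sum>l\<in>UNIV. ?h l z"]) (use hi in \<open>auto intro!: borel_measurable_sum\<close>)
    have 1: "(LINT x|lebesgue. u x t $ l * u x t $ k * ka (ex l) (ex k) (x, t)) = (LINT x|lborel. ?g l k (x, t))" for l k
    proof (rule LINT_lebesgue_AE_eq[OF m1])
     show "AE x in lborel. ?g l k (x, t) = u x t $ l * u x t $ k * ka (ex l) (ex k) (x, t)"
      using elim(1)
     proof (rule eventually_mono)
      fix x assume "(x, t) \<in> \<Omega> --> v (x, t) = u x t \<and> \<pi> (x, t) = p x t"
      then show "?g l k (x, t) = u x t $ l * u x t $ k * ka (ex l) (ex k) (x, t)"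
       by (cases "(x, t) \<in> \<Omega>") (simp_all add: ka_zero)
     qed
    qed
    have 2: "(LINT x|lebesgue. p x t * ?\<phi> x) = (LINT x|lborel. (\<Sum>l\<in>UNIV. ?h l (x, t)))"
    proof (rule LINT_lebesgue_AE_eq[OF m2])
     show "AE x in lborel. (\<Sum>l\<in>UNIV. ?h l (x, t)) = p x t * ?\<phi> x"
      using elim(1)
     proof (rule eventually_mono)
      fix x assume "(x, t) \<in> \<Omega> --> v (x, t) = u x t \<and> \<pi> (x, t) = p x t"
      then show "(\<Sum>l\<in>UNIV. ?h l (x, t)) = p x t * ?\<phi> x"
       unfolding lap sum_distrib_left by (cases "(x, t) \<in> \<Omega>") (simp_all add: ka_zero)
     qed
    qed
    have "(LINT x|lborel. ?f (x, t)) = (\<Sum>l\<in>UNIV. \<Sum>k\<in>UNIV. LINT x|lborel. ?g l k (x, t)) + (LINT x|lborel. (\<Sum>l\<in>UNIV. ?h l (x, t)))"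
     unfolding f using elim(3,4)
     by (subst Bochner_Integration.integral_add) (auto intro!: Bochner_Integration.integrable_sum simp: Bochner_Integration.integral_sum)
    then show ?thesis using e unfolding 1 2 by simp
   next
    case False
    then have "(x, t) \<notin> \<Omega>" for x using \<Omega>(3) by auto
    then have "?f (x, t) = 0" for x by (simp add: ka_zero)
    then show ?thesis by simp
   qed
  qed
 qed
qed

text \<open>The field \<open>\<psi>\<close> is divergence-free because the Hessian of
  \<open>\<eta>\<close> is symmetric. With end time \<open>T\<close> both boundary terms vanish, as
  the support avoids the times \<open>0\<close> and \<open>T\<close>. The term \<open>A\<close>
  comes from the time derivative and \<open>B\<close> from the nonlinearity.\<close>

lemma weak_momentum: "(LINT z|lborel. (\<Sum>a\<in>Basis. \<Sum>b\<in>Basis. momentum_form i j (v z) (\<pi> z) a b * ka a b z)) = 0"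
proof -
 let ?f = "\<lambda>z. \<Sum>a\<in>Basis. \<Sum>b\<in>Basis. momentum_form i j (v z) (\<pi> z) a b * ka a b z"
 define A where "A w z = w $ i * ka (ex j) et z - w $ j * ka (ex i) et z" for w :: "real^'n" and z
 define B where "B w z = (\<Sum>k\<in>UNIV. w $ k * (w $ i * ka (ex j) (ex k) z - w $ j * ka (ex i) (ex k) z))" for w :: "real^'n" and z
 have F: "momentum_form i j \<in> euler_forms" unfolding euler_forms_def by (intro UnI2 image_eqI[of _ _ "(i, j)"]) auto
 have f: "?f z = A (v z) z + B (v z) z" for z
 proof -
  let ?w = "v z"
  \<comment> \<open>Summation over the spatial direction \<open>a\<close> acts as a Kronecker
    selection of the indices \<open>i\<close> and \<open>j\<close>.\<close>
  have pick: "(\<Sum>l\<in>UNIV. (?w $ i * axis l 1 $ j - ?w $ j * axis l 1 $ i) * X l) = ?w $ i * X j - ?w $ j * X i" for X :: "'n => real"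
  proof -
   have "(\<Sum>l\<in>UNIV. (?w $ i * axis l 1 $ j - ?w $ j * axis l 1 $ i) * X l) =
    (\<Sum>l\<in>UNIV. (if l = j then ?w $ i * X j else 0) - (if l = i then ?w $ j * X i else 0))"
    by (intro sum.cong refl) (auto simp: axis_def left_diff_distrib)
   then show ?thesis by (simp add: sum_subtractf)
  qed
  have "?f z = (\<Sum>b\<in>Basis. \<Sum>a\<in>Basis. momentum_form i j ?w (\<pi> z) a b * ka a b z)" by (rule sum.swap)
  also have "\<dots> = (\<Sum>b\<in>Basis. (snd b + ?w \<bullet> fst b) * (?w $ i * ka (ex j) b z - ?w $ j * ka (ex i) b z))"
  proof (rule sum.cong[OF refl])
   fix b :: "(real^'n) \<times> real"
   have "(\<Sum>a\<in>Basis. momentum_form i j ?w (\<pi> z) a b * ka a b z) =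
    (snd b + ?w \<bullet> fst b) * (\<Sum>l\<in>UNIV. (?w $ i * axis l 1 $ j - ?w $ j * axis l 1 $ i) * ka (ex l) b z)"
    by (simp add: sum_Basis_spacetime momentum_form_def sum_distrib_left ex_def mult.assoc)
   then show "(\<Sum>a\<in>Basis. momentum_form i j ?w (\<pi> z) a b * ka a b z) =
    (snd b + ?w \<bullet> fst b) * (?w $ i * ka (ex j) b z - ?w $ j * ka (ex i) b z)" unfolding pick .
  qed
  also have "\<dots> = A ?w z + B ?w z" by (simp add: sum_Basis_spacetime A_def B_def ex_def et_def inner_axis)
  finally show ?thesis .
 qed
 have vb: "\<bar>v z $ l\<bar> \<le> 4 * (1 + (norm (v z))\<^sup>2 + \<bar>\<pi> z\<bar>)" for z l
  by (rule growth_arith[OF component_le_norm_cart two_norm_le]) simp_all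
 have vm1: "(\<lambda>z. v z $ l) \<in> borel_measurable borel" for l by measurable
 have i1: "integrable lborel (\<lambda>z. v z $ l * ka (ex m) et z)" for l m
  by (intro integrable_bounded_form vm1 vb ex_Basis et_Basis)
 have vm: "(\<lambda>z. v z $ l * v z $ k) \<in> borel_measurable borel" for l k by measurable
 have i2: "integrable lborel (\<lambda>z. v z $ l * v z $ k * ka (ex m) (ex q) z)" for l k m q
  by (intro integrable_bounded_form vm product_bound ex_Basis)
 have Ai: "integrable lborel (\<lambda>z. A (v z) z)" unfolding A_def by (intro Bochner_Integration.integrable_diff i1)
 have "integrable lborel (\<lambda>z. \<Sum>k\<in>UNIV. v z $ k * v z $ i * ka (ex j) (ex k) z - v z $ k * v z $ j * ka (ex i) (ex k) z)"
  by (intro Bochner_Integration.integrable_sum Bochner_Integration.integrable_diff i2)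
 then have Bi: "integrable lborel (\<lambda>z. B (v z) z)" unfolding B_def right_diff_distrib mult.assoc .
 define \<psi> where "\<psi> z = pderivative \<eta> (ex j) z *\<^sub>R axis i 1 + pderivative \<eta> (ex i) z *\<^sub>R (- axis j (1::real))" for z
 have tj: "test_function (pderivative \<eta> (ex m))" for m by (rule test_function_pderivative[OF \<eta> ex_Basis])
 have sj: "smooth (pderivative \<eta> (ex m))" for m by (rule smooth_pderivative[OF smooth_\<eta> ex_Basis])
 have \<psi>t: "test_function \<psi>" unfolding \<psi>_def[abs_def]
  by (intro test_function_add test_function_linear_image[OF bounded_linear_scaleR_left] tj)
 then have \<psi>s: "smooth \<psi>" by (simp add: test_function_iff_bounded)
 have pd: "pderivative \<psi> b z = ka (ex j) b z *\<^sub>R axis i 1 + ka (ex i) b z *\<^sub>R (- axis j 1)" for b z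
 proof -
  have "(\<psi> has_derivative (\<lambda>h. pderivative (pderivative \<eta> (ex j)) h z *\<^sub>R axis i 1 + pderivative (pderivative \<eta> (ex i)) h z *\<^sub>R (- axis j 1))) (at z)"
   unfolding \<psi>_def[abs_def] by (intro has_derivative_add has_derivative_scaleR_left smooth_imp_differentiable sj)
  from pderivative_eq[OF this, of b] show ?thesis by (simp add: ka_def second_derivative_def)
 qed
 have J: "jacobian (\<lambda>x. \<psi> (x, s)) (at x) $ b $ a = ka (ex j) (ex a) (x, s) * axis i 1 $ b - ka (ex i) (ex a) (x, s) * axis j 1 $ b" for x s a b
  unfolding jacobian_def matrix_def using pderivative_slice[OF \<psi>s, of s "axis a 1" x]
  by (simp add: pderivative_def[symmetric] pd ex_def[symmetric])
 have div: "divergence (\<lambda>x. \<psi> (x, s)) x = 0" for x s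
 proof -
  have "divergence (\<lambda>x. \<psi> (x, s)) x = (\<Sum>a\<in>UNIV. (if a = i then ka (ex j) (ex i) (x, s) else 0) - (if a = j then ka (ex i) (ex j) (x, s) else 0))"
   unfolding divergence_def trace_def J by (intro sum.cong refl) (auto simp: axis_def)
  also have "\<dots> = 0" by (simp add: sum_subtractf ka_sym[OF ex_Basis ex_Basis, of i j])
  finally show ?thesis .
 qed
 have dt: "w \<bullet> vector_derivative (\<lambda>s. \<psi> (x, s)) (at s) = A w (x, s)" for w x s
  unfolding vector_derivative_slice[OF \<psi>s] pd A_def by (simp add: et_def inner_add_right inner_axis inner_diff_right mult.commute)
 have tr: "trace (tensor w w ** jacobian (\<lambda>x. \<psi> (x, s)) (at x)) = B w (x, s)" for w x s
 proof -
  have "(\<Sum>a\<in>UNIV. w $ b * w $ a * (ka (ex j) (ex b) (x, s) * axis i 1 $ a - ka (ex i) (ex b) (x, s) * axis j 1 $ a)) =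
   w $ b * (w $ i * ka (ex j) (ex b) (x, s) - w $ j * ka (ex i) (ex b) (x, s))" for b
  proof -
   have "(\<Sum>a\<in>UNIV. w $ b * w $ a * (ka (ex j) (ex b) (x, s) * axis i 1 $ a - ka (ex i) (ex b) (x, s) * axis j 1 $ a)) =
    (\<Sum>a\<in>UNIV. (if a = i then w $ b * w $ i * ka (ex j) (ex b) (x, s) else 0) - (if a = j then w $ b * w $ j * ka (ex i) (ex b) (x, s) else 0))"
    by (intro sum.cong refl) (auto simp: axis_def right_diff_distrib)
   then show ?thesis by (simp add: sum_subtractf right_diff_distrib)
  qed
  then show ?thesis unfolding B_def trace_def matrix_matrix_mult_def tensor_def by (simp add: J)
 qed
 have \<psi>0: "\<psi> z = 0" if "z \<notin> \<Omega>" for z using \<eta>'_zero[OF that] by (simp add: \<psi>_def)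
 have out: "(x, 0) \<notin> \<Omega>" "(x, T) \<notin> \<Omega>" for x using \<Omega>(3) by auto
 have "\<forall>t\<in>{0..T}. (LINT x|lebesgue. u x t \<bullet> \<psi> (x, t)) - (LINT x|lebesgue. u0 x \<bullet> \<psi> (x, 0))
     - (LINT s:{0..t}|lebesgue. LINT x|lebesgue. u x s \<bullet> vector_derivative (\<lambda>s. \<psi> (x, s)) (at s))
     = (LINT s:{0..t}|lebesgue. LINT x|lebesgue. trace (tensor (u x s) (u x s) ** jacobian (\<lambda>x. \<psi> (x, s)) (at x)))"
  using weak \<psi>t div unfolding weak_solution_def by blast
 from bspec[OF this, of T]
 have "- (LINT s:{0..T}|lebesgue. LINT x|lebesgue. A (u x s) (x, s)) = (LINT s:{0..T}|lebesgue. LINT x|lebesgue. B (u x s) (x, s))"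
  using T unfolding dt tr by (simp add: \<psi>0 out)
 moreover have "(LINT s:{0..T}|lebesgue. LINT x|lebesgue. A (u x s) (x, s)) = (LINT z|lborel. A (v z) z)"
 proof (rule spacetime_LINT[OF Ai])
  show "AE t in lborel. t \<in> {0..T} --> (AE x in lborel. A (v (x, t)) (x, t) = A (u x t) (x, t))"
   using rep_slice
  proof (rule eventually_mono, intro impI)
   fix t assume "AE x in lborel. (x, t) \<in> \<Omega> --> v (x, t) = u x t \<and> \<pi> (x, t) = p x t"
   then show "AE x in lborel. A (v (x, t)) (x, t) = A (u x t) (x, t)"
   proof (rule eventually_mono)
    fix x assume "(x, t) \<in> \<Omega> --> v (x, t) = u x t \<and> \<pi> (x, t) = p x t"
    then show "A (v (x, t)) (x, t) = A (u x t) (x, t)" by (cases "(x, t) \<in> \<Omega>") (simp_all add: A_def ka_zero)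
   qed
  qed
  show "A (v (x, t)) (x, t) = 0" if "t \<notin> {0..T}" for x t
  proof -
   have "(x, t) \<notin> \<Omega>" using that \<Omega>(3) by auto
   then show ?thesis by (simp add: A_def ka_zero)
  qed
 qed
 moreover have "(LINT s:{0..T}|lebesgue. LINT x|lebesgue. B (u x s) (x, s)) = (LINT z|lborel. B (v z) z)"
 proof (rule spacetime_LINT[OF Bi])
  show "AE t in lborel. t \<in> {0..T} --> (AE x in lborel. B (v (x, t)) (x, t) = B (u x t) (x, t))"
   using rep_slice
  proof (rule eventually_mono, intro impI)
   fix t assume "AE x in lborel. (x, t) \<in> \<Omega> --> v (x, t) = u x t \<and> \<pi> (x, t) = p x t"
   then show "AE x in lborel. B (v (x, t)) (x, t) = B (u x t) (x, t)"
   proof (rule eventually_mono)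
    fix x assume "(x, t) \<in> \<Omega> --> v (x, t) = u x t \<and> \<pi> (x, t) = p x t"
    then show "B (v (x, t)) (x, t) = B (u x t) (x, t)" by (cases "(x, t) \<in> \<Omega>") (simp_all add: B_def ka_zero)
   qed
  qed
  show "B (v (x, t)) (x, t) = 0" if "t \<notin> {0..T}" for x t
  proof -
   have "(x, t) \<notin> \<Omega>" using that \<Omega>(3) by auto
   then show ?thesis by (simp add: B_def ka_zero)
  qed
 qed
 ultimately have "(LINT z|lborel. A (v z) z) + (LINT z|lborel. B (v z) z) = 0" by simp
 then show ?thesis unfolding f using Ai Bi by simp
qed

lemma weak_form:
 assumes F: "F \<in> euler_forms"
 shows "(\<Sum>a\<in>Basis. \<Sum>b\<in>Basis. LINT z|lborel. F (v z) (\<pi> z) a b * second_derivative \<eta> a b z) = 0"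
proof -
 have "(LINT z|lborel. (\<Sum>a\<in>Basis. \<Sum>b\<in>Basis. F (v z) (\<pi> z) a b * ka a b z)) = 0"
  using F
 proof (cases rule: euler_formsE)
  case (1 c)
  show ?thesis unfolding 1(2) by (rule weak_divergence[OF 1(1)])
 next
  case 2
  show ?thesis unfolding 2 by (rule weak_pressure)
 next
  case (3 i j)
  show ?thesis unfolding 3 by (rule weak_momentum)
 qed
 then show ?thesis using form_sum(1)[OF F] unfolding ka_def by simp
qed

end

text \<open>The bump is rescaled to size \<open>\<epsilon>\<close> at \<open>z0\<close>; two
  derivatives produce a factor \<open>1 / \<epsilon>\<^sup>2\<close>, which is divided out. The
  translation by \<open>s *\<^sub>R c\<close> enlarges the radius of the support to at most
  \<open>\<epsilon> * (1 + \<bar>s\<bar>)\<close>.\<close>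

lemma scaled_weak_form:
 assumes F: "F \<in> euler_forms" and b: "ball z0 \<rho> \<subseteq> \<Omega>" and \<epsilon>: "0 < \<epsilon>" "\<epsilon> * (1 + \<bar>s\<bar>) < \<rho>" and c: "c \<in> Basis"
 shows "(\<Sum>(a, b)\<in>Basis \<times> Basis. LINT z|lborel. F (v z) (\<pi> z) a b *
  second_derivative (bump 0) a b ((z - z0) /\<^sub>R \<epsilon> + s *\<^sub>R c)) = 0"
proof -
 let ?l = "inverse \<epsilon>" and ?d = "s *\<^sub>R c - z0 /\<^sub>R \<epsilon>"
 let ?\<eta> = "\<lambda>z :: (real^'n) \<times> real. bump 0 (?l *\<^sub>R z + ?d)"
 have arg: "?l *\<^sub>R z + ?d = (z - z0) /\<^sub>R \<epsilon> + s *\<^sub>R c" for z by (simp add: scaleR_diff_right)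
 have sb: "smooth (bump 0 :: (real^'n) \<times> real => real)"
 proof -
  have "test_function (bump 0 :: (real^'n) \<times> real => real)" by (rule test_function_bump)
  then show ?thesis by (simp add: test_function_iff_bounded)
 qed
 have lin: "linear (\<lambda>z :: (real^'n) \<times> real. ?l *\<^sub>R z)" "inj (\<lambda>z :: (real^'n) \<times> real. ?l *\<^sub>R z)"
  using \<epsilon> by (auto intro!: linearI injI simp: scaleR_add_right)
 have \<eta>: "test_function ?\<eta>" by (rule test_function_affine_compose[OF test_function_bump lin])
 have sd: "second_derivative ?\<eta> a b z = ?l\<^sup>2 * second_derivative (bump 0) a b ((z - z0) /\<^sub>R \<epsilon> + s *\<^sub>R c)" if "a \<in> Basis" for a b z
  using second_derivative_affine[OF sb that, of ?l ?d b z] unfolding arg .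
 have hess: "second_derivative (bump 0) a b = (second_derivative (bump 0) b a :: (real^'n) \<times> real => real)" for a b
  unfolding second_derivative_def by (rule bump_hessian_symmetric)
 have sdg: "second_derivative ?\<eta> a b = second_derivative ?\<eta> b a" if "a \<in> Basis" "b \<in> Basis" for a b
  by (rule ext) (simp only: sd[OF that(1)] sd[OF that(2)] hess[of a b])
 have "norm (z - z0) \<le> \<epsilon> * (1 + \<bar>s\<bar>)" if "?\<eta> z \<noteq> 0" for z
 proof -
  let ?w = "(z - z0) /\<^sub>R \<epsilon> + s *\<^sub>R c"
  have "bump 0 ?w \<noteq> 0" using that unfolding arg .
  then have "?w \<bullet> ?w \<le> 1" by (auto simp: bump_def flat_exp_def split: if_splits)
  then have "norm ?w \<le> 1" by (simp add: norm_eq_sqrt_inner)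
  moreover have "norm ((z - z0) /\<^sub>R \<epsilon>) \<le> norm ?w + norm (s *\<^sub>R c)"
   using norm_triangle_ineq4[of ?w "s *\<^sub>R c"] by simp
  ultimately have "norm ((z - z0) /\<^sub>R \<epsilon>) \<le> 1 + \<bar>s\<bar>" using norm_Basis[OF c] by simp
  moreover have "norm ((z - z0) /\<^sub>R \<epsilon>) = norm (z - z0) / \<epsilon>"
   unfolding norm_scaleR using \<epsilon>(1) by (simp add: divide_inverse mult.commute)
  ultimately show ?thesis using \<epsilon>(1) by (simp add: pos_divide_le_eq mult.commute)
 qed
 then have "{z. ?\<eta> z \<noteq> 0} \<subseteq> cball z0 (\<epsilon> * (1 + \<bar>s\<bar>))" by (auto simp: dist_norm norm_minus_commute)
 then have "closure {z. ?\<eta> z \<noteq> 0} \<subseteq> cball z0 (\<epsilon> * (1 + \<bar>s\<bar>))" by (rule closure_minimal) simp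
 also have "\<dots> \<subseteq> \<Omega>" using b \<epsilon>(2) by (auto simp: subset_iff)
 finally have "(\<Sum>a\<in>Basis. \<Sum>b\<in>Basis. LINT z|lborel. F (v z) (\<pi> z) a b * second_derivative ?\<eta> a b z) = 0"
  by (rule weak_form[OF \<eta> _ sdg F])
 then have "(\<Sum>a\<in>Basis. \<Sum>b\<in>Basis. ?l\<^sup>2 * (LINT z|lborel. F (v z) (\<pi> z) a b * second_derivative (bump 0) a b ((z - z0) /\<^sub>R \<epsilon> + s *\<^sub>R c))) = 0"
  by (simp add: sd mult.left_commute)
 then have "?l\<^sup>2 * (\<Sum>a\<in>Basis. \<Sum>b\<in>Basis. LINT z|lborel. F (v z) (\<pi> z) a b * second_derivative (bump 0) a b ((z - z0) /\<^sub>R \<epsilon> + s *\<^sub>R c)) = 0"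
  by (simp add: sum_distrib_left)
 then show ?thesis using \<epsilon>(1) by (simp add: sum.cartesian_product)
qed

end

section \<open>Jumps across a slit\<close>

lemma borel_representative_on:
 fixes f :: "'a::euclidean_space => real"
 assumes A: "A \<in> sets lebesgue" and f: "f \<in> borel_measurable (lebesgue_on A)"
 shows "\<exists>g\<in>borel_measurable borel. AE z in lborel. z \<in> A --> g z = f z"
proof -
 have "(\<lambda>z. f z * indicator A z) \<in> borel_measurable lebesgue"
  using f A by (simp add: borel_measurable_restrict_space_iff[of A lebesgue f] mult.commute)
 from completion_ex_borel_measurable_real[OF this] obtain g where
  g: "g \<in> borel_measurable lborel" "AE z in lborel. f z * indicator A z = g z" by blast
 have "AE z in lborel. z \<in> A --> g z = f z" using g(2) by eventually_elim auto
 then show ?thesis using g(1) by auto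
qed

lemma borel_representative_on_vec:
 fixes f :: "'a::euclidean_space => real^'n"
 assumes A: "A \<in> sets lebesgue" and f: "f \<in> borel_measurable (lebesgue_on A)"
 shows "\<exists>g\<in>borel_measurable borel. AE z in lborel. z \<in> A --> g z = f z"
proof -
 have "\<forall>i. \<exists>g\<in>borel_measurable borel. AE z in lborel. z \<in> A --> g z = f z $ i"
 proof
  fix i
  have "(\<lambda>x. x $ i) \<in> borel_measurable (borel :: (real^'n) measure)"
   by (intro borel_measurable_continuous_onI continuous_intros)
  from measurable_compose[OF f this] show "\<exists>g\<in>borel_measurable borel. AE z in lborel. z \<in> A --> g z = f z $ i"
   by (rule borel_representative_on[OF A])
 qed
 then obtain g where g: "\<And>i. g i \<in> borel_measurable borel" "\<And>i. AE z in lborel. z \<in> A --> g i z = f z $ i" by metis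
 have "AE z in lborel. \<forall>i. z \<in> A --> g i z = f z $ i" unfolding AE_all_countable using g(2) by blast
 then have 1: "AE z in lborel. z \<in> A --> vec_lambda (\<lambda>i. g i z) = f z" by eventually_elim (simp add: vec_eq_iff)
 have 2: "(\<lambda>z. vec_lambda (\<lambda>i. g i z)) \<in> borel_measurable borel"
  unfolding borel_measurable_euclidean_space[where f = "\<lambda>z. vec_lambda (\<lambda>i. g i z)"]
  using g(1) by (auto simp: Basis_vec_def inner_axis)
 show ?thesis
  by (rule bexI[where x = "\<lambda>z. vec_lambda (\<lambda>i. g i z)" and P = "\<lambda>g. AE z in lborel. z \<in> A --> g z = f z", OF 1 2])
qed

text \<open>Scaling the line preserves null sets, and there are only countably many scales.\<close>

lemma AE_scaled_coordinate:
 fixes b :: "'a::euclidean_space"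
 assumes "AE s in lborel. R (s::real)" and b: "b \<in> Basis"
 shows "AE om in lborel. \<forall>m. R (eps m * (om \<bullet> b))"
 unfolding AE_all_countable
proof
 fix m
 obtain Y where Y: "Y \<in> null_sets lborel" "\<And>s. s \<notin> Y ==> R s" using AE_null_setE[OF assms(1)] by auto
 have [measurable]: "Y \<in> sets borel" using null_setsD2[OF Y(1)] by simp
 have "AE s in lborel. s \<notin> Y" using Y(1) by (rule AE_not_in)
 from AE_lborel_affine[OF _ _ this, of "eps m" 0] have "AE s in lborel. eps m * s \<notin> Y" using eps_pos[of m] by simp
 from AE_coordinate[OF this b] show "AE om in lborel. R (eps m * (om \<bullet> b))"
  by (rule eventually_mono) (rule Y(2))
qed

lemma normal_limit_sequence:
 fixes f :: "real^'n => real => 'b::real_normed_vector"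
 assumes lim: "has_normal_limit \<nu> c f x t" and \<nu>: "norm (\<nu> x t) = 1" and c: "c \<in> {1, -1}"
  and s: "s \<longlonglongrightarrow> 0" "\<And>m. s m > 0"
 shows "(\<lambda>m. f (x + (c * s m) *\<^sub>R \<nu> x t) t) \<longlonglongrightarrow> normal_limit \<nu> c f x t"
proof -
 let ?A = "normal_segment \<nu> c 1 x t"
 let ?X = "\<lambda>m. x + (c * s m) *\<^sub>R \<nu> x t"
 have "?X \<longlonglongrightarrow> x + (c * 0) *\<^sub>R \<nu> x t" by (intro tendsto_intros s)
 moreover have "\<forall>\<^sub>F m in sequentially. ?X m \<in> ?A \<and> ?X m \<noteq> x"
  using order_tendstoD(2)[OF s(1), of 1, simplified]
 proof (rule eventually_mono)
  fix m assume "s m < 1"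
  then show "?X m \<in> ?A \<and> ?X m \<noteq> x" using s(2)[of m] \<nu> c by (auto simp: normal_segment_def intro: exI[of _ "s m"])
 qed
 ultimately have X: "filterlim ?X (at x within ?A) sequentially" by (simp add: filterlim_at eventually_conj_iff)
 \<comment> \<open>\<open>Lim\<close> returns the limit only along a nontrivial filter; the sequence
   itself shows that \<open>x\<close> is a limit point of the segment.\<close>
 have nt: "at x within ?A \<noteq> bot"
  using X by (auto simp: filterlim_def filtermap_bot_iff bot.extremum_unique)
 obtain l where l: "((\<lambda>x'. f x' t) \<longlongrightarrow> l) (at x within ?A)" using lim unfolding has_normal_limit_def by blast
 have "normal_limit \<nu> c f x t = l" unfolding normal_limit_def using nt l by (rule tendsto_Lim)
 then show ?thesis using filterlim_compose[OF l X] by simp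
qed

lemma normal_max_bound:
 assumes "normal_max \<nu> c \<epsilon> f x t ^ n \<le> ennreal g" "0 \<le> g" "0 \<le> s" "s \<le> \<epsilon>"
 shows "norm (f (x + (c * s) *\<^sub>R \<nu> x t) t) ^ n \<le> g"
proof -
 have "ennreal (norm (f (x + (c * s) *\<^sub>R \<nu> x t) t)) \<le> normal_max \<nu> c \<epsilon> f x t"
  unfolding normal_max_def using assms by (intro SUP_upper) (auto simp: normal_segment_def)
 then have "ennreal (norm (f (x + (c * s) *\<^sub>R \<nu> x t) t)) ^ n \<le> normal_max \<nu> c \<epsilon> f x t ^ n" by (rule power_mono) simp
 also note assms(1)
 finally show ?thesis using assms(2) by (simp add: ennreal_power)
qed

text \<open>The hyperplane is null, so the two masses add up to the whole integral, which is
  \<open>0\<close>. Hence only the difference of the one-sided limits survives in the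
  blow-up.\<close>

lemma minus_part_eq:
 assumes i: "integrable lborel ka" and z: "(LINT z|lborel. ka z) = 0" and N: "N \<noteq> 0"
 shows "minus_part ka N = - plus_part ka N"
proof -
 have "negligible {z. N \<bullet> z = 0}" using N by (intro negligible_hyperplane) simp
 then have "AE z in lebesgue. z \<notin> {z. N \<bullet> z = 0}" by (intro AE_not_in) (simp add: negligible_iff_null_sets)
 then have ae: "AE z in lborel. N \<bullet> z \<noteq> 0" by (simp add: AE_completion_iff)
 have [measurable]: "ka \<in> borel_measurable borel" using i by auto
 have i1: "integrable lborel (\<lambda>z. indicator {z. N \<bullet> z > 0} z * ka z)" "integrable lborel (\<lambda>z. indicator {z. N \<bullet> z < 0} z * ka z)"
  by (rule Bochner_Integration.integrable_bound[OF i]; (measurable; fail)?; auto simp: indicator_def)+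
 have "plus_part ka N + minus_part ka N = (LINT z|lborel. indicator {z. N \<bullet> z > 0} z * ka z + indicator {z. N \<bullet> z < 0} z * ka z)"
  unfolding plus_part_def minus_part_def using i1 by simp
 also have "\<dots> = (LINT z|lborel. ka z)"
 proof (rule integral_cong_AE)
  show "AE z in lborel. indicator {z. N \<bullet> z > 0} z * ka z + indicator {z. N \<bullet> z < 0} z * ka z = ka z"
   using ae by eventually_elim (auto simp: indicator_def)
 qed (use i i1 in auto)
 finally show ?thesis using z by simp
qed

lemma bump_kernel:
 fixes c :: "'a::euclidean_space" and s :: real
 assumes a: "a \<in> Basis" and b: "b \<in> Basis"
 defines "ka \<equiv> \<lambda>z. second_derivative (bump 0) a b (z + s *\<^sub>R c)"
 shows "continuous_on UNIV ka" "integrable lborel ka" "(LINT z|lborel. ka z) = 0"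
  "norm c = 1 ==> ka z \<noteq> 0 ==> norm z \<le> 1 + \<bar>s\<bar>"
proof -
 have t1: "test_function (pderivative (bump 0) a :: 'a => real)" by (rule test_function_pderivative[OF test_function_bump a])
 have t0: "test_function (second_derivative (bump 0) a b :: 'a => real)" by (rule test_function_second_derivative[OF test_function_bump a b])
 have t: "test_function ka" unfolding ka_def by (rule test_function_translate[OF t0])
 show "continuous_on UNIV ka" using t by (simp add: test_function_iff_bounded smooth_imp_continuous)
 show "integrable lborel ka" by (rule test_function_integrable(1)[OF t])
 have "(LINT z|lborel. second_derivative (bump 0) a b (z :: 'a)) = 0"
  unfolding second_derivative_def
 proof (rule integral_pderivative_zero)
  show "((pderivative (bump 0) a :: 'a => real) has_derivative (\<lambda>h. pderivative (pderivative (bump 0) a) h x)) (at x)" for x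
   using t1 by (intro smooth_imp_differentiable) (simp add: test_function_iff_bounded)
  show "continuous_on UNIV (\<lambda>x. pderivative (pderivative (bump 0) a) b (x :: 'a))"
   using t0 by (simp add: second_derivative_def test_function_iff_bounded smooth_imp_continuous)
  show "bounded {x. pderivative (bump 0) a (x :: 'a) \<noteq> 0}" using t1 by (simp add: test_function_iff_bounded)
 qed
 then show "(LINT z|lborel. ka z) = 0"
  using integral_lborel_translation[OF test_function_integrable(2)[OF t0], of "s *\<^sub>R c"] by (simp add: ka_def add.commute)
 assume c: "norm c = 1" and z: "ka z \<noteq> 0"
 have "{z. bump 0 z \<noteq> 0} \<subseteq> cball (0::'a) 1"
 proof
  fix z :: 'a assume "z \<in> {z. bump 0 z \<noteq> 0}"
  then have "z \<bullet> z \<le> 1" by (auto simp: bump_def flat_exp_def split: if_splits)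
  then show "z \<in> cball 0 1" by (simp add: norm_eq_sqrt_inner)
 qed
 then have "closure {z. bump 0 z \<noteq> 0} \<subseteq> cball (0::'a) 1" by (rule closure_minimal) simp
 then have "z + s *\<^sub>R c \<in> cball 0 1" using z second_derivative_zero_outside[of "z + s *\<^sub>R c" "bump 0" a b] unfolding ka_def by blast
 then show "norm z \<le> 1 + \<bar>s\<bar>" using c norm_triangle_ineq4[of "z + s *\<^sub>R c" "s *\<^sub>R c"] by simp
qed

text \<open>The divergence form, with \<open>c\<close> not orthogonal to the conormal, gives equal
  normal velocities, and then the pressure form gives equal pressures. If
  \<open>m + u1 \<bullet> n\<close> is nonzero, the momentum forms give equality of all
  \<open>u $ i * n $ j - u $ j * n $ i\<close>, and these determine the tangential part.\<close>

lemma jump_algebra: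
 fixes n u1 u2 :: "real^'n"
 assumes n: "norm n = 1" and J: "\<And>F. F \<in> euler_forms ==> F u1 p1 (n, m) (n, m) = F u2 p2 (n, m) (n, m)"
 shows "u1 \<bullet> n = u2 \<bullet> n \<and> p1 = p2 \<and> (u1 \<noteq> u2 --> m = - (u1 \<bullet> n))"
proof -
 have nn: "n \<bullet> n = 1" using n by (simp add: dot_square_norm)
 have "(n, m) \<noteq> 0" using n by (auto simp: zero_prod_def)
 then obtain c where c: "c \<in> Basis" "(n, m) \<bullet> c \<noteq> 0" using euclidean_all_zero_iff[of "(n, m)"] by blast
 have "divergence_form c \<in> euler_forms" using c by (auto simp: euler_forms_def)
 from J[OF this] have un: "u1 \<bullet> n = u2 \<bullet> n" using c by (simp add: divergence_form_def)
 have "pressure_form \<in> euler_forms" by (auto simp: euler_forms_def)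
 from J[OF this] have p: "p1 = p2" using un nn by (simp add: pressure_form_def)
 have mom: "(m + u1 \<bullet> n) * (u1 $ i * n $ j - u1 $ j * n $ i) = (m + u1 \<bullet> n) * (u2 $ i * n $ j - u2 $ j * n $ i)" for i j
 proof -
  have "momentum_form i j \<in> euler_forms" unfolding euler_forms_def by (intro UnI2 image_eqI[of _ _ "(i, j)"]) auto
  from J[OF this] show ?thesis using un by (simp add: momentum_form_def)
 qed
 have eq: "u1 = u2" if "m + u1 \<bullet> n \<noteq> 0"
 proof (rule vec_eq_iff[THEN iffD2, rule_format])
  fix i
  have "u1 $ i * n $ j - u1 $ j * n $ i = u2 $ i * n $ j - u2 $ j * n $ i" for j using mom[of i j] that by simp
  \<comment> \<open>Contraction with \<open>n $ j\<close> recovers the tangential part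
    \<open>w - (w \<bullet> n) *\<^sub>R n\<close>.\<close>
  then have "(\<Sum>j\<in>UNIV. (u1 $ i * n $ j - u1 $ j * n $ i) * n $ j) = (\<Sum>j\<in>UNIV. (u2 $ i * n $ j - u2 $ j * n $ i) * n $ j)" by simp
  moreover have "(\<Sum>j\<in>UNIV. (w $ i * n $ j - w $ j * n $ i) * n $ j) = w $ i * (n \<bullet> n) - n $ i * (w \<bullet> n)" for w :: "real^'n"
   unfolding inner_vec_def sum_distrib_left sum_subtractf[symmetric]
   by (intro sum.cong refl) (simp add: inner_real_def algebra_simps)
  ultimately show "u1 $ i = u2 $ i" using un nn by simp
 qed
 show ?thesis
 proof (intro conjI impI un p)
  assume "u1 \<noteq> u2"
  then have "m + u1 \<bullet> n = 0" using eq by blast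
  then show "m = - (u1 \<bullet> n)" by simp
 qed
qed

lemma bounded_cube: "bounded (cube :: (real^'n) set)"
proof -
 have "norm y \<le> real CARD('n)" if "y \<in> cube" for y :: "real^'n"
 proof -
  have "norm y \<le> (\<Sum>i\<in>UNIV. \<bar>y $ i\<bar>)" by (rule norm_le_l1_cart)
  also have "\<dots> \<le> (\<Sum>i\<in>(UNIV::'n set). 1)" using that by (intro sum_mono) (auto simp: cube_def less_imp_le)
  finally show ?thesis by simp
 qed
 then show ?thesis by (auto simp: bounded_iff)
qed

context chart begin

lemma volume_element_flatten: "(y, t) \<in> Q ==> volume_element k r (flatten k y) t = volume_element k r y t"
proof -
 assume q: "(y, t) \<in> Q"
 then have q': "(flatten k y, t) \<in> Q" using proj_Q[OF q] by (simp add: proj_def)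
 have tan: "tangent r (flatten k y) t i = tangent r y t i" for i
  unfolding tangent_eq[OF q] tangent_eq[OF q'] by (simp add: proj_def)
 show ?thesis by (simp only: volume_element_def tan)
qed

lemma \<Psi>_line: "\<Psi> (proj k (y, t) + s *\<^sub>R normal_axis k) = (r y t + (e * s) *\<^sub>R \<nu> (r y t) t, t)"
proof -
 have "flatten k (flatten k y + s *\<^sub>R axis k 1) = flatten k y" by (auto simp: flatten_def vec_eq_iff axis_def)
 then have "r (flatten k y + s *\<^sub>R axis k 1) t = r y t"
  using r_flatten[of "flatten k y + s *\<^sub>R axis k 1" t] r_flatten[of y t] by simp
 moreover have "(flatten k y + s *\<^sub>R axis k 1) $ k = s" by (simp add: flatten_def axis_def)
 ultimately show ?thesis by (simp add: \<Psi>_def \<Phi>_def tubular_map_def proj_def normal_axis_def)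
qed

lemma \<Psi>_eq: "\<Psi> (y, t) = (r y t + (e * y $ k) *\<^sub>R \<nu> (r y t) t, t)"
 by (simp add: \<Psi>_def \<Phi>_def tubular_map_def)

lemma jac_pos_Q: "q \<in> Q ==> jac (\<lambda>w. D q (w, 0)) > 0"
proof (rule jac_pos)
 assume q: "q \<in> Q"
 show lin: "linear (\<lambda>w. D q (w, 0))"
  using blinfun.add_right[of "D q" "(_, 0)" "(_, 0)"] blinfun.scaleR_right[of "D q" _ "(_, 0)"] by (intro linearI) auto
 show "inj (\<lambda>w. D q (w, 0))" using nonsing[OF q] by (intro linear_injective_0[THEN iffD2, OF lin]) auto
qed

lemma emeasure_Q_finite: "emeasure lborel Q < \<infinity>"
proof -
 have "bounded (cube \<times> {0<..<T} :: ((real^'n) \<times> real) set)" by (intro bounded_Times bounded_cube) auto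
 then have "bounded Q" by (rule bounded_subset) (auto simp: Q_def Io_def)
 then show ?thesis by (rule emeasure_bounded_finite)
qed

lemma cont_Q_\<Phi>: "continuous_on Q \<Phi>"
 using der by (intro continuous_at_imp_continuous_on) (auto intro: has_derivative_continuous)

end

text \<open>The pointwise content of both assertions; the last clause is the second assertion
  written for densities with respect to \<open>\<sigma> t\<close>.\<close>

definition jump_condition :: "real => ((real^'n::finite) \<times> real) set => (real^'n => real => real^'n) =>
  (real^'n => real => real^'n) => (real^'n => real => real) => real^'n => real => bool" where
 "jump_condition T S \<nu> u p x t \<longleftrightarrow> normal_limit \<nu> 1 u x t \<bullet> \<nu> x t = normal_limit \<nu> (-1) u x t \<bullet> \<nu> x t \<and>
  normal_limit \<nu> 1 p x t = normal_limit \<nu> (-1) p x t \<and>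
  (normal_limit \<nu> 1 u x t \<noteq> normal_limit \<nu> (-1) u x t --> mu_density T S \<nu> x t = - (normal_limit \<nu> 1 u x t \<bullet> \<nu> x t))"

locale slit_chart = surface_chart T S \<nu> \<sigma> U I k r e
 for T :: real and S :: "((real^'n::finite) \<times> real) set" and \<nu> \<sigma> U I k r e +
 fixes u :: "real^'n => real => real^'n" and u0 :: "real^'n => real^'n"
  and p :: "real^'n => real => real" and W :: "((real^'n) \<times> real) set"
 assumes T_pos: "0 < T" and weak: "weak_solution T u0 u"
  and W: "openin (top_of_set (UNIV \<times> {0..T})) W" "S \<subseteq> W"
  and press: "associated_pressure_on T W u p" and slit: "slit T S \<nu> \<sigma> W u p"
begin

lemma representatives:
 obtains v \<pi> Z where "v \<in> borel_measurable borel" "\<pi> \<in> borel_measurable borel" "Z \<in> null_sets lborel"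
  "\<And>x t. (x, t) \<notin> Z ==> (x, t) \<in> W ==> v (x, t) = u x t \<and> \<pi> (x, t) = p x t"
proof -
 let ?A = "UNIV \<times> {0..T} :: ((real^'n) \<times> real) set"
 have "closed ?A" by (intro closed_Times) auto
 then have A: "?A \<in> sets borel" by (rule borel_closed)
 obtain O' where O': "open O'" "W = ?A \<inter> O'" using W(1) unfolding openin_open by blast
 have "W \<in> sets borel" unfolding O'(2) using A O'(1) by auto
 then have Wl: "W \<in> sets lebesgue" "?A \<in> sets lebesgue" using A by auto
 have "(\<lambda>(x, t). u x t) \<in> borel_measurable (lebesgue_on ?A)" using weak unfolding weak_solution_def by blast
 from borel_representative_on_vec[OF Wl(2) this] obtain v where
  v: "v \<in> borel_measurable borel" "AE z in lborel. z \<in> ?A --> v z = (case z of (x, t) => u x t)" by blast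
 have "(\<lambda>(x, t). p x t) \<in> borel_measurable (lebesgue_on W)" using press unfolding associated_pressure_on_def by blast
 from borel_representative_on[OF Wl(1) this] obtain \<pi> where
  \<pi>: "\<pi> \<in> borel_measurable borel" "AE z in lborel. z \<in> W --> \<pi> z = (case z of (x, t) => p x t)" by blast
 have "AE z in lborel. z \<in> W --> v z = (case z of (x, t) => u x t) \<and> \<pi> z = (case z of (x, t) => p x t)"
  using v(2) \<pi>(2) by eventually_elim (auto simp: O'(2))
 then obtain Z where Z: "Z \<in> null_sets lborel"
  "\<And>z. z \<notin> Z ==> z \<in> W --> v z = (case z of (x, t) => u x t) \<and> \<pi> z = (case z of (x, t) => p x t)"
  by (rule AE_null_setE) simp
 show ?thesis by (rule that[OF v(1) \<pi>(1) Z(1)]) (use Z(2) in fastforce)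
qed

lemma cont_jac: "continuous_on Q (\<lambda>q. jac (\<lambda>w. D q (w, 0)))"
proof (cases "Q = {}")
 case False
 then obtain y t where "(y, t) \<in> Q" by auto
 then have y: "flatten k y \<in> flat_cube k" "t \<in> Io" using flatten_cube by (auto simp: Q_def)
 obtain d \<rho> c Jmax where "\<And>s0. s0 > 0 ==> tube k \<Phi> D Q (nbhd (flatten k y) t d) N e \<rho> c s0 Jmax"
  by (rule tube_exists[OF y open_UNIV UNIV_I]) (rule that)
 then have "tube k \<Phi> D Q (nbhd (flatten k y) t d) N e \<rho> c 1 Jmax" by simp
 then show ?thesis by (rule tube.cont_J)
qed simp

text \<open>The tube map has a positive spatial Jacobian, so by the change of variables the preimage
  of a null set is null.\<close>

lemma AE_not_in_null_image:
 assumes "Z \<in> null_sets lborel" shows "AE q in lborel. q \<in> Q --> \<Psi> q \<notin> Z"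
proof -
 have [measurable]: "Z \<in> sets borel" using null_setsD2[OF assms] by simp
 have m: "(indicator Z :: (real^'n) \<times> real => ennreal) \<in> borel_measurable borel" by simp
 have c: "(\<lambda>q. indicator Q q * jac (\<lambda>w. D q (w, 0))) \<in> borel_measurable borel"
  using borel_measurable_continuous_on_indicator[OF borel_open[OF open_Q] cont_jac] by simp
 define \<Psi>0 where "\<Psi>0 q = (if q \<in> Q then (\<Phi> q, snd q) else 0)" for q
 have [measurable]: "\<Psi>0 \<in> borel_measurable borel" unfolding \<Psi>0_def
  using open_Q by (intro borel_measurable_continuous_on_if continuous_on_Pair cont_Q_\<Phi> continuous_intros borel_open)
 note [measurable] = c
 have "(\<integral>\<^sup>+q. ennreal (indicator Q q * jac (\<lambda>w. D q (w, 0))) * indicator Z (\<Psi>0 q) \<partial>lborel) =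
  (\<integral>\<^sup>+q. ennreal (indicator Q q * jac (\<lambda>w. D q (w, 0))) * indicator Z (\<Phi> q, snd q) \<partial>lborel)"
  by (rule nn_integral_cong) (simp add: \<Psi>0_def indicator_def)
 also have "\<dots> = (\<integral>\<^sup>+z. indicator ((\<lambda>q. (\<Phi> q, snd q)) ` Q) z * indicator Z z \<partial>lborel)"
  by (rule nn_integral_spacetime_image[OF open_Q cont_Q_\<Phi> slice_der _ cont_jac m, symmetric])
   (use inj in \<open>simp_all add: \<Psi>_def[abs_def]\<close>)
 also have "\<dots> \<le> (\<integral>\<^sup>+z. indicator Z z \<partial>lborel)" by (intro nn_integral_mono) (auto simp: indicator_def)
 also have "\<dots> = 0" using null_setsD1[OF assms] by simp
 finally have "AE q in lborel. ennreal (indicator Q q * jac (\<lambda>w. D q (w, 0))) * indicator Z (\<Psi>0 q) = 0"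
  by (simp add: nn_integral_0_iff_AE)
 then show ?thesis
 proof (rule eventually_mono, intro impI)
  fix q assume *: "ennreal (indicator Q q * jac (\<lambda>w. D q (w, 0))) * indicator Z (\<Psi>0 q) = 0" and q: "q \<in> Q"
  then show "\<Psi> q \<notin> Z" using jac_pos_Q[OF q] by (auto simp: \<Psi>0_def \<Psi>_def ennreal_eq_0_iff)
 qed
qed

lemma nn_integral_image_bound:
 assumes P: "open P" "P \<subseteq> Q" and J: "\<And>q. q \<in> P ==> jac (\<lambda>w. D q (w, 0)) \<le> J0"
  and f [measurable]: "f \<in> borel_measurable borel" and bd: "AE q in lborel. q \<in> P --> f (\<Psi> q) \<le> ennreal (g q)"
 shows "(\<integral>\<^sup>+z. indicator (\<Psi> ` P) z * f z \<partial>lborel) \<le> (\<integral>\<^sup>+q. ennreal J0 * (indicator P q * ennreal (g q)) \<partial>lborel)"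
proof -
 have "(\<integral>\<^sup>+z. indicator (\<Psi> ` P) z * f z \<partial>lborel) = (\<integral>\<^sup>+z. indicator ((\<lambda>q. (\<Phi> q, snd q)) ` P) z * f z \<partial>lborel)"
  by (simp add: \<Psi>_def[abs_def])
 also have "\<dots> = (\<integral>\<^sup>+q. ennreal (indicator P q * jac (\<lambda>w. D q (w, 0))) * f (\<Phi> q, snd q) \<partial>lborel)"
 proof (rule nn_integral_spacetime_image[OF P(1) _ _ _ _ f])
  show "continuous_on P \<Phi>" using cont_Q_\<Phi> P(2) by (rule continuous_on_subset)
  show "((\<lambda>y. \<Phi> (y, t)) has_derivative (\<lambda>w. D (y, t) (w, 0))) (at y)" if "(y, t) \<in> P" for y t
   using slice_der that P(2) by blast
  show "inj_on (\<lambda>q. (\<Phi> q, snd q)) P" using inj_on_subset[OF inj P(2)] by (simp add: \<Psi>_def[abs_def])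
  show "continuous_on P (\<lambda>q. jac (\<lambda>w. D q (w, 0)))" using cont_jac P(2) by (rule continuous_on_subset)
 qed
 also have "\<dots> \<le> (\<integral>\<^sup>+q. ennreal J0 * (indicator P q * ennreal (g q)) \<partial>lborel)"
 proof (rule nn_integral_mono_AE, rule eventually_mono[OF bd])
  fix q assume *: "q \<in> P --> f (\<Psi> q) \<le> ennreal (g q)"
  show "ennreal (indicator P q * jac (\<lambda>w. D q (w, 0))) * f (\<Phi> q, snd q) \<le> ennreal J0 * (indicator P q * ennreal (g q))"
   using * J[of q] by (cases "q \<in> P") (auto simp: \<Psi>_def intro!: mult_mono ennreal_leI)
 qed
 finally show ?thesis .
qed

lemma limits_AE:
 "AE t in lborel. t \<in> Io --> (AE y in lborel. y \<in> cube -->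
  (\<forall>c\<in>{1, -1}. has_normal_limit \<nu> c u (r y t) t \<and> has_normal_limit \<nu> c p (r y t) t))"
proof -
 have "AE t in lborel. 0 < t \<and> t < T --> (AE x in \<sigma> t. x \<in> slice S t -->
    (\<forall>c\<in>{1, -1}. has_normal_limit \<nu> c u x t \<and> has_normal_limit \<nu> c p x t))"
  using slit unfolding slit_def AE_lebesgue_on_Icc_iff by blast
 then show ?thesis
 proof (rule eventually_mono, intro impI)
  fix t assume *: "0 < t \<and> t < T --> (AE x in \<sigma> t. x \<in> slice S t -->
    (\<forall>c\<in>{1, -1}. has_normal_limit \<nu> c u x t \<and> has_normal_limit \<nu> c p x t))" and t: "t \<in> Io"
  then have "AE x in \<sigma> t. x \<in> slice S t -->
    (\<forall>c\<in>{1, -1}. has_normal_limit \<nu> c u x t \<and> has_normal_limit \<nu> c p x t)" by (auto simp: Io_def)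
  from chart_AE[OF sm closed_all t this] show "AE y in lborel. y \<in> cube -->
   (\<forall>c\<in>{1, -1}. has_normal_limit \<nu> c u (r y t) t \<and> has_normal_limit \<nu> c p (r y t) t)" .
 qed
qed

lemma Lq_on_chart_exists:
 assumes "Lq_on STM A n g" "n > 0"
 shows "\<exists>G. G \<in> borel_measurable borel \<and> (\<forall>q. 0 \<le> G q) \<and> integrable lborel (\<lambda>q. weight q * G q) \<and>
  (AE q in lborel. q \<in> Q --> R0 q \<in> A --> g (R0 q) ^ n \<le> ennreal (G q))"
proof -
 obtain G where G: "G \<in> borel_measurable borel" "\<And>q. 0 \<le> G q" "integrable lborel (\<lambda>q. weight q * G q)"
  "AE q in lborel. q \<in> Q --> R0 q \<in> A --> g (R0 q) ^ n \<le> ennreal (G q)"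
  by (rule Lq_on_chart[OF assms]) (rule that)
 show ?thesis by (intro exI[of _ G] conjI allI G)
qed

text \<open>The local form of the result, in parameters. The slit conditions are pulled back to the
  chart, a region \<open>\<Omega>\<close> is chosen where the Euler forms are integrable, and the
  blow-up is carried out for every Euler form and every rational translate of the bump.\<close>

lemma local_jump:
 assumes y0: "y0 \<in> flat_cube k" "t0 \<in> Io"
 shows "\<exists>d>0. AE t in lborel. AE y in lborel. (y, t) \<in> nbhd y0 t0 d --> jump_condition T S \<nu> u p (r y t) t"
proof -
 let ?q0 = "(y0, t0)" and ?z0 = "(r y0 t0, t0)"
 have y0c: "y0 \<in> cube" using y0 flat_cube_subset by blast
 have q0: "?q0 \<in> Q" using y0 y0c by (auto simp: Q_def)
 have "?z0 \<in> S" using surface_point[of y0 t0] q0 Q_subset by auto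
 have "\<forall>z\<in>S. \<exists>N \<epsilon>. openin (top_of_set S) N \<and> z \<in> N \<and> \<epsilon> > 0 \<and>
    (\<forall>c\<in>{1, -1}. (\<forall>(x, t)\<in>N. normal_segment \<nu> c \<epsilon> x t \<subseteq> slice W t) \<and>
     Lq_on STM N 2 (\<lambda>(x, t). normal_max \<nu> c \<epsilon> u x t) \<and> Lq_on STM N 1 (\<lambda>(x, t). normal_max \<nu> c \<epsilon> p x t))"
  using slit unfolding slit_def by (rule conjunct2)
 from bspec[OF this \<open>?z0 \<in> S\<close>] obtain N0 \<epsilon> where all: "openin (top_of_set S) N0 \<and> ?z0 \<in> N0 \<and> \<epsilon> > 0 \<and>
    (\<forall>c\<in>{1, -1}. (\<forall>(x, t)\<in>N0. normal_segment \<nu> c \<epsilon> x t \<subseteq> slice W t) \<and>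
     Lq_on STM N0 2 (\<lambda>(x, t). normal_max \<nu> c \<epsilon> u x t) \<and> Lq_on STM N0 1 (\<lambda>(x, t). normal_max \<nu> c \<epsilon> p x t))"
  by (elim exE) (rule that)
 note N0 = conjunct1[OF all] conjunct1[OF conjunct2[OF all]] and \<epsilon> = conjunct1[OF conjunct2[OF conjunct2[OF all]]]
  and allc = bspec[OF conjunct2[OF conjunct2[OF conjunct2[OF all]]]]
 have seg: "normal_segment \<nu> c \<epsilon> x t \<subseteq> slice W t" if "c \<in> {1, -1}" "(x, t) \<in> N0" for c x t
  using bspec[OF conjunct1[OF allc[OF that(1)]] that(2)] by simp
 note Lu = conjunct1[OF conjunct2[OF allc]] and Lp = conjunct2[OF conjunct2[OF allc]]
 obtain N' where N': "open N'" "N0 = S \<inter> N'" using N0(1) unfolding openin_open by blast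
 obtain v \<pi> Z where v [measurable]: "v \<in> borel_measurable borel" and \<pi> [measurable]: "\<pi> \<in> borel_measurable borel"
  and Z: "Z \<in> null_sets lborel" and rep: "\<And>x t. (x, t) \<notin> Z ==> (x, t) \<in> W ==> v (x, t) = u x t \<and> \<pi> (x, t) = p x t"
  by (rule representatives) (rule that)
 have exGu: "\<forall>c\<in>{1, -1}. \<exists>G. G \<in> borel_measurable borel \<and> (\<forall>q. 0 \<le> G q) \<and> integrable lborel (\<lambda>q. weight q * G q) \<and>
  (AE q in lborel. q \<in> Q --> R0 q \<in> N0 --> (case R0 q of (x, t) => normal_max \<nu> c \<epsilon> u x t) ^ 2 \<le> ennreal (G q))"
  by (rule ballI, rule Lq_on_chart_exists, erule Lu, simp)
 obtain Gu where GuA: "\<forall>c\<in>{1, -1}. Gu c \<in> borel_measurable borel \<and> (\<forall>q. 0 \<le> Gu c q) \<and> integrable lborel (\<lambda>q. weight q * Gu c q) \<and>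
  (AE q in lborel. q \<in> Q --> R0 q \<in> N0 --> (case R0 q of (x, t) => normal_max \<nu> c \<epsilon> u x t) ^ 2 \<le> ennreal (Gu c q))"
  using bchoice[OF exGu] by (elim exE) (rule that)
 note Gu = conjunct1[OF bspec[OF GuA]] spec[OF conjunct1[OF conjunct2[OF bspec[OF GuA]]]]
  conjunct1[OF conjunct2[OF conjunct2[OF bspec[OF GuA]]]] conjunct2[OF conjunct2[OF conjunct2[OF bspec[OF GuA]]]]
 have exGp: "\<forall>c\<in>{1, -1}. \<exists>G. G \<in> borel_measurable borel \<and> (\<forall>q. 0 \<le> G q) \<and> integrable lborel (\<lambda>q. weight q * G q) \<and>
  (AE q in lborel. q \<in> Q --> R0 q \<in> N0 --> (case R0 q of (x, t) => normal_max \<nu> c \<epsilon> p x t) ^ 1 \<le> ennreal (G q))"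
  by (rule ballI, rule Lq_on_chart_exists, erule Lp, simp)
 obtain Gp where GpA: "\<forall>c\<in>{1, -1}. Gp c \<in> borel_measurable borel \<and> (\<forall>q. 0 \<le> Gp c q) \<and> integrable lborel (\<lambda>q. weight q * Gp c q) \<and>
  (AE q in lborel. q \<in> Q --> R0 q \<in> N0 --> (case R0 q of (x, t) => normal_max \<nu> c \<epsilon> p x t) ^ 1 \<le> ennreal (Gp c q))"
  using bchoice[OF exGp] by (elim exE) (rule that)
 note Gp = conjunct1[OF bspec[OF GpA]] spec[OF conjunct1[OF conjunct2[OF bspec[OF GpA]]]]
  conjunct1[OF conjunct2[OF conjunct2[OF bspec[OF GpA]]]] conjunct2[OF conjunct2[OF conjunct2[OF bspec[OF GpA]]]]
 note pm = insertI1[of "1::real" "{-1}"] insertI2[OF singletonI, of "-1::real" 1]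
 \<comment> \<open>One majorant for both sides, velocity and pressure: it bounds the squared
   velocity plus the pressure on the whole normal segment of half-length
   \<open>\<epsilon>\<close>.\<close>
 define H where "H q = Gu 1 q + Gu (-1) q + Gp 1 q + Gp (-1) q" for q
 have Hm [measurable]: "H \<in> borel_measurable borel" unfolding H_def using Gu(1) Gp(1) by (intro borel_measurable_add) auto
 have H0: "0 \<le> H q" for q unfolding H_def using Gu(2) Gp(2) by (intro add_nonneg_nonneg) auto
 have "integrable lborel (\<lambda>q. weight q * Gu 1 q + weight q * Gu (-1) q + weight q * Gp 1 q + weight q * Gp (-1) q)"
  using Gu(3) Gp(3) by (intro Bochner_Integration.integrable_add) auto
 then have Hi: "integrable lborel (\<lambda>q. weight q * H q)" by (simp add: H_def distrib_left)
 have dom: "AE q in lborel. q \<in> Q --> R0 q \<in> N0 -->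
   (\<forall>a. \<bar>a\<bar> \<le> \<epsilon> --> (norm (u (r (fst q) (snd q) + a *\<^sub>R \<nu> (r (fst q) (snd q)) (snd q)) (snd q)))\<^sup>2
    + \<bar>p (r (fst q) (snd q) + a *\<^sub>R \<nu> (r (fst q) (snd q)) (snd q)) (snd q)\<bar> \<le> H q)"
  using Gu(4)[OF pm(1)] Gu(4)[OF pm(2)] Gp(4)[OF pm(1)] Gp(4)[OF pm(2)]
 proof eventually_elim
  case (elim q)
  show ?case
  proof (intro impI allI)
  fix a assume qa: "q \<in> Q" "R0 q \<in> N0" "\<bar>a\<bar> \<le> \<epsilon>"
  obtain y t where q: "q = (y, t)" by (cases q)
  have R: "R0 q = (r y t, t)" using qa(1) by (simp add: q R0_eq)
  define c :: real where "c = (if a \<ge> 0 then 1 else -1)"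
  have c: "c \<in> {1, -1}" "c * \<bar>a\<bar> = a" by (auto simp: c_def)
  have "normal_max \<nu> c \<epsilon> u (r y t) t ^ 2 \<le> ennreal (Gu c q)" "normal_max \<nu> c \<epsilon> p (r y t) t ^ 1 \<le> ennreal (Gp c q)"
   using elim qa R by (auto simp: c_def)
  from normal_max_bound[OF this(1) Gu(2)[OF c(1)] abs_ge_zero[of a] qa(3)]
   normal_max_bound[OF this(2) Gp(2)[OF c(1)] abs_ge_zero[of a] qa(3)]
  have "(norm (u (r y t + a *\<^sub>R \<nu> (r y t) t) t))\<^sup>2 + \<bar>p (r y t + a *\<^sub>R \<nu> (r y t) t) t\<bar> \<le> Gu c q + Gp c q"
   unfolding c(2) by simp
  also have "\<dots> \<le> H q" using Gu(2)[OF pm(1), of q] Gu(2)[OF pm(2), of q] Gp(2)[OF pm(1), of q] Gp(2)[OF pm(2), of q]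
   by (auto simp: c_def H_def)
  finally show "(norm (u (r (fst q) (snd q) + a *\<^sub>R \<nu> (r (fst q) (snd q)) (snd q)) (snd q)))\<^sup>2
    + \<bar>p (r (fst q) (snd q) + a *\<^sub>R \<nu> (r (fst q) (snd q)) (snd q)) (snd q)\<bar> \<le> H q" by (simp add: q)
  qed
 qed
 \<comment> \<open>\<open>e * s0 \<le> \<epsilon>\<close> keeps the sampled points on the normal
   segments, and \<open>s0 < 1\<close> keeps their parameters in the cube.\<close>
 define s0 where "s0 = min (\<epsilon> / e) (1 / 2)"
 have s0: "s0 > 0" "s0 < 1" "e * s0 \<le> \<epsilon>"
  using \<epsilon> e_pos by (auto simp: s0_def min_def field_simps)
 let ?vol = "\<lambda>(y, t). volume_element k r y t" and ?J = "\<lambda>q. jac (\<lambda>w. D q (w, 0))"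
 \<comment> \<open>Half of the volume element at the centre: on \<open>P2\<close> this bounds the
   weight away from \<open>0\<close>, so the majorant \<open>H\<close> is integrable there without
   the weight.\<close>
 define v0 where "v0 = ?vol ?q0 / 2"
 have v0: "v0 > 0" using volume_element_pos[OF q0] by (simp add: v0_def)
 define P2 where "P2 = (Q \<inter> ?vol -` {v0<..}) \<inter> (Q \<inter> (\<lambda>(y, t). (r y t, t)) -` N')"
 \<comment> \<open>\<open>P2\<close> consists of whole normal columns. \<open>P1\<close> also limits
   the height and the Jacobian, so that its image \<open>\<Omega>\<close> lies in \<open>W\<close>
   and the data are integrable on it.\<close>
 define P1 where "P1 = P2 \<inter> (Q \<inter> ?J -` {..<?J ?q0 + 1}) \<inter> (\<lambda>q. fst q $ k) -` {-s0<..<s0}"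
 have oP2: "open P2" unfolding P2_def
  by (intro open_Int continuous_open_preimage cont_volume_element cont_surface_map open_Q N'(1) open_greaterThan)
 have "open ((\<lambda>q::(real^'n) \<times> real. fst q $ k) -` {-s0<..<s0})"
  by (intro open_vimage open_greaterThanLessThan continuous_intros)
 then have oP1: "open P1" unfolding P1_def
  by (intro open_Int oP2 continuous_open_preimage cont_jac open_Q open_lessThan)
 have P21: "P2 \<subseteq> Q" "P1 \<subseteq> P2" "P1 \<subseteq> Q" by (auto simp: P1_def P2_def)
 have [measurable]: "P2 \<in> sets borel" "P1 \<in> sets borel" using oP1 oP2 by auto
 have P2N0: "R0 q \<in> N0" if "q \<in> P2" for q
  using that P21 R0_in[of q] by (cases q) (auto simp: P2_def R0_eq N'(2))
 have P1q0: "?q0 \<in> P1"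
  using q0 v0 N0(2) s0 y0(1) by (auto simp: P1_def P2_def v0_def N'(2) flat_cube_def)
 define \<Omega> where "\<Omega> = \<Psi> ` P1"
 have o\<Omega>: "open \<Omega>" unfolding \<Omega>_def by (rule open_image[OF P21(3) oP1])
 have lineW: "(r y t + a *\<^sub>R \<nu> (r y t) t, t) \<in> W" if "(y, t) \<in> P2" "\<bar>a\<bar> \<le> \<epsilon>" for y t a
 proof -
  define c :: real where "c = (if a \<ge> 0 then 1 else -1)"
  have "r y t + a *\<^sub>R \<nu> (r y t) t \<in> normal_segment \<nu> c \<epsilon> (r y t) t"
   unfolding normal_segment_def using that(2) by (intro CollectI exI[of _ "\<bar>a\<bar>"]) (auto simp: c_def)
  moreover have "(r y t, t) \<in> N0" using P2N0[OF that(1)] that(1) P21 by (auto simp: R0_eq)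
  ultimately show ?thesis using seg[of c "r y t" t] by (auto simp: c_def slice_def split: if_splits)
 qed
 have small: "\<bar>e * s\<bar> \<le> \<epsilon>" if "\<bar>s\<bar> \<le> s0" for s
 proof -
  have "e * \<bar>s\<bar> \<le> e * s0" using that e_pos by simp
  then have "e * \<bar>s\<bar> \<le> \<epsilon>" using s0(3) by (rule order_trans)
  then show ?thesis using e_pos by (simp add: abs_mult)
 qed
 have \<Omega>W: "\<Omega> \<subseteq> W"
 proof
  fix z assume "z \<in> \<Omega>"
  then obtain y t where q: "(y, t) \<in> P1" "z = \<Psi> (y, t)" by (auto simp: \<Omega>_def)
  then show "z \<in> W" using lineW[of y t "e * y $ k"] small[of "y $ k"] P21 by (auto simp: \<Psi>_eq P1_def)
 qed
 have \<Omega>T: "\<Omega> \<subseteq> UNIV \<times> {0<..<T}" using P21(3) by (auto simp: \<Omega>_def \<Psi>_def Q_def Io_def)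
 have notZ: "AE q in lborel. q \<in> Q --> \<Psi> q \<notin> Z" by (rule AE_not_in_null_image[OF Z])
 have G2: "integrable lborel (\<lambda>q. indicator P2 q * (1 + H q))"
 proof (rule Bochner_Integration.integrable_bound)
  show "integrable lborel (\<lambda>q. (2 / v0) * (weight q * H q) + indicator Q q *\<^sub>R 1)"
   using emeasure_Q_finite open_Q by (intro Bochner_Integration.integrable_add integrable_mult_right Hi integrable_scaleR_left integrable_real_indicator) auto
  show "AE q in lborel. norm (indicator P2 q * (1 + H q)) \<le> norm ((2 / v0) * (weight q * H q) + indicator Q q *\<^sub>R 1)"
  proof (rule AE_I2)
   fix q
   show "norm (indicator P2 q * (1 + H q)) \<le> norm ((2 / v0) * (weight q * H q) + indicator Q q *\<^sub>R 1)"
   proof (cases "q \<in> P2")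
    case True
    then have q: "q \<in> Q" "?vol q > v0" using P21 by (auto simp: P2_def)
    have "weight q = ?vol q / 2" using q(1) by (simp add: weight_def)
    then have "1 \<le> (2 / v0) * weight q" using q(2) v0 by (simp add: field_simps)
    then have "1 * H q \<le> ((2 / v0) * weight q) * H q" using H0 by (intro mult_right_mono)
    then show ?thesis using True q(1) H0[of q] by (simp add: mult.assoc)
   qed simp
  qed
 qed measurable
 \<comment> \<open>The change of variables carries the bound by \<open>1 + H\<close> from parameters
   to \<open>\<Omega>\<close>; the Jacobian is bounded on \<open>P1\<close>.\<close>
 have int\<Omega>: "integrable lborel (\<lambda>z. indicator \<Omega> z * (1 + (norm (v z))\<^sup>2 + \<bar>\<pi> z\<bar>))"
 proof (rule integrableI_bounded)
  have [measurable]: "\<Omega> \<in> sets borel" using o\<Omega> by auto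
  show "(\<lambda>z. indicator \<Omega> z * (1 + (norm (v z))\<^sup>2 + \<bar>\<pi> z\<bar>)) \<in> borel_measurable lborel" by measurable
  let ?f = "\<lambda>z. ennreal (1 + (norm (v z))\<^sup>2 + \<bar>\<pi> z\<bar>)"
  have "(\<integral>\<^sup>+z. ennreal (norm (indicator \<Omega> z * (1 + (norm (v z))\<^sup>2 + \<bar>\<pi> z\<bar>))) \<partial>lborel) = (\<integral>\<^sup>+z. indicator (\<Psi> ` P1) z * ?f z \<partial>lborel)"
   by (rule nn_integral_cong) (auto simp: \<Omega>_def indicator_def abs_of_nonneg add_nonneg_nonneg)
  also have "\<dots> \<le> (\<integral>\<^sup>+q. ennreal (?J ?q0 + 1) * (indicator P1 q * ennreal (1 + H q)) \<partial>lborel)"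
  proof (rule nn_integral_image_bound[OF oP1 P21(3)])
   show "?J q \<le> ?J ?q0 + 1" if "q \<in> P1" for q using that by (auto simp: P1_def)
   show "AE q in lborel. q \<in> P1 --> ?f (\<Psi> q) \<le> ennreal (1 + H q)"
    using dom notZ
   proof eventually_elim
    case (elim q)
    show ?case
    proof
    assume qP: "q \<in> P1"
    obtain y t where q: "q = (y, t)" by (cases q)
    have qQ: "q \<in> Q" "q \<in> P2" using qP P21 by auto
    have "\<bar>y $ k\<bar> \<le> s0" using qP by (auto simp: P1_def q)
    then have a: "\<bar>e * y $ k\<bar> \<le> \<epsilon>" by (rule small)
    have "\<Psi> q \<in> W" using qP \<Omega>W by (auto simp: \<Omega>_def)
    then have "v (\<Psi> q) = u (fst (\<Psi> q)) (snd (\<Psi> q)) \<and> \<pi> (\<Psi> q) = p (fst (\<Psi> q)) (snd (\<Psi> q))"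
     using rep[of "fst (\<Psi> q)" "snd (\<Psi> q)"] elim(2) qQ by simp
    then show "?f (\<Psi> q) \<le> ennreal (1 + H q)" using elim(1) qQ(1) P2N0[OF qQ(2)] a by (intro ennreal_leI) (auto simp: q \<Psi>_eq)
    qed
   qed
  qed measurable
  also have "\<dots> \<le> (\<integral>\<^sup>+q. ennreal (?J ?q0 + 1) * ennreal (norm (indicator P2 q * (1 + H q))) \<partial>lborel)"
  proof (intro nn_integral_mono mult_left_mono)
   fix q show "indicator P1 q * ennreal (1 + H q) \<le> ennreal (norm (indicator P2 q * (1 + H q)))"
    using P21(2) H0[of q] by (auto simp: indicator_def)
  qed simp
  also have "\<dots> = ennreal (?J ?q0 + 1) * (\<integral>\<^sup>+q. ennreal (norm (indicator P2 q * (1 + H q))) \<partial>lborel)"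
   by (intro nn_integral_cmult) measurable
  also have "\<dots> < \<infinity>" using conjunct2[OF integrable_iff_bounded[THEN iffD1, OF G2]] by (simp add: ennreal_mult_less_top less_top)
  finally show "(\<integral>\<^sup>+z. ennreal (norm (indicator \<Omega> z * (1 + (norm (v z))\<^sup>2 + \<bar>\<pi> z\<bar>))) \<partial>lborel) < \<infinity>" .
 qed
 have ER: "euler_representative T u u0 p W \<Omega> v \<pi>"
 proof (rule euler_representative.intro)
  have "AE z in lborel. z \<notin> Z" using Z by (rule AE_not_in)
  then show "AE z in lborel. z \<in> \<Omega> --> v z = u (fst z) (snd z) \<and> \<pi> z = p (fst z) (snd z)"
  proof (rule eventually_mono, intro impI)
   fix z assume "z \<notin> Z" "z \<in> \<Omega>"
   then show "v z = u (fst z) (snd z) \<and> \<pi> z = p (fst z) (snd z)" using rep[of "fst z" "snd z"] \<Omega>W by auto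
  qed
 qed (fact T_pos weak press o\<Omega> \<Omega>W \<Omega>T v \<pi> int\<Omega>)+
 have z0\<Omega>: "?z0 \<in> \<Omega>"
 proof -
  have "\<Psi> ?q0 = ?z0" using \<Psi>_flat[of ?q0] y0(1) by (simp add: proj_def flat_cube_flatten)
  then show ?thesis using imageI[OF P1q0, of \<Psi>] by (simp add: \<Omega>_def)
 qed
 \<comment> \<open>\<open>tube_exists\<close> with \<open>\<Omega>\<close> as the prescribed open
   set: the test balls at all base points lie in \<open>\<Omega>\<close>.\<close>
 obtain d \<rho> c Jmax where d: "d > 0" and \<rho>: "\<rho> > 0"
  and tubes: "\<And>s0. s0 > 0 ==> tube k \<Phi> D Q (nbhd y0 t0 d) N e \<rho> c s0 Jmax"
  and balls: "\<And>q. q \<in> nbhd y0 t0 d ==> ball (\<Psi> (proj k q)) \<rho> \<subseteq> \<Omega>"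
  by (rule tube_exists[OF y0 o\<Omega> z0\<Omega>]) (rule that)
 define P where "P = nbhd y0 t0 d"
 have PQ: "P \<subseteq> Q" unfolding P_def by (rule nbhd_subset)
 \<comment> \<open>Within \<open>Q\<close>, membership in \<open>P2\<close> depends on the foot of
   the normal only, and the foot lies in \<open>P1\<close>.\<close>
 have PP2: "P \<subseteq> P2"
 proof
  fix q assume q: "q \<in> P"
  obtain y t where yt: "q = (y, t)" by (cases q)
  have "\<Psi> (proj k q) \<in> \<Omega>" using balls[OF q[unfolded P_def]] \<rho> centre_in_ball by blast
  then obtain q' where q': "q' \<in> P1" "\<Psi> (proj k q) = \<Psi> q'" by (auto simp: \<Omega>_def)
  have "q \<in> Q" using q PQ by blast
  then have "proj k q = q'" using inj_onD[OF inj q'(2)] proj_Q q'(1) P21(3) by blast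
  then have "proj k q \<in> P2" using q'(1) P21 by blast
  then show "q \<in> P2" using \<open>q \<in> Q\<close> by (auto simp: P2_def yt proj_def volume_element_flatten r_flatten)
 qed
 interpret tb: tube k \<Phi> D Q P N e \<rho> c s0 Jmax "\<lambda>q. (\<Phi> q, snd q)" "\<lambda>q. jac (\<lambda>w. D q (w, 0))"
  unfolding P_def using tubes[OF s0(1)] by simp_all
 have oP: "open P" unfolding P_def by (rule open_nbhd)
 have \<Psi>': "(\<Phi> q, snd q) = \<Psi> q" for q by (simp add: \<Psi>_def)
 let ?up = "\<lambda>y t. normal_limit \<nu> 1 u (r y t) t" and ?um = "\<lambda>y t. normal_limit \<nu> (-1) u (r y t) t"
 let ?pp = "\<lambda>y t. normal_limit \<nu> 1 p (r y t) t" and ?pm = "\<lambda>y t. normal_limit \<nu> (-1) p (r y t) t"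
 have bk: "((axis k 1, 0) :: (real^'n) \<times> real) \<in> Basis" by (rule axis_prod_Basis)
 let ?good = "\<lambda>y t. (\<forall>a. \<bar>a\<bar> \<le> \<epsilon> --> (norm (u (r y t + a *\<^sub>R \<nu> (r y t) t) t))\<^sup>2 + \<bar>p (r y t + a *\<^sub>R \<nu> (r y t) t) t\<bar> \<le> H (y, t)) \<and>
   (\<forall>c\<in>{1, -1}. has_normal_limit \<nu> c u (r y t) t \<and> has_normal_limit \<nu> c p (r y t) t) \<and>
   (AE om in (lborel :: ((real^'n) \<times> real) measure). \<forall>m. eps m * \<bar>fst om $ k\<bar> < 1 --> (r y t + (e * (eps m * fst om $ k)) *\<^sub>R \<nu> (r y t) t, t) \<notin> Z)"
 \<comment> \<open>\<open>?good\<close> collects what holds for almost every parameter: domination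
   along the normal segment, existence of the limits, and avoidance of the null set \<open>Z\<close>
   by the sampled points at all scales.\<close>
 have good: "AE t in lborel. AE y in lborel. (y, t) \<in> P -->
   ?good y t"
  using AE_lborel_snd[OF dom] AE_lborel_snd[OF notZ] limits_AE
 proof eventually_elim
  case (elim t)
  show ?case
  proof (cases "t \<in> Io")
   case True
   show ?thesis using elim(1) elim(3)[rule_format, OF True] AE_lines[OF elim(2), of k]
   proof eventually_elim
    case (elim y)
    show ?case
    proof (intro impI conjI)
    assume yP: "(y, t) \<in> P"
    have q: "(y, t) \<in> Q" "y \<in> cube" using yP PQ by (auto simp: Q_def)
    show "\<forall>a. \<bar>a\<bar> \<le> \<epsilon> --> (norm (u (r y t + a *\<^sub>R \<nu> (r y t) t) t))\<^sup>2 + \<bar>p (r y t + a *\<^sub>R \<nu> (r y t) t) t\<bar> \<le> H (y, t)"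
     using elim(1) q(1) P2N0 PP2 yP by auto
    show "\<forall>c\<in>{1, -1}. has_normal_limit \<nu> c u (r y t) t \<and> has_normal_limit \<nu> c p (r y t) t"
     using elim(2) q(2) by blast
    show "AE om in (lborel :: ((real^'n) \<times> real) measure). \<forall>m. eps m * \<bar>fst om $ k\<bar> < 1 --> (r y t + (e * (eps m * fst om $ k)) *\<^sub>R \<nu> (r y t) t, t) \<notin> Z"
     using AE_scaled_coordinate[OF elim(3) bk]
    proof (rule eventually_mono, intro allI impI)
     fix om :: "(real^'n) \<times> real" and m
     assume *: "\<forall>m. (flatten k y + (eps m * (om \<bullet> (axis k 1, 0))) *\<^sub>R axis k 1, t) \<in> Q -->
      \<Psi> (flatten k y + (eps m * (om \<bullet> (axis k 1, 0))) *\<^sub>R axis k 1, t) \<notin> Z" and m: "eps m * \<bar>fst om $ k\<bar> < 1"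
     let ?s = "eps m * fst om $ k"
     have ip: "om \<bullet> (axis k 1, 0) = fst om $ k" by (simp add: inner_prod_def inner_axis)
     have "\<bar>?s\<bar> < 1" using m eps_pos[of m] by (simp add: abs_mult)
     \<comment> \<open>Heights below \<open>1\<close> stay in the cube, which is the reason for the
       restriction on \<open>eps m\<close>.\<close>
     then have "(flatten k y + ?s *\<^sub>R axis k 1, t) \<in> Q"
      using q by (auto simp: Q_def cube_def flatten_def axis_def)
     then have "\<Psi> (flatten k y + ?s *\<^sub>R axis k 1, t) \<notin> Z" using * ip by simp
     moreover have "\<Psi> (flatten k y + ?s *\<^sub>R axis k 1, t) = (r y t + (e * ?s) *\<^sub>R \<nu> (r y t) t, t)"
      using \<Psi>_line[of y t ?s] by (simp add: proj_def normal_axis_def)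
     ultimately show "(r y t + (e * ?s) *\<^sub>R \<nu> (r y t) t, t) \<notin> Z" by simp
    qed
    qed
   qed
  next
   case False
   then have "(y, t) \<notin> P" for y using PQ by (auto simp: Q_def)
   then show ?thesis by simp
  qed
 qed
 have os: "tb.one_sided (\<lambda>z. F (v z) (\<pi> z) a b) (\<lambda>q. 4 * (1 + H q))
   (\<lambda>y t. F (?up y t) (?pp y t) a b) (\<lambda>y t. F (?um y t) (?pm y t) a b)"
  if F: "F \<in> euler_forms" and ab: "a \<in> Basis" "b \<in> Basis" for F a b
  unfolding tb.one_sided_def
 proof (intro conjI allI)
  show "(\<lambda>z. F (v z) (\<pi> z) a b) \<in> borel_measurable borel"
  proof -
   have "(\<lambda>z. (v z, \<pi> z)) \<in> borel_measurable borel" by measurable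
   from measurable_compose[OF this borel_measurable_continuous_onI[OF euler_form_continuous[OF F, of a b]]]
   show ?thesis by simp
  qed
  show "(\<lambda>q. 4 * (1 + H q)) \<in> borel_measurable borel" by measurable
  show "0 \<le> 4 * (1 + H q)" for q using H0[of q] by simp
  have [measurable]: "P \<in> sets borel" using oP by auto
  show "integrable lborel (\<lambda>q. indicator P q * (4 * (1 + H q)))"
  proof (rule Bochner_Integration.integrable_bound[OF integrable_mult_right[OF G2, of 4]])
   show "AE q in lborel. norm (indicator P q * (4 * (1 + H q))) \<le> norm (4 * (indicator P2 q * (1 + H q)))"
    using PP2 by (intro AE_I2) (auto simp: indicator_def)
  qed measurable
  show "AE t in lborel. AE y in lborel. (y, t) \<in> P --> (AE om in lborel.
    tb.dominated_at (\<lambda>z. F (v z) (\<pi> z) a b) (\<lambda>q. 4 * (1 + H q)) (y, t) om \<and>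
    tb.converges_at (\<lambda>z. F (v z) (\<pi> z) a b) (F (?up y t) (?pp y t) a b) (F (?um y t) (?pm y t) a b) (y, t) om)"
   using good
  proof (rule eventually_mono)
   fix t assume "AE y in lborel. (y, t) \<in> P -->
   ?good y t"
   then show "AE y in lborel. (y, t) \<in> P --> (AE om in lborel.
    tb.dominated_at (\<lambda>z. F (v z) (\<pi> z) a b) (\<lambda>q. 4 * (1 + H q)) (y, t) om \<and>
    tb.converges_at (\<lambda>z. F (v z) (\<pi> z) a b) (F (?up y t) (?pp y t) a b) (F (?um y t) (?pm y t) a b) (y, t) om)"
   proof (rule eventually_mono, intro impI)
    fix y assume A: "(y, t) \<in> P -->
   ?good y t"
     and yP: "(y, t) \<in> P"
    have bd: "\<And>a. \<bar>a\<bar> \<le> \<epsilon> ==> (norm (u (r y t + a *\<^sub>R \<nu> (r y t) t) t))\<^sup>2 + \<bar>p (r y t + a *\<^sub>R \<nu> (r y t) t) t\<bar> \<le> H (y, t)"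
     and lim: "\<And>c. c \<in> {1, -1} ==> has_normal_limit \<nu> c u (r y t) t \<and> has_normal_limit \<nu> c p (r y t) t"
     and aeZ: "AE om in (lborel :: ((real^'n) \<times> real) measure). \<forall>m. eps m * \<bar>fst om $ k\<bar> < 1 --> (r y t + (e * (eps m * fst om $ k)) *\<^sub>R \<nu> (r y t) t, t) \<notin> Z"
     using A yP by blast+
    have yP2: "(y, t) \<in> P2" and yQ: "(y, t) \<in> Q" using yP PP2 PQ by auto
    have n1: "norm (\<nu> (r y t) t) = 1" using norm_normal[OF yQ] by (simp add: normal_def)
    show "AE om in lborel.
     tb.dominated_at (\<lambda>z. F (v z) (\<pi> z) a b) (\<lambda>q. 4 * (1 + H q)) (y, t) om \<and>
     tb.converges_at (\<lambda>z. F (v z) (\<pi> z) a b) (F (?up y t) (?pp y t) a b) (F (?um y t) (?pm y t) a b) (y, t) om"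
     using aeZ
    proof (rule eventually_mono)
     fix om :: "(real^'n) \<times> real"
     assume nz: "\<forall>m. eps m * \<bar>fst om $ k\<bar> < 1 --> (r y t + (e * (eps m * fst om $ k)) *\<^sub>R \<nu> (r y t) t, t) \<notin> Z"
     let ?x = "\<lambda>m. r y t + (e * (eps m * fst om $ k)) *\<^sub>R \<nu> (r y t) t"
     have val: "v (?x m, t) = u (?x m) t \<and> \<pi> (?x m, t) = p (?x m) t" if "eps m * \<bar>fst om $ k\<bar> \<le> s0" for m
     proof -
      have "\<bar>eps m * fst om $ k\<bar> \<le> s0" using that eps_pos[of m] by (simp add: abs_mult)
      then have "(?x m, t) \<in> W" by (intro lineW[OF yP2] small)
      moreover have "(?x m, t) \<notin> Z" using nz that s0(2) by auto
      ultimately show ?thesis using rep by blast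
     qed
     \<comment> \<open>Both sides are treated at once: \<open>c\<close> is the sign of
       \<open>fst om $ k\<close>.\<close>
     have lim': "(\<lambda>m. F (v (?x m, t)) (\<pi> (?x m, t)) a b) \<longlonglongrightarrow>
       F (normal_limit \<nu> c u (r y t) t) (normal_limit \<nu> c p (r y t) t) a b" if c: "c \<in> {1, -1}" "c * fst om $ k > 0" for c
     proof -
      have ce: "?x m = r y t + (c * (e * (eps m * (c * fst om $ k)))) *\<^sub>R \<nu> (r y t) t" for m using c(1) by auto
      have st: "(\<lambda>m. e * (eps m * (c * fst om $ k))) \<longlonglongrightarrow> 0"
      proof -
       have "(\<lambda>m. e * (eps m * (c * fst om $ k))) \<longlonglongrightarrow> e * (0 * (c * fst om $ k))" by (intro tendsto_intros eps_tendsto)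
       then show ?thesis by simp
      qed
      have sp: "e * (eps m * (c * fst om $ k)) > 0" for m using c(2) e_pos eps_pos[of m] by simp
      have 1: "(\<lambda>m. u (?x m) t) \<longlonglongrightarrow> normal_limit \<nu> c u (r y t) t"
       unfolding ce using lim[OF c(1)] by (intro normal_limit_sequence n1 c(1) st sp) auto
      have 2: "(\<lambda>m. p (?x m) t) \<longlonglongrightarrow> normal_limit \<nu> c p (r y t) t"
       unfolding ce using lim[OF c(1)] by (intro normal_limit_sequence n1 c(1) st sp) auto
      have "isCont (\<lambda>z. F (fst z) (snd z) a b) (normal_limit \<nu> c u (r y t) t, normal_limit \<nu> c p (r y t) t)"
       using euler_form_continuous[OF F, of a b] by (simp add: continuous_on_eq_continuous_at)
      from isCont_tendsto_compose[OF this tendsto_Pair[OF 1 2]]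
      have "(\<lambda>m. F (u (?x m) t) (p (?x m) t) a b) \<longlonglongrightarrow> F (normal_limit \<nu> c u (r y t) t) (normal_limit \<nu> c p (r y t) t) a b" by simp
      moreover have "(\<lambda>m. eps m * \<bar>fst om $ k\<bar>) \<longlonglongrightarrow> 0 * \<bar>fst om $ k\<bar>" by (intro tendsto_intros eps_tendsto)
      then have "\<forall>\<^sub>F m in sequentially. eps m * \<bar>fst om $ k\<bar> < s0" using s0(1) by (intro order_tendstoD(2)) auto
      then have "\<forall>\<^sub>F m in sequentially. F (u (?x m) t) (p (?x m) t) a b = F (v (?x m, t)) (\<pi> (?x m, t)) a b"
       by (rule eventually_mono) (use val in auto)
      ultimately show ?thesis by (rule Lim_transform_eventually)
     qed
     have dm: "\<bar>F (v (?x m, t)) (\<pi> (?x m, t)) a b\<bar> \<le> 4 * (1 + H (y, t))" if m: "eps m * \<bar>fst om $ k\<bar> \<le> s0" for m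
     proof -
      have "\<bar>eps m * fst om $ k\<bar> \<le> s0" using m eps_pos[of m] by (simp add: abs_mult)
      from bd[OF small[OF this]] have "(norm (u (?x m) t))\<^sup>2 + \<bar>p (?x m) t\<bar> \<le> H (y, t)" .
      then show ?thesis using euler_form_growth[OF F ab, of "u (?x m) t" "p (?x m) t"] val[OF m] by simp
     qed
     show "tb.dominated_at (\<lambda>z. F (v z) (\<pi> z) a b) (\<lambda>q. 4 * (1 + H q)) (y, t) om \<and>
      tb.converges_at (\<lambda>z. F (v z) (\<pi> z) a b) (F (?up y t) (?pp y t) a b) (F (?um y t) (?pm y t) a b) (y, t) om"
      unfolding tb.dominated_at_def tb.converges_at_def \<Psi>' \<Psi>_line
      using dm lim'[of 1] lim'[of "-1"] by auto
    qed
   qed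
  qed
 qed
 let ?ka = "\<lambda>s c i z. second_derivative (bump 0) (fst i) (snd i) (z + s *\<^sub>R (c :: (real^'n) \<times> real)) :: real"
 have step: "AE t in lborel. AE y in lborel. (y, t) \<in> P -->
   (\<Sum>i\<in>Basis \<times> Basis. F (?up y t) (?pp y t) (fst i) (snd i) * plus_part (?ka s c i) (N (y, t)) +
    F (?um y t) (?pm y t) (fst i) (snd i) * minus_part (?ka s c i) (N (y, t))) = 0"
  if F: "F \<in> euler_forms" and c: "c \<in> Basis" for F s c
 proof (rule tb.jump_ae[where R = "1 + \<bar>s\<bar>" and d = "\<rho> / (1 + \<bar>s\<bar>)" and f = "\<lambda>i z. F (v z) (\<pi> z) (fst i) (snd i)"
   and G = "\<lambda>i q. 4 * (1 + H q)" and Bx = "{y \<in> cube. dist (flatten k y) y0 < d}" and It = "{t0 - d<..<t0 + d} \<inter> Io"])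
  show "finite (Basis \<times> Basis :: (((real^'n) \<times> real) \<times> ((real^'n) \<times> real)) set)" by simp
  fix i :: "((real^'n) \<times> real) \<times> ((real^'n) \<times> real)" assume i: "i \<in> Basis \<times> Basis"
  then have ib: "fst i \<in> Basis" "snd i \<in> Basis" by auto
  show "tb.one_sided (\<lambda>z. F (v z) (\<pi> z) (fst i) (snd i)) (\<lambda>q. 4 * (1 + H q))
   (\<lambda>y t. F (?up y t) (?pp y t) (fst i) (snd i)) (\<lambda>y t. F (?um y t) (?pm y t) (fst i) (snd i))"
   by (rule os[OF F ib])
  show "continuous_on UNIV (?ka s c i)" by (rule bump_kernel(1)[OF ib])
  show "norm z \<le> 1 + \<bar>s\<bar>" if "?ka s c i z \<noteq> 0" for z
   using bump_kernel(4)[OF ib norm_Basis[OF c] that] .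
 next
  show "0 \<le> 1 + \<bar>s\<bar>" by simp
  show "0 < \<rho> / (1 + \<bar>s\<bar>)" using \<rho> by (simp add: add_pos_nonneg)
  show "P = {y \<in> cube. dist (flatten k y) y0 < d} \<times> ({t0 - d<..<t0 + d} \<inter> Io)" unfolding P_def nbhd_def ..
  show "open {y \<in> cube. dist (flatten k y) y0 < d}" "open ({t0 - d<..<t0 + d} \<inter> Io)" by (rule open_nbhd)+
  fix q m assume q: "q \<in> P" and m: "eps m < \<rho> / (1 + \<bar>s\<bar>)"
  have "eps m * (1 + \<bar>s\<bar>) < \<rho>" using m by (simp add: pos_less_divide_eq add_pos_nonneg)
  from euler_representative.scaled_weak_form[OF ER F balls[OF q[unfolded P_def]] eps_pos this c]
  show "(\<Sum>i\<in>Basis \<times> Basis. LINT z|lborel. F (v z) (\<pi> z) (fst i) (snd i) *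
    ?ka s c i ((z - (\<Phi> (proj k q), snd (proj k q))) /\<^sub>R eps m)) = 0"
   unfolding \<Psi>' by (simp add: case_prod_beta)
 qed
 \<comment> \<open>Countably many forms and bump translates, so that one null set serves all of
   them.\<close>
 let ?X = "(euler_forms :: 'n form set) \<times> (\<rat> \<times> (Basis :: ((real^'n) \<times> real) set))"
 have cX: "countable ?X" using finite_euler_forms by (intro countable_SIGMA countable_finite countable_rat) auto
 have "AE t in lborel. \<forall>w\<in>?X. AE y in lborel. (y, t) \<in> P -->
   (\<Sum>i\<in>Basis \<times> Basis. fst w (?up y t) (?pp y t) (fst i) (snd i) * plus_part (?ka (fst (snd w)) (snd (snd w)) i) (N (y, t)) +
    fst w (?um y t) (?pm y t) (fst i) (snd i) * minus_part (?ka (fst (snd w)) (snd (snd w)) i) (N (y, t))) = 0"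
  unfolding AE_ball_countable[OF cX] using step by auto
 then have "AE t in lborel. AE y in lborel. (y, t) \<in> P --> jump_condition T S \<nu> u p (r y t) t"
 proof (rule eventually_mono)
  fix t assume "\<forall>w\<in>?X. AE y in lborel. (y, t) \<in> P -->
   (\<Sum>i\<in>Basis \<times> Basis. fst w (?up y t) (?pp y t) (fst i) (snd i) * plus_part (?ka (fst (snd w)) (snd (snd w)) i) (N (y, t)) +
    fst w (?um y t) (?pm y t) (fst i) (snd i) * minus_part (?ka (fst (snd w)) (snd (snd w)) i) (N (y, t))) = 0"
  then have "AE y in lborel. \<forall>w\<in>?X. (y, t) \<in> P -->
   (\<Sum>i\<in>Basis \<times> Basis. fst w (?up y t) (?pp y t) (fst i) (snd i) * plus_part (?ka (fst (snd w)) (snd (snd w)) i) (N (y, t)) +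
    fst w (?um y t) (?pm y t) (fst i) (snd i) * minus_part (?ka (fst (snd w)) (snd (snd w)) i) (N (y, t))) = 0"
   unfolding AE_ball_countable[OF cX] .
  then show "AE y in lborel. (y, t) \<in> P --> jump_condition T S \<nu> u p (r y t) t"
  proof (rule eventually_mono, intro impI)
   fix y assume A: "\<forall>w\<in>?X. (y, t) \<in> P -->
   (\<Sum>i\<in>Basis \<times> Basis. fst w (?up y t) (?pp y t) (fst i) (snd i) * plus_part (?ka (fst (snd w)) (snd (snd w)) i) (N (y, t)) +
    fst w (?um y t) (?pm y t) (fst i) (snd i) * minus_part (?ka (fst (snd w)) (snd (snd w)) i) (N (y, t))) = 0"
    and yP: "(y, t) \<in> P"
   have q: "(y, t) \<in> Q" using yP PQ by blast
   have n1: "norm (\<nu> (r y t) t) = 1" using norm_normal[OF q] by (simp add: normal_def)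
   \<comment> \<open>The time component of the conormal is the density of mu; this is how mu enters
     the jump relations.\<close>
   have Neq: "N (y, t) = (\<nu> (r y t) t, mu_density T S \<nu> (r y t) t)"
    using mu_density_eq[OF q] by (simp add: N_def normal_def)
   have N0: "N (y, t) \<noteq> 0" unfolding Neq using n1 by (auto simp: zero_prod_def)
   have FN: "F (?up y t) (?pp y t) (N (y, t)) (N (y, t)) = F (?um y t) (?pm y t) (N (y, t)) (N (y, t))" if F: "F \<in> euler_forms" for F
   proof -
    \<comment> \<open>The jump coefficients. By \<open>minus_part_eq\<close> the relation from the
      blow-up is the hypothesis of \<open>half_space_jump\<close> for them.\<close>
    let ?Jm = "\<lambda>a b. F (?up y t) (?pp y t) a b - F (?um y t) (?pm y t) a b"
    have "(\<Sum>a\<in>Basis. \<Sum>b\<in>Basis. ?Jm a b * ((N (y, t) \<bullet> a) * (N (y, t) \<bullet> b))) = 0"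
    proof (rule half_space_jump[OF N0])
     fix s :: real and c :: "(real^'n) \<times> real" assume s: "s \<in> \<rat>" and c: "c \<in> Basis"
     have "(\<Sum>i\<in>Basis \<times> Basis. F (?up y t) (?pp y t) (fst i) (snd i) * plus_part (?ka s c i) (N (y, t)) +
       F (?um y t) (?pm y t) (fst i) (snd i) * minus_part (?ka s c i) (N (y, t))) = 0"
      using A[rule_format, of "(F, s, c)"] yP F s c by simp
     moreover have "minus_part (?ka s c i) (N (y, t)) = - plus_part (?ka s c i) (N (y, t))" if "i \<in> Basis \<times> Basis" for i
     proof -
      have ib: "fst i \<in> Basis" "snd i \<in> Basis" using that by auto
      show ?thesis by (rule minus_part_eq[OF bump_kernel(2)[OF ib] bump_kernel(3)[OF ib] N0])
     qed
     ultimately have "(\<Sum>i\<in>Basis \<times> Basis. ?Jm (fst i) (snd i) * plus_part (?ka s c i) (N (y, t))) = 0"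
      by (simp add: left_diff_distrib)
     then have "(\<Sum>i\<in>Basis \<times> Basis. ?Jm (fst i) (snd i) * (LINT z|lborel. indicator (half (N (y, t))) z * ?ka s c i z)) = 0"
      by (simp add: plus_part_def half_def[OF N0])
     then show "(\<Sum>a\<in>Basis. \<Sum>b\<in>Basis. ?Jm a b * (LINT z|lborel. indicator (half (N (y, t))) z * second_derivative (bump 0) a b (z + s *\<^sub>R c))) = 0"
      unfolding sum.cartesian_product by (simp add: case_prod_beta)
    qed
    then have "(\<Sum>a\<in>Basis. \<Sum>b\<in>Basis. F (?up y t) (?pp y t) a b * ((N (y, t) \<bullet> a) * (N (y, t) \<bullet> b))) -
     (\<Sum>a\<in>Basis. \<Sum>b\<in>Basis. F (?um y t) (?pm y t) a b * ((N (y, t) \<bullet> a) * (N (y, t) \<bullet> b))) = 0"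
     by (simp add: left_diff_distrib sum_subtractf)
    then show ?thesis unfolding euler_form_quadratic[OF F] by simp
   qed
   show "jump_condition T S \<nu> u p (r y t) t"
    unfolding jump_condition_def by (rule jump_algebra[OF n1]) (erule FN[unfolded Neq])
  qed
 qed
 then show ?thesis using d unfolding P_def by blast
qed

end

lemma borel_measurable_completion_AE:
 fixes f g :: "'a => real"
 assumes f: "f \<in> borel_measurable (completion M)" and ae: "AE x in completion M. f x = g x"
 shows "g \<in> borel_measurable (completion M)"
proof (rule measurableI)
 fix B :: "real set" assume B: "B \<in> sets borel"
 show "g -` B \<inter> space (completion M) \<in> sets (completion M)"
 proof (rule completion.in_sets_AE)
  show "f -` B \<inter> space (completion M) \<in> sets (completion M)" using f B by (rule measurable_sets)
  show "AE x in completion M. x \<in> f -` B \<inter> space (completion M) \<longleftrightarrow> x \<in> g -` B \<inter> space (completion M)"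
   using ae by (rule eventually_mono) simp
 qed simp
qed simp

section \<open>Continuity of the density and local finiteness of surface measure\<close>

context surface_chart begin

lemma cont_snd_N: "continuous_on Q (\<lambda>q. snd (N q))"
 unfolding N_def snd_conv
 by (intro continuous_on_minus continuous_on_inner cont_normal
  bounded_bilinear.continuous_on[OF bounded_bilinear_blinfun_apply cont_D_proj continuous_on_const])

lemma chart_inverse:
 assumes t: "t \<in> Io"
 obtains g where "continuous_on (slice S t \<inter> U) g" "\<And>x. x \<in> slice S t \<inter> U ==> (g x, t) \<in> Q \<and> r (g x) t = x"
  "\<And>y. y \<in> cube ==> g (r y t) = flatten k y"
proof -
 have tI: "t \<in> I" using t by (simp add: Io_def)
 obtain g where g: "homeomorphism (flat_cube k) (slice S t \<inter> U) (\<lambda>y. r y t) g" using r_hom[OF tI] by blast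
 show ?thesis
 proof (rule that)
  show "continuous_on (slice S t \<inter> U) g" using g by (simp add: homeomorphism_def)
  show "(g x, t) \<in> Q \<and> r (g x) t = x" if "x \<in> slice S t \<inter> U" for x
  proof -
   have "g x \<in> flat_cube k" "r (g x) t = x" using g that by (auto simp: homeomorphism_def)
   then show ?thesis using t flat_cube_subset by (auto simp: Q_def)
  qed
  show "g (r y t) = flatten k y" if "y \<in> cube" for y
   using homeomorphism_apply1[OF g flatten_cube[OF that, of k]] by (simp add: r_flatten)
 qed
qed

text \<open>On a slice the density is \<open>snd (N (y, t))\<close> read through the inverse chart,
  and \<open>N\<close> depends continuously on the parameters.\<close>

lemma mu_density_continuous:
 assumes t: "t \<in> Io" and x0: "x0 \<in> slice S t" "x0 \<in> U"
 shows "continuous (at x0 within slice S t) (\<lambda>x. mu_density T S \<nu> x t)"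
proof -
 obtain g where g: "continuous_on (slice S t \<inter> U) g" "\<And>x. x \<in> slice S t \<inter> U ==> (g x, t) \<in> Q \<and> r (g x) t = x"
  "\<And>y. y \<in> cube ==> g (r y t) = flatten k y"
  using chart_inverse[OF t] by metis
 have "continuous_on (slice S t \<inter> U) (\<lambda>x. (g x, t))" by (intro continuous_on_Pair g continuous_on_const)
 from continuous_on_compose2[OF cont_snd_N this]
 have "continuous_on (slice S t \<inter> U) (\<lambda>x. snd (N (g x, t)))" using g(2) by blast
 moreover have "snd (N (g x, t)) = mu_density T S \<nu> x t" if "x \<in> slice S t \<inter> U" for x
  using mu_density_eq[of "g x" t] g(2)[OF that] by simp
 ultimately have "continuous_on (slice S t \<inter> U) (\<lambda>x. mu_density T S \<nu> x t)" by (rule continuous_on_eq)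
 then have "continuous (at x0 within slice S t \<inter> U) (\<lambda>x. mu_density T S \<nu> x t)"
  using x0 by (simp add: continuous_on_eq_continuous_within)
 moreover have "at x0 within slice S t \<inter> U = at x0 within slice S t"
  using x0(2) open_U by (rule at_within_nhd) auto
 ultimately show ?thesis by simp
qed

text \<open>Near a point the volume element is bounded, and the parameter cube has finite
  volume.\<close>

lemma surface_measure_locally_finite:
 assumes t: "t \<in> Io" and x0: "x0 \<in> slice S t" "x0 \<in> U"
 shows "\<exists>V. open V \<and> x0 \<in> V \<and> emeasure (\<sigma> t) V < \<infinity>"
proof -
 obtain g where g: "continuous_on (slice S t \<inter> U) g" "\<And>x. x \<in> slice S t \<inter> U ==> (g x, t) \<in> Q \<and> r (g x) t = x"
  "\<And>y. y \<in> cube ==> g (r y t) = flatten k y"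
  using chart_inverse[OF t] by metis
 let ?vol = "\<lambda>(y, t). volume_element k r y t"
 define c where "c = ?vol (g x0, t) + 1"
 define Y where "Y = (\<lambda>y. (y, t)) -` (Q \<inter> ?vol -` {..<c})"
 have oY: "open Y" unfolding Y_def
  by (intro open_vimage continuous_open_preimage cont_volume_element open_Q open_lessThan continuous_intros)
 obtain V' where V': "open V'" "(slice S t \<inter> U) \<inter> g -` Y = (slice S t \<inter> U) \<inter> V'"
  using continuous_openin_preimage_gen[OF g(1) oY] unfolding openin_open by blast
 define V where "V = V' \<inter> U"
 have oV: "open V" unfolding V_def using V' open_U by auto
 have "g x0 \<in> Y" using g(2)[of x0] x0 by (simp add: Y_def c_def)
 then have "x0 \<in> V" using V'(2) x0 by (auto simp: V_def)
 have Vb: "V \<in> sets borel" "V \<subseteq> U" using oV by (auto simp: V_def)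
 have "emeasure (\<sigma> t) V = (\<integral>\<^sup>+y. ennreal (weight (y, t)) * indicator V (fst (R0 (y, t))) \<partial>lborel)"
  by (rule surface_measure_eq[OF sm closed_all t Vb])
 also have "\<dots> \<le> (\<integral>\<^sup>+(y::real^'n). ennreal (c / 2) * indicator cube y \<partial>lborel)"
 proof (rule nn_integral_mono)
  fix y :: "real^'n"
  show "ennreal (weight (y, t)) * indicator V (fst (R0 (y, t))) \<le> ennreal (c / 2) * indicator cube y"
  proof (cases "(y, t) \<in> Q \<and> r y t \<in> V")
   case True
   then have q: "(y, t) \<in> Q" "y \<in> cube" by (auto simp: Q_def)
   have "r y t \<in> slice S t \<inter> U" using surface_point[of y t] q Q_subset by (auto simp: slice_def)
   then have "g (r y t) \<in> Y" using V'(2) True by (auto simp: V_def)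
   then have "volume_element k r y t < c" using g(3)[OF q(2)] volume_element_flatten[OF q(1)] by (simp add: Y_def)
   then have "weight (y, t) \<le> c / 2" using q(1) by (simp add: weight_def)
   then show ?thesis using q True by (simp add: R0_eq ennreal_leI)
  next
   case False
   then show ?thesis by (cases "(y, t) \<in> Q") (auto simp: weight_zero R0_eq)
  qed
 qed
 also have "\<dots> = ennreal (c / 2) * emeasure lborel (cube :: (real^'n) set)"
  by (rule nn_integral_cmult_indicator) (simp add: borel_open[OF open_cube])
 also have "\<dots> < \<infinity>"
 proof -
  have "emeasure lborel (cube :: (real^'n) set) < \<infinity>" by (rule emeasure_bounded_finite[OF bounded_cube])
  then show ?thesis by (simp add: ennreal_mult_less_top less_top)
 qed
 finally show ?thesis using oV \<open>x0 \<in> V\<close> by blast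
qed

end

section \<open>From charts to the whole surface\<close>

locale slit_setting = surfaces T S \<nu> \<sigma>
 for T :: real and S :: "((real^'n::finite) \<times> real) set" and \<nu> \<sigma> +
 fixes u :: "real^'n => real => real^'n" and u0 :: "real^'n => real^'n"
  and p :: "real^'n => real => real" and W :: "((real^'n) \<times> real) set"
 assumes T_pos: "0 < T" and weak: "weak_solution T u0 u"
  and W: "openin (top_of_set (UNIV \<times> {0..T})) W" "S \<subseteq> W"
  and press: "associated_pressure_on T W u p" and slit: "slit T S \<nu> \<sigma> W u p"
begin

text \<open>\<open>surface_AE\<close> carries the jump relation from parameters to the surface. The
  neighbourhood \<open>V\<close> is the image of the tube region, cut with \<open>U\<close> so that
  its surface points belong to the chart.\<close>

lemma jump_near:
 assumes z: "(x, t) \<in> S" "0 < t" "t < T"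
 shows "\<exists>V. open V \<and> (x, t) \<in> V \<and> (AE t in lborel. 0 < t \<and> t < T -->
  (AE x in \<sigma> t. (x, t) \<in> S \<inter> V --> jump_condition T S \<nu> u p x t))"
proof -
 obtain U I k r e where ch: "chart T S \<nu> U I k r e" "x \<in> U" "t \<in> I" using chart_at[OF z(1)] by blast
 have sc: "surface_chart T S \<nu> \<sigma> U I k r e" by (intro surface_chart.intro surfaces_axioms ch)
 interpret sc: slit_chart T S \<nu> \<sigma> U I k r e u u0 p W
  by (intro slit_chart.intro slit_chart_axioms.intro) (fact sc T_pos weak W press slit)+
 have t: "t \<in> sc.Io" using ch z by (simp add: sc.Io_def)
 obtain y0 where y0: "y0 \<in> flat_cube k" "r y0 t = x" using sc.surface_point_flat[OF z(1) ch(2,3)] by blast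
 obtain d where d: "d > 0" and ae: "AE s in lborel. AE y in lborel. (y, s) \<in> sc.nbhd y0 t d --> jump_condition T S \<nu> u p (r y s) s"
  using sc.local_jump[OF y0(1) t] by blast
 define V where "V = sc.\<Psi> ` sc.nbhd y0 t d \<inter> (U \<times> UNIV)"
 have oV: "open V" unfolding V_def
  by (intro open_Int sc.open_image sc.nbhd_subset sc.open_nbhd open_Times sc.open_U open_UNIV)
 have y0c: "y0 \<in> cube" using y0(1) flat_cube_subset by blast
 have "(y0, t) \<in> sc.nbhd y0 t d" using y0 y0c t d by (simp add: sc.nbhd_def flat_cube_flatten)
 moreover have "sc.\<Psi> (y0, t) = (x, t)" using sc.\<Psi>_flat[of "(y0, t)"] y0 by (simp add: proj_def flat_cube_flatten)
 ultimately have "(x, t) \<in> sc.\<Psi> ` sc.nbhd y0 t d" by (metis imageI)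
 then have zV: "(x, t) \<in> V" using ch(2) by (simp add: V_def)
 have "AE s in lborel. 0 < s \<and> s < T --> (AE x in \<sigma> s. (x, s) \<in> S \<inter> V --> jump_condition T S \<nu> u p x s)"
  using ae
 proof (rule eventually_mono, intro impI)
  fix s assume A: "AE y in lborel. (y, s) \<in> sc.nbhd y0 t d --> jump_condition T S \<nu> u p (r y s) s" and s: "0 < s \<and> s < T"
  show "AE x in \<sigma> s. (x, s) \<in> S \<inter> V --> jump_condition T S \<nu> u p x s"
  proof (cases "s \<in> {t - d<..<t + d} \<inter> sc.Io")
   case True
   then have sI: "s \<in> sc.Io" by simp
   let ?B = "{y. dist y y0 < d}"
   have "AE y in lborel. y \<in> cube \<and> flatten k y \<in> ?B --> jump_condition T S \<nu> u p (r y s) s"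
    using A by (rule eventually_mono) (use True in \<open>auto simp: sc.nbhd_def\<close>)
   from sc.surface_AE[OF sm closed_all sI this]
   show ?thesis
   proof (rule eventually_mono, intro impI)
    fix x assume B: "x \<in> (\<lambda>y. r y s) ` {y \<in> cube. flatten k y \<in> ?B} --> jump_condition T S \<nu> u p x s"
     and x: "(x, s) \<in> S \<inter> V"
    then obtain y where y: "(y, s) \<in> sc.nbhd y0 t d" "y \<in> flat_cube k" "x = r y s"
     using sc.surface_in_image[OF sc.nbhd_subset, of x s y0 t d] by (auto simp: V_def)
    then have "x \<in> (\<lambda>y. r y s) ` {y \<in> cube. flatten k y \<in> ?B}" by (auto simp: sc.nbhd_def)
    then show "jump_condition T S \<nu> u p x s" using B by blast
   qed
  next
   case False
   then have "(x, s) \<notin> V" for x by (auto simp: V_def sc.\<Psi>_def sc.nbhd_def)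
   then show ?thesis by simp
  qed
 qed
 then show ?thesis using oV zV by blast
qed

text \<open>By the Lindelof property countably many of the neighbourhoods from
  \<open>jump_near\<close> cover the surface at interior times, and their null sets can be united,
  in time as well as on each slice.\<close>

lemma jump_AE:
 "AE t in lborel. 0 < t \<and> t < T --> (AE x in \<sigma> t. x \<in> slice S t --> jump_condition T S \<nu> u p x t)"
proof -
 let ?F = "{V. open V \<and> (AE t in lborel. 0 < t \<and> t < T -->
  (AE x in \<sigma> t. (x, t) \<in> S \<inter> V --> jump_condition T S \<nu> u p x t))}"
 have opn: "open V" if "V \<in> ?F" for V using that by simp
 obtain F' where F': "F' \<subseteq> ?F" "countable F'" "\<Union>F' = \<Union>?F" by (rule Lindelof[of ?F], rule opn, assumption, rule that)
 have "\<forall>V\<in>F'. AE t in lborel. 0 < t \<and> t < T --> (AE x in \<sigma> t. (x, t) \<in> S \<inter> V --> jump_condition T S \<nu> u p x t)"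
  using F'(1) by blast
 then have "AE t in lborel. \<forall>V\<in>F'. 0 < t \<and> t < T --> (AE x in \<sigma> t. (x, t) \<in> S \<inter> V --> jump_condition T S \<nu> u p x t)"
  unfolding AE_ball_countable[OF F'(2)] .
 then show ?thesis
 proof (rule eventually_mono, intro impI)
  fix t assume A: "\<forall>V\<in>F'. 0 < t \<and> t < T --> (AE x in \<sigma> t. (x, t) \<in> S \<inter> V --> jump_condition T S \<nu> u p x t)" and t: "0 < t \<and> t < T"
  then have "\<forall>V\<in>F'. AE x in \<sigma> t. (x, t) \<in> S \<inter> V --> jump_condition T S \<nu> u p x t" by blast
  then have "AE x in \<sigma> t. \<forall>V\<in>F'. (x, t) \<in> S \<inter> V --> jump_condition T S \<nu> u p x t"
   unfolding AE_ball_countable[OF F'(2)] .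
  then show "AE x in \<sigma> t. x \<in> slice S t --> jump_condition T S \<nu> u p x t"
  proof (rule eventually_mono, intro impI)
   fix x assume B: "\<forall>V\<in>F'. (x, t) \<in> S \<inter> V --> jump_condition T S \<nu> u p x t" and x: "x \<in> slice S t"
   then have xS: "(x, t) \<in> S" by (simp add: slice_def)
   then have "(x, t) \<in> \<Union>?F" using jump_near[OF xS] t by blast
   then obtain V where "V \<in> F'" "(x, t) \<in> V" unfolding F'(3)[symmetric] by blast
   then show "jump_condition T S \<nu> u p x t" using B xS by blast
  qed
 qed
qed

text \<open>The closure of a bounded set in the closed slice is compact, so the density is bounded
  on it and finitely many neighbourhoods of finite measure cover it. On \<open>A\<close> the jump
  relation is an identity of densities, and integration gives the balance.\<close>

lemma mu_balance:
 assumes t: "0 < t" "t < T" and jump: "AE x in \<sigma> t. x \<in> slice S t --> jump_condition T S \<nu> u p x t"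
  and A: "A \<in> sets (completion (\<sigma> t))" "A \<subseteq> {x \<in> slice S t. normal_limit \<nu> 1 u x t \<noteq> normal_limit \<nu> (-1) u x t}" "bounded A"
 shows "set_integrable (completion (\<sigma> t)) A (\<lambda>x. mu_density T S \<nu> x t)"
  "set_integrable (completion (\<sigma> t)) A (\<lambda>x. normal_limit \<nu> 1 u x t \<bullet> \<nu> x t)"
  "mu T S \<nu> \<sigma> t A + (LINT x:A|completion (\<sigma> t). normal_limit \<nu> 1 u x t \<bullet> \<nu> x t) = 0"
proof -
 let ?m = "\<lambda>x. mu_density T S \<nu> x t" and ?C = "closure A" and ?M = "completion (\<sigma> t)"
 have cS: "closed (slice S t)" using closed_S[of t] t by simp
 have AS: "A \<subseteq> slice S t" using A(2) by blast
 have CS: "?C \<subseteq> slice S t" using AS cS by (rule closure_minimal)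
 have comp: "compact ?C" using A(3) by (simp add: compact_closure)
 have near: "continuous (at x within slice S t) ?m \<and> (\<exists>V. open V \<and> x \<in> V \<and> emeasure (\<sigma> t) V < \<infinity>)" if x: "x \<in> slice S t" for x
 proof -
  have "(x, t) \<in> S" using x by (simp add: slice_def)
  then obtain U I k r e where ch: "chart T S \<nu> U I k r e" "x \<in> U" "t \<in> I" using chart_at by blast
  interpret sc: surface_chart T S \<nu> \<sigma> U I k r e by (intro surface_chart.intro surfaces_axioms ch)
  have "t \<in> sc.Io" using ch t by (simp add: sc.Io_def)
  then show ?thesis using sc.mu_density_continuous sc.surface_measure_locally_finite x ch(2) by blast
 qed
 then have cont: "continuous_on (slice S t) ?m" by (simp add: continuous_on_eq_continuous_within)
 have "compact (?m ` ?C)" using continuous_on_subset[OF cont CS] comp by (rule compact_continuous_image)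
 then obtain B where B: "\<And>x. x \<in> ?C ==> \<bar>?m x\<bar> \<le> B" using compact_imp_bounded[of "?m ` ?C"] unfolding bounded_iff by auto
 have "\<forall>x\<in>?C. \<exists>V. open V \<and> x \<in> V \<and> emeasure (\<sigma> t) V < \<infinity>" using near CS by blast
 then obtain V where V: "\<And>x. x \<in> ?C ==> open (V x) \<and> x \<in> V x \<and> emeasure (\<sigma> t) (V x) < \<infinity>" by metis
 have VC: "?C \<subseteq> (\<Union>x\<in>?C. V x)" using V by blast
 obtain X where X: "X \<subseteq> ?C" "finite X" "?C \<subseteq> (\<Union>x\<in>X. V x)"
  by (rule compactE_image[OF comp _ VC]) (use V in blast, rule that)
 have sets: "sets (\<sigma> t) = sets borel" by (rule \<sigma>_time[OF t])
 have VX: "(\<Union>x\<in>X. V x) \<in> fmeasurable (\<sigma> t)"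
  using X V sets by (intro fmeasurable.finite_UN fmeasurableI) auto
 have "emeasure (\<sigma> t) (\<Union>x\<in>X. V x) < \<infinity>" using fmeasurableD2[OF VX] by (simp add: less_top)
 moreover have "emeasure (\<sigma> t) ?C \<le> emeasure (\<sigma> t) (\<Union>x\<in>X. V x)"
  using X(3) fmeasurableD[OF VX] by (rule emeasure_mono)
 ultimately have finC: "emeasure (\<sigma> t) ?C < \<infinity>" by (rule le_less_trans[rotated])
 have Csets: "?C \<in> sets (\<sigma> t)" using sets by simp
 have "emeasure ?M A \<le> emeasure ?M ?C" using closure_subset Csets by (intro emeasure_mono) auto
 also have "\<dots> = emeasure (\<sigma> t) ?C" using Csets by simp
 finally have finA: "emeasure ?M A < \<infinity>" using finC by (rule le_less_trans)
 let ?f = "\<lambda>x. indicator (slice S t) x *\<^sub>R ?m x"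
 have "?f \<in> borel_measurable borel" using cS cont by (intro borel_measurable_continuous_on_indicator) auto
 then have "?f \<in> borel_measurable (\<sigma> t)" by (simp add: measurable_cong_sets[OF sets refl])
 then have fm: "?f \<in> borel_measurable ?M" by (rule measurable_completion)
 have "AE x in ?M. x \<in> A --> norm (?f x) \<le> B"
  using B AS closure_subset by (intro AE_I2) (auto simp: indicator_def)
 note bd = this
 have eqA: "indicator A x *\<^sub>R ?f x = indicator A x *\<^sub>R ?m x" for x using AS by (auto simp: indicator_def)
 have int: "integrable ?M (\<lambda>x. indicator A x *\<^sub>R ?m x)"
  using integrableI_bounded_set_indicator[OF A(1) fm finA bd] unfolding eqA .
 then show "set_integrable ?M A ?m" unfolding set_integrable_def .
 let ?g = "\<lambda>x. indicator A x *\<^sub>R (normal_limit \<nu> 1 u x t \<bullet> \<nu> x t)"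
 have mi: "integrable ?M (\<lambda>x. - (indicator A x *\<^sub>R ?m x))" using int by simp
 have "AE x in \<sigma> t. - (indicator A x *\<^sub>R ?m x) = ?g x"
  using jump
 proof (rule eventually_mono)
  fix x assume "x \<in> slice S t --> jump_condition T S \<nu> u p x t"
  then show "- (indicator A x *\<^sub>R ?m x) = ?g x"
   using A(2) by (cases "x \<in> A") (auto simp: jump_condition_def)
 qed
 then have ae: "AE x in ?M. - (indicator A x *\<^sub>R ?m x) = ?g x" by (rule AE_completion)
 \<comment> \<open>Measurability of the normal velocity on \<open>A\<close> is inherited from the
   density, to which it is equal up to sign almost everywhere.\<close>
 have gm: "?g \<in> borel_measurable ?M"
  by (rule borel_measurable_completion_AE[OF borel_measurable_integrable[OF mi] ae])
 have "integrable ?M ?g" using integrable_cong_AE[OF borel_measurable_integrable[OF mi] gm ae] mi by simp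
 then show "set_integrable ?M A (\<lambda>x. normal_limit \<nu> 1 u x t \<bullet> \<nu> x t)" unfolding set_integrable_def .
 have "(LINT x|?M. ?g x) = (LINT x|?M. - (indicator A x *\<^sub>R ?m x))"
  using integral_cong_AE[OF borel_measurable_integrable[OF mi] gm ae] by simp
 then show "mu T S \<nu> \<sigma> t A + (LINT x:A|?M. normal_limit \<nu> 1 u x t \<bullet> \<nu> x t) = 0"
  unfolding mu_def set_lebesgue_integral_def by simp
qed

end

theorem lemma4p3:
 fixes T :: real
  and u :: "real^'n \<Rightarrow> real \<Rightarrow> real^'n" and u0 :: "real^'n \<Rightarrow> real^'n"
  and p :: "real^'n \<Rightarrow> real \<Rightarrow> real"
  and S W :: "((real^'n) \<times> real) set"
  and \<nu> :: "real^'n \<Rightarrow> real \<Rightarrow> real^'n"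
  and \<sigma> :: "real \<Rightarrow> (real^'n) measure"
 assumes "0 < T"
  and "weak_solution T u0 u"
  and "C1_family_of_surfaces T S \<nu>"
  and "surface_measures T S \<sigma>"
  and "openin (top_of_set (UNIV \<times> {0..T})) W" and "S \<subseteq> W"
  and "associated_pressure_on T W u p"
  and "slit T S \<nu> \<sigma> W u p"
 defines "u_plus \<equiv> normal_limit \<nu> 1 u" and "u_minus \<equiv> normal_limit \<nu> (-1) u"
  and "p_plus \<equiv> normal_limit \<nu> 1 p" and "p_minus \<equiv> normal_limit \<nu> (-1) p"
 shows "(AE t in lebesgue_on {0..T}. AE x in \<sigma> t. x \<in> slice S t \<longrightarrow>
      u_plus x t \<bullet> \<nu> x t = u_minus x t \<bullet> \<nu> x t \<and> p_plus x t = p_minus x t) \<and>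
    (AE t in lebesgue_on {0..T}.
      \<forall>A\<in>sets (completion (\<sigma> t)).
       A \<subseteq> {x \<in> slice S t. u_plus x t \<noteq> u_minus x t} \<and> bounded A \<longrightarrow>
       set_integrable (completion (\<sigma> t)) A (\<lambda>x. mu_density T S \<nu> x t) \<and>
       set_integrable (completion (\<sigma> t)) A (\<lambda>x. u_plus x t \<bullet> \<nu> x t) \<and>
       mu T S \<nu> \<sigma> t A + (LINT x:A|completion (\<sigma> t). u_plus x t \<bullet> \<nu> x t) = 0)"
proof -
 interpret slit_setting T S \<nu> \<sigma> u u0 p W
  by (intro slit_setting.intro surfaces.intro slit_setting_axioms.intro) (fact assms)+
 show ?thesis
  unfolding AE_lebesgue_on_Icc_iff u_plus_def u_minus_def p_plus_def p_minus_def
 proof (intro conjI)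
  show "AE t in lborel. 0 < t \<and> t < T \<longrightarrow> (AE x in \<sigma> t. x \<in> slice S t \<longrightarrow>
   normal_limit \<nu> 1 u x t \<bullet> \<nu> x t = normal_limit \<nu> (-1) u x t \<bullet> \<nu> x t \<and> normal_limit \<nu> 1 p x t = normal_limit \<nu> (-1) p x t)"
   using jump_AE
  proof (rule eventually_mono, intro impI)
   fix t assume "0 < t \<and> t < T \<longrightarrow> (AE x in \<sigma> t. x \<in> slice S t \<longrightarrow> jump_condition T S \<nu> u p x t)" "0 < t \<and> t < T"
   then have "AE x in \<sigma> t. x \<in> slice S t \<longrightarrow> jump_condition T S \<nu> u p x t" by blast
   then show "AE x in \<sigma> t. x \<in> slice S t \<longrightarrow>
    normal_limit \<nu> 1 u x t \<bullet> \<nu> x t = normal_limit \<nu> (-1) u x t \<bullet> \<nu> x t \<and> normal_limit \<nu> 1 p x t = normal_limit \<nu> (-1) p x t"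
    by (rule eventually_mono) (simp add: jump_condition_def)
  qed
  show "AE t in lborel. 0 < t \<and> t < T \<longrightarrow> (\<forall>A\<in>sets (completion (\<sigma> t)).
       A \<subseteq> {x \<in> slice S t. normal_limit \<nu> 1 u x t \<noteq> normal_limit \<nu> (-1) u x t} \<and> bounded A \<longrightarrow>
       set_integrable (completion (\<sigma> t)) A (\<lambda>x. mu_density T S \<nu> x t) \<and>
       set_integrable (completion (\<sigma> t)) A (\<lambda>x. normal_limit \<nu> 1 u x t \<bullet> \<nu> x t) \<and>
       mu T S \<nu> \<sigma> t A + (LINT x:A|completion (\<sigma> t). normal_limit \<nu> 1 u x t \<bullet> \<nu> x t) = 0)"
   using jump_AE
  proof (rule eventually_mono, intro impI ballI)
   fix t A assume J: "0 < t \<and> t < T \<longrightarrow> (AE x in \<sigma> t. x \<in> slice S t \<longrightarrow> jump_condition T S \<nu> u p x t)" and t: "0 < t \<and> t < T"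
    and A: "A \<in> sets (completion (\<sigma> t))" "A \<subseteq> {x \<in> slice S t. normal_limit \<nu> 1 u x t \<noteq> normal_limit \<nu> (-1) u x t} \<and> bounded A"
   note m = mu_balance[OF conjunct1[OF t] conjunct2[OF t] mp[OF J t] A(1) conjunct1[OF A(2)] conjunct2[OF A(2)]]
   show "set_integrable (completion (\<sigma> t)) A (\<lambda>x. mu_density T S \<nu> x t) \<and>
       set_integrable (completion (\<sigma> t)) A (\<lambda>x. normal_limit \<nu> 1 u x t \<bullet> \<nu> x t) \<and>
       mu T S \<nu> \<sigma> t A + (LINT x:A|completion (\<sigma> t). normal_limit \<nu> 1 u x t \<bullet> \<nu> x t) = 0"
    by (intro conjI m)
  qed
 qed
qed

end
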